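(* Let $N\ge 3$, let $\ell$ be a positive integer, $1<p<\frac{N}{N-2}$, and $\mu_i>0$ for $i=1,\ldots,\ell$. Let $(\lambda_k)$ be a sequence of negative numbers such that $\lambda_k\to-\infty$ as $k\to\infty$, and let $\mathbf u_k=(u_{k,1},\ldots,u_{k,\ell})$ be a nonnegative least energy solution of the system $$\begin{cases}-\Delta u_i=\mu_iQ_1(x)|u_i|^{2p-2}u_i+\sum_{j\ne i}\lambda_{ij}|u_j|^p|u_i|^{p-2}u_i,\\ u_i\in E,\quad u_i\ne0,\quad i=1,\ldots,\ell,\end{cases}$$ with $\lambda_{ij}=\lambda_k$ for all $i\ne j$. Then, after passing to a subsequence, for all $i,j=1,\ldots,\ell$ we have that $u_{k,i}\to u_{\infty,i}$ strongly in $E$, $u_{\infty,i}\ge0$, $u_{\infty,i}u_{\infty,j}=0$ if $i\ne j$, $u_{\infty,i}$ is continuous in $\mathbb{R}^N$, and $u_{\infty,i}|_{\Omega_i}$ is a least energy solution of the problem $$-\Delta w=\mu_iQ_1(x)|w|^{2p-2}w,\qquad w\in E_i:=D_0^{1,2}(\Omega_i)\cap L^{2p}(\Omega_i),\quad w\ne0,$$ where $\Omega_i:=\{x\in\mathbb{R}^N:u_{\infty,i}(x)>0\}$ for each $i=1,\ldots,\ell$. Hence, $\Omega_i\cap\Omega_j=\emptyset$ if $i\ne j$, and $\Omega_i\cap B_1(0)\ne\emptyset$.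
   Context: $Q_1(x):=1$ if $|x|<1$ and $Q_1(x):=-1$ if $|x|\ge1$. $B_1(0)$ is the open unit ball in $\mathbb{R}^N$ centered at the origin. For $1<p<2$ the expression $|t|^{p-2}t$ is taken to be $0$ at $t=0$. $E:=D^{1,2}(\mathbb{R}^N)\cap L^{2p}(\mathbb{R}^N)$ is the Banach space with norm $\|u\|_E^2:=\|u\|^2+|u|_{2p}^2$, where $\|u\|^2:=\int_{\mathbb{R}^N}|\nabla u|^2$ and $|u|_{2p}^{2p}:=\int_{\mathbb{R}^N}|u|^{2p}$. For an open set $\Omega\subset\mathbb{R}^N$, $D^{1,2}_0(\Omega)$ is the closure of $\mathcal{C}_c^\infty(\Omega)$ in $D^{1,2}(\mathbb{R}^N)$ (functions extended by $0$). "Continuous" means having a continuous representative, which is used in the definition of $\Omega_i$. Solutions of the system are the critical points with all components nontrivial of $\mathcal{J}_0:E^\ell\to\mathbb{R}$, $$\mathcal{J}_0(\mathbf u):=\frac12\sum_{i=1}^\ell\|u_i\|^2-\frac1{2p}\sum_{i=1}^\ell\int_{\mathbb{R}^N}\mu_iQ_1(x)|u_i|^{2p}-\frac1{2p}\sum_{i\ne j}\int_{\mathbb{R}^N}\lambda_{ij}|u_j|^p|u_i|^p$$ (last sum over ordered pairs). A solution is nonnegative if all its components are $\ge0$; a least energy solution of the system is a solution $\mathbf u$ with $\mathcal{J}_0(\mathbf u)=\inf_{\mathcal{N}_0}\mathcal{J}_0$, where $\mathcal{N}_0:=\{\mathbf u\in E^\ell:u_i\ne0,\ \partial_i\mathcal{J}_0(\mathbf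 u)u_i=0\text{ for all }i\}$. A least energy solution of the problem in $\Omega_i$ is a (weak) solution $w$ at which the functional $\frac12\int_{\Omega_i}|\nabla w|^2-\frac1{2p}\int_{\Omega_i}\mu_iQ_1(x)|w|^{2p}$ attains its infimum over the Nehari manifold $\{w\in E_i:w\ne0,\ \int_{\Omega_i}|\nabla w|^2=\int_{\Omega_i}\mu_iQ_1(x)|w|^{2p}\}$. *)

theory Defs
  imports "HOL-Analysis.Analysis"
begin

text \<open>
  Conventions. The space \<open>\<real>\<^sup>N\<close> is \<open>real ^ 'n\<close> with \<open>N = CARD('n)\<close>. Elements of the function spaces
  are represented by Borel functions; two representatives denote the same element iff they agree
  almost everywhere, and every class has a Borel representative. Hence \<open>u \<noteq> 0\<close> and \<open>u \<ge> 0\<close> are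
  read almost everywhere. A function on an open set \<open>\<Omega>\<close> is extended by \<open>0\<close>.
  Vectors \<open>(u\<^sub>1, \<dots>, u\<^sub>l)\<close> are maps on \<open>nat\<close> of which only the values on \<open>{1..l}\<close> matter.
\<close>

section \<open>Function spaces\<close>

definition partial_derivative :: "'n \<Rightarrow> (real ^ 'n \<Rightarrow> real) \<Rightarrow> real ^ 'n \<Rightarrow> real" where
  "partial_derivative m f x = frechet_derivative f (at x) (axis m 1)"

primrec C_k :: "nat \<Rightarrow> (real ^ 'n \<Rightarrow> real) \<Rightarrow> bool" where
  "C_k 0 f \<longleftrightarrow> continuous_on UNIV f"
| "C_k (Suc k) f \<longleftrightarrow> f differentiable_on UNIV \<and> (\<forall>m. C_k k (partial_derivative m f))"

definition test_functions :: "(real ^ 'n) set \<Rightarrow> (real ^ 'n \<Rightarrow> real) set" where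
  "test_functions \<Omega> = {\<phi>. (\<forall>k. C_k k \<phi>) \<and>
     compact (closure {x. \<phi> x \<noteq> 0}) \<and> closure {x. \<phi> x \<noteq> 0} \<subseteq> \<Omega>}"

definition locally_integrable :: "(real ^ 'n \<Rightarrow> 'b::{banach, second_countable_topology}) \<Rightarrow> bool" where
  "locally_integrable f \<longleftrightarrow> (\<forall>K. compact K \<longrightarrow> set_integrable lborel K f)"

definition is_weak_gradient :: "(real ^ 'n \<Rightarrow> real) \<Rightarrow> (real ^ 'n \<Rightarrow> real ^ 'n) \<Rightarrow> bool" where
  "is_weak_gradient u g \<longleftrightarrow> locally_integrable u \<and> locally_integrable g \<and>
     (\<forall>\<phi>\<in>test_functions UNIV. \<forall>m.
        (LINT x|lborel. u x * partial_derivative m \<phi> x) = - (LINT x|lborel. g x $ m * \<phi> x))"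

text \<open>Weak gradients are unique up to null sets, so the choice below is harmless under integrals.\<close>

definition weak_gradient :: "(real ^ 'n \<Rightarrow> real) \<Rightarrow> real ^ 'n \<Rightarrow> real ^ 'n" where
  "weak_gradient u = (SOME g. is_weak_gradient u g)"

definition L_space :: "real \<Rightarrow> (real ^ 'n) set \<Rightarrow> (real ^ 'n \<Rightarrow> real) set" where
  "L_space q \<Omega> = {u \<in> borel_measurable lborel. set_integrable lborel \<Omega> (\<lambda>x. \<bar>u x\<bar> powr q)}"

definition L_norm :: "real \<Rightarrow> (real ^ 'n \<Rightarrow> real) \<Rightarrow> real" where
  "L_norm q u = (LINT x|lborel. \<bar>u x\<bar> powr q) powr (1 / q)"

text \<open>
  \<open>D\<^sup>1\<^sup>,\<^sup>2(\<real>\<^sup>N)\<close> for \<open>N \<ge> 3\<close>: the functions in \<open>L\<^sup>q(\<real>\<^sup>N)\<close>, where \<open>q = 2N / (N - 2)\<close> is the critical Sobolev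
  exponent, with weak gradient in \<open>L\<^sup>2(\<real>\<^sup>N)\<close>.
\<close>

definition D12 :: "(real ^ 'n \<Rightarrow> real) set" where
  "D12 = {u \<in> L_space (2 * real CARD('n) / (real CARD('n) - 2)) UNIV.
            \<exists>g. is_weak_gradient u g \<and> integrable lborel (\<lambda>x. (norm (g x))\<^sup>2)}"

definition D12_norm :: "(real ^ 'n \<Rightarrow> real) \<Rightarrow> real" where
  "D12_norm u = sqrt (LINT x|lborel. (norm (weak_gradient u x))\<^sup>2)"

definition D12_0 :: "(real ^ 'n) set \<Rightarrow> (real ^ 'n \<Rightarrow> real) set" where
  "D12_0 \<Omega> = {u \<in> D12. \<forall>\<epsilon>>0. \<exists>\<phi>\<in>test_functions \<Omega>. D12_norm (\<lambda>x. u x - \<phi> x) < \<epsilon>}"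

definition E_space :: "real \<Rightarrow> (real ^ 'n \<Rightarrow> real) set" where
  "E_space p = D12 \<inter> L_space (2 * p) UNIV"

definition E_norm :: "real \<Rightarrow> (real ^ 'n \<Rightarrow> real) \<Rightarrow> real" where
  "E_norm p u = sqrt ((D12_norm u)\<^sup>2 + (L_norm (2 * p) u)\<^sup>2)"

definition E_on :: "(real ^ 'n) set \<Rightarrow> real \<Rightarrow> (real ^ 'n \<Rightarrow> real) set" where
  "E_on \<Omega> p = D12_0 \<Omega> \<inter> L_space (2 * p) \<Omega>"

definition nonzero :: "(real ^ 'n \<Rightarrow> real) \<Rightarrow> bool" where
  "nonzero u \<longleftrightarrow> \<not> (AE x in lborel. u x = 0)"


section \<open>The system\<close>

definition Q1 :: "real ^ 'n \<Rightarrow> real" where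
  "Q1 x = (if norm x < 1 then 1 else - 1)"

definition J0 ::
  "nat \<Rightarrow> real \<Rightarrow> (nat \<Rightarrow> real) \<Rightarrow> (nat \<Rightarrow> nat \<Rightarrow> real) \<Rightarrow> (nat \<Rightarrow> real ^ 'n \<Rightarrow> real) \<Rightarrow> real" where
  "J0 l p \<mu> lam u =
     1 / 2 * (\<Sum>i\<in>{1..l}. (D12_norm (u i))\<^sup>2)
     - 1 / (2 * p) * (\<Sum>i\<in>{1..l}. LINT x|lborel. \<mu> i * Q1 x * \<bar>u i x\<bar> powr (2 * p))
     - 1 / (2 * p) * (\<Sum>i\<in>{1..l}. \<Sum>j\<in>{1..l} - {i}.
         LINT x|lborel. lam i j * \<bar>u j x\<bar> powr p * \<bar>u i x\<bar> powr p)"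

definition E_power :: "nat \<Rightarrow> real \<Rightarrow> (nat \<Rightarrow> real ^ 'n \<Rightarrow> real) set" where
  "E_power l p = {u. \<forall>i\<in>{1..l}. u i \<in> E_space p}"

definition E_power_norm :: "nat \<Rightarrow> real \<Rightarrow> (nat \<Rightarrow> real ^ 'n \<Rightarrow> real) \<Rightarrow> real" where
  "E_power_norm l p u = sqrt (\<Sum>i\<in>{1..l}. (E_norm p (u i))\<^sup>2)"

text \<open>Critical points: the Frechet derivative at \<open>u\<close> of a functional on \<open>E\<^sup>l\<close> exists and vanishes.\<close>

definition critical_point ::
  "nat \<Rightarrow> real \<Rightarrow> ((nat \<Rightarrow> real ^ 'n \<Rightarrow> real) \<Rightarrow> real) \<Rightarrow> (nat \<Rightarrow> real ^ 'n \<Rightarrow> real) \<Rightarrow> bool" where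
  "critical_point l p J u \<longleftrightarrow> u \<in> E_power l p \<and>
     (\<forall>\<epsilon>>0. \<exists>\<delta>>0. \<forall>h\<in>E_power l p. E_power_norm l p h < \<delta> \<longrightarrow>
        \<bar>J (\<lambda>i x. u i x + h i x) - J u\<bar> \<le> \<epsilon> * E_power_norm l p h)"

definition solution ::
  "nat \<Rightarrow> real \<Rightarrow> (nat \<Rightarrow> real) \<Rightarrow> (nat \<Rightarrow> nat \<Rightarrow> real) \<Rightarrow> (nat \<Rightarrow> real ^ 'n \<Rightarrow> real) \<Rightarrow> bool" where
  "solution l p \<mu> lam u \<longleftrightarrow> critical_point l p (J0 l p \<mu> lam) u \<and> (\<forall>i\<in>{1..l}. nonzero (u i))"

text \<open>
  The condition \<open>\<partial>\<^sub>i J\<^sub>0(u) u\<^sub>i = 0\<close> is the vanishing of the derivative at \<open>t = 0\<close> of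
  \<open>t \<mapsto> J\<^sub>0(u\<^sub>1, \<dots>, u\<^sub>i + t u\<^sub>i, \<dots>, u\<^sub>l)\<close>.
\<close>

definition Nehari0 ::
  "nat \<Rightarrow> real \<Rightarrow> (nat \<Rightarrow> real) \<Rightarrow> (nat \<Rightarrow> nat \<Rightarrow> real) \<Rightarrow> (nat \<Rightarrow> real ^ 'n \<Rightarrow> real) set" where
  "Nehari0 l p \<mu> lam = {u \<in> E_power l p. \<forall>i\<in>{1..l}. nonzero (u i) \<and>
     ((\<lambda>t. J0 l p \<mu> lam (u(i := (\<lambda>x. u i x + t * u i x)))) has_real_derivative 0) (at 0)}"

text \<open>
  On \<open>Nehari0\<close> the functional is bounded below (by \<open>0\<close>, as \<open>p > 1\<close>), so the real infimum is
  meaningful.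
\<close>

definition least_energy_solution ::
  "nat \<Rightarrow> real \<Rightarrow> (nat \<Rightarrow> real) \<Rightarrow> (nat \<Rightarrow> nat \<Rightarrow> real) \<Rightarrow> (nat \<Rightarrow> real ^ 'n \<Rightarrow> real) \<Rightarrow> bool" where
  "least_energy_solution l p \<mu> lam u \<longleftrightarrow> solution l p \<mu> lam u \<and>
     J0 l p \<mu> lam u = Inf (J0 l p \<mu> lam ` (Nehari0 l p \<mu> lam :: (nat \<Rightarrow> real ^ 'n \<Rightarrow> real) set))"

definition nonnegative :: "nat \<Rightarrow> (nat \<Rightarrow> real ^ 'n \<Rightarrow> real) \<Rightarrow> bool" where
  "nonnegative l u \<longleftrightarrow> (\<forall>i\<in>{1..l}. AE x in lborel. u i x \<ge> 0)"


section \<open>The single equation in an open set\<close>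

definition weak_solution_on :: "(real ^ 'n) set \<Rightarrow> real \<Rightarrow> real \<Rightarrow> (real ^ 'n \<Rightarrow> real) \<Rightarrow> bool" where
  "weak_solution_on \<Omega> p m w \<longleftrightarrow> w \<in> E_on \<Omega> p \<and> nonzero w \<and>
     (\<forall>\<phi>\<in>E_on \<Omega> p.
        (LINT x:\<Omega>|lborel. weak_gradient w x \<bullet> weak_gradient \<phi> x)
        = (LINT x:\<Omega>|lborel. m * Q1 x * (\<bar>w x\<bar> powr (2 * p - 2) * w x) * \<phi> x))"

definition energy_on :: "(real ^ 'n) set \<Rightarrow> real \<Rightarrow> real \<Rightarrow> (real ^ 'n \<Rightarrow> real) \<Rightarrow> real" where
  "energy_on \<Omega> p m w =
     1 / 2 * (LINT x:\<Omega>|lborel. (norm (weak_gradient w x))\<^sup>2)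
     - 1 / (2 * p) * (LINT x:\<Omega>|lborel. m * Q1 x * \<bar>w x\<bar> powr (2 * p))"

definition Nehari_on :: "(real ^ 'n) set \<Rightarrow> real \<Rightarrow> real \<Rightarrow> (real ^ 'n \<Rightarrow> real) set" where
  "Nehari_on \<Omega> p m = {w \<in> E_on \<Omega> p. nonzero w \<and>
     (LINT x:\<Omega>|lborel. (norm (weak_gradient w x))\<^sup>2)
     = (LINT x:\<Omega>|lborel. m * Q1 x * \<bar>w x\<bar> powr (2 * p))}"

definition least_energy_solution_on ::
  "(real ^ 'n) set \<Rightarrow> real \<Rightarrow> real \<Rightarrow> (real ^ 'n \<Rightarrow> real) \<Rightarrow> bool" where
  "least_energy_solution_on \<Omega> p m w \<longleftrightarrow> weak_solution_on \<Omega> p m w \<and>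
     w \<in> Nehari_on \<Omega> p m \<and> (\<forall>v\<in>Nehari_on \<Omega> p m. energy_on \<Omega> p m w \<le> energy_on \<Omega> p m v)"

end

theory Submission
  imports Defs "HOL-Complex_Analysis.Great_Picard"
begin

text \<open>
 A segregated tuple can be scaled into every Nehari set, so it bounds the energies of the \<open>u\<^sub>k\<close> independently
 of \<open>k\<close>; with the Sobolev inequality the \<open>u\<^sub>k\<close> are bounded in \<open>E\<close>. As \<open>Q\<^sub>1 < 0\<close> outside the unit ball, the Nehari
 identities bound all other quantities by the mass in the ball, where Rellich's theorem applies; since
 \<open>\<lambda>\<^sub>k \<rightarrow> -\<infinity>\<close>, the limit is segregated. Using the limit itself as a competitor turns lower semicontinuity
 into strong convergence, and the limit minimizes the sum of the Nehari levels \<open>psi\<close> among segregated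
 tuples. Variations of this minimum show that, for some \<open>C\<close>, both \<open>-\<Delta>u\<^sub>i \<le> C\<close> and
 \<open>-\<Delta>(\<Sum>\<^sub>j\<^sub>\<noteq>\<^sub>i u\<^sub>j - u\<^sub>i) \<le> C\<close>. By the mean value inequality these functions have upper semicontinuous
 representatives, which together with the segregation gives continuity. Finally, a continuous function of \<open>E\<close>
 lies in \<open>D\<^sub>0\<^sup>1\<^sup>,\<^sup>2\<close> of its positivity set, and replacing the \<open>i\<close>-th component by a function on \<open>\<Omega>\<^sub>i\<close> keeps the
 tuple segregated, so minimality of the tuple gives minimality in each \<open>\<Omega>\<^sub>i\<close>.
\<close>

text \<open>For \<open>a <= b\<close> the level \<open>psi a b\<close> lies below \<open>a\<close>,
  with equality only if \<open>a = b\<close>. Semicontinuity places the limit of the energies of a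
  component between the Dirichlet integral and the potential of its limit; comparison with the limit
  itself closes this gap for every component, which is the strong convergence. At a diagonal point
  \<open>psi\<close> has the derivative \<open>(p * \<alpha> - \<beta>) / (p - 1)\<close>, so a
  variation of the minimum becomes an inequality between Dirichlet and potential terms. The obstacle
  is that competitors must stay segregated. Two kinds do. One adds to \<open>u\<^sub>i\<close> a
  function that vanishes where the other components live; it gives boundedness, the bound for
  \<open>u\<^sub>i\<close> and the equation on the positivity set. The other shifts the signed
  function \<open>u\<^sub>i - \<Sum>\<^sub>j u\<^sub>j\<close> and splits it again into components;
  its Dirichlet integral is the total energy, because weak gradients vanish almost everywhere on
  zero sets. It gives the second bound, which supplies lower semicontinuity where
  \<open>u\<^sub>i > 0\<close>. The Sobolev inequality comes from translations and truncation,
  compactness from mollification.\<close>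

abbreviation (input) seq_lim (infix "---->" 60) where "X ----> L \<equiv> X \<longlonglongrightarrow> L"

abbreviation "pd \<equiv> partial_derivative"

abbreviation TF :: "(real^'n => real) set" where "TF \<equiv> test_functions UNIV"

abbreviation "Bmeas \<equiv> borel_measurable borel"

abbreviation L2 :: "('a::euclidean_space => 'b::real_normed_vector) => bool" where
  "L2 f \<equiv> integrable lborel (%x. (norm (f x))\<^sup>2)"

abbreviation sq :: "('a::euclidean_space => 'b::real_normed_vector) => real" where
  "sq f \<equiv> LBINT x. (norm (f x))\<^sup>2"

abbreviation Lpw :: "real => ('a::euclidean_space => real) => bool" where
  "Lpw s f \<equiv> integrable lborel (%x. \<bar>f x\<bar> powr s)"

abbreviation pw :: "real => ('a::euclidean_space => real) => real" where
  "pw s f \<equiv> LBINT x. \<bar>f x\<bar> powr s"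

abbreviation ldist :: "real => ('a::euclidean_space => 'b::euclidean_space) => ('a => 'b) => real" where
  "ldist R f g \<equiv> LBINT x:cball 0 R. norm (f x - g x)"

lemmas Bcong = Bochner_Integration.integral_cong
lemmas Bbound = Bochner_Integration.integrable_bound
lemmas Bnonneg = Bochner_Integration.integral_nonneg
lemmas Badd = Bochner_Integration.integrable_add
lemmas BIadd = Bochner_Integration.integral_add

subsection \<open>Smooth functions\<close>

lemma partial_derivative_eq:
 assumes "(f has_derivative D) (at x)"
 shows "pd m f x = D (axis m 1)"
 using frechet_derivative_at[OF assms] by (simp add: partial_derivative_def)

lemma C_k_mono: "C_k (Suc k) f ==> C_k k f"
proof (induction k arbitrary: f)
 case 0
 then have "f differentiable_on UNIV" unfolding C_k.simps by blast
 then show ?case unfolding C_k.simps by (rule differentiable_imp_continuous_on)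
next
 case (Suc k)
 have "f differentiable_on UNIV" "!!m. C_k (Suc k) (pd m f)"
  using Suc.prems C_k.simps(2)[of "Suc k" f] by blast+
 with Suc.IH show ?case using C_k.simps(2)[of k f] by blast
qed

lemma differentiable_on_UNIV_D:
 "f differentiable_on UNIV ==> (f has_derivative frechet_derivative f (at x)) (at x)"
 by (simp add: differentiable_on_def frechet_derivative_works)

lemma partial_derivative_works:
 assumes "f differentiable_on UNIV"
 shows "(f has_derivative (%h. \<Sum>m\<in>UNIV. pd m f x * h $ m)) (at x)"
proof -
 let ?D = "frechet_derivative f (at x)"
 have D: "(f has_derivative ?D) (at x)" using differentiable_on_UNIV_D[OF assms] .
 then interpret linear ?D using has_derivative_linear by blast
 have "?D h = (\<Sum>m\<in>UNIV. pd m f x * h $ m)" for h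
 proof -
  have "?D h = ?D (\<Sum>m\<in>UNIV. h $ m *\<^sub>R axis m 1)"
   by (simp add: basis_expansion flip: scalar_mult_eq_scaleR)
  also have "... = (\<Sum>m\<in>UNIV. h $ m *\<^sub>R ?D (axis m 1))"
   by (simp add: sum scale)
  finally show ?thesis by (simp add: partial_derivative_def mult.commute)
 qed
 then have "?D = (%h. \<Sum>m\<in>UNIV. pd m f x * h $ m)" by auto
 with D show ?thesis by simp
qed

lemma C_k_const: "C_k k (%_::real^'n. c)"
proof (induction k arbitrary: c)
 case (Suc k)
 have "pd m (%_::real^'n. c) = (%_. 0)" for m
  by (rule ext, subst partial_derivative_eq[where D="%_. 0"]) auto
 then have "\<forall>m. C_k k (pd m (%_::real^'n. c))" using Suc by metis
 then show ?case by simp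
qed simp

lemma C_k_add:
 "C_k k f ==> C_k k g ==> C_k k (%x. f x + g x)"
proof (induction k arbitrary: f g)
 case (Suc k)
 then have d: "f differentiable_on UNIV" "g differentiable_on UNIV" by auto
 have "pd m (%x. f x + g x) = (%x. pd m f x + pd m g x)" for m
  by (rule ext, subst partial_derivative_eq[OF has_derivative_add[OF differentiable_on_UNIV_D[OF d(1)] differentiable_on_UNIV_D[OF d(2)]]])
   (simp add: partial_derivative_def)
 with Suc d show ?case by (auto intro: differentiable_on_add)
qed (auto intro: continuous_intros)

lemma partial_derivative_mult:
 assumes "f differentiable_on UNIV" "g differentiable_on UNIV"
 shows "pd m (%x. f x * g x) x = pd m f x * g x + f x * pd m g x"
 by (subst partial_derivative_eq[OF has_derivative_mult[OF differentiable_on_UNIV_D[OF assms(1)] differentiable_on_UNIV_D[OF assms(2)]]])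
  (simp add: partial_derivative_def)

lemma C_k_mult:
 "C_k k f ==> C_k k g ==> C_k k (%x. f x * g x)"
proof (induction k arbitrary: f g)
 case (Suc k)
 then have d: "f differentiable_on UNIV" "g differentiable_on UNIV" by auto
 have "pd m (%x. f x * g x) = (%x. pd m f x * g x + f x * pd m g x)" for m
  using partial_derivative_mult[OF d] by blast
 moreover have "C_k k f" "C_k k g" using Suc.prems by (blast intro: C_k_mono)+
 ultimately show ?case
  using Suc.prems d by (auto intro!: differentiable_on_mult C_k_add Suc.IH)
qed (auto intro: continuous_intros)

lemma has_derivative_affine_compose:
 fixes f :: "real^'n => real"
 assumes "f differentiable_on UNIV"
 shows "((%x. f (b + a *\<^sub>R x)) has_derivative (%h. frechet_derivative f (at (b + a *\<^sub>R x)) (a *\<^sub>R h))) (at x)"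
proof -
 have 1: "((%x. b + a *\<^sub>R x) has_derivative (%h. a *\<^sub>R h)) (at x)"
  by (auto intro!: derivative_eq_intros)
 show ?thesis
  using diff_chain_at[OF 1 differentiable_on_UNIV_D[OF assms]] by (simp add: o_def)
qed

lemma partial_derivative_affine:
 fixes f :: "real^'n => real"
 assumes "f differentiable_on UNIV"
 shows "pd m (%x. f (b + a *\<^sub>R x)) x = a * pd m f (b + a *\<^sub>R x)"
proof -
 interpret linear "frechet_derivative f (at (b + a *\<^sub>R x))"
  using differentiable_on_UNIV_D[OF assms] has_derivative_linear by blast
 show ?thesis
  by (subst partial_derivative_eq[OF has_derivative_affine_compose[OF assms]])
   (simp add: partial_derivative_def scale)
qed

lemma C_k_affine:
 fixes f :: "real^'n => real"
 shows "C_k k f ==> C_k k (%x. f (b + a *\<^sub>R x))"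
proof (induction k arbitrary: f)
 case 0
 then show ?case by (auto intro!: continuous_on_compose2[of UNIV f] continuous_intros)
next
 case (Suc k)
 then have d: "f differentiable_on UNIV" by auto
 have "pd m (%x. f (b + a *\<^sub>R x)) = (%x. a * pd m f (b + a *\<^sub>R x))" for m
  using partial_derivative_affine[OF d] by blast
 moreover have "(%x. f (b + a *\<^sub>R x)) differentiable_on UNIV"
  using has_derivative_affine_compose[OF d] by (auto simp: differentiable_on_def differentiable_def)
 ultimately show ?case using Suc by (auto intro!: C_k_mult C_k_const)
qed

lemma C_k_component: "C_k k (%x::real^'n. x $ m)"
proof (cases k)
 case (Suc j)
 have d: "((%x. x $ m) has_derivative (%h. h $ m)) (at x)" for x :: "real^'n"
  by (rule bounded_linear_imp_has_derivative[OF bounded_linear_vec_nth])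
 have "pd i (%x. x $ m) = (%_. axis i 1 $ m)" for i
  by (rule ext) (rule partial_derivative_eq[OF d])
 with d Suc show ?thesis by (auto intro!: C_k_const simp: differentiable_on_def differentiable_def)
qed (auto intro: continuous_intros)

text \<open>The flat function exp(-1/s) divided by powers of s. The index makes the family closed
  under differentiation, so one induction gives the smoothness of every radial bump built from
  it.\<close>

definition hexp :: "nat => real => real" where
 "hexp k s = (if s > 0 then exp (- 1 / s) / s ^ k else 0)"

lemma hexp_nonneg: "hexp k s >= 0" by (simp add: hexp_def)

lemma hexp_pos: "s > 0 ==> hexp k s > 0" by (simp add: hexp_def)

text \<open>The single term of order \<open>k + 2\<close> of the series of exp(1/s) is enough. A
  quadratic bound makes the derivative vanish at \<open>s = 0\<close>, where the two branches of the
  definition meet.\<close>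

lemma hexp_bound: "\<bar>hexp k s\<bar> <= fact (k + 2) * s\<^sup>2"
proof (cases "s > 0")
 case True
 have "(\<Sum>n\<in>{k + 2}. (1/s) ^ n /\<^sub>R fact n) <= (\<Sum>n. (1/s) ^ n /\<^sub>R fact n)"
  using True by (intro sum_le_suminf summable_exp_generic) auto
 then have "(1/s) ^ (k + 2) / fact (k + 2) <= exp (1/s)"
  by (simp add: exp_def field_simps)
 then have "exp (- (1/s)) * ((1/s) ^ (k + 2) / fact (k + 2)) <= exp (- (1/s)) * exp (1/s)"
  by (intro mult_left_mono) auto
 also have "... = 1" by (simp flip: exp_add)
 finally have "exp (- (1/s)) / (s^k * s\<^sup>2) <= fact (k + 2)"
  using True by (simp only: power_divide power_add power_one) (simp add: divide_le_eq mult.commute del: fact_Suc)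
 then have "exp (- (1/s)) / s^k <= fact (k+2) * s\<^sup>2"
  using True by (simp add: divide_le_eq mult.commute mult.left_commute del: fact_Suc add_2_eq_Suc')
 then show ?thesis using True by (simp add: hexp_def)
qed (simp add: hexp_def)

lemma hexp_deriv: "(hexp k has_real_derivative hexp (k + 2) s - k * hexp (k + 1) s) (at s)"
proof -
 consider "s > 0" | "s < 0" | "s = 0" by linarith
 then show ?thesis
 proof cases
  case 1
  have "((%s. exp (- 1 / s) / s ^ k) has_real_derivative hexp (k + 2) s - k * hexp (k + 1) s) (at s)"
  proof (cases k)
   case 0
   show ?thesis unfolding 0 using 1
    by (auto intro!: derivative_eq_intros simp: hexp_def power2_eq_square)
  next
   case (Suc j)
   have "((%s. exp (- 1 / s) / s ^ Suc j) has_real_derivative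
    (exp (-1/s) * (1 / (s * s)) * s ^ Suc j - exp (-1/s) * (real (Suc j) * s ^ j)) / (s ^ Suc j * s ^ Suc j)) (at s)"
    using 1 by (auto intro!: derivative_eq_intros simp del: power_Suc of_nat_Suc)
   moreover have "(exp (-1/s) * (1 / (s * s)) * s ^ Suc j - exp (-1/s) * (real (Suc j) * s ^ j)) / (s ^ Suc j * s ^ Suc j)
    = exp (-1/s) / s ^ (Suc j + 2) - real (Suc j) * (exp (-1/s) / s ^ (Suc j + 1))"
    using 1 by (simp add: field_simps del: of_nat_Suc)
   ultimately show ?thesis unfolding Suc using 1 by (simp add: hexp_def)
  qed
  then show ?thesis
   by (rule has_field_derivative_transform_within_open[where S="{0<..}"]) (use 1 in \<open>auto simp: hexp_def\<close>)
 next
  case 2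
  have "((%s. 0) has_real_derivative 0) (at s)" by simp
  then have "(hexp k has_real_derivative 0) (at s)"
   by (rule has_field_derivative_transform_within_open[where S="{..<0}"]) (use 2 in \<open>auto simp: hexp_def\<close>)
  then show ?thesis using 2 by (simp add: hexp_def)
 next
  case 3
  have "((%h. (hexp k (0 + h) - hexp k 0) / h) \<longlongrightarrow> 0) (at 0)"
  proof (rule Lim_null_comparison)
   show "\<forall>\<^sub>F x in at 0. norm ((hexp k (0 + x) - hexp k 0) / x) <= fact (k+2) * \<bar>x\<bar>"
    unfolding eventually_at_filter
   proof (rule always_eventually, safe)
    fix x :: real assume "x ~= 0"
    have "\<bar>hexp k x\<bar> <= (fact (k+2) * \<bar>x\<bar>) * \<bar>x\<bar>"
     using hexp_bound[of k x] by (simp only: mult.assoc abs_mult_self_eq power2_eq_square)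
    then show "norm ((hexp k (0 + x) - hexp k 0) / x) <= fact (k+2) * \<bar>x\<bar>"
     using \<open>x ~= 0\<close> by (simp add: hexp_def[of k 0] divide_le_eq del: fact_Suc add_2_eq_Suc')
   qed
   have "((%x. fact (k+2) * \<bar>x\<bar>) \<longlongrightarrow> fact (k+2) * \<bar>0::real\<bar>) (at 0)"
    by (intro tendsto_intros)
   then show "((%x. fact (k+2) * \<bar>x::real\<bar>) \<longlongrightarrow> 0) (at 0)" by simp
  qed
  then show ?thesis using 3 by (simp add: DERIV_def hexp_def[of _ 0])
 qed
qed

lemma hexp_radial_has_derivative:
 fixes x :: "real^'n"
 shows "((%x. hexp k (1 - (norm x)\<^sup>2)) has_derivative
  (%h. (hexp (k+2) (1 - (norm x)\<^sup>2) - k * hexp (k+1) (1 - (norm x)\<^sup>2)) * (- 2 * (x \<bullet> h)))) (at x)"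
proof -
 have 1: "((%x::real^'n. 1 - x \<bullet> x) has_derivative (%h. - 2 * (x \<bullet> h))) (at x)"
  using has_derivative_diff[OF has_derivative_const has_derivative_inner[OF has_derivative_ident has_derivative_ident], of 1 x UNIV]
  by (simp add: inner_commute)
 show ?thesis
  using diff_chain_at[OF 1 hexp_deriv[unfolded has_field_derivative_def]]
  by (simp add: o_def power2_norm_eq_inner)
qed

text \<open>Each partial derivative is a combination of \<open>hexp (k + 2)\<close> and
  \<open>hexp (k + 1)\<close> times a coordinate, so the induction on the order has to leave
  \<open>k\<close> free.\<close>

lemma hexp_radial_C_k:
 "C_k j (%x::real^'n. hexp k (1 - (norm x)\<^sup>2))"
proof (induction j arbitrary: k)
 case 0
 show ?case unfolding C_k.simps
  by (rule has_derivative_continuous_on[OF has_derivative_at_withinI[OF hexp_radial_has_derivative]])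
next
 case (Suc j)
 have "pd m (%x::real^'n. hexp k (1 - (norm x)\<^sup>2)) = (%x.
  (hexp (k+2) (1 - (norm x)\<^sup>2) + (- real k) * hexp (k+1) (1 - (norm x)\<^sup>2)) * (- 2 * x $ m))" for m
  by (rule ext, subst partial_derivative_eq[OF hexp_radial_has_derivative]) (simp add: inner_axis)
 moreover have "(%x::real^'n. hexp k (1 - (norm x)\<^sup>2)) differentiable_on UNIV"
  unfolding differentiable_on_def differentiable_def
  using has_derivative_at_withinI[OF hexp_radial_has_derivative] by blast
 moreover have "C_k j (%x::real^'n.
  (hexp (k+2) (1 - (norm x)\<^sup>2) + (- real k) * hexp (k+1) (1 - (norm x)\<^sup>2)) * (- 2 * x $ m))" for m
  by (intro C_k_mult C_k_add C_k_const C_k_component Suc)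
 ultimately show ?case unfolding C_k.simps by presburger
qed

definition smooth :: "(real^'n => real) => bool" where
 "smooth f \<longleftrightarrow> (\<forall>k. C_k k f)"

lemma smooth_diff: "smooth f ==> f differentiable_on UNIV"
 unfolding smooth_def by (metis C_k.simps(2))

lemma smooth_partial: "smooth f ==> smooth (pd m f)"
 unfolding smooth_def by (metis C_k.simps(2))

lemma smooth_continuous: "smooth f ==> continuous_on UNIV f"
 unfolding smooth_def by (metis C_k.simps(1))

lemma smooth_mult: "smooth f ==> smooth g ==> smooth (%x. f x * g x)"
 by (simp add: smooth_def C_k_mult)

lemma smooth_const: "smooth (%_. c)"
 by (simp add: smooth_def C_k_const)

lemma smooth_affine: "smooth f ==> smooth (%x. f (b + a *\<^sub>R x))"
 by (simp add: smooth_def C_k_affine)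

subsection \<open>Test functions\<close>

text \<open>Compactness of the support is traded for a radius beyond which the function vanishes,
  the form in which all estimates use it.\<close>

lemma test_functions_UNIV:
 "\<phi> \<in> TF \<longleftrightarrow> smooth \<phi> \<and> (\<exists>R. \<forall>x. \<phi> x ~= 0 --> norm x <= R)"
proof -
 have "compact (closure {x. \<phi> x ~= 0}) \<longleftrightarrow> bounded {x. \<phi> x ~= 0}"
  by (meson bounded_closure bounded_subset closure_subset compact_closure compact_eq_bounded_closed)
 also have "... \<longleftrightarrow> (\<exists>R. \<forall>x. \<phi> x ~= 0 --> norm x <= R)"
  by (auto simp: bounded_iff)
 finally have "compact (closure {x. \<phi> x ~= 0}) \<longleftrightarrow> (\<exists>R. \<forall>x. \<phi> x ~= 0 --> norm x <= R)" .
 then show ?thesis by (auto simp: test_functions_def smooth_def)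
qed

lemma test_functions_mono: "\<phi> \<in> test_functions A ==> \<phi> \<in> TF"
 by (auto simp: test_functions_def)

lemma test_smooth: "\<phi> \<in> TF ==> smooth \<phi>"
 by (simp add: test_functions_UNIV)

lemma test_partial:
 assumes "\<phi> \<in> TF" shows "pd m \<phi> \<in> TF"
proof -
 obtain R where R: "!!x. \<phi> x ~= 0 ==> norm x <= R" and s: "smooth \<phi>"
  using assms by (auto simp: test_functions_UNIV)
 have "pd m \<phi> x = 0" if "norm x > R" for x
 proof -
  have "((%_. 0) has_derivative (%_. 0)) (at x)" by simp
  moreover have "open {x::real^'a. norm x > R}" by (intro open_Collect_less continuous_intros)
  ultimately have "(\<phi> has_derivative (%_. 0)) (at x)"
   by (rule has_derivative_transform_within_open) (use that R in fastforce)+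
  then show ?thesis by (simp add: partial_derivative_eq)
 qed
 then show ?thesis using smooth_partial[OF s] by (auto simp: test_functions_UNIV intro!: exI[of _ R] intro: leI)
qed

lemma test_smooth_mult:
 "\<phi> \<in> TF ==> smooth \<psi> ==> (%x. \<psi> x * \<phi> x) \<in> TF"
 by (auto simp: test_functions_UNIV intro!: smooth_mult)

lemma test_affine:
 assumes "\<phi> \<in> TF" "a ~= 0"
 shows "(%x. \<phi> (b + a *\<^sub>R x)) \<in> TF"
proof -
 obtain R where R: "!!x. \<phi> x ~= 0 ==> norm x <= R" and s: "smooth \<phi>"
  using assms by (auto simp: test_functions_UNIV)
 have "norm x <= (R + norm b) / \<bar>a\<bar>" if "\<phi> (b + a *\<^sub>R x) ~= 0" for x
 proof -
  have "norm (a *\<^sub>R x) <= R + norm b"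
   using R[OF that] norm_triangle_ineq4[of "b + a *\<^sub>R x" b] by simp
  then show ?thesis using assms(2) by (simp add: field_simps)
 qed
 then show ?thesis using s by (auto simp: test_functions_UNIV intro!: smooth_affine)
qed

lemma test_bounded:
 assumes "\<phi> \<in> TF" obtains B where "B > 0" "!!x. \<bar>\<phi> x\<bar> <= B"
proof -
 obtain R where R: "!!x. \<phi> x ~= 0 ==> norm x <= R" and s: "smooth \<phi>"
  using assms by (auto simp: test_functions_UNIV)
 have "compact (\<phi> ` cball 0 R)"
  by (intro compact_continuous_image continuous_on_subset[OF smooth_continuous[OF s]]) auto
 then obtain B where B: "B > 0" "!!x. norm x <= R ==> \<bar>\<phi> x\<bar> <= B"
  by (auto dest!: compact_imp_bounded simp: bounded_pos)
 then have "\<bar>\<phi> x\<bar> <= B" for x using R[of x] by (cases "\<phi> x = 0") auto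
 with B(1) show thesis using that by blast
qed

lemma test_measurable [measurable_dest]:
 "\<phi> \<in> TF ==> \<phi> \<in> Bmeas"
 by (intro borel_measurable_continuous_onI smooth_continuous test_smooth)

lemma test_lipschitz:
 assumes "\<phi> \<in> TF" obtains B where "B > 0" "!!x y. \<bar>\<phi> x - \<phi> y\<bar> <= B * norm (x - y)"
proof -
 have "\<exists>B>0. \<forall>x. \<bar>pd m \<phi> x\<bar> <= B" for m
  using test_bounded[OF test_partial[OF assms]] by metis
 then obtain B where B: "!!m. B m > 0" "!!m x. \<bar>pd m \<phi> x\<bar> <= B m" by metis
 let ?B = "\<Sum>m\<in>UNIV. B m"
 have "norm (\<phi> x - \<phi> y) <= ?B * norm (x - y)" for x y
 proof (rule differentiable_bound[where S=UNIV])
  fix x show "(\<phi> has_derivative (%h. \<Sum>m\<in>UNIV. pd m \<phi> x * h $ m)) (at x within UNIV)"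
   using partial_derivative_works smooth_diff test_smooth assms by blast
  show "onorm (%h. \<Sum>m\<in>UNIV. pd m \<phi> x * h $ m) <= ?B"
  proof (rule onorm_le)
   fix h :: "real^'a"
   have "norm (\<Sum>m\<in>UNIV. pd m \<phi> x * h $ m) <= (\<Sum>m\<in>UNIV. B m * norm h)"
    by (rule sum_norm_le) (auto simp: abs_mult intro!: mult_mono B(2) component_le_norm_cart less_imp_le[OF B(1)])
   then show "norm (\<Sum>m\<in>UNIV. pd m \<phi> x * h $ m) <= ?B * norm h"
    by (simp add: sum_distrib_right)
  qed
 qed auto
 moreover have "?B > 0" using B(1) by (intro sum_pos) auto
 ultimately show thesis using that by auto
qed

lemma test_integrable_mult:
 fixes f :: "real^'n => 'b::euclidean_space"
 assumes "\<phi> \<in> TF" "locally_integrable f"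
 shows "integrable lborel (%x. \<phi> x *\<^sub>R f x)"
proof -
 obtain R where R: "!!x. \<phi> x ~= 0 ==> norm x <= R" and s: "smooth \<phi>"
  using assms by (auto simp: test_functions_UNIV)
 obtain B where B: "!!x. \<bar>\<phi> x\<bar> <= B" "B > 0" using test_bounded[OF assms(1)] by metis
 have i: "integrable lborel (%x. indicator (cball 0 R) x *\<^sub>R f x)"
  using assms(2) by (auto simp: locally_integrable_def set_integrable_def)
 note [measurable] = test_measurable[OF assms(1)]
 have "integrable lborel (%x. \<phi> x *\<^sub>R (indicator (cball 0 R) x *\<^sub>R f x))"
 proof (rule Bbound[OF integrable_mult_right[OF integrable_norm[OF i], of B]])
  show "(%x. \<phi> x *\<^sub>R (indicator (cball 0 R) x *\<^sub>R f x)) \<in> borel_measurable lborel"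
   using i by measurable
  show "AE x in lborel. norm (\<phi> x *\<^sub>R indicat_real (cball 0 R) x *\<^sub>R f x)
   <= norm (B * norm (indicat_real (cball 0 R) x *\<^sub>R f x))"
   using B by (intro AE_I2) (auto simp: abs_mult mult.assoc indicator_def intro!: mult_right_mono)
 qed
 moreover have "(%x. \<phi> x *\<^sub>R (indicator (cball 0 R) x *\<^sub>R f x)) = (%x. \<phi> x *\<^sub>R f x)"
  using R by (force simp: indicator_def)
 ultimately show ?thesis by metis
qed

lemma locint_continuous:
 fixes f :: "real^'n => 'b::euclidean_space"
 assumes "continuous_on UNIV f" shows "locally_integrable f"
 unfolding locally_integrable_def set_integrable_def
 using borel_integrable_compact continuous_on_subset[OF assms] by blast

lemma test_integrable: "\<phi> \<in> TF ==> integrable lborel \<phi>"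
 using test_integrable_mult[of \<phi> "%_. 1::real"] locint_continuous[of "%_. 1::real"]
 by simp

subsection \<open>Integration\<close>

lemma has_derivative_directional:
 fixes f :: "'a::real_normed_vector => real"
 assumes "(f has_derivative D) (at x)"
 shows "((%t. f (x + t *\<^sub>R h)) has_real_derivative D h) (at 0)"
proof -
 have 1: "((%t::real. x + t *\<^sub>R h) has_derivative (%t. t *\<^sub>R h)) (at 0)"
  by (auto intro!: derivative_eq_intros)
 have 2: "((%t. f (x + t *\<^sub>R h)) has_derivative (%t. D (t *\<^sub>R h))) (at 0)"
  using diff_chain_at[OF 1, of f D] assms by (simp add: o_def)
 have "D (t *\<^sub>R h) = D h * t" for t
  using linear_scale[OF has_derivative_linear[OF assms]] by (simp add: mult.commute)
 then show ?thesis using 2 by (simp add: has_field_derivative_def)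
qed

lemma has_derivative_directional_seq:
 fixes f :: "'a::real_normed_vector => real"
 assumes "(f has_derivative D) (at x)" "t ----> 0" "!!n. t n ~= 0"
 shows "(%n. (f (x + t n *\<^sub>R h) - f x) / t n) ----> D h"
proof -
 have "((%s. (f (x + s *\<^sub>R h) - f x) / s) \<longlongrightarrow> D h) (at 0)"
  using has_derivative_directional[OF assms(1), of h] by (simp add: DERIV_def)
 then show ?thesis using assms(2,3)
  unfolding tendsto_at_iff_sequentially o_def by auto
qed

text \<open>Domination is asked of the increments, through a Lipschitz factor \<open>L\<close>. The
  bound and the measurability of \<open>F'\<close> follow because it is a limit of difference
  quotients, and the remainder quotients are dominated by \<open>2 * L\<close>.\<close>

lemma
 fixes F :: "'a::euclidean_space => 'b => real"
 assumes D: "!!y. ((%x. F x y) has_derivative F' y) (at x0)"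
  and d: "d > 0" and I: "!!x. norm (x - x0) < d ==> integrable M (F x)"
  and L: "integrable M L"
  and Lip: "!!x y. norm (x - x0) < d ==> \<bar>F x y - F x0 y\<bar> <= L y * norm (x - x0)"
 shows integrable_param_derivative: "integrable M (%y. F' y h)"
  and has_derivative_param_integral:
   "((%x. \<integral>y. F x y \<partial>M) has_derivative (%h. \<integral>y. F' y h \<partial>M)) (at x0)"
proof -
 have I0: "integrable M (F x0)" using I[of x0] d by simp
 note [measurable] = borel_measurable_integrable[OF I0] borel_measurable_integrable[OF L]
 have bound: "\<bar>F' y h\<bar> <= L y * norm h"
  and meas: "(%y. F' y h) \<in> borel_measurable M" for y h
 proof -
  \<comment> \<open>Positive step sizes tending to 0 for which \<open>x0 + t n *\<^sub>R h\<close>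
    stays within distance \<open>d\<close> of \<open>x0\<close>, whatever \<open>h\<close>
    is.\<close>
  define t where "t n = d / (1 + norm h) / real (Suc n)" for n
  have t0: "t ----> 0" unfolding t_def
   using tendsto_mult[OF tendsto_const[of "d / (1 + norm h)"] LIMSEQ_inverse_real_of_nat]
   by (simp add: field_simps)
  have tpos: "t n > 0" for n unfolding t_def using d
   by (intro divide_pos_pos) (auto intro: add_pos_nonneg)
  have tsm: "norm (t n *\<^sub>R h) < d" for n
  proof -
   have "norm (t n *\<^sub>R h) = d * (norm h / (1 + norm h)) / real (Suc n)" using d by (simp add: t_def)
   also have "... <= d * (norm h / (1 + norm h)) / 1"
    using d by (intro divide_left_mono mult_nonneg_nonneg divide_nonneg_nonneg) auto
   also have "... < d * 1" using d by (auto intro!: mult_strict_left_mono simp: divide_less_eq add_pos_nonneg)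
   finally show ?thesis by simp
  qed
  have lim: "(%n. (F (x0 + t n *\<^sub>R h) y - F x0 y) / t n) ----> F' y h" for y
   using has_derivative_directional_seq[OF D t0] tpos by (metis less_irrefl)
  have "(%y. (F (x0 + t n *\<^sub>R h) y - F x0 y) / t n) \<in> borel_measurable M" for n
   using borel_measurable_integrable[OF I[of "x0 + t n *\<^sub>R h"]] tsm[of n] by simp
  then show "(%y. F' y h) \<in> borel_measurable M"
   by (rule borel_measurable_LIMSEQ_real[OF lim])
  have "\<bar>(F (x0 + t n *\<^sub>R h) y - F x0 y) / t n\<bar> <= L y * norm h" for n
   using Lip[of "x0 + t n *\<^sub>R h" y] tsm[of n] tpos[of n]
   by (simp add: abs_mult divide_le_eq mult.commute mult.left_commute)
  then show "\<bar>F' y h\<bar> <= L y * norm h"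
   using LIMSEQ_le_const2[OF tendsto_rabs[OF lim]] by blast
 qed
 show int: "integrable M (%y. F' y h)" for h
  by (rule Bbound[OF integrable_mult_left[OF L, of "norm h"] meas])
   (use order_trans[OF bound abs_ge_self] in auto)
 have blin: "bounded_linear (%h. \<integral>y. F' y h \<partial>M)"
 proof (rule bounded_linear_intro)
  fix h k :: 'a and r :: real
  show "(\<integral>y. F' y (h + k) \<partial>M) = (\<integral>y. F' y h \<partial>M) + (\<integral>y. F' y k \<partial>M)"
   using linear_add[OF has_derivative_linear[OF D]] int by simp
  show "(\<integral>y. F' y (r *\<^sub>R h) \<partial>M) = r *\<^sub>R (\<integral>y. F' y h \<partial>M)"
   using linear_scale[OF has_derivative_linear[OF D]] by simp
  have "norm (\<integral>y. F' y h \<partial>M) <= (\<integral>y. L y * norm h \<partial>M)"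
   by (intro order_trans[OF integral_norm_bound] integral_mono) (use bound int L in auto)
  then show "norm (\<integral>y. F' y h \<partial>M) <= norm h * (\<integral>y. L y \<partial>M)" by (simp add: mult.commute)
 qed
 show "((%x. \<integral>y. F x y \<partial>M) has_derivative (%h. \<integral>y. F' y h \<partial>M)) (at x0)"
  unfolding has_derivative_iff_norm
 proof (intro conjI blin)
  let ?I = "%x. \<integral>y. F x y \<partial>M"
  show "((%x. norm (?I x - ?I x0 - (\<integral>y. F' y (x - x0) \<partial>M)) / norm (x - x0)) \<longlongrightarrow> 0) (at x0)"
   unfolding tendsto_at_iff_sequentially o_def
  proof (intro allI impI)
   fix X :: "nat => 'a" assume X: "\<forall>i. X i \<in> UNIV - {x0}" "X ----> x0"
   \<comment> \<open>The remainder quotient is set to 0 outside the ball in which integrability is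
     assumed, so that every \<open>s n\<close> is measurable and dominated.\<close>
   define s where "s n y = (if norm (X n - x0) < d then (F (X n) y - F x0 y - F' y (X n - x0)) / norm (X n - x0) else 0)" for n y
   have ev: "\<forall>\<^sub>F n in sequentially. norm (X n - x0) < d"
    using X(2) d by (auto simp: tendsto_iff dist_norm)
   have smeas: "s n \<in> borel_measurable M" for n
    using borel_measurable_integrable[OF I[of "X n"]] meas[of "X n - x0"]
    by (cases "norm (X n - x0) < d") (auto simp: s_def[abs_def])
   have "(%n. \<integral>y. s n y \<partial>M) ----> (\<integral>y. 0 \<partial>M)"
   proof (rule integral_dominated_convergence[where w="%y. 2 * L y"])
    show "integrable M (%y. 2 * L y)" using L by simp
    show "AE y in M. (%n. s n y) ----> 0"
    proof (intro AE_I2)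
     fix y
     have "((%x. norm (F x y - F x0 y - F' y (x - x0)) / norm (x - x0)) \<longlongrightarrow> 0) (at x0)"
      using D[of y] unfolding has_derivative_iff_norm by blast
     then have "(%n. norm (F (X n) y - F x0 y - F' y (X n - x0)) / norm (X n - x0)) ----> 0"
      unfolding tendsto_at_iff_sequentially o_def using X by blast
     then show "(%n. s n y) ----> 0"
      by (rule Lim_null_comparison[rotated]) (auto simp: s_def)
    qed
    show "AE y in M. norm (s n y) <= 2 * L y" for n
    proof (intro AE_I2)
     fix y
     \<comment> \<open>The sign follows from the Lipschitz bound at a point displaced from
       \<open>x0\<close> along a basis vector.\<close>
     have "L y >= 0"
     proof -
      have "0 <= L y * norm (x0 + (d / 2 / norm (SOME b. b \<in> (Basis::'a set))) *\<^sub>R (SOME b. b \<in> (Basis::'a set)) - x0)"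
       using some_in_eq[of "Basis::'a set"] d
       by (intro order_trans[OF abs_ge_zero Lip]) auto
      then show ?thesis using some_in_eq[of "Basis::'a set"] d by (simp add: zero_le_mult_iff)
     qed
     moreover have "\<bar>F (X n) y - F x0 y - F' y (X n - x0)\<bar> <= 2 * L y * norm (X n - x0)" if "norm (X n - x0) < d"
      using Lip[OF that, of y] bound[of y "X n - x0"] by (simp add: mult.assoc)
     ultimately show "norm (s n y) <= 2 * L y"
      using X(1) by (auto simp: s_def divide_le_eq)
    qed
   qed (use smeas in auto)
   moreover have "\<forall>\<^sub>F n in sequentially. (\<integral>y. s n y \<partial>M) = (?I (X n) - ?I x0 - (\<integral>y. F' y (X n - x0) \<partial>M)) / norm (X n - x0)"
    using ev
   proof eventually_elim
    case (elim n)
    then have "s n = (%y. (F (X n) y - F x0 y - F' y (X n - x0)) / norm (X n - x0))" by (auto simp: s_def)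
    then show ?case using I[OF elim] I0 int by simp
   qed
   ultimately have "(%n. (?I (X n) - ?I x0 - (\<integral>y. F' y (X n - x0) \<partial>M)) / norm (X n - x0)) ----> 0"
    by (simp add: filterlim_cong)
   from tendsto_norm[OF this] show "(%n. norm (?I (X n) - ?I x0 - (\<integral>y. F' y (X n - x0) \<partial>M)) / norm (X n - x0)) ----> 0"
    by simp
  qed
 qed
qed

section \<open>Lebesgue integrals under translation and scaling\<close>

lemma integrable_lborel_translate:
 fixes f :: "'a::euclidean_space => 'b::euclidean_space"
 assumes "integrable lborel f" shows "integrable lborel (%x. f (c + x))"
proof -
 have "integrable (distr lborel borel ((+) c)) f" using assms by (simp add: lborel_distr_plus)
 then show ?thesis by (subst (asm) integrable_distr_eq) (use assms in auto)
qed

lemma lborel_integral_translate: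
 fixes f :: "'a::euclidean_space => 'b::euclidean_space"
 assumes "f \<in> Bmeas" shows "(LBINT x. f (c + x)) = (LBINT x. f x)"
proof -
 have "(LBINT x. f x) = (LINT x|distr lborel borel ((+) c). f x)" by (simp add: lborel_distr_plus)
 also have "... = (LBINT x. f (c + x))" by (rule integral_distr) (use assms in auto)
 finally show ?thesis by simp
qed

lemma lborel_nn_integral_translate:
 fixes f :: "'a::euclidean_space => ennreal"
 assumes "f \<in> Bmeas" shows "(\<integral>\<^sup>+x. f (c + x) \<partial>lborel) = (\<integral>\<^sup>+x. f x \<partial>lborel)"
proof -
 have "(\<integral>\<^sup>+x. f x \<partial>lborel) = (\<integral>\<^sup>+x. f x \<partial>distr lborel borel ((+) c))" by (simp add: lborel_distr_plus)
 also have "... = (\<integral>\<^sup>+x. f (c + x) \<partial>lborel)" by (rule nn_integral_distr) (use assms in auto)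
 finally show ?thesis by simp
qed

lemma lborel_AE_translate:
 fixes P :: "'a::euclidean_space => bool"
 assumes "AE x in lborel. P x" shows "AE x in lborel. P (c + x)"
proof -
 obtain N where N: "{x. \<not> P x} \<subseteq> N" "N \<in> null_sets lborel" using assms by (auto simp: eventually_ae_filter)
 have 0: "(\<integral>\<^sup>+x. indicator N (c + x) \<partial>lborel) = (0::ennreal)"
  using N lborel_nn_integral_translate[of "indicator N" c] by (auto simp: null_sets_def)
 then have "AE x in lborel. indicator N (c + x) = (0::ennreal)"
  using N by (subst (asm) nn_integral_0_iff_AE) (auto simp: null_sets_def)
 then show ?thesis by eventually_elim (use N(1) in \<open>auto simp: indicator_def split: if_splits\<close>)
qed

lemma lborel_integral_scale:
 fixes f :: "'a::euclidean_space => real"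
 assumes "r > 0" "f \<in> Bmeas"
 shows "(LBINT x. f (x /\<^sub>R r)) = r ^ DIM('a) * (LBINT x. f x)"
proof -
 have "(LBINT x. f (x /\<^sub>R r)) = (LINT x|density (distr lborel borel (%x::'a. 0 + r *\<^sub>R x)) (%_. \<bar>r\<bar> ^ DIM('a)). f (x /\<^sub>R r))"
  using lborel_affine[of r "0::'a"] assms(1) by simp
 also have "... = (LINT x|distr lborel borel (%x::'a. 0 + r *\<^sub>R x). r ^ DIM('a) *\<^sub>R f (x /\<^sub>R r))"
  using assms by (subst integral_density) (auto intro!: measurable_compose[OF _ assms(2)])
 also have "... = (LBINT x. r ^ DIM('a) *\<^sub>R f ((0 + r *\<^sub>R x) /\<^sub>R r))"
  using assms by (subst integral_distr) (auto intro!: borel_measurable_scaleR measurable_compose[OF _ assms(2)])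
 finally show ?thesis using assms by simp
qed

section \<open>Almost everywhere convergence along subsequences, and Fatou arguments\<close>

lemma summable_AE_of_integral_bound:
 fixes d :: "nat => 'a => real"
 assumes "!!k. integrable M (d k)" "!!k x. d k x >= 0" "!!k. (\<integral>x. d k x \<partial>M) <= b k" "summable b"
 shows "AE x in M. summable (%k. d k x)"
proof -
 have b0: "b k >= 0" for k by (rule order_trans[OF Bnonneg assms(3)]) (simp add: assms(2))
 have [measurable]: "d k \<in> borel_measurable M" for k using assms(1) by auto
 have "(\<integral>\<^sup>+x. (\<Sum>k. ennreal (d k x)) \<partial>M) = (\<Sum>k. \<integral>\<^sup>+x. ennreal (d k x) \<partial>M)"
  by (rule nn_integral_suminf) auto
 also have "... = (\<Sum>k. ennreal (\<integral>x. d k x \<partial>M))"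
  using assms by (subst nn_integral_eq_integral) auto
 also have "... <= (\<Sum>k. ennreal (b k))"
  by (intro suminf_le ennreal_leI assms) auto
 also have "... < \<infinity>" using suminf_ennreal_eq[OF b0 summable_sums[OF assms(4)]] by simp
 finally have "AE x in M. (\<Sum>k. ennreal (d k x)) ~= \<infinity>"
  by (intro nn_integral_noteq_infinite) auto
 then show ?thesis
  by eventually_elim (intro summable_suminf_not_top assms, simp add: infinity_ennreal_def)
qed

text \<open>Consecutive terms of the subsequence have squared distance below 4^(-k). With the weight
  2^k the integrals remain summable, so almost everywhere the weighted increments are bounded and
  the increments decay like 2^(-k/2).\<close>

lemma L2_Cauchy_AE_subseq:
 fixes f :: "nat => 'a => 'b::euclidean_space"
 assumes meas[measurable]: "!!n. f n \<in> borel_measurable M"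
  and int: "!!m n. integrable M (%x. (norm (f m x - f n x))\<^sup>2)"
  and cau: "!!e. e > 0 ==> \<exists>N. \<forall>m\<ge>N. \<forall>n\<ge>N. (\<integral>x. (norm (f m x - f n x))\<^sup>2 \<partial>M) < e"
 obtains g r where "g \<in> borel_measurable M" "strict_mono r"
  "AE x in M. (%n. f (r n) x) ----> g x"
proof -
 have "\<forall>k. \<exists>N. \<forall>m\<ge>N. \<forall>n\<ge>N. (\<integral>x. (norm (f m x - f n x))\<^sup>2 \<partial>M) < (1/4)^k" using cau by simp
 then obtain N where N: "!!k m n. m >= N k ==> n >= N k ==> (\<integral>x. (norm (f m x - f n x))\<^sup>2 \<partial>M) < (1/4)^k"
  by metis
 \<comment> \<open>The summand \<open>k\<close> makes \<open>r\<close> strictly increasing, and the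
   partial sums keep \<open>r k\<close> above \<open>N k\<close>.\<close>
 define r where "r k = k + (\<Sum>j\<le>k. N j)" for k
 have r: "strict_mono r" unfolding strict_mono_Suc_iff r_def by simp
 have rN: "r k >= N k" for k
  unfolding r_def using member_le_sum[of k "{..k}" N] by (simp add: trans_le_add2)
 let ?d = "%k x. 2^k * (norm (f (r (Suc k)) x - f (r k) x))\<^sup>2"
 have "AE x in M. summable (%k. ?d k x)"
 proof (rule summable_AE_of_integral_bound)
  show "integrable M (?d k)" for k using int by simp
  show "summable (%k. (1/2::real)^k)" by (rule summable_geometric) simp
  show "(\<integral>x. ?d k x \<partial>M) <= (1/2)^k" for k
  proof -
   have "N k <= r (Suc k)" using rN[of k] r by (meson lessI order_trans less_imp_le strict_mono_less)
   then have "(\<integral>x. ?d k x \<partial>M) <= 2^k * (1/4)^k"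
    using N[of k "r (Suc k)" "r k"] rN[of k] by simp
   also have "... = (1/2)^k" by (simp flip: power_mult_distrib)
   finally show ?thesis .
  qed
 qed simp
 then have conv: "AE x in M. convergent (%k. f (r k) x)"
 proof eventually_elim
  case (elim x)
  have "Bseq (%k. ?d k x)"
   using summable_LIMSEQ_zero[OF elim] by (intro convergent_imp_Bseq convergentI)
  then obtain C where C: "C > 0" "!!k. norm (?d k x) <= C" by (auto elim: BseqE)
  have "norm (f (r (Suc k)) x - f (r k) x) <= sqrt C * (sqrt (1/2))^k" for k
  proof -
   have "(norm (f (r (Suc k)) x - f (r k) x))\<^sup>2 <= C / 2^k" using C(2)[of k] by (simp add: le_divide_eq mult.commute)
   then have "norm (f (r (Suc k)) x - f (r k) x) <= sqrt (C / 2^k)"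
    by (rule real_le_rsqrt)
   then show ?thesis by (simp add: real_sqrt_divide real_sqrt_power power_divide)
  qed
  moreover have "summable (%k. sqrt C * (sqrt (1/2))^k)"
   by (intro summable_mult summable_geometric) (simp add: real_sqrt_divide)
  ultimately have "summable (%k. f (r (Suc k)) x - f (r k) x)"
   by (meson summable_comparison_test')
  then have "convergent (%n. \<Sum>k<n. f (r (Suc k)) x - f (r k) x)" by (simp add: summable_iff_convergent)
  then have "convergent (%n. (f (r n) x - f (r 0) x) + f (r 0) x)"
   by (intro convergent_add convergent_const) (simp add: sum_lessThan_telescope[of "%k. f (r k) x"])
  then show ?case by simp
 qed
 define g where "g x = lim (%k. f (r k) x)" for x
 have [measurable]: "g \<in> borel_measurable M" unfolding g_def by measurable
 have lim: "AE x in M. (%k. f (r k) x) ----> g x"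
  using conv by eventually_elim (simp add: g_def convergent_LIMSEQ_iff)
 have "g \<in> borel_measurable M" by measurable
 then show thesis by (rule that[OF _ r lim])
qed

text \<open>Fatou and semicontinuity arguments yield an inequality in the limit. Along a subsequence
  bounded away from 0 that inequality becomes a contradiction.\<close>

lemma tendsto_zero_via_subseq:
 fixes b :: "nat => real"
 assumes "!!e r. e > 0 ==> strict_mono (r :: nat => nat) ==> (!!n. b (r n) >= e) ==> False"
  and "!!n. b n >= 0"
 shows "b ----> 0"
proof (rule ccontr)
 assume "\<not> b ----> 0"
 then obtain e where e: "e > 0" "\<forall>N. \<exists>n\<ge>N. b n >= e"
  using assms(2) unfolding LIMSEQ_def dist_real_def by (metis abs_of_nonneg diff_zero not_less)
 then have inf: "infinite {n. b n >= e}" unfolding infinite_nat_iff_unbounded_le by blast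
 then show False
  using assms(1)[OF e(1) strict_mono_enumerate[OF inf]] enumerate_in_set[OF inf] by blast
qed

lemma powr_triangle:
 fixes a b :: real
 assumes "0 <= a" "0 <= b" "q >= 0"
 shows "(a + b) powr q <= 2 powr q * (a powr q + b powr q)"
proof -
 have "(a + b) powr q <= (2 * max a b) powr q" using assms by (intro powr_mono2) auto
 also have "... = 2 powr q * (max a b) powr q" using assms by (simp add: powr_mult)
 also have "(max a b) powr q <= a powr q + b powr q" by (simp add: max_def)
 finally show ?thesis by simp
qed

text \<open>Fatou's lemma for real integrals. Integrability of the limit belongs to the conclusion,
  because a bound on the integrals is all that the applications know.\<close>

lemma fatou_bound:
 fixes F :: "nat => 'a => real"
 assumes F: "!!n. integrable M (F n)" "!!n. AE x in M. F n x >= 0" and f: "f \<in> borel_measurable M"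
  and ae: "AE x in M. (%n. F n x) ----> f x"
  and b: "!!n. (\<integral>x. F n x \<partial>M) <= b n" "b ----> B"
 shows "integrable M f" "(\<integral>x. f x \<partial>M) <= B" "AE x in M. f x >= 0"
proof -
 have "AE x in M. \<forall>n. F n x >= 0" using F(2) by (simp add: AE_all_countable)
 with ae have pos: "AE x in M. f x >= 0 \<and> (\<forall>n. F n x >= 0)"
  by eventually_elim (auto intro: LIMSEQ_le_const)
 then show "AE x in M. f x >= 0" by eventually_elim simp
 have b0: "b n >= 0" for n by (rule order_trans[OF integral_nonneg_AE[OF F(2)] b(1)])
 have B0: "B >= 0" by (rule LIMSEQ_le_const[OF b(2)]) (use b0 in auto)
 have "(\<integral>\<^sup>+x. ennreal (f x) \<partial>M) = (\<integral>\<^sup>+x. liminf (%n. ennreal (F n x)) \<partial>M)"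
  using ae
 proof (intro nn_integral_cong_AE, eventually_elim)
  case (elim x)
  have "(%n. ennreal (F n x)) ----> ennreal (f x)" using elim by (intro tendsto_ennrealI) auto
  then show ?case using lim_imp_Liminf by force
 qed
 also have "... <= liminf (%n. \<integral>\<^sup>+x. ennreal (F n x) \<partial>M)"
  by (rule nn_integral_liminf) (use F(1) in auto)
 also have "... <= liminf (%n. ennreal (b n))"
  using b(1) by (intro Liminf_mono always_eventually allI) (simp add: nn_integral_eq_integral[OF F(1) F(2)] ennreal_leI)
 also have "... = ennreal B" by (intro lim_imp_Liminf tendsto_ennrealI b) simp
 finally have *: "(\<integral>\<^sup>+x. ennreal (f x) \<partial>M) <= ennreal B" .
 have "(\<integral>\<^sup>+x. ennreal (norm (f x)) \<partial>M) = (\<integral>\<^sup>+x. ennreal (f x) \<partial>M)"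
  using pos by (intro nn_integral_cong_AE, eventually_elim) simp
 then show i: "integrable M f" using f le_less_trans[OF * ennreal_less_top] by (intro integrableI_bounded) auto
 have "ennreal (\<integral>x. f x \<partial>M) <= ennreal B"
  using * pos by (subst (asm) nn_integral_eq_integral[OF i]) (auto elim: eventually_mono)
 then show "(\<integral>x. f x \<partial>M) <= B" using B0 by (simp add: ennreal_le_iff)
qed

text \<open>Fatou's lemma is applied to \<open>2\<^sup>q (|f\<^sub>n|\<^sup>q + |f|\<^sup>q) - |f\<^sub>n - f|\<^sup>q\<close>.\<close>

lemma Lq_convergence:
 fixes f :: "nat => 'a => 'b::euclidean_space"
 assumes q: "q > 0"
  and meas[measurable]: "!!n. f n \<in> borel_measurable M" "g \<in> borel_measurable M"
  and int: "!!n. integrable M (%x. norm (f n x) powr q)" "integrable M (%x. norm (g x) powr q)"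
  and ae: "AE x in M. (%n. f n x) ----> g x"
  and bd: "!!n. (\<integral>x. norm (f n x) powr q \<partial>M) <= b n"
  and lim: "b ----> (\<integral>x. norm (g x) powr q \<partial>M)"
 shows "(%n. \<integral>x. norm (f n x - g x) powr q \<partial>M) ----> 0"
proof (rule tendsto_zero_via_subseq)
 let ?b = "%n. \<integral>x. norm (f n x - g x) powr q \<partial>M"
 let ?G = "\<integral>x. norm (g x) powr q \<partial>M"
 define h where "h n x = 2 powr q * (norm (f n x) powr q + norm (g x) powr q) - norm (f n x - g x) powr q" for n x
 have h0: "h n x >= 0" for n x
 proof -
  have "norm (f n x - g x) powr q <= (norm (f n x) + norm (g x)) powr q"
   using q by (intro powr_mono2) (auto intro: norm_triangle_ineq4)
  then show ?thesis using powr_triangle[of "norm (f n x)" "norm (g x)" q] q by (simp add: h_def)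
 qed
 have [measurable]: "h n \<in> borel_measurable M" for n unfolding h_def by measurable
 have fg: "integrable M (%x. norm (f n x - g x) powr q)" for n
 proof (rule Bbound[where f="%x. 2 powr q * (norm (f n x) powr q + norm (g x) powr q)"])
  show "integrable M (%x. 2 powr q * (norm (f n x) powr q + norm (g x) powr q))" using int by simp
  show "AE x in M. norm (norm (f n x - g x) powr q) <= norm (2 powr q * (norm (f n x) powr q + norm (g x) powr q))"
   using h0[of n] by (auto simp: h_def)
 qed measurable
 have hi: "integrable M (h n)" for n unfolding h_def using fg int by simp
 have hv: "(\<integral>x. h n x \<partial>M) = 2 powr q * ((\<integral>x. norm (f n x) powr q \<partial>M) + ?G) - ?b n" for n
  unfolding h_def using fg int by simp
 fix e r assume e: "e > 0" and r: "strict_mono (r::nat=>nat)" and be: "!!n. ?b (r n) >= e"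
 have hb: "(\<integral>x. h n x \<partial>M) <= 2 powr q * (b n + ?G) - ?b n" for n
  unfolding hv using bd[of n] by (intro diff_right_mono mult_left_mono) auto
 have lb: "(%n. b (r n)) ----> ?G" using LIMSEQ_subseq_LIMSEQ[OF lim r] by (simp add: o_def)
 have "(\<integral>x. 2 powr q * (norm (g x) powr q + norm (g x) powr q) \<partial>M) <= 2 powr q * (?G + ?G) - e"
 proof (rule fatou_bound(2)[where F="%n. h (r n)" and b="%n. 2 powr q * (b (r n) + ?G) - e"])
  show "AE x in M. (%n. h (r n) x) ----> 2 powr q * (norm (g x) powr q + norm (g x) powr q)" using ae
  proof eventually_elim
   case (elim x)
   then have 1: "(%n. f (r n) x) ----> g x" using LIMSEQ_subseq_LIMSEQ[OF _ r] by (simp add: o_def)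
   have "(%n. h (r n) x) ----> 2 powr q * (norm (g x) powr q + norm (g x) powr q) - norm (g x - g x) powr q"
    unfolding h_def using q by (intro tendsto_intros tendsto_powr' 1) auto
   then show ?case by simp
  qed
  show "(%n. 2 powr q * (b (r n) + ?G) - e) ----> 2 powr q * (?G + ?G) - e" by (intro tendsto_intros lb)
  show "(\<integral>x. h (r n) x \<partial>M) <= 2 powr q * (b (r n) + ?G) - e" for n
   by (rule order_trans[OF hb diff_left_mono[OF be]])
 qed (use hi h0 in auto)
 moreover have "(\<integral>x. 2 powr q * (norm (g x) powr q + norm (g x) powr q) \<partial>M) = 2 powr q * (?G + ?G)" using int by simp
 ultimately show False using e by linarith
qed simp

text \<open>Translations preserve L1 distances, so continuity of translation passes to L1 limits by
  an estimate with three thirds.\<close>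

lemma L1_approx_translation:
 fixes f :: "'a::euclidean_space => 'b::euclidean_space"
 assumes f: "integrable lborel f"
  and app: "!!e. e > 0 ==> \<exists>g. integrable lborel g \<and> (LBINT x. norm (f x - g x)) < e \<and>
    (\<exists>d>0. \<forall>h. norm h < d --> (LBINT x. norm (g (h + x) - g x)) < e)"
  and e: "e > 0"
 shows "\<exists>d>0. \<forall>h. norm h < d --> (LBINT x. norm (f (h + x) - f x)) < e"
proof -
 obtain g d where g: "integrable lborel g" "(LBINT x. norm (f x - g x)) < e/3" "d > 0"
  "!!h. norm h < d ==> (LBINT x. norm (g (h + x) - g x)) < e/3"
  using app[of "e/3"] e by auto
 note [measurable] = borel_measurable_integrable[OF f] borel_measurable_integrable[OF g(1)]
 have "(LBINT x. norm (f (h + x) - f x)) < e" if "norm h < d" for h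
 proof -
  have i1: "integrable lborel (%x. norm (f (h + x) - g (h + x)))"
   and i2: "integrable lborel (%x. norm (g (h + x) - g x))"
   and i3: "integrable lborel (%x. norm (f x - g x))"
   and i4: "integrable lborel (%x. norm (f (h + x) - f x))"
   using f g(1) by (auto intro!: integrable_norm Bochner_Integration.integrable_diff integrable_lborel_translate)
  have "(LBINT x. norm (f (h + x) - f x)) <= (LBINT x. norm (f (h + x) - g (h + x)) + norm (g (h + x) - g x) + norm (f x - g x))"
   using i1 i2 i3 i4
   by (intro integral_mono Badd) (smt (verit, ccfv_SIG) norm_minus_commute norm_triangle_lt diff_add_cancel norm_triangle_ineq4 add_diff_cancel_left' diff_diff_eq2 norm_diff_triangle_le)+
  also have "... = (LBINT x. norm (f (h + x) - g (h + x))) + (LBINT x. norm (g (h + x) - g x)) + (LBINT x. norm (f x - g x))"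
   using i1 i2 i3 by simp
  also have "(LBINT x. norm (f (h + x) - g (h + x))) = (LBINT x. norm (f x - g x))"
   by (rule lborel_integral_translate) measurable
  finally show ?thesis using g(2) g(4)[OF that] by simp
 qed
 with g(3) show ?thesis by blast
qed

lemma L1_translation_open:
 fixes U :: "'a::euclidean_space set"
 assumes U: "open U" "emeasure lborel U < \<infinity>" and e: "e > 0"
 shows "\<exists>d>0. \<forall>h. norm h < d --> (LBINT x. norm (indicat_real U (h + x) - indicat_real U x)) < e"
proof -
 have [measurable]: "U \<in> sets borel" using U by simp
 have iU: "integrable lborel (indicat_real U)" using U by (simp add: integrable_indicator_iff)
 \<comment> \<open>\<open>S h\<close> measures the points of \<open>U\<close> that the shift moves
   out of \<open>U\<close>; those moved into \<open>U\<close> are counted by \<open>S (- h)\<close>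
   after a translation. As \<open>U\<close> is open, the integrand tends to 0 pointwise.\<close>
 define S where "S h = (LBINT x. indicat_real U x * (1 - indicat_real U (h + x)))" for h
 have Si: "integrable lborel (%x. indicat_real U x * (1 - indicat_real U (h + x)))" for h
  by (rule Bbound[OF iU]) (auto simp: indicator_def)
 have "(S \<longlongrightarrow> 0) (at 0)"
  unfolding tendsto_at_iff_sequentially o_def
 proof (intro allI impI)
  fix X :: "nat => 'a" assume X: "X ----> 0"
  have "(%n. S (X n)) ----> (\<integral>x. 0 \<partial>(lborel :: 'a measure))"
   unfolding S_def
  proof (rule integral_dominated_convergence[OF _ _ iU])
   show "AE x in lborel. (%n. indicat_real U x * (1 - indicat_real U (X n + x))) ----> 0"
   proof (intro AE_I2)
    fix x :: 'a
    show "(%n. indicat_real U x * (1 - indicat_real U (X n + x))) ----> 0"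
    proof (cases "x \<in> U")
     case True
     have "(%n. X n + x) ----> 0 + x" using X by (intro tendsto_intros)
     then have "\<forall>\<^sub>F n in sequentially. X n + x \<in> U" using topological_tendstoD[OF _ U(1)] True by auto
     then have "\<forall>\<^sub>F n in sequentially. indicat_real U x * (1 - indicat_real U (X n + x)) = 0"
      by eventually_elim simp
     then show ?thesis by (simp add: tendsto_eventually)
    qed simp
   qed
  qed (auto simp: indicator_def)
  then show "(%n. S (X n)) ----> 0" by simp
 qed
 then obtain d where d: "d > 0" "!!h. h ~= 0 ==> norm h < d ==> \<bar>S h\<bar> < e/2"
  using e unfolding LIM_eq by (metis diff_zero half_gt_zero norm_eq_zero real_norm_def zero_less_norm_iff)
 have "(LBINT x. norm (indicat_real U (h + x) - indicat_real U x)) < e" if h: "norm h < d" for h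
 proof (cases "h = 0")
  case False
  have i: "integrable lborel (%x. indicat_real U (h + x) * (1 - indicat_real U x))"
   using integrable_lborel_translate[OF Si[of "-h"], of h] by simp
  have "(LBINT x. norm (indicat_real U (h + x) - indicat_real U x)) =
   (LBINT x. indicat_real U x * (1 - indicat_real U (h + x)) + indicat_real U (h + x) * (1 - indicat_real U x))"
   by (intro Bcong) (auto simp: indicator_def)
  also have "... = S h + (LBINT x. indicat_real U (h + x) * (1 - indicat_real U x))"
   unfolding S_def using Si i by simp
  also have "(LBINT x. indicat_real U (h + x) * (1 - indicat_real U x)) = S (- h)"
   using lborel_integral_translate[of "%x. indicat_real U x * (1 - indicat_real U (-h + x))" h] by (simp add: S_def)
  finally show ?thesis using d(2)[of h] d(2)[of "-h"] h False by simp
 qed (use e in simp)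
 with d(1) show ?thesis by blast
qed

text \<open>Density: open sets of finite measure come first, sets of finite measure follow by outer
  regularity, and \<open>integrable_induct\<close> passes to sums and dominated limits.\<close>

lemma L1_translation:
 fixes f :: "'a::euclidean_space => 'b::euclidean_space"
 assumes "integrable lborel f" "e > 0"
 shows "\<exists>d>0. \<forall>h. norm h < d --> (LBINT x. norm (f (h + x) - f x)) < e"
 using assms
proof (induction f arbitrary: e rule: integrable_induct)
 case (base A c)
 have [measurable]: "A \<in> sets borel" using base by simp
 have iA: "integrable lborel (indicat_real A)" using base by (simp add: integrable_indicator_iff)
 have *: "\<exists>d>0. \<forall>h. norm h < d --> (LBINT x. norm (indicat_real A (h + x) - indicat_real A x)) < e" if "e > 0" for e
 proof (rule L1_approx_translation[OF iA _ that])
  fix e :: real assume e: "e > 0"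
  obtain U where U: "open U" "A \<subseteq> U" "emeasure lborel (U - A) < ennreal e"
   using outer_regular_lborel[of A e] base e by auto
  then have [measurable]: "U \<in> sets borel" by simp
  have "emeasure lborel U <= emeasure lborel A + emeasure lborel (U - A)"
   using emeasure_subadditive[of A lborel "U - A"] U(2) by (simp add: Un_absorb1)
  also have "... < \<infinity>" using base less_trans[OF U(3) ennreal_less_top] by simp
  finally have fU: "emeasure lborel U < \<infinity>" .
  have iU: "integrable lborel (indicat_real U)" using fU by (simp add: integrable_indicator_iff)
  have "(LBINT x. norm (indicat_real A x - indicat_real U x)) = (LBINT x. indicat_real (U - A) x)"
   using U(2) by (intro Bcong) (auto simp: indicator_def)
  also have "... = measure lborel (U - A)" by simp
  also have "... < e" using U(3) e by (subst measure_def) (metis enn2real_less_iff ennreal_less_top less_trans)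
  finally show "\<exists>g. integrable lborel g \<and> (LBINT x. norm (indicat_real A x - g x)) < e \<and>
    (\<exists>d>0. \<forall>h. norm h < d --> (LBINT x. norm (g (h + x) - g x)) < e)"
   using L1_translation_open[OF U(1) fU e] iU by blast
 qed
 have eq: "norm (indicat_real A (h + x) *\<^sub>R c - indicat_real A x *\<^sub>R c) = norm (indicat_real A (h + x) - indicat_real A x) * norm c" for h x
  by (simp flip: scaleR_diff_left)
 show ?case
 proof (cases "c = 0")
  case False
  obtain d where d: "d > 0" "!!h. norm h < d ==> (LBINT x. norm (indicat_real A (h + x) - indicat_real A x)) < e / norm c"
   using *[of "e / norm c"] False base by auto
  then show ?thesis unfolding eq using False by (auto simp: less_divide_eq intro!: exI[of _ d])
 qed (use base in \<open>auto intro: exI[of _ 1]\<close>)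
next
 case (add f g)
 obtain d1 d2 where d: "d1 > 0" "!!h. norm h < d1 ==> (LBINT x. norm (f (h + x) - f x)) < e/2"
  "d2 > 0" "!!h. norm h < d2 ==> (LBINT x. norm (g (h + x) - g x)) < e/2"
  using add.IH(1)[of "e/2"] add.IH(2)[of "e/2"] add.prems by auto
 have "(LBINT x. norm (f (h + x) + g (h + x) - (f x + g x))) < e" if "norm h < min d1 d2" for h
 proof -
  have i1: "integrable lborel (%x. norm (f (h + x) - f x))"
   and i2: "integrable lborel (%x. norm (g (h + x) - g x))"
   and i3: "integrable lborel (%x. norm (f (h + x) + g (h + x) - (f x + g x)))"
   using add.hyps by (auto intro!: integrable_norm Bochner_Integration.integrable_diff Badd integrable_lborel_translate)
  have "(LBINT x. norm (f (h + x) + g (h + x) - (f x + g x))) <= (LBINT x. norm (f (h + x) - f x) + norm (g (h + x) - g x))"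
   using i1 i2 i3 by (intro integral_mono Badd) (auto intro: norm_diff_triangle_ineq)
  also have "... < e" using d(2)[of h] d(4)[of h] that i1 i2 by simp
  finally show ?thesis .
 qed
 then show ?case using d by (intro exI[of _ "min d1 d2"]) auto
next
 case (lim f s)
 show ?case
 proof (rule L1_approx_translation[OF lim.hyps(4) _ lim.prems])
  fix e :: real assume e: "e > 0"
  note [measurable] = borel_measurable_integrable[OF lim.hyps(4)] borel_measurable_integrable[OF lim.hyps(1)]
  have "(%n. \<integral>x. norm (f x - s n x) \<partial>lborel) ----> (\<integral>x. 0 \<partial>(lborel::'a measure))"
  proof (rule integral_dominated_convergence[where w="%x. 3 * norm (f x)"])
   show "integrable lborel (%x. 3 * norm (f x))" using lim.hyps(4) by simp
   show "AE x in lborel. (%n. norm (f x - s n x)) ----> 0"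
   proof (intro AE_I2)
    fix x :: 'a
    have "(%n. norm (f x - s n x)) ----> norm (f x - f x)" using lim.hyps(2)[of x] by (intro tendsto_intros) auto
    then show "(%n. norm (f x - s n x)) ----> 0" by simp
   qed
   show "AE x in lborel. norm (norm (f x - s n x)) <= 3 * norm (f x)" for n
   proof (intro AE_I2)
    fix x :: 'a
    show "norm (norm (f x - s n x)) <= 3 * norm (f x)"
     using norm_triangle_ineq4[of "f x" "s n x"] lim.hyps(3)[of x n] by simp
   qed
  qed auto
  then have "\<forall>\<^sub>F n in sequentially. (LBINT x. norm (f x - s n x)) < e" using e by (intro order_tendstoD) auto
  then obtain n where "(LBINT x. norm (f x - s n x)) < e" by (auto simp: eventually_sequentially)
  then show "\<exists>g. integrable lborel g \<and> (LBINT x. norm (f x - g x)) < e \<and>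
    (\<exists>d>0. \<forall>h. norm h < d --> (LBINT x. norm (g (h + x) - g x)) < e)"
   using lim.hyps(1) lim.IH[OF e] by blast
 qed
qed

subsection \<open>Locally integrable functions\<close>

lemma locint_cball:
 "locally_integrable f \<longleftrightarrow> (\<forall>R. set_integrable lborel (cball 0 R) f)"
proof
 assume *: "\<forall>R. set_integrable lborel (cball 0 R) f"
 show "locally_integrable f" unfolding locally_integrable_def
 proof (intro allI impI)
  fix K :: "(real^'a) set" assume "compact K"
  then obtain R where "K \<subseteq> cball 0 R" using compact_imp_bounded[OF \<open>compact K\<close>] by (auto simp: bounded_iff subset_iff)
  with * \<open>compact K\<close> show "set_integrable lborel K f"
   using set_integrable_subset[of lborel "cball 0 R" f K] borel_compact[of K] by auto
 qed
qed (auto simp: locally_integrable_def)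

lemma locint_measurable:
 fixes f :: "real^'n => 'b::euclidean_space"
 assumes "locally_integrable f" shows "f \<in> Bmeas"
proof (rule borel_measurable_LIMSEQ_metric)
 show "(%x. indicat_real (cball 0 (real n)) x *\<^sub>R f x) \<in> Bmeas" for n
 proof -
  have "integrable lborel (%x. indicat_real (cball 0 (real n)) x *\<^sub>R f x)"
   using assms by (simp add: locint_cball set_integrable_def)
  from borel_measurable_integrable[OF this] show ?thesis by simp
 qed
 show "(%n. indicat_real (cball 0 (real n)) x *\<^sub>R f x) ----> f x" for x
 proof (rule tendsto_eventually)
  obtain N :: nat where N: "norm x <= N" using real_arch_simple by blast
  show "\<forall>\<^sub>F n in sequentially. indicat_real (cball 0 (real n)) x *\<^sub>R f x = f x"
   using eventually_ge_at_top[of N] by eventually_elim (use N in \<open>auto simp: indicator_def\<close>)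
 qed
qed

lemma locint_bound:
 fixes f :: "real^'n => 'b::euclidean_space"
  and g :: "real^'n => 'c::euclidean_space"
 assumes "locally_integrable f" "g \<in> Bmeas" "AE x in lborel. norm (g x) <= norm (f x)"
 shows "locally_integrable g"
 unfolding locint_cball
proof
 fix R :: real
 have "set_integrable lborel (cball 0 R) f" using assms(1) by (simp add: locint_cball)
 then show "set_integrable lborel (cball 0 R) g"
 proof (rule set_integrable_bound)
  show "set_borel_measurable lborel (cball 0 R) g"
   unfolding set_borel_measurable_def using assms(2)
   by (intro borel_measurable_scaleR borel_measurable_indicator) auto
 qed (use assms in auto)
qed

lemma locint_norm:
 fixes f :: "real^'n => 'b::euclidean_space"
 assumes "locally_integrable f" shows "locally_integrable (%x. norm (f x))"
 using assms locint_measurable[OF assms]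
 by (intro locint_bound[OF assms]) auto

lemma locint_add:
 fixes f g :: "real^'n => 'b::euclidean_space"
 assumes "locally_integrable f" "locally_integrable g" shows "locally_integrable (%x. f x + g x)"
 using assms unfolding locint_cball by auto

lemma locint_diff:
 fixes f g :: "real^'n => 'b::euclidean_space"
 assumes "locally_integrable f" "locally_integrable g" shows "locally_integrable (%x. f x - g x)"
 using assms unfolding locint_cball by auto

lemma locint_scaleR:
 fixes f :: "real^'n => 'b::euclidean_space"
 assumes "locally_integrable f" shows "locally_integrable (%x. c *\<^sub>R f x)"
 using assms unfolding locint_cball by auto

lemma locint_mult_bounded:
 fixes f :: "real^'n => 'b::euclidean_space"
 assumes f: "locally_integrable f" and w: "w \<in> Bmeas" "!!x. \<bar>w x\<bar> <= B"
 shows "locally_integrable (%x. w x *\<^sub>R f x)"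
proof (rule locint_bound[OF locint_scaleR[OF f, of B]])
 show "(%x. w x *\<^sub>R f x) \<in> Bmeas"
  using w locint_measurable[OF f] by measurable
 show "AE x in lborel. norm (w x *\<^sub>R f x) <= norm (B *\<^sub>R f x)"
  by (intro AE_I2) (auto intro!: mult_right_mono intro: order_trans[OF w(2) abs_ge_self])
qed

lemma locint_component:
 assumes "locally_integrable g" shows "locally_integrable (%x. g x $ m)"
proof (rule locint_bound[OF assms])
 show "(%x. g x $ m) \<in> Bmeas"
  by (rule measurable_compose[OF locint_measurable[OF assms]])
   (intro borel_measurable_continuous_onI continuous_intros)
 show "AE x in lborel. norm (g x $ m) <= norm (g x)" by (intro AE_I2) (rule Finite_Cartesian_Product.norm_nth_le)
qed

text \<open>The pointwise bound \<open>a <= 1 + a powr q\<close> takes the place of Hoelder's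
  inequality on bounded sets.\<close>

lemma locint_powr:
 fixes f :: "real^'n => 'b::euclidean_space"
 assumes "q >= 1" and f: "f \<in> Bmeas" "integrable lborel (%x. norm (f x) powr q)"
 shows "locally_integrable f"
proof (rule locint_bound[OF _ f(1)])
 have "locally_integrable (%x. norm (f x) powr q)"
  unfolding locint_cball set_integrable_def using f(2)
  by (intro allI integrable_mult_indicator) auto
 then show "locally_integrable (%x. 1 + norm (f x) powr q)"
  by (intro locint_add locint_continuous[of "%_. 1"]) auto
 have "a <= 1 + a powr q" if "a >= 0" for a :: real
 proof (cases "a <= 1")
  case False
  then have "a powr 1 <= a powr q" using assms(1) by (intro powr_mono) auto
  then show ?thesis using that by simp
 qed (use powr_ge_zero[of a q] in linarith)
 then show "AE x in lborel. norm (f x) <= norm (1 + norm (f x) powr q)" by (simp add: abs_of_nonneg)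
qed

subsection \<open>Convolution with test functions\<close>

text \<open>The kernel is evaluated at \<open>y - x\<close>, hence the minus sign in
  \<open>conv_partial_derivative\<close>. For the radial kernel \<open>eta\<close> this is the usual
  convolution.\<close>

definition conv :: "(real^'n => real) => (real^'n => 'b) => real^'n => 'b::euclidean_space" where
 "conv \<phi> f x = (LBINT y. \<phi> (y - x) *\<^sub>R f y)"

lemma test_shift: "\<phi> \<in> TF ==> (%y. \<phi> (y - x)) \<in> TF"
 using test_affine[of \<phi> 1 "- x"] by simp

lemma conv_integrable:
 "\<phi> \<in> TF ==> locally_integrable (f :: _ => _::euclidean_space) ==> integrable lborel (%y. \<phi> (y - x) *\<^sub>R f y)"
 by (rule test_integrable_mult[OF test_shift])

lemma conv_measurable:
 assumes "\<phi> \<in> TF" "locally_integrable f"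
 shows "conv \<phi> f \<in> Bmeas"
proof -
 note [measurable] = test_measurable[OF assms(1)] locint_measurable[OF assms(2)]
 show ?thesis unfolding conv_def by measurable
qed

lemma conv_component:
 fixes g :: "real^'n => real^'m"
 assumes "\<phi> \<in> TF" "locally_integrable g"
 shows "conv \<phi> g x $ m = conv \<phi> (%x. g x $ m) x"
 unfolding conv_def
 using integral_bounded_linear[OF bounded_linear_vec_nth conv_integrable[OF assms]] by simp

text \<open>The derivative falls on the kernel, which is Lipschitz. For all points within distance 1
  of \<open>x\<close> the shifted kernels live in one ball, on which \<open>f\<close> is
  integrable.\<close>

lemma conv_has_derivative:
 fixes f :: "real^'n => real"
 assumes \<phi>: "\<phi> \<in> TF" and f: "locally_integrable f"
 shows "(conv \<phi> f has_derivative (%h. \<Sum>m\<in>UNIV. - conv (pd m \<phi>) f x * h $ m)) (at x)"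
proof -
 obtain R where R: "!!x. \<phi> x ~= 0 ==> norm x <= R" and s: "smooth \<phi>"
  using \<phi> by (auto simp: test_functions_UNIV)
 obtain B where B: "B > 0" "!!x y. \<bar>\<phi> x - \<phi> y\<bar> <= B * norm (x - y)" using test_lipschitz[OF \<phi>] by metis
 let ?K = "cball 0 (R + norm x + 1) :: (real^'n) set"
 let ?L = "%y. B * (indicator ?K y * \<bar>f y\<bar>)"
 let ?D = "%y h. - (\<Sum>m\<in>UNIV. pd m \<phi> (y - x) * h $ m) * f y"
 have D: "((%x. \<phi> (y - x) * f y) has_derivative ?D y) (at x)" for y
 proof -
  have 1: "((%x. y - x) has_derivative (%h. 0 - h)) (at x)"
   by (intro has_derivative_diff has_derivative_const has_derivative_ident)
  have "((%x. \<phi> (y - x)) has_derivative (%h. \<Sum>m\<in>UNIV. pd m \<phi> (y - x) * (- h) $ m)) (at x)"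
   using diff_chain_at[OF 1 partial_derivative_works[OF smooth_diff[OF s]]] by (simp add: o_def)
  from has_derivative_mult_left[OF this, of "f y"] show ?thesis by (simp add: sum_negf)
 qed
 have int: "integrable lborel (%y. \<phi> (y - x) * f y)" for x
  using conv_integrable[OF \<phi> f] by simp
 have "((%x. \<integral>y. \<phi> (y - x) * f y \<partial>lborel) has_derivative (%h. \<integral>y. ?D y h \<partial>lborel)) (at x)"
 proof (rule has_derivative_param_integral[where d=1 and L="?L"])
  show "integrable lborel ?L"
   using f by (auto simp: locint_cball set_integrable_def dest!: spec[of _ "R + norm x + 1"] dest: integrable_abs simp: abs_mult)
  fix x' y assume x': "norm (x' - x) < (1::real)"
  show "\<bar>\<phi> (y - x') * f y - \<phi> (y - x) * f y\<bar> <= ?L y * norm (x' - x)"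
  proof (cases "y \<in> ?K")
   case True
   have "\<bar>\<phi> (y - x') - \<phi> (y - x)\<bar> * \<bar>f y\<bar> <= (B * norm (x' - x)) * \<bar>f y\<bar>"
    using B(2)[of "y - x'" "y - x"] by (intro mult_right_mono) (auto simp: norm_minus_commute)
   moreover have "\<bar>\<phi> (y - x') * f y - \<phi> (y - x) * f y\<bar> = \<bar>\<phi> (y - x') - \<phi> (y - x)\<bar> * \<bar>f y\<bar>"
    by (simp flip: abs_mult left_diff_distrib)
   ultimately show ?thesis using True by (simp add: mult_ac)
  next
   case False
   have "norm y <= norm (y - x') + norm x'" "norm y <= norm (y - x) + norm x" "norm x' <= norm (x' - x) + norm x"
    by (metis norm_triangle_sub add.commute)+
   then have "\<phi> (y - x') = 0" "\<phi> (y - x) = 0" using False x' R[of "y - x'"] R[of "y - x"] by force+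
   then show ?thesis using B(1) by simp
  qed
 qed (use D int in auto)
 moreover have "(LBINT y. ?D y h) = (\<Sum>m\<in>UNIV. - conv (pd m \<phi>) f x * h $ m)" for h
 proof -
  have i: "integrable lborel (%y. pd m \<phi> (y - x) * f y)" for m
   using conv_integrable[OF test_partial[OF \<phi>] f] by simp
  have "(LBINT y. ?D y h) = (LBINT y. (\<Sum>m\<in>UNIV. - (h $ m) * (pd m \<phi> (y - x) * f y)))"
   by (intro Bcong) (auto simp: sum_distrib_right sum_distrib_left sum_negf algebra_simps)
  also have "... = (\<Sum>m\<in>UNIV. - (h $ m) * (LBINT y. pd m \<phi> (y - x) * f y))"
   using i by (subst Bochner_Integration.integral_sum) auto
  finally show ?thesis by (simp add: conv_def mult.commute)
 qed
 ultimately show ?thesis by (simp add: conv_def[abs_def])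
qed

lemma conv_partial_derivative:
 fixes f :: "real^'n => real"
 assumes \<phi>: "\<phi> \<in> TF" and f: "locally_integrable f"
 shows "pd m (conv \<phi> f) x = - conv (pd m \<phi>) f x"
 by (subst partial_derivative_eq[OF conv_has_derivative[OF assms]])
  (simp add: axis_def if_distrib[of "times _"] cong: if_cong)

lemma conv_C_k:
 fixes f :: "real^'n => real"
 assumes "locally_integrable f" "\<phi> \<in> TF"
 shows "C_k k (conv \<phi> f)"
 using assms(2)
proof (induction k arbitrary: \<phi>)
 case 0
 show ?case unfolding C_k.simps
  by (rule has_derivative_continuous_on[OF has_derivative_at_withinI[OF conv_has_derivative[OF 0 assms(1)]]])
next
 case (Suc k)
 have "pd m (conv \<phi> f) = (%x. (-1) * conv (pd m \<phi>) f x)" for m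
  using conv_partial_derivative[OF Suc.prems assms(1)] by (intro ext) simp
 moreover have "C_k k (%x. (-1) * conv (pd m \<phi>) f x)" for m
  by (intro C_k_mult C_k_const Suc.IH test_partial Suc.prems)
 moreover have "conv \<phi> f differentiable_on UNIV"
  unfolding differentiable_on_def differentiable_def
  using has_derivative_at_withinI[OF conv_has_derivative[OF Suc.prems assms(1)]] by blast
 ultimately show ?case unfolding C_k.simps by presburger
qed

lemma conv_smooth:
 fixes f :: "real^'n => real"
 shows "locally_integrable f ==> \<phi> \<in> TF ==> smooth (conv \<phi> f)"
 by (simp add: smooth_def conv_C_k)

subsection \<open>Mollification\<close>

text \<open>The index 2 and the factor 2 are tied to \<open>Psi_bump\<close>: the gradient of
  \<open>hexp 0 (1 - (norm z)\<^sup>2)\<close> is \<open>- bumpf z *\<^sub>R z\<close>. This is what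
  turns the radius derivative of the mollifier into a Laplacian.\<close>

definition bumpf :: "real^'n => real" where
 "bumpf z = 2 * hexp 2 (1 - (norm z)\<^sup>2)"

lemma bumpf_nonneg: "bumpf z >= 0" by (simp add: bumpf_def hexp_nonneg)

lemma bumpf_support: "bumpf z ~= 0 \<longleftrightarrow> norm z < 1"
 using hexp_pos[of "1 - (norm z)\<^sup>2" 2] by (auto simp: bumpf_def hexp_def abs_square_less_1)

lemma hexp_radial_test: "(%z::real^'n. hexp k (1 - (norm z)\<^sup>2)) \<in> TF"
proof -
 have "norm z <= 1" if "hexp k (1 - (norm z)\<^sup>2) ~= 0" for z :: "real^'n"
  using that by (auto simp: hexp_def abs_square_less_1 split: if_splits)
 then show ?thesis by (auto simp: test_functions_UNIV smooth_def hexp_radial_C_k)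
qed

lemma bumpf_test: "bumpf \<in> TF"
 using test_smooth_mult[OF hexp_radial_test[of 2] smooth_const[of 2]] by (simp add: bumpf_def[abs_def])

lemma bumpf_mass_pos: "(LBINT z. bumpf (z :: real^'n)) > 0"
proof (rule ccontr)
 assume "\<not> ?thesis"
 moreover have "(LBINT z. bumpf (z :: real^'n)) >= 0" by (simp add: bumpf_nonneg)
 ultimately have "(LBINT z. bumpf (z :: real^'n)) = 0" by linarith
 then have "AE z in lborel. bumpf (z :: real^'n) = 0"
  by (subst (asm) integral_nonneg_eq_0_iff_AE) (auto simp: bumpf_nonneg intro: test_integrable bumpf_test)
 then have "AE z in lborel. (z :: real^'n) \<notin> ball 0 1"
  by eventually_elim (metis bumpf_support dist_0_norm mem_ball)
 then have "ball 0 1 \<in> null_sets (lborel :: (real^'n) measure)"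
  by (subst (asm) AE_iff_null_sets[symmetric]) auto
 then show False using emeasure_lborel_ball_finite content_ball_pos[of 1 "0::real^'n"]
  by (auto simp: null_sets_def measure_def)
qed

definition eta :: "real => real^'n => real" where
 "eta r z = bumpf (z /\<^sub>R r) / (r ^ CARD('n) * (LBINT z. bumpf (z :: real^'n)))"

lemma eta_nonneg: "r > 0 ==> eta r z >= 0"
 using bumpf_mass_pos by (auto simp: eta_def bumpf_nonneg intro!: divide_nonneg_nonneg mult_nonneg_nonneg less_imp_le)

lemma eta_support: "r > 0 ==> eta r z ~= 0 ==> norm z < r"
 using bumpf_support[of "z /\<^sub>R r"] by (auto simp: eta_def divide_less_eq divide_inverse_commute[symmetric] mult.commute)

lemma eta_test:
 assumes "r > 0" shows "eta r \<in> TF"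
proof -
 have "(%z. bumpf (0 + (1/r) *\<^sub>R z)) \<in> TF"
  using assms by (intro test_affine bumpf_test) auto
 from test_smooth_mult[OF this smooth_const[of "1 / (r ^ CARD('a) * (LBINT z. bumpf (z :: real^'a)))"]]
 show ?thesis by (simp add: eta_def[abs_def] inverse_eq_divide)
qed

lemma eta_integral: "r > 0 ==> (LBINT z. eta r (z::real^'n)) = 1"
 using lborel_integral_scale[of r "bumpf :: real^'n => real"] bumpf_mass_pos[where 'n='n]
  test_measurable[OF bumpf_test, where 'a='n]
 by (simp add: eta_def del: real_scaleR_def)

lemma eta_bound: obtains C where "C > 0" "!!r z. r > 0 ==> eta r (z::real^'n) <= C / r ^ CARD('n)"
proof -
 obtain B where B: "B > 0" "!!z::real^'n. \<bar>bumpf z\<bar> <= B" using test_bounded[OF bumpf_test] by metis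
 have "eta r z <= B / (LBINT z. bumpf (z :: real^'n)) / r ^ CARD('n)" if "r > 0" for r and z :: "real^'n"
  unfolding eta_def divide_divide_eq_left using B(2)[of "z /\<^sub>R r"] bumpf_mass_pos[where 'n='n] that
  by (subst mult.commute) (intro divide_right_mono, auto)
 moreover have "B / (LBINT z. bumpf (z :: real^'n)) > 0" using B(1) bumpf_mass_pos[where 'n='n] by simp
 ultimately show thesis using that by blast
qed

definition moll :: "real => (real^'n => 'b) => real^'n => 'b::euclidean_space" where
 "moll r = conv (eta r)"

lemma moll_eq:
 fixes f :: "real^'n => 'b::euclidean_space"
 assumes "r > 0" "locally_integrable f"
 shows "integrable lborel (%z. eta r z *\<^sub>R f (x + z))" "moll r f x = (LBINT z. eta r z *\<^sub>R f (x + z))"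
proof -
 note [measurable] = test_measurable[OF eta_test[OF assms(1)]] locint_measurable[OF assms(2)]
 have "integrable lborel (%y. eta r (y - x) *\<^sub>R f y)" by (rule conv_integrable[OF eta_test[OF assms(1)] assms(2)])
 from integrable_lborel_translate[OF this, of x] show "integrable lborel (%z. eta r z *\<^sub>R f (x + z))" by simp
 show "moll r f x = (LBINT z. eta r z *\<^sub>R f (x + z))"
  unfolding moll_def conv_def
  using lborel_integral_translate[of "%y. eta r (y - x) *\<^sub>R f y" x] by simp
qed

lemma moll_diff_eq:
 fixes f :: "real^'n => 'b::euclidean_space"
 assumes "r > 0" "locally_integrable f"
 shows "integrable lborel (%z. eta r z *\<^sub>R (f (x + z) - c))"
  "moll r f x - c = (LBINT z. eta r z *\<^sub>R (f (x + z) - c))"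
proof -
 have i: "integrable lborel (%z. eta r z *\<^sub>R c)"
  by (intro integrable_scaleR_left test_integrable[OF eta_test[OF assms(1)]])
 show "integrable lborel (%z. eta r z *\<^sub>R (f (x + z) - c))"
  unfolding scaleR_diff_right by (intro Bochner_Integration.integrable_diff moll_eq(1)[OF assms] i)
 show "moll r f x - c = (LBINT z. eta r z *\<^sub>R (f (x + z) - c))"
  unfolding scaleR_diff_right moll_eq(2)[OF assms] Bochner_Integration.integral_diff[OF moll_eq(1)[OF assms] i]
  using eta_integral[OF assms(1), where 'n='n] by (simp add: integral_scaleR_left test_integrable[OF eta_test[OF assms(1)]])
qed

text \<open>The variance of \<open>g\<close> under the probability density \<open>w\<close> is
  nonnegative.\<close>

lemma weighted_jensen:
 fixes w g :: "'a => real"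
 assumes "!!x. w x >= 0" "integrable M w" "(\<integral>x. w x \<partial>M) = 1" "integrable M (%x. w x * g x)" "integrable M (%x. w x * (g x)\<^sup>2)"
 shows "(\<integral>x. w x * g x \<partial>M)\<^sup>2 <= (\<integral>x. w x * (g x)\<^sup>2 \<partial>M)"
proof -
 let ?m = "\<integral>x. w x * g x \<partial>M"
 have "0 <= (\<integral>x. w x * (g x - ?m)\<^sup>2 \<partial>M)" using assms(1) by simp
 also have "... = (\<integral>x. w x * (g x)\<^sup>2 - 2 * ?m * (w x * g x) + ?m\<^sup>2 * w x \<partial>M)"
  by (intro Bcong) (auto simp: power2_eq_square algebra_simps)
 also have "... = (\<integral>x. w x * (g x)\<^sup>2 \<partial>M) - 2 * ?m * ?m + ?m\<^sup>2"
  using assms by simp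
 finally show ?thesis by (simp add: power2_eq_square)
qed

text \<open>Stated with nonnegative extended integrals so that \<open>moll_fubini\<close> can
  exchange the order of integration before any integrability in \<open>x\<close> is known.\<close>

lemma moll_diff_norm:
 fixes f :: "real^'n => 'b::euclidean_space"
 assumes "r > 0" "locally_integrable f"
 shows "ennreal (norm (moll r f x - c)) <= (\<integral>\<^sup>+z. ennreal (eta r z * norm (f (x + z) - c)) \<partial>lborel)"
proof -
 have "norm (moll r f x - c) <= (LBINT z. norm (eta r z *\<^sub>R (f (x + z) - c)))"
  unfolding moll_diff_eq(2)[OF assms] by (rule integral_norm_bound)
 then have "ennreal (norm (moll r f x - c)) <= (\<integral>\<^sup>+z. ennreal (norm (eta r z *\<^sub>R (f (x + z) - c))) \<partial>lborel)"
  by (subst nn_integral_eq_integral[OF integrable_norm[OF moll_diff_eq(1)[OF assms]]]) (auto intro: ennreal_leI)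
 then show ?thesis by (simp add: eta_nonneg[OF assms(1)])
qed

lemma moll_diff_norm2:
 fixes f :: "real^'n => 'b::euclidean_space"
 assumes "r > 0" "locally_integrable f"
 shows "ennreal ((norm (moll r f x - c))\<^sup>2) <= (\<integral>\<^sup>+z. ennreal (eta r z * (norm (f (x + z) - c))\<^sup>2) \<partial>lborel)"
proof (cases "(\<integral>\<^sup>+z. ennreal (eta r z * (norm (f (x + z) - c))\<^sup>2) \<partial>lborel) < \<infinity>")
 case True
 note [measurable] = test_measurable[OF eta_test[OF assms(1)]] locint_measurable[OF assms(2)]
 have i2: "integrable lborel (%z. eta r z * (norm (f (x + z) - c))\<^sup>2)"
  using True by (intro integrableI_bounded) (auto simp: eta_nonneg[OF assms(1)] abs_mult)
 have i1: "integrable lborel (%z. eta r z * norm (f (x + z) - c))"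
  using integrable_norm[OF moll_diff_eq(1)[OF assms, of x c]] by (simp add: eta_nonneg[OF assms(1)])
 have "norm (moll r f x - c) <= (LBINT z. norm (eta r z *\<^sub>R (f (x + z) - c)))"
  unfolding moll_diff_eq(2)[OF assms] by (rule integral_norm_bound)
 also have "... = (LBINT z. eta r z * norm (f (x + z) - c))" by (simp add: eta_nonneg[OF assms(1)])
 finally have "(norm (moll r f x - c))\<^sup>2 <= (LBINT z. eta r z * norm (f (x + z) - c))\<^sup>2"
  by (intro power_mono) auto
 also have "... <= (LBINT z. eta r z * (norm (f (x + z) - c))\<^sup>2)"
  by (rule weighted_jensen) (use i1 i2 assms eta_nonneg eta_integral test_integrable[OF eta_test] in auto)
 finally show ?thesis
  by (subst nn_integral_eq_integral[OF i2]) (auto intro: ennreal_leI simp: eta_nonneg[OF assms(1)])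
qed (simp add: not_less top_unique)

text \<open>\<open>eta r\<close> is a probability density supported in the ball of radius
  \<open>r\<close>, so a bound that is uniform over shifts shorter than \<open>r\<close> survives
  averaging.\<close>

lemma moll_fubini:
 fixes \<Phi> :: "real^'n => real^'n => real"
 assumes r: "r > 0" and [measurable]: "case_prod \<Phi> \<in> borel_measurable (borel \<Otimes>\<^sub>M borel)"
  and pos: "!!x z. \<Phi> x z >= 0"
  and bd: "!!z. norm z < r ==> (\<integral>\<^sup>+x. ennreal (\<Phi> x z) \<partial>lborel) <= e"
 shows "(\<integral>\<^sup>+x. (\<integral>\<^sup>+z. ennreal (eta r z * \<Phi> x z) \<partial>lborel) \<partial>lborel) <= e"
proof -
 note [measurable] = test_measurable[OF eta_test[OF r]]
 have "(\<integral>\<^sup>+x. (\<integral>\<^sup>+z. ennreal (eta r z * \<Phi> x z) \<partial>lborel) \<partial>lborel) = (\<integral>\<^sup>+z. (\<integral>\<^sup>+x. ennreal (eta r z * \<Phi> x z) \<partial>lborel) \<partial>lborel)"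
  by (rule lborel_pair.Fubini'[symmetric]) measurable
 also have "... = (\<integral>\<^sup>+z. ennreal (eta r z) * (\<integral>\<^sup>+x. ennreal (\<Phi> x z) \<partial>lborel) \<partial>lborel)"
 proof (intro nn_integral_cong)
  fix z :: "real^'n"
  have "(%x. case_prod \<Phi> (x, z)) \<in> Bmeas" by measurable
  then show "(\<integral>\<^sup>+x. ennreal (eta r z * \<Phi> x z) \<partial>lborel) = ennreal (eta r z) * (\<integral>\<^sup>+x. ennreal (\<Phi> x z) \<partial>lborel)"
   by (subst nn_integral_cmult[symmetric]) (auto simp: ennreal_mult eta_nonneg[OF r] pos)
 qed
 also have "... <= (\<integral>\<^sup>+z. ennreal (eta r (z::real^'n)) * e \<partial>lborel)"
 proof (intro nn_integral_mono)
  fix z :: "real^'n"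
  show "ennreal (eta r z) * (\<integral>\<^sup>+x. ennreal (\<Phi> x z) \<partial>lborel) <= ennreal (eta r z) * e"
   using bd[of z] eta_support[OF r, of z] by (cases "eta r z = 0") (auto intro: mult_left_mono)
 qed
 also have "... = (\<integral>\<^sup>+z. ennreal (eta r (z::real^'n)) \<partial>lborel) * e" by (rule nn_integral_multc) simp
 also have "(\<integral>\<^sup>+z. ennreal (eta r (z::real^'n)) \<partial>lborel) = 1"
  by (subst nn_integral_eq_integral) (simp_all add: eta_integral[OF r] test_integrable[OF eta_test[OF r]] eta_nonneg[OF r])
 finally show ?thesis by simp
qed

lemma moll_measurable:
 "r > 0 ==> locally_integrable f ==> moll r f \<in> Bmeas"
 unfolding moll_def by (intro conv_measurable eta_test)

lemma locint_integrable:
 assumes "integrable lborel f" shows "locally_integrable f"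
 unfolding locint_cball set_integrable_def using assms by (intro allI integrable_mult_indicator) auto

lemma moll_L1:
 fixes f :: "real^'n => 'b::euclidean_space"
 assumes f: "integrable lborel f" and e: "e > 0"
 shows "\<exists>d>0. \<forall>r. 0 < r \<and> r < d --> integrable lborel (%x. norm (moll r f x - f x)) \<and>
  (LBINT x. norm (moll r f x - f x)) < e"
proof -
 have [measurable]: "f \<in> Bmeas" using f by auto
 obtain d where d: "d > 0" "!!h. norm h < d ==> (LBINT x. norm (f (h + x) - f x)) < e / 2"
  using L1_translation[OF f, of "e/2"] e by auto
 have "integrable lborel (%x. norm (moll r f x - f x)) \<and> (LBINT x. norm (moll r f x - f x)) < e"
  if r: "0 < r" "r < d" for r
 proof -
  note li = locint_integrable[OF f]
  have [measurable]: "moll r f \<in> Bmeas" by (rule moll_measurable[OF r(1) li])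
  have "(\<integral>\<^sup>+x. ennreal (norm (moll r f x - f x)) \<partial>lborel) <= (\<integral>\<^sup>+x. (\<integral>\<^sup>+z. ennreal (eta r z * norm (f (x + z) - f x)) \<partial>lborel) \<partial>lborel)"
   by (intro nn_integral_mono moll_diff_norm r li)
  also have "... <= ennreal (e/2)"
  proof (rule moll_fubini[OF r(1)])
   fix z :: "real^'n" assume z: "norm z < r"
   have "integrable lborel (%x. f (x + z) - f x)"
    using integrable_lborel_translate[OF f, of z] f by (simp add: add.commute)
   then have "(\<integral>\<^sup>+x. ennreal (norm (f (x + z) - f x)) \<partial>lborel) = ennreal (LBINT x. norm (f (z + x) - f x))"
    by (subst nn_integral_eq_integral) (auto simp: add.commute)
   also have "... <= ennreal (e/2)" using d(2)[of z] z r by (intro ennreal_leI) auto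
   finally show "(\<integral>\<^sup>+x. ennreal (norm (f (x + z) - f x)) \<partial>lborel) <= ennreal (e/2)" .
  qed auto
  finally have *: "(\<integral>\<^sup>+x. ennreal (norm (moll r f x - f x)) \<partial>lborel) <= ennreal (e/2)" .
  have i: "integrable lborel (%x. norm (moll r f x - f x))"
   using le_less_trans[OF * ennreal_less_top] by (intro integrableI_bounded) auto
  have "(LBINT x. norm (moll r f x - f x)) <= e/2"
   using * e by (subst (asm) nn_integral_eq_integral[OF i]) (auto simp: ennreal_le_iff)
  with i e show ?thesis by simp
 qed
 with d(1) show ?thesis by blast
qed

text \<open>A Bochner integral of a non-integrable function is 0 by convention. The lemmas that
  extract limits from this relation therefore also assume local integrability of both sides.\<close>

definition L1loc :: "(nat => real^'n => 'b) => (real^'n => 'b::euclidean_space) => bool" where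
 "L1loc f g \<longleftrightarrow> (\<forall>R. (%n. LBINT x:cball 0 R. norm (f n x - g x)) ----> 0)"

lemma moll_L1loc:
 fixes f :: "real^'n => 'b::euclidean_space"
 assumes f: "locally_integrable f" and r: "!!n. r n > 0" "r ----> 0"
 shows "L1loc (%n. moll (r n) f) f"
 unfolding L1loc_def
proof
 fix R :: real
 have [measurable]: "f \<in> Bmeas" using locint_measurable[OF f] .
 \<comment> \<open>For \<open>r <= 1\<close> the mollification on the ball of radius
   \<open>R\<close> sees \<open>f\<close> only within radius \<open>R + 1\<close>, so the global L1
   result can be applied to the cut-off function.\<close>
 define F where "F = (%x. indicator (cball 0 (R + 1)) x *\<^sub>R f x)"
 have F: "integrable lborel F" using f by (simp add: F_def locint_cball set_integrable_def)
 have eq: "moll r f x = moll r F x" if "0 < r" "r <= 1" "norm x <= R" for r x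
  unfolding moll_def conv_def
 proof (intro Bcong refl)
  fix y :: "real^'n"
  have "norm y <= norm (y - x) + norm x" by (metis norm_triangle_sub add.commute)
  then show "eta r (y - x) *\<^sub>R f y = eta r (y - x) *\<^sub>R F y"
   using eta_support[OF that(1), of "y - x"] that by (cases "eta r (y - x) = 0") (auto simp: F_def)
 qed
 show "(%n. LBINT x:cball 0 R. norm (moll (r n) f x - f x)) ----> 0"
 proof (rule LIMSEQ_I)
  fix e :: real assume "e > 0"
  then obtain d where d: "d > 0" "!!r. 0 < r \<and> r < d ==> integrable lborel (%x. norm (moll r F x - F x)) \<and>
  (LBINT x. norm (moll r F x - F x)) < e"
   using moll_L1[OF F] by metis
  have "\<forall>\<^sub>F n in sequentially. r n < min d 1" using r(2) d(1) by (intro order_tendstoD) auto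
  then obtain N where N: "!!n. n >= N ==> r n < min d 1" by (auto simp: eventually_sequentially)
  have "norm ((ldist R (%x. moll (r n) f x) f) - 0) < e" if "n >= N" for n
  proof -
   have i: "integrable lborel (%x. norm (moll (r n) F x - F x))" "(LBINT x. norm (moll (r n) F x - F x)) < e"
    using d(2)[of "r n"] N[OF that] r(1) by auto
   have [measurable]: "F \<in> Bmeas" "moll (r n) F \<in> Bmeas"
    using F r(1) by (auto intro: moll_measurable locint_integrable)
   have "(ldist R (%x. moll (r n) f x) f) = (ldist R (%x. moll (r n) F x) F)"
    unfolding set_lebesgue_integral_def using eq[of "r n"] r(1)[of n] N[OF that]
    by (intro Bcong) (auto simp: indicator_def F_def)
   also have "... <= (LBINT x. norm (moll (r n) F x - F x))"
    unfolding set_lebesgue_integral_def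
    by (intro integral_mono i integrable_mult_indicator) (auto simp: indicator_def)
   finally have "(ldist R (%x. moll (r n) f x) f) < e" using i by simp
   moreover have "(ldist R (%x. moll (r n) f x) f) >= 0"
    unfolding set_lebesgue_integral_def by (intro Bnonneg) auto
   ultimately show ?thesis by simp
  qed
  then show "\<exists>N. \<forall>n\<ge>N. norm ((ldist R (%x. moll (r n) f x) f) - 0) < e" by blast
 qed
qed

lemma moll_locally_integrable:
 fixes f :: "real^'n => real"
 assumes "locally_integrable f" "r > 0" shows "locally_integrable (moll r f)"
 unfolding moll_def by (intro locint_continuous smooth_continuous conv_smooth assms eta_test)


text \<open>Diagonal choice: the \<open>k\<close>-th error is below 2^(-k) on the ball of radius
  \<open>k\<close>. The errors are then summable almost everywhere, and a given point lies in all
  balls from some index on.\<close>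

lemma L1loc_AE_subseq:
 fixes f :: "nat => real^'n => 'b::euclidean_space"
 assumes li: "!!n. locally_integrable (f n)" "locally_integrable g" and L: "L1loc f g"
 obtains r where "strict_mono r" "AE x in lborel. (%n. f (r n) x) ----> g x"
proof -
 have "\<exists>N. \<forall>n\<ge>N. (ldist (real k) (f n) g) < (1/2)^k" for k
 proof -
  have "(%n. LBINT x:cball 0 (real k). norm (f n x - g x)) ----> 0" using L by (simp add: L1loc_def)
  then have "\<forall>\<^sub>F n in sequentially. (ldist (real k) (f n) g) < (1/2)^k"
   by (intro order_tendstoD) auto
  then show ?thesis by (auto simp: eventually_sequentially)
 qed
 then obtain N where N: "!!k n. n >= N k ==> (ldist (real k) (f n) g) < (1/2)^k"
  by metis
 define r where "r k = k + (\<Sum>j\<le>k. N j)" for k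
 have r: "strict_mono r" unfolding strict_mono_Suc_iff r_def by simp
 have rN: "r k >= N k" for k
  unfolding r_def using member_le_sum[of k "{..k}" N] by (simp add: trans_le_add2)
 have "AE x in lborel. summable (%k. indicat_real (cball 0 (real k)) x *\<^sub>R norm (f (r k) x - g x))"
 proof (rule summable_AE_of_integral_bound)
  show "integrable lborel (%x. indicat_real (cball 0 (real k)) x *\<^sub>R norm (f (r k) x - g x))" for k
   using locint_norm[OF locint_diff[OF li(1)[of "r k"] li(2)]]
   by (simp add: locint_cball set_integrable_def)
  show "(LBINT x. indicat_real (cball 0 (real k)) x *\<^sub>R norm (f (r k) x - g x)) <= (1/2)^k" for k
   using N[OF rN[of k]] by (simp add: set_lebesgue_integral_def)
  show "summable (%k. (1/2::real)^k)" by (rule summable_geometric) simp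
 qed auto
 then have "AE x in lborel. (%n. f (r n) x) ----> g x"
 proof eventually_elim
  case (elim x)
  obtain K :: nat where K: "norm x <= K" using real_arch_simple by blast
  have "(%k. indicat_real (cball 0 (real k)) x *\<^sub>R norm (f (r k) x - g x)) ----> 0"
   by (rule summable_LIMSEQ_zero[OF elim])
  moreover have "\<forall>\<^sub>F k in sequentially. indicat_real (cball 0 (real k)) x *\<^sub>R norm (f (r k) x - g x) = norm (f (r k) x - g x)"
   using eventually_ge_at_top[of K] by eventually_elim (use K in \<open>auto simp: indicator_def\<close>)
  ultimately have "(%k. norm (f (r k) x - g x)) ----> 0" by (rule Lim_transform_eventually)
  from LIM_zero_cancel[OF tendsto_norm_zero_cancel[OF this]] show ?case .
 qed
 with that r show thesis by blast
qed

lemma L1loc_subseq: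
 assumes "L1loc f g" "strict_mono r" shows "L1loc (%n. f (r n)) g"
 using assms LIMSEQ_subseq_LIMSEQ[OF _ assms(2)] by (auto simp: L1loc_def o_def)

lemma L1loc_tendsto_test:
 fixes f :: "nat => real^'n => 'b::euclidean_space"
 assumes li: "!!n. locally_integrable (f n)" "locally_integrable g" and L: "L1loc f g"
  and \<phi>: "\<phi> \<in> TF"
 shows "(%n. LBINT x. \<phi> x *\<^sub>R f n x) ----> (LBINT x. \<phi> x *\<^sub>R g x)"
proof -
 obtain R where R: "!!x. \<phi> x ~= 0 ==> norm x <= R" using \<phi> by (auto simp: test_functions_UNIV)
 obtain B where B: "!!x. \<bar>\<phi> x\<bar> <= B" "B > 0" using test_bounded[OF \<phi>] by metis
 have "(%n. (LBINT x. \<phi> x *\<^sub>R f n x) - (LBINT x. \<phi> x *\<^sub>R g x)) ----> 0"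
 proof (rule Lim_null_comparison)
  show "(%n. B * (ldist R (f n) g)) ----> 0"
   using L by (intro tendsto_mult_right_zero) (simp add: L1loc_def)
  show "\<forall>\<^sub>F n in sequentially. norm ((LBINT x. \<phi> x *\<^sub>R f n x) - (LBINT x. \<phi> x *\<^sub>R g x))
   <= B * (ldist R (f n) g)"
  proof (intro always_eventually allI)
   fix n
   have i: "integrable lborel (%x. \<phi> x *\<^sub>R (f n x - g x))"
    by (intro test_integrable_mult \<phi> locint_diff li)
   have i2: "integrable lborel (%x. indicat_real (cball 0 R) x *\<^sub>R norm (f n x - g x))"
    using locint_norm[OF locint_diff[OF li(1)[of n] li(2)]]
    by (simp add: locint_cball set_integrable_def)
   have "(LBINT x. \<phi> x *\<^sub>R f n x) - (LBINT x. \<phi> x *\<^sub>R g x) = (LBINT x. \<phi> x *\<^sub>R (f n x - g x))"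
    unfolding scaleR_diff_right by (intro Bochner_Integration.integral_diff[symmetric] test_integrable_mult \<phi> li)
   also have "norm ... <= (LBINT x. norm (\<phi> x *\<^sub>R (f n x - g x)))" by (rule integral_norm_bound)
   also have "... <= (LBINT x. B * (indicat_real (cball 0 R) x *\<^sub>R norm (f n x - g x)))"
   proof (intro integral_mono integrable_norm i integrable_mult_right i2)
    fix x :: "real^'n"
    show "norm (\<phi> x *\<^sub>R (f n x - g x)) <= B * (indicat_real (cball 0 R) x *\<^sub>R norm (f n x - g x))"
     using R[of x] B(1)[of x] by (cases "\<phi> x = 0") (auto intro!: mult_right_mono mult_nonneg_nonneg less_imp_le[OF B(2)])
   qed
   finally show "norm ((LBINT x. \<phi> x *\<^sub>R f n x) - (LBINT x. \<phi> x *\<^sub>R g x))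
    <= B * (ldist R (f n) g)"
    by (simp add: set_lebesgue_integral_def)
  qed
 qed
 then show ?thesis by (simp add: LIM_zero_iff)
qed

subsection \<open>Weak gradients\<close>

text \<open>The integral of \<open>h\<close> shifted along an axis is constant in the shift, and its
  derivative at 0 is the integral of the partial derivative.\<close>

lemma integral_derivative_compact_support:
 fixes h :: "real^'n => real"
 assumes D: "!!x. (h has_derivative (%k. G x \<bullet> k)) (at x)" and R: "!!x. h x ~= 0 ==> norm x <= R"
  and B: "!!x. norm (G x) <= B"
 shows "(LBINT x. G x $ m) = 0"
proof -
 have cont: "continuous_on UNIV h" by (rule has_derivative_continuous_on[OF has_derivative_at_withinI[OF D]])
 have [measurable]: "h \<in> Bmeas" by (rule borel_measurable_continuous_onI[OF cont])
 have "h x = indicat_real (cball 0 R) x *\<^sub>R h x" for x using R[of x] by (auto simp: indicator_def)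
 moreover have "integrable lborel (%x. indicat_real (cball 0 R) x *\<^sub>R h x)"
  using locint_continuous[OF cont] by (simp add: locint_cball set_integrable_def)
 ultimately have hi: "integrable lborel h" by presburger
 have B0: "B >= 0" using B[of 0] norm_ge_zero order_trans by blast
 have lip: "norm (h x - h y) <= B * norm (x - y)" for x y
 proof (rule differentiable_bound[of UNIV])
  show "(h has_derivative (%k. G x \<bullet> k)) (at x within UNIV)" for x using D by simp
  show "onorm (%k. G x \<bullet> k) <= B" for x
   by (rule onorm_le) (use order_trans[OF Cauchy_Schwarz_ineq2 mult_right_mono[OF B]] in auto)
 qed auto
 let ?e = "axis m 1 :: real^'n"
 have "((%t. \<integral>y. h (t *\<^sub>R ?e + y) \<partial>lborel) has_derivative (%t. \<integral>y. t * (G y \<bullet> ?e) \<partial>lborel)) (at (0::real))"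
 proof (rule has_derivative_param_integral[where d=1 and L="%y. B * indicat_real (cball 0 (R + 1)) y"])
  fix y :: "real^'n"
  have 1: "((%t. t *\<^sub>R ?e + y) has_derivative (%t. t *\<^sub>R ?e)) (at (0::real))"
   by (auto intro!: derivative_eq_intros)
  show "((%t. h (t *\<^sub>R ?e + y)) has_derivative (%t. t * (G y \<bullet> ?e))) (at 0)"
   using diff_chain_at[OF 1, of h "%k. G y \<bullet> k"] D[of y] by (simp add: o_def)
 next
  fix t :: real and y :: "real^'n" assume t: "norm (t - 0) < 1"
  have n: "norm (t *\<^sub>R ?e) = \<bar>t\<bar>" by simp
  show "\<bar>h (t *\<^sub>R ?e + y) - h (0 *\<^sub>R ?e + y)\<bar> <= B * indicat_real (cball 0 (R + 1)) y * norm (t - 0)"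
  proof (cases "norm y <= R + 1")
   case True
   then show ?thesis using lip[of "t *\<^sub>R ?e + y" y] n by simp
  next
   case False
   have "norm y <= norm (t *\<^sub>R ?e + y) + norm (t *\<^sub>R ?e)"
    by (metis add_diff_cancel_left' norm_triangle_ineq4 add.commute)
   then have "h (t *\<^sub>R ?e + y) = 0" "h y = 0" using False t n R[of "t *\<^sub>R ?e + y"] R[of y] by force+
   then show ?thesis using B0 by simp
  qed
 next
  show "integrable lborel (%y. B * indicat_real (cball 0 (R + 1)) (y::real^'n))"
   using emeasure_lborel_cball_finite[of "0::real^'n" "R+1"] by (intro integrable_mult_right) (simp add: integrable_indicator_iff)
 qed (auto intro!: integrable_lborel_translate hi)
 moreover have "(LBINT y. h (t *\<^sub>R ?e + y)) = (LBINT y. h y)" for t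
  by (rule lborel_integral_translate) simp
 ultimately have "((%t. \<integral>y. h y \<partial>lborel) has_derivative (%t. \<integral>y. t * (G y \<bullet> ?e) \<partial>lborel)) (at (0::real))" by simp
 from has_derivative_unique[OF this has_derivative_const] have "(LBINT y. 1 * (G y \<bullet> ?e)) = 0"
  by metis
 then show ?thesis by (simp add: inner_axis)
qed

definition grad :: "(real^'n => real) => real^'n => real^'n" where
 "grad f x = (\<chi> m. pd m f x)"

lemma grad_has_derivative:
 "f differentiable_on UNIV ==> (f has_derivative (%h. grad f x \<bullet> h)) (at x)"
 using partial_derivative_works[of f x] by (simp add: grad_def inner_vec_def)

lemma smooth_grad_continuous: "smooth f ==> continuous_on UNIV (grad f)"
 unfolding grad_def[abs_def] by (intro continuous_on_vec_lambda smooth_continuous smooth_partial)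

lemma bounded_by_compact_support:
 fixes G :: "real^'n => 'b::real_normed_vector"
 assumes "continuous_on UNIV G" "!!x. norm x > R ==> G x = 0"
 obtains B where "!!x. norm (G x) <= B"
proof -
 have "compact (G ` cball 0 R)" using assms(1) by (intro compact_continuous_image) (auto intro: continuous_on_subset)
 then obtain B where B: "B > 0" "!!x. norm x <= R ==> norm (G x) <= B"
  by (auto dest!: compact_imp_bounded simp: bounded_pos)
 have "norm (G x) <= B" for x using B assms(2)[of x] by (cases "norm x <= R") auto
 then show thesis using that by blast
qed

text \<open>Integration by parts: the derivative of the compactly supported product of
  \<open>f\<close> with the test function integrates to 0.\<close>

lemma C1_is_weak_gradient:
 fixes f :: "real^'n => real"
 assumes D: "!!x. (f has_derivative (%k. G x \<bullet> k)) (at x)" and G: "continuous_on UNIV G"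
 shows "is_weak_gradient f G"
proof -
 have f: "continuous_on UNIV f" by (rule has_derivative_continuous_on[OF has_derivative_at_withinI[OF D]])
 have "(LBINT x. f x * pd m \<phi> x) = - (LBINT x. G x $ m * \<phi> x)"
  if \<phi>: "\<phi> \<in> TF" for \<phi> m
 proof -
  note s = test_smooth[OF \<phi>]
  obtain R where R: "!!x. \<phi> x ~= 0 ==> norm x <= R" using \<phi> by (auto simp: test_functions_UNIV)
  have "\<exists>R. \<forall>x. pd m \<phi> x ~= 0 --> norm x <= R" for m
   using test_partial[OF \<phi>] by (simp add: test_functions_UNIV)
  then obtain R' where R': "!!m x. pd m \<phi> x ~= 0 ==> norm x <= R' m" by metis
  \<comment> \<open>A common radius for \<open>\<phi>\<close> and all its partial derivatives,
    beyond which the gradient of the product vanishes.\<close>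
  define S where "S = Max (insert R (range R'))"
  have S: "R <= S" "R' m <= S" for m unfolding S_def by (intro Max_ge; simp)+
  let ?H = "%x. \<phi> x *\<^sub>R G x + f x *\<^sub>R grad \<phi> x"
  have "?H x = 0" if "norm x > S" for x
  proof -
   have "\<phi> x = 0" using R[of x] S(1) that by force
   moreover have "pd m \<phi> x = 0" for m using R'[of m x] S(2)[of m] that by force
   ultimately show ?thesis by (simp add: grad_def vec_eq_iff)
  qed
  moreover have "continuous_on UNIV ?H"
   by (intro continuous_intros f G smooth_continuous[OF s] smooth_grad_continuous[OF s])
  ultimately obtain B where B: "!!x. norm (?H x) <= B" using bounded_by_compact_support by blast
  have "(LBINT x. ?H x $ m) = 0"
  proof (rule integral_derivative_compact_support[OF _ _ B])
   show "((%x. f x * \<phi> x) has_derivative (%k. ?H x \<bullet> k)) (at x)" for x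
    using has_derivative_mult[OF D grad_has_derivative[OF smooth_diff[OF s]], of x]
    by (simp add: inner_add_left add.commute mult.commute)
   show "f x * \<phi> x ~= 0 ==> norm x <= R" for x using R by auto
  qed
  moreover have "integrable lborel (%x. \<phi> x *\<^sub>R (G x $ m))"
   by (intro test_integrable_mult \<phi> locint_component locint_continuous G)
  moreover have "integrable lborel (%x. pd m \<phi> x *\<^sub>R f x)"
   by (intro test_integrable_mult test_partial \<phi> locint_continuous f)
  ultimately have "(LBINT x. \<phi> x * (G x $ m)) + (LBINT x. f x * pd m \<phi> x) = 0"
   by (subst BIadd[symmetric]) (auto simp: grad_def mult.commute)
  then show ?thesis by (simp add: mult.commute)
 qed
 then show ?thesis unfolding is_weak_gradient_def
  using locint_continuous[OF f] locint_continuous[OF G] by blast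
qed

lemma smooth_is_weak_gradient: "smooth f ==> is_weak_gradient f (grad f)"
 by (intro C1_is_weak_gradient grad_has_derivative smooth_diff smooth_grad_continuous)

lemma wgD:
 assumes "is_weak_gradient u g"
 shows "locally_integrable u" "locally_integrable g"
  "!!\<phi> m. \<phi> \<in> TF ==> (LBINT x. u x * pd m \<phi> x) = - (LBINT x. g x $ m * \<phi> x)"
 using assms by (auto simp: is_weak_gradient_def)

lemma moll_seq: "(%n. 1 / real (Suc n)) ----> 0" "1 / real (Suc n) > 0"
 using LIMSEQ_inverse_real_of_nat by (simp_all add: inverse_eq_divide)

text \<open>Mollifications are integrals against shifted test functions, so they are all 0, and a
  subsequence of them converges to \<open>f\<close> almost everywhere.\<close>

lemma zero_by_test:
 fixes f :: "real^'n => real"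
 assumes f: "locally_integrable f" and z: "!!\<phi>. \<phi> \<in> TF ==> (LBINT x. \<phi> x * f x) = 0"
 shows "AE x in lborel. f x = 0"
proof -
 let ?r = "%n. 1 / real (Suc n)"
 have 0: "moll (?r n) f x = 0" for n x
  unfolding moll_def conv_def using z[OF test_shift[OF eta_test[OF moll_seq(2)]]] by simp
 obtain r where "AE x in lborel. (%n. moll (?r (r n)) f x) ----> f x"
  using L1loc_AE_subseq[OF moll_locally_integrable[OF f moll_seq(2)] f moll_L1loc[OF f moll_seq(2) moll_seq(1)]] by blast
 then show ?thesis unfolding 0 by eventually_elim (metis LIMSEQ_unique tendsto_const)
qed

text \<open>Allowing \<open>u\<close> and \<open>v\<close> to differ on a null set is what makes the
  choice operator \<open>weak_gradient\<close> compatible with almost everywhere classes.\<close>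

lemma wg_unique:
 assumes "is_weak_gradient u g" "is_weak_gradient v h" "AE x in lborel. u x = v x"
 shows "AE x in lborel. g x = h x"
proof -
 have "AE x in lborel. g x $ m - h x $ m = 0" for m
 proof (rule zero_by_test)
  note li = locint_component[OF wgD(2)[OF assms(1)]]
   locint_component[OF wgD(2)[OF assms(2)]]
  show "locally_integrable (%x. g x $ m - h x $ m)" by (rule locint_diff[OF li])
  fix \<phi> :: "real^'a => real" assume \<phi>: "\<phi> \<in> TF"
  note [measurable] = test_measurable[OF test_partial[OF \<phi>]]
   locint_measurable[OF wgD(1)[OF assms(1)]]
   locint_measurable[OF wgD(1)[OF assms(2)]]
  have "(LBINT x. u x * pd m \<phi> x) = (LBINT x. v x * pd m \<phi> x)"
   by (rule integral_cong_AE) (use assms(3) in auto)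
  then have "(LBINT x. \<phi> x * g x $ m) = (LBINT x. \<phi> x * h x $ m)"
   using wgD(3)[OF assms(1) \<phi>, of m] wgD(3)[OF assms(2) \<phi>, of m] by (simp add: mult.commute)
  then show "(LBINT x. \<phi> x * (g x $ m - h x $ m)) = 0"
   using test_integrable_mult[OF \<phi> li(1), of m] test_integrable_mult[OF \<phi> li(2), of m] by (simp add: right_diff_distrib)
 qed
 then have "AE x in lborel. \<forall>m\<in>UNIV. g x $ m - h x $ m = 0"
  by (subst AE_finite_all) auto
 then show ?thesis by eventually_elim (simp add: vec_eq_iff)
qed

lemma wg_cong:
 assumes "is_weak_gradient u g" "AE x in lborel. u x = v x" "AE x in lborel. g x = h x"
  "v \<in> Bmeas" "h \<in> Bmeas"
 shows "is_weak_gradient v h"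
proof -
 note [measurable] = locint_measurable[OF wgD(1)[OF assms(1)]]
   locint_measurable[OF wgD(2)[OF assms(1)]] assms(4,5)
 have c: "(%x. x $ m) \<in> Bmeas" for m by (intro borel_measurable_continuous_onI continuous_intros)
 have "locally_integrable v"
  by (rule locint_bound[OF wgD(1)[OF assms(1)]]) (use assms in auto)
 moreover have "locally_integrable h"
  by (rule locint_bound[OF wgD(2)[OF assms(1)]]) (use assms in auto)
 moreover have "(LBINT x. v x * pd m \<phi> x) = - (LBINT x. h x $ m * \<phi> x)"
  if \<phi>: "\<phi> \<in> TF" for \<phi> m
 proof -
  note [measurable] = test_measurable[OF \<phi>] test_measurable[OF test_partial[OF \<phi>]]
  have [measurable]: "(%x. g x $ m) \<in> Bmeas" "(%x. h x $ m) \<in> Bmeas"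
   by (intro measurable_compose[OF _ c] locint_measurable[OF wgD(2)[OF assms(1)]] assms(5))+
  have "(LBINT x. v x * pd m \<phi> x) = (LBINT x. u x * pd m \<phi> x)"
   by (rule integral_cong_AE) (use assms(2) in auto)
  also have "... = - (LBINT x. g x $ m * \<phi> x)" by (rule wgD(3)[OF assms(1) \<phi>])
  also have "(LBINT x. g x $ m * \<phi> x) = (LBINT x. h x $ m * \<phi> x)"
   by (rule integral_cong_AE) (use assms(3) in auto)
  finally show ?thesis .
 qed
 ultimately show ?thesis by (simp add: is_weak_gradient_def)
qed

lemma L1loc_component:
 fixes g :: "nat => real^'n => real^'m"
 assumes li: "!!n. locally_integrable (g n)" "locally_integrable h" and "L1loc g h"
 shows "L1loc (%n x. g n x $ m) (%x. h x $ m)"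
 unfolding L1loc_def
proof
 fix R
 show "(%n. LBINT x:cball 0 R. norm (g n x $ m - h x $ m)) ----> 0"
 proof (rule tendsto_sandwich[OF _ _ tendsto_const])
  show "(%n. LBINT x:cball 0 R. norm (g n x - h x)) ----> 0" using assms(3) by (simp add: L1loc_def)
  show "\<forall>\<^sub>F n in sequentially. 0 <= (ldist R (%x. g n x $ m) (%x. h x $ m))"
   unfolding set_lebesgue_integral_def by (intro always_eventually allI Bnonneg) auto
  show "\<forall>\<^sub>F n in sequentially. (ldist R (%x. g n x $ m) (%x. h x $ m)) <= (ldist R (g n) h)"
  proof (intro always_eventually allI)
   fix n
   note d = locint_diff[OF li(1)[of n] li(2)]
   show "(ldist R (%x. g n x $ m) (%x. h x $ m)) <= (ldist R (g n) h)"
    unfolding set_lebesgue_integral_def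
   proof (rule integral_mono)
    show "integrable lborel (%x. indicat_real (cball 0 R) x *\<^sub>R norm (g n x - h x))"
     using locint_norm[OF d] by (simp add: locint_cball set_integrable_def)
    show "integrable lborel (%x. indicat_real (cball 0 R) x *\<^sub>R norm (g n x $ m - h x $ m))"
     using locint_norm[OF locint_component[OF d, of m]] by (simp add: locint_cball set_integrable_def)
    show "indicat_real (cball 0 R) x *\<^sub>R norm (g n x $ m - h x $ m) <= indicat_real (cball 0 R) x *\<^sub>R norm (g n x - h x)" for x
     using Finite_Cartesian_Product.norm_nth_le[of "g n x - h x" m] by (auto intro!: mult_left_mono)
   qed
  qed
 qed
qed

text \<open>Test functions are bounded with bounded support, so both sides of the defining identity
  are continuous under local L1 convergence. The chain rule and the formula for positive parts rest
  on this.\<close>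

lemma wg_limit:
 assumes w: "!!n. is_weak_gradient (u n) (g n)" and li: "locally_integrable v" "locally_integrable h"
  and L: "L1loc u v" "L1loc g h"
 shows "is_weak_gradient v h"
proof -
 have "(LBINT x. v x * pd m \<phi> x) = - (LBINT x. h x $ m * \<phi> x)"
  if \<phi>: "\<phi> \<in> TF" for \<phi> m
 proof -
  have 1: "(%n. LBINT x. pd m \<phi> x *\<^sub>R u n x) ----> (LBINT x. pd m \<phi> x *\<^sub>R v x)"
   by (intro L1loc_tendsto_test wgD(1)[OF w] li L test_partial \<phi>)
  have 2: "(%n. LBINT x. \<phi> x *\<^sub>R (g n x $ m)) ----> (LBINT x. \<phi> x *\<^sub>R (h x $ m))"
   by (intro L1loc_tendsto_test locint_component L1loc_component wgD(2)[OF w] li L \<phi>)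
  have "(LBINT x. pd m \<phi> x *\<^sub>R u n x) = - (LBINT x. \<phi> x *\<^sub>R (g n x $ m))" for n
   using wgD(3)[OF w \<phi>, of n m] by (simp add: mult.commute)
  then have "(%n. LBINT x. pd m \<phi> x *\<^sub>R u n x) ----> - (LBINT x. \<phi> x *\<^sub>R (h x $ m))"
   using tendsto_minus[OF 2] by simp
  from LIMSEQ_unique[OF 1 this] show ?thesis by (simp add: mult.commute)
 qed
 with li show ?thesis by (simp add: is_weak_gradient_def)
qed

lemma wg_add:
 assumes "is_weak_gradient u g" "is_weak_gradient v h"
 shows "is_weak_gradient (%x. u x + v x) (%x. g x + h x)"
proof -
 note a = wgD[OF assms(1)] and b = wgD[OF assms(2)]
 have "(LBINT x. (u x + v x) * pd m \<phi> x) = - (LBINT x. (g x + h x) $ m * \<phi> x)"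
  if \<phi>: "\<phi> \<in> TF" for \<phi> m
  using a(3)[OF \<phi>, of m] b(3)[OF \<phi>, of m]
   test_integrable_mult[OF test_partial[OF \<phi>] a(1), of m] test_integrable_mult[OF test_partial[OF \<phi>] b(1), of m]
   test_integrable_mult[OF \<phi> locint_component[OF a(2)], of m]
   test_integrable_mult[OF \<phi> locint_component[OF b(2)], of m]
  by (simp add: algebra_simps)
 then show ?thesis using a(1,2) b(1,2) by (simp add: is_weak_gradient_def locint_add)
qed

lemma wg_cmult:
 assumes "is_weak_gradient u g"
 shows "is_weak_gradient (%x. c * u x) (%x. c *\<^sub>R g x)"
proof -
 note a = wgD[OF assms(1)]
 have "locally_integrable (%x. c * u x)" using locint_scaleR[OF a(1), of c] by simp
 moreover have "(LBINT x. c * u x * pd m \<phi> x) = - (LBINT x. (c *\<^sub>R g x) $ m * \<phi> x)"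
  if \<phi>: "\<phi> \<in> TF" for \<phi> m
  using a(3)[OF \<phi>, of m] by (simp add: mult.assoc)
 ultimately show ?thesis using a(1,2) by (simp add: is_weak_gradient_def locint_scaleR)
qed

lemma wg_smooth_mult:
 assumes "is_weak_gradient u g" and \<psi>: "smooth \<psi>"
 shows "is_weak_gradient (%x. \<psi> x * u x) (%x. \<psi> x *\<^sub>R g x + u x *\<^sub>R grad \<psi> x)"
proof -
 note a = wgD[OF assms(1)]
 have li: "locally_integrable (%x. \<psi> x *\<^sub>R f x)" if "locally_integrable f" "continuous_on UNIV \<psi>"
  for f :: "real^'a => 'b::euclidean_space" and \<psi>
  unfolding locint_cball
 proof
  fix R :: real
  have m: "\<psi> \<in> Bmeas" by (intro borel_measurable_continuous_onI that)
  have "compact (\<psi> ` cball 0 R)" by (intro compact_continuous_image continuous_on_subset[OF that(2)]) auto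
  then obtain B where B: "!!x. norm x <= R ==> \<bar>\<psi> x\<bar> <= B"
   by (force dest!: compact_imp_bounded simp: bounded_pos)
  have "locally_integrable (%x. (indicator (cball 0 R) x * \<psi> x) *\<^sub>R f x)"
  proof (rule locint_mult_bounded[OF that(1)])
   show "\<bar>indicator (cball 0 R) x * \<psi> x\<bar> <= max B 0" for x using B[of x] by (auto simp: indicator_def)
  qed (use m in \<open>auto intro!: borel_measurable_times borel_measurable_indicator\<close>)
  then have "set_integrable lborel (cball 0 R) (%x. (indicator (cball 0 R) x * \<psi> x) *\<^sub>R f x)"
   by (simp add: locint_cball)
  then show "set_integrable lborel (cball 0 R) (%x. \<psi> x *\<^sub>R f x)"
   by (rule set_integrable_cong[THEN iffD1, rotated -1]) auto
 qed
 have 1: "locally_integrable (%x. \<psi> x * u x)" using li[OF a(1) smooth_continuous[OF \<psi>]] by simp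
 have 2: "locally_integrable (%x. \<psi> x *\<^sub>R g x)" using li[OF a(2) smooth_continuous[OF \<psi>]] .
 have 3: "locally_integrable (%x. u x *\<^sub>R grad \<psi> x)"
 proof (rule locint_bound)
  show "locally_integrable (%x. norm (grad \<psi> x) *\<^sub>R u x)"
   by (intro li a continuous_intros smooth_grad_continuous \<psi>)
  show "(%x. u x *\<^sub>R grad \<psi> x) \<in> Bmeas"
   by (intro borel_measurable_scaleR locint_measurable a borel_measurable_continuous_onI smooth_grad_continuous \<psi>)
 qed (simp add: abs_mult mult.commute)
 have "(LBINT x. \<psi> x * u x * pd m \<phi> x) = - (LBINT x. (\<psi> x *\<^sub>R g x + u x *\<^sub>R grad \<psi> x) $ m * \<phi> x)"
  if \<phi>: "\<phi> \<in> TF" for \<phi> m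
 proof -
  let ?t = "%x. \<psi> x * \<phi> x"
  have t: "?t \<in> TF" by (rule test_smooth_mult[OF \<phi> \<psi>])
  have t2: "(%x. pd m \<psi> x * \<phi> x) \<in> TF" by (rule test_smooth_mult[OF \<phi> smooth_partial[OF \<psi>]])
  have t3: "(%x. \<psi> x * pd m \<phi> x) \<in> TF" by (rule test_smooth_mult[OF test_partial[OF \<phi>] \<psi>])
  have p: "pd m ?t x = pd m \<psi> x * \<phi> x + \<psi> x * pd m \<phi> x" for x
   by (rule partial_derivative_mult) (intro smooth_diff \<psi> test_smooth \<phi>)+
  have "(LBINT x. u x * pd m ?t x) =
   (LBINT x. pd m \<psi> x * \<phi> x * u x) + (LBINT x. \<psi> x * pd m \<phi> x * u x)"
   unfolding p using test_integrable_mult[OF t2 a(1)] test_integrable_mult[OF t3 a(1)]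
   by (subst BIadd[symmetric]) (auto simp: algebra_simps)
  moreover have "(LBINT x. (\<psi> x *\<^sub>R g x + u x *\<^sub>R grad \<psi> x) $ m * \<phi> x) =
   (LBINT x. ?t x * (g x $ m)) + (LBINT x. pd m \<psi> x * \<phi> x * u x)"
   using test_integrable_mult[OF t2 a(1)] test_integrable_mult[OF t locint_component[OF a(2)], of m]
   by (subst BIadd[symmetric]) (auto simp: algebra_simps grad_def)
  ultimately show ?thesis using a(3)[OF t, of m] by (simp add: mult_ac)
 qed
 with 1 2 3 show ?thesis by (auto simp: is_weak_gradient_def intro: locint_add)
qed

text \<open>Up to sign, differentiating the kernel in \<open>x\<close> is differentiating the
  shifted kernel in \<open>y\<close>, and the shifted kernel is an admissible test function.\<close>

lemma moll_is_weak_gradient: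
 assumes "is_weak_gradient u g" "r > 0"
 shows "grad (moll r u) x = moll r g x"
proof -
 note a = wgD[OF assms(1)]
 have "pd m (moll r u) x = moll r g x $ m" for m
 proof -
  have e: "eta r \<in> TF" by (rule eta_test[OF assms(2)])
  have p: "pd m (%y. eta r (y - x)) y = pd m (eta r) (y - x)" for y
   using partial_derivative_affine[OF smooth_diff[OF test_smooth[OF e]], of m "-x" 1 y] by simp
  have "pd m (moll r u) x = - (LBINT y. pd m (eta r) (y - x) * u y)"
   unfolding moll_def using conv_partial_derivative[OF e a(1)] by (simp add: conv_def)
  also have "... = - (LBINT y. u y * pd m (%y. eta r (y - x)) y)"
   by (simp add: p mult.commute)
  also have "... = (LBINT y. eta r (y - x) * (g y $ m))"
   using a(3)[OF test_shift[OF e, of x], of m] by (simp add: mult.commute)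
  also have "... = moll r g x $ m"
   using conv_component[OF e a(2)] by (simp add: moll_def conv_def)
  finally show ?thesis .
 qed
 then show ?thesis by (simp add: grad_def vec_eq_iff)
qed

lemma moll_smooth:
 fixes f :: "real^'n => real"
 shows "locally_integrable f ==> r > 0 ==> smooth (moll r f)"
 by (simp add: moll_def conv_smooth eta_test)

lemma set_integrable_cball:
 "locally_integrable f ==> integrable lborel (%x. indicat_real (cball 0 R) x *\<^sub>R f x)"
 by (simp add: locint_cball set_integrable_def)

lemma L1locI_bound:
 fixes f :: "nat => real^'n => 'b::euclidean_space"
 assumes li: "!!n. locally_integrable (f n)" "locally_integrable g" "!!n. locally_integrable (h n)"
  and bd: "!!n. AE x in lborel. norm (f n x - g x) <= h n x"
  and lim: "!!R. (%n. LBINT x:cball 0 R. h n x) ----> 0"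
 shows "L1loc f g"
 unfolding L1loc_def
proof
 fix R
 show "(%n. LBINT x:cball 0 R. norm (f n x - g x)) ----> 0"
 proof (rule tendsto_sandwich[OF _ _ tendsto_const lim])
  show "\<forall>\<^sub>F n in sequentially. 0 <= (ldist R (f n) g)"
   unfolding set_lebesgue_integral_def by (intro always_eventually allI Bnonneg) auto
  show "\<forall>\<^sub>F n in sequentially. (ldist R (f n) g) <= (LBINT x:cball 0 R. h n x)"
  proof (intro always_eventually allI)
   fix n
   show "(ldist R (f n) g) <= (LBINT x:cball 0 R. h n x)"
    unfolding set_lebesgue_integral_def
   proof (intro integral_mono_AE set_integrable_cball locint_norm locint_diff li)
    show "AE x in lborel. indicat_real (cball 0 R) x *\<^sub>R norm (f n x - g x) <= indicat_real (cball 0 R) x *\<^sub>R h n x"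
     using bd[of n] by eventually_elim (auto simp: indicator_def)
   qed
  qed
 qed
qed

lemma LINT_cball_dominated:
 fixes f :: "nat => real^'n => real"
 assumes "!!n. f n \<in> Bmeas" "locally_integrable w"
  "AE x in lborel. (%n. f n x) ----> 0" "!!n. AE x in lborel. \<bar>f n x\<bar> <= w x"
 shows "(%n. LBINT x:cball 0 R. f n x) ----> 0"
proof -
 have "(%n. LBINT x. indicat_real (cball 0 R) x *\<^sub>R f n x) ----> (LINT x|(lborel::(real^'n) measure). 0)"
 proof (rule integral_dominated_convergence[OF _ _ set_integrable_cball[OF assms(2), of R]])
  show "(%x. indicat_real (cball 0 R) x *\<^sub>R f n x) \<in> borel_measurable lborel" for n
   using assms(1) by (auto intro!: borel_measurable_times borel_measurable_indicator)
  show "AE x in lborel. (%n. indicat_real (cball 0 R) x *\<^sub>R f n x) ----> 0"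
   using assms(3) by eventually_elim (auto intro: tendsto_mult_right_zero)
  show "AE x in lborel. norm (indicat_real (cball 0 R) x *\<^sub>R f n x) <= indicat_real (cball 0 R) x *\<^sub>R w x" for n
   using assms(4)[of n] by eventually_elim (auto simp: indicator_def)
 qed simp
 then show ?thesis by (simp add: set_lebesgue_integral_def)
qed

lemma L1loc_dominated:
 fixes f :: "nat => real^'n => 'b::euclidean_space"
 assumes li: "!!n. locally_integrable (f n)" "locally_integrable g" "locally_integrable w"
  and "AE x in lborel. (%n. f n x) ----> g x" "!!n. AE x in lborel. norm (f n x - g x) <= w x"
 shows "L1loc f g"
proof (rule L1locI_bound[OF li(1,2) locint_norm[OF locint_diff[OF li(1,2)]]])
 note [measurable] = locint_measurable[OF li(1)] locint_measurable[OF li(2)]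
 show "(%n. LBINT x:cball 0 R. norm (f n x - g x)) ----> 0" for R
 proof (rule LINT_cball_dominated[OF _ li(3)])
  show "AE x in lborel. (%n. norm (f n x - g x)) ----> 0"
   using assms(4) by eventually_elim (simp add: tendsto_norm_zero LIM_zero)
 qed (use assms(5) in auto)
qed auto

text \<open>Mollify, use the classical chain rule and pass to the limit. The gradient error splits
  into a bounded factor times a term small in L1, and \<open>F' (v n x) - F' (u x)\<close> times
  \<open>g x\<close>, which is dominated and tends to 0 along an almost everywhere convergent
  subsequence.\<close>

lemma chain_rule_C1:
 fixes F :: "real => real"
 assumes w: "is_weak_gradient u g" and F: "!!s. (F has_real_derivative F' s) (at s)"
  and cont: "continuous_on UNIV F'" and L: "!!s. \<bar>F' s\<bar> <= L"
 shows "is_weak_gradient (%x. F (u x)) (%x. F' (u x) *\<^sub>R g x)"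
proof -
 note a = wgD[OF w]
 let ?r = "%n. 1 / real (Suc n)"
 have L0: "L >= 0" using L[of 0] by linarith
 have Lip: "\<bar>F s - F t\<bar> <= L * \<bar>s - t\<bar>" for s t
  using field_differentiable_bound[OF convex_UNIV, of F F' L s t] F L by simp
 have Fc: "continuous_on UNIV F" using DERIV_isCont[OF F] by (simp add: continuous_on_eq_continuous_at)
 have [measurable]: "F \<in> Bmeas" "F' \<in> Bmeas"
  using Fc cont by (auto intro: borel_measurable_continuous_onI)
 note [measurable] = locint_measurable[OF a(1)] locint_measurable[OF a(2)]
 have sm: "smooth (moll (?r n) u)" for n by (intro moll_smooth a moll_seq(2))
 have gm: "grad (moll (?r n) u) = moll (?r n) g" for n using moll_is_weak_gradient[OF w moll_seq(2)] by blast
 have mc: "continuous_on UNIV (moll (?r n) g)" for n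
  unfolding gm[symmetric] by (rule smooth_grad_continuous[OF sm])
 have li: "locally_integrable (moll (?r n) u)" "locally_integrable (moll (?r n) g)" for n
  by (intro locint_continuous smooth_continuous sm mc)+
 obtain r where r: "strict_mono r" and ae: "AE x in lborel. (%n. moll (?r (r n)) u x) ----> u x"
  using L1loc_AE_subseq[OF li(1) a(1) moll_L1loc[OF a(1) moll_seq(2,1)]] by blast
 define v where "v n = moll (?r (r n)) u" for n
 define G where "G n = moll (?r (r n)) g" for n
 have lv: "locally_integrable (v n)" "locally_integrable (G n)" for n using li by (simp_all add: v_def G_def)
 have L1: "L1loc v u" "L1loc G g"
  unfolding v_def G_def by (intro L1loc_subseq[OF moll_L1loc[OF _ moll_seq(2,1)] r] a)+
 have vc: "continuous_on UNIV (v n)" "continuous_on UNIV (G n)" for n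
  unfolding v_def G_def by (intro smooth_continuous sm mc)+
 note [measurable] = borel_measurable_continuous_onI[OF vc(1)] borel_measurable_continuous_onI[OF vc(2)]
 have W: "is_weak_gradient (%x. F (v n x)) (%x. F' (v n x) *\<^sub>R G n x)" for n
 proof (rule C1_is_weak_gradient)
  have "(v n has_derivative (%h. G n x \<bullet> h)) (at x)" for x
   unfolding v_def G_def gm[symmetric] by (intro grad_has_derivative smooth_diff sm)
  from diff_chain_at[OF this F[unfolded has_field_derivative_def]]
  show "((%x. F (v n x)) has_derivative (%k. (F' (v n x) *\<^sub>R G n x) \<bullet> k)) (at x)" for x
   by (simp add: o_def)
  show "continuous_on UNIV (%x. F' (v n x) *\<^sub>R G n x)"
   by (intro continuous_intros continuous_on_compose2[OF cont] vc) auto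
 qed
 have liF: "locally_integrable (%x. F (u x))"
 proof (rule locint_bound)
  show "locally_integrable (%x. \<bar>F 0\<bar> + L * \<bar>u x\<bar>)"
   using locint_add[OF locint_continuous[of "%_. \<bar>F 0\<bar>"] locint_scaleR[OF locint_norm[OF a(1)], of L]]
   by simp
  show "AE x in lborel. norm (F (u x)) <= norm (\<bar>F 0\<bar> + L * \<bar>u x\<bar>)"
  proof (rule AE_I2)
   fix x
   have "0 <= L * \<bar>u x\<bar>" using L0 by simp
   then show "norm (F (u x)) <= norm (\<bar>F 0\<bar> + L * \<bar>u x\<bar>)" using Lip[of "u x" 0] unfolding real_norm_def diff_zero by linarith
  qed
 qed measurable
 have liG: "locally_integrable (%x. F' (u x) *\<^sub>R g x)"
  by (rule locint_mult_bounded[OF a(2) _ L]) measurable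
 show ?thesis
 proof (rule wg_limit[OF W liF liG])
  show "L1loc (%n x. F (v n x)) (%x. F (u x))"
  proof (rule L1locI_bound[where h="%n x. L *\<^sub>R norm (v n x - u x)"])
   show "locally_integrable (%x. F (v n x))" for n using wgD(1)[OF W] .
   show "locally_integrable (%x. L *\<^sub>R norm (v n x - u x))" for n
    by (intro locint_scaleR locint_norm locint_diff lv a)
   show "(%n. LBINT x:cball 0 R. L *\<^sub>R norm (v n x - u x)) ----> 0" for R
    using tendsto_mult_right_zero[OF L1(1)[unfolded L1loc_def, rule_format, of R], of L] by simp
  qed (use liF Lip in auto)
  show "L1loc (%n x. F' (v n x) *\<^sub>R G n x) (%x. F' (u x) *\<^sub>R g x)"
  proof (rule L1locI_bound[where h="%n x. L *\<^sub>R norm (G n x - g x) + \<bar>F' (v n x) - F' (u x)\<bar> *\<^sub>R norm (g x)"])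
   have b2: "\<bar>\<bar>F' s - F' t\<bar>\<bar> <= 2 * L" for s t using L[of s] L[of t] by linarith
   have l1: "locally_integrable (%x. L *\<^sub>R norm (G n x - g x))" for n
    by (intro locint_scaleR locint_norm locint_diff lv a)
   have l2: "locally_integrable (%x. \<bar>F' (v n x) - F' (u x)\<bar> *\<^sub>R norm (g x))" for n
    by (rule locint_mult_bounded[OF locint_norm[OF a(2)] _ b2]) measurable
   show "locally_integrable (%x. F' (v n x) *\<^sub>R G n x)" for n using wgD(2)[OF W] .
   show "locally_integrable (%x. L *\<^sub>R norm (G n x - g x) + \<bar>F' (v n x) - F' (u x)\<bar> *\<^sub>R norm (g x))" for n
    by (intro locint_add l1 l2)
   show "AE x in lborel. norm (F' (v n x) *\<^sub>R G n x - F' (u x) *\<^sub>R g x) <= L *\<^sub>R norm (G n x - g x) + \<bar>F' (v n x) - F' (u x)\<bar> *\<^sub>R norm (g x)" for n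
   proof (rule AE_I2)
    fix x
    have "F' (v n x) *\<^sub>R G n x - F' (u x) *\<^sub>R g x = F' (v n x) *\<^sub>R (G n x - g x) + (F' (v n x) - F' (u x)) *\<^sub>R g x"
     by (simp add: algebra_simps)
    then have "norm (F' (v n x) *\<^sub>R G n x - F' (u x) *\<^sub>R g x) <= \<bar>F' (v n x)\<bar> * norm (G n x - g x) + \<bar>F' (v n x) - F' (u x)\<bar> * norm (g x)"
     by (metis norm_scaleR norm_triangle_ineq)
    also have "... <= L * norm (G n x - g x) + \<bar>F' (v n x) - F' (u x)\<bar> * norm (g x)"
     using mult_right_mono[OF L norm_ge_zero] by (intro add_right_mono)
    finally show "norm (F' (v n x) *\<^sub>R G n x - F' (u x) *\<^sub>R g x) <= L *\<^sub>R norm (G n x - g x) + \<bar>F' (v n x) - F' (u x)\<bar> *\<^sub>R norm (g x)" by simp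
   qed
   fix R
   have "(%n. LBINT x:cball 0 R. \<bar>F' (v n x) - F' (u x)\<bar> * norm (g x)) ----> 0"
   proof (rule LINT_cball_dominated)
    show "locally_integrable (%x. (2 * L) *\<^sub>R norm (g x))"
     by (intro locint_scaleR locint_norm a)
    show "AE x in lborel. (%n. \<bar>F' (v n x) - F' (u x)\<bar> * norm (g x)) ----> 0"
     using ae
    proof eventually_elim
     case (elim x)
     have "isCont F' (u x)" using cont by (simp add: continuous_on_eq_continuous_at)
     then have "(%n. F' (v n x)) ----> F' (u x)" using elim unfolding v_def by (rule isCont_tendsto_compose)
     then have "(%n. \<bar>F' (v n x) - F' (u x)\<bar>) ----> 0" by (intro tendsto_rabs_zero LIM_zero)
     then show ?case by (intro tendsto_mult_left_zero)
    qed
    show "AE x in lborel. \<bar>\<bar>F' (v n x) - F' (u x)\<bar> * norm (g x)\<bar> <= (2 * L) *\<^sub>R norm (g x)" for n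
     using b2 by (auto simp: abs_mult intro!: mult_right_mono)
   qed measurable
   from tendsto_add[OF tendsto_mult_right_zero[OF L1(2)[unfolded L1loc_def, rule_format, of R], of L] this]
   show "(%n. LBINT x:cball 0 R. L *\<^sub>R norm (G n x - g x) + \<bar>F' (v n x) - F' (u x)\<bar> *\<^sub>R norm (g x)) ----> 0"
    using set_integrable_cball[OF l1, of R] set_integrable_cball[OF l2, of R]
    by (simp add: set_lebesgue_integral_def distrib_left BIadd mult.left_commute)
  qed (rule liG)
 qed
qed

text \<open>A regularised positive part. The shift \<open>e\<close> is large compared with the
  smoothing scale \<open>e\<^sup>2\<close>; it makes the derivative at \<open>s = 0\<close> tend to
  0 and not to 1/2, so that the limiting gradient vanishes on the zero set.\<close>

definition smooth_pos :: "real => real => real" where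
 "smooth_pos e s = ((s - e) + sqrt ((s - e)\<^sup>2 + e ^ 4)) / 2"

definition smooth_pos' :: "real => real => real" where
 "smooth_pos' e s = (1 + (s - e) / sqrt ((s - e)\<^sup>2 + e ^ 4)) / 2"

lemma smooth_pos_derivative:
 assumes "e > 0" shows "(smooth_pos e has_real_derivative smooth_pos' e s) (at s)"
proof -
 have "(s - e)\<^sup>2 + e ^ 4 > 0" using assms by (intro add_nonneg_pos) auto
 then have "((%s. sqrt ((s - e)\<^sup>2 + e ^ 4)) has_real_derivative (inverse (sqrt ((s - e)\<^sup>2 + e ^ 4)) / 2) * (2 * (s - e))) (at s)"
  by (intro DERIV_chain'[where g=sqrt] DERIV_real_sqrt) (auto intro!: derivative_eq_intros)
 then have "((%s. ((s - e) + sqrt ((s - e)\<^sup>2 + e ^ 4)) / 2) has_real_derivative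
  ((1 - 0) + (inverse (sqrt ((s - e)\<^sup>2 + e ^ 4)) / 2) * (2 * (s - e))) / 2) (at s)"
  by (intro DERIV_cdivide DERIV_add DERIV_diff DERIV_ident DERIV_const)
 moreover have "inverse a / 2 * (2 * (s - e)) = (s - e) / a" for a :: real by (cases "a = 0") (simp_all add: field_simps)
 ultimately show ?thesis unfolding smooth_pos_def[abs_def] smooth_pos'_def by (simp only: diff_zero)
qed

lemma smooth_pos'_bound:
 assumes "e > 0" shows "0 <= smooth_pos' e s" "smooth_pos' e s <= 1"
proof -
 have "\<bar>s - e\<bar> <= sqrt ((s - e)\<^sup>2 + e ^ 4)"
  using real_sqrt_le_mono[of "(s-e)\<^sup>2" "(s - e)\<^sup>2 + e ^ 4"] by simp
 moreover have "sqrt ((s - e)\<^sup>2 + e ^ 4) > 0" using assms by (simp add: add_nonneg_pos)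
 ultimately have "\<bar>(s - e) / sqrt ((s - e)\<^sup>2 + e ^ 4)\<bar> <= 1"
  by (simp add: abs_divide divide_le_eq)
 then have "- 1 <= (s - e) / sqrt ((s - e)\<^sup>2 + e ^ 4)" "(s - e) / sqrt ((s - e)\<^sup>2 + e ^ 4) <= 1"
  by (simp_all only: abs_le_iff) linarith+
 then show "0 <= smooth_pos' e s" "smooth_pos' e s <= 1" unfolding smooth_pos'_def by simp_all
qed

lemma smooth_pos'_cont: "e > 0 ==> continuous_on UNIV (smooth_pos' e)"
proof -
 assume "e > 0"
 then have "(s - e)\<^sup>2 + e ^ 4 > 0" for s :: real by (intro add_nonneg_pos) auto
 then have "sqrt ((s - e)\<^sup>2 + e ^ 4) ~= 0" for s :: real by (metis less_irrefl real_sqrt_gt_zero)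
 then show ?thesis unfolding smooth_pos'_def[abs_def] by (intro continuous_intros) auto
qed

lemma smooth_pos_bound:
 assumes "0 < e" "e <= 1" shows "\<bar>smooth_pos e s - max 0 s\<bar> <= 2 * e"
proof -
 have "sqrt ((s - e)\<^sup>2 + e ^ 4) <= \<bar>s - e\<bar> + e\<^sup>2"
 proof (rule real_le_lsqrt)
  have "(s - e)\<^sup>2 + e ^ 4 + 2 * \<bar>s - e\<bar> * e\<^sup>2 = (\<bar>s - e\<bar> + e\<^sup>2)\<^sup>2"
   by (simp add: power2_sum flip: power_mult)
  then show "(s - e)\<^sup>2 + e ^ 4 <= (\<bar>s - e\<bar> + e\<^sup>2)\<^sup>2" by (smt (verit) zero_le_mult_iff abs_ge_zero zero_le_power2)
 qed auto
 moreover have "\<bar>s - e\<bar> <= sqrt ((s - e)\<^sup>2 + e ^ 4)"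
  using real_sqrt_le_mono[of "(s-e)\<^sup>2" "(s - e)\<^sup>2 + e ^ 4"] by simp
 moreover have "e\<^sup>2 <= e" using assms by (simp add: power2_eq_square mult_left_le)
 moreover have "\<bar>((s - e) + S) / 2 - max 0 s\<bar> <= 2 * e"
  if "S <= \<bar>s - e\<bar> + e\<^sup>2" "\<bar>s - e\<bar> <= S" "e\<^sup>2 <= e" for S
 proof (cases "s >= e")
  case True
  then show ?thesis using that assms by (simp add: max_def abs_le_iff field_simps)
 next
  case False
  then show ?thesis using that assms by (cases "s >= 0") (simp_all add: max_def abs_le_iff field_simps)
 qed
 ultimately show ?thesis unfolding smooth_pos_def by blast
qed

lemma smooth_pos'_lim:
 "(%n. smooth_pos' (1 / real (Suc n)) s) ----> (if s > 0 then 1 else 0)"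
proof (cases "s = 0")
 case False
 have "(%n. smooth_pos' (1 / real (Suc n)) s) ----> smooth_pos' 0 s"
  unfolding smooth_pos'_def using False by (intro tendsto_intros moll_seq(1)) auto
 then show ?thesis using False by (auto simp: smooth_pos'_def)
next
 case True
 have eq: "smooth_pos' (1 / real (Suc n)) 0 = (1 - 1 / sqrt (1 + (1 / real (Suc n))\<^sup>2)) / 2" for n
 proof -
  define e where "e = 1 / real (Suc n)"
  have e: "e > 0" unfolding e_def by simp
  have "sqrt ((0 - e)\<^sup>2 + e ^ 4) = sqrt (e\<^sup>2 * (1 + e\<^sup>2))" by (simp add: algebra_simps flip: power_add)
  also have "... = e * sqrt (1 + e\<^sup>2)" using e by (simp add: real_sqrt_mult)
  finally have "smooth_pos' e 0 = (1 - e / (e * sqrt (1 + e\<^sup>2))) / 2" by (simp add: smooth_pos'_def)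
  then show ?thesis using e by (simp add: e_def)
 qed
 have "(%n. (1 - 1 / sqrt (1 + (1 / real (Suc n))\<^sup>2)) / 2) ----> (1 - 1 / sqrt (1 + 0\<^sup>2)) / 2"
  by (intro tendsto_intros moll_seq(1)) auto
 then show ?thesis using True by (simp only: eq) simp
qed

lemma weak_gradient_pos_part:
 assumes w: "is_weak_gradient u g"
 shows "is_weak_gradient (%x. max 0 (u x)) (%x. if u x > 0 then g x else 0)"
proof -
 note a = wgD[OF w]
 note [measurable] = locint_measurable[OF a(1)] locint_measurable[OF a(2)]
 let ?r = "%n. 1 / real (Suc n)"
 have W: "is_weak_gradient (%x. smooth_pos (?r n) (u x)) (%x. smooth_pos' (?r n) (u x) *\<^sub>R g x)" for n
  by (rule chain_rule_C1[OF w smooth_pos_derivative[OF moll_seq(2)] smooth_pos'_cont[OF moll_seq(2)], of _ 1])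
   (use smooth_pos'_bound[OF moll_seq(2)] in \<open>simp add: abs_le_iff order_trans[of _ 0]\<close>)
 have r1: "?r n <= 1" for n by simp
 show ?thesis
 proof (rule wg_limit[OF W])
  show l1: "locally_integrable (%x. max 0 (u x))"
   by (rule locint_bound[OF a(1)]) auto
  show l2: "locally_integrable (%x. if 0 < u x then g x else 0)"
   by (rule locint_bound[OF a(2)]) auto
  show "L1loc (%n x. smooth_pos (?r n) (u x)) (%x. max 0 (u x))"
  proof (rule L1loc_dominated[OF wgD(1)[OF W] l1])
   show "locally_integrable (%_::real^'a. 2::real)" by (intro locint_continuous continuous_intros)
   have b: "norm (smooth_pos (?r n) s - max 0 s) <= 2 * ?r n" for n s
    using smooth_pos_bound[OF moll_seq(2) r1] by simp
   show "AE x in lborel. norm (smooth_pos (?r n) (u x) - max 0 (u x)) <= 2" for n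
    using r1[of n] by (intro AE_I2 order_trans[OF b]) linarith
   show "AE x in lborel. (%n. smooth_pos (?r n) (u x)) ----> max 0 (u x)"
   proof (intro AE_I2)
    fix x
    have "(%n. 2 * ?r n) ----> 0" by (intro tendsto_mult_right_zero moll_seq)
    then have "(%n. smooth_pos (?r n) (u x) - max 0 (u x)) ----> 0"
     by (rule Lim_null_comparison[rotated]) (intro always_eventually allI b)
    then show "(%n. smooth_pos (?r n) (u x)) ----> max 0 (u x)" by (rule LIM_zero_cancel)
   qed
  qed
  show "L1loc (%n x. smooth_pos' (?r n) (u x) *\<^sub>R g x) (%x. if 0 < u x then g x else 0)"
  proof (rule L1loc_dominated[OF wgD(2)[OF W] l2 locint_norm[OF a(2)]])
   show "AE x in lborel. (%n. smooth_pos' (?r n) (u x) *\<^sub>R g x) ----> (if 0 < u x then g x else 0)"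
   proof (intro AE_I2)
    fix x
    have "(%n. smooth_pos' (?r n) (u x) *\<^sub>R g x) ----> (if u x > 0 then 1 else 0) *\<^sub>R g x"
     by (intro tendsto_scaleR smooth_pos'_lim tendsto_const)
    then show "(%n. smooth_pos' (?r n) (u x) *\<^sub>R g x) ----> (if 0 < u x then g x else 0)" by (simp split: if_splits)
   qed
   have "norm (smooth_pos' (?r n) s *\<^sub>R y - (if 0 < s then y else 0)) <= norm y" for n s and y :: "real^'a"
   proof -
    have "smooth_pos' (?r n) s *\<^sub>R y - (if 0 < s then y else 0) = (smooth_pos' (?r n) s - (if 0 < s then 1 else 0)) *\<^sub>R y"
     by (simp add: scaleR_diff_left)
    also have "norm ... <= 1 * norm y"
     unfolding norm_scaleR using smooth_pos'_bound[OF moll_seq(2), of n s] by (intro mult_right_mono) auto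
    finally show ?thesis by simp
   qed
   then show "AE x in lborel. norm (smooth_pos' (?r n) (u x) *\<^sub>R g x - (if 0 < u x then g x else 0)) <= norm (g x)" for n
    by simp
  qed
 qed
qed

lemma weak_gradient_diff:
 assumes "is_weak_gradient u g" "is_weak_gradient v h"
 shows "is_weak_gradient (%x. u x - v x) (%x. g x - h x)"
 using wg_add[OF assms(1) wg_cmult[OF assms(2), of "-1"]] by simp

text \<open>Write \<open>u\<close> as the difference of the positive parts of \<open>u\<close> and
  \<open>- u\<close>. Both gradient formulas give 0 where \<open>u = 0\<close>, and weak gradients
  are unique. The orthogonality of segregated functions comes from here.\<close>

lemma weak_gradient_zero_set:
 assumes w: "is_weak_gradient u g"
 shows "AE x in lborel. u x = 0 --> g x = 0"
proof -
 have 1: "is_weak_gradient (%x. - u x) (%x. - g x)" using wg_cmult[OF w, of "-1"] by simp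
 have "is_weak_gradient (%x. max 0 (u x) - max 0 (- u x)) (%x. (if u x > 0 then g x else 0) - (if - u x > 0 then - g x else 0))"
  by (intro weak_gradient_diff weak_gradient_pos_part w 1)
 from wg_unique[OF w this] have "AE x in lborel. g x = (if u x > 0 then g x else 0) - (if - u x > 0 then - g x else 0)"
  by (simp add: max_def)
 then show ?thesis by eventually_elim auto
qed

lemma weak_gradient_min:
 assumes "is_weak_gradient u g" "is_weak_gradient v h"
 shows "is_weak_gradient (%x. min (u x) (v x)) (%x. if u x > v x then h x else g x)"
proof -
 have "is_weak_gradient (%x. u x - max 0 (u x - v x)) (%x. g x - (if u x - v x > 0 then g x - h x else 0))"
  by (rule weak_gradient_diff[OF assms(1) weak_gradient_pos_part[OF weak_gradient_diff[OF assms]]])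
 moreover have "(%x. u x - max 0 (u x - v x)) = (%x. min (u x) (v x))" by (auto simp: max_def min_def)
 moreover have "(%x. g x - (if u x - v x > 0 then g x - h x else 0)) = (%x. if u x > v x then h x else g x)" by auto
 ultimately show ?thesis by simp
qed

lemma weak_gradient_abs:
 assumes w: "is_weak_gradient u g"
 shows "is_weak_gradient (%x. \<bar>u x\<bar>) (%x. sgn (u x) *\<^sub>R g x)"
proof -
 have 1: "is_weak_gradient (%x. - u x) (%x. - g x)" using wg_cmult[OF w, of "-1"] by simp
 have "is_weak_gradient (%x. max 0 (u x) + max 0 (- u x)) (%x. (if u x > 0 then g x else 0) + (if - u x > 0 then - g x else 0))"
  by (intro wg_add weak_gradient_pos_part w 1)
 moreover have "(%x. max 0 (u x) + max 0 (- u x)) = (%x. \<bar>u x\<bar>)" by (auto simp: max_def)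
 moreover have "(%x. (if u x > 0 then g x else 0) + (if - u x > 0 then - g x else 0)) = (%x. sgn (u x) *\<^sub>R g x)" by (auto simp: sgn_if)
 ultimately show ?thesis by simp
qed

subsection \<open>The Sobolev inequality\<close>

text \<open>The increment is an integral of the gradient along a segment. Jensen's inequality on the
  unit interval, an exchange of integrals and translation invariance give the bound.\<close>

lemma translate_L2_C1:
 fixes v :: "real^'n => real"
 assumes D: "!!x. (v has_derivative (%k. G x \<bullet> k)) (at x)" and G: "continuous_on UNIV G"
 shows "(\<integral>\<^sup>+x. ennreal ((v (h + x) - v x)\<^sup>2) \<partial>lborel) <= ennreal ((norm h)\<^sup>2) * (\<integral>\<^sup>+x. ennreal ((norm (G x))\<^sup>2) \<partial>lborel)"
proof -
 let ?I = "%t::real. indicat_real {0..1} t"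
 have [measurable]: "G \<in> Bmeas" by (rule borel_measurable_continuous_onI[OF G])
 have pw: "ennreal ((v (h + x) - v x)\<^sup>2) <= ennreal ((norm h)\<^sup>2) * (\<integral>\<^sup>+t. ennreal (?I t * (norm (G (t *\<^sub>R h + x)))\<^sup>2) \<partial>lborel)" for x
 proof -
  have Gc: "continuous_on {0..1} (%t. G (t *\<^sub>R h + x))"
   by (intro continuous_on_compose2[OF G] continuous_intros) auto
  have c1: "continuous_on {0..1} (%t. G (t *\<^sub>R h + x) \<bullet> h)"
   and c2: "continuous_on {0..1} (%t. (G (t *\<^sub>R h + x) \<bullet> h)\<^sup>2)"
   and c3: "continuous_on {0..1} (%t. (norm (G (t *\<^sub>R h + x)))\<^sup>2)"
   by (intro continuous_intros Gc)+
  have ci: "integrable lborel (%t. ?I t *\<^sub>R f t)" if "continuous_on {0..1} f" for f :: "real => real"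
   using borel_integrable_compact[OF compact_Icc that] by simp
  have "(LBINT t. ?I t *\<^sub>R (G (t *\<^sub>R h + x) \<bullet> h)) = v (1 *\<^sub>R h + x) - v (0 *\<^sub>R h + x)"
  proof (rule integral_FTC_atLeastAtMost)
   fix t :: real
   have 1: "((%t. t *\<^sub>R h + x) has_derivative (%t. t *\<^sub>R h)) (at t)"
    by (auto intro!: derivative_eq_intros)
   show "((%t. v (t *\<^sub>R h + x)) has_vector_derivative G (t *\<^sub>R h + x) \<bullet> h) (at t within {0..1})"
    using has_derivative_at_withinI[OF diff_chain_at[OF 1 D]] by (simp add: o_def has_vector_derivative_def)
   show "continuous_on {0..1} (%t. G (t *\<^sub>R h + x) \<bullet> h)" by (intro continuous_intros Gc)
  qed simp
  then have "(v (h + x) - v x)\<^sup>2 = (LBINT t. ?I t * (G (t *\<^sub>R h + x) \<bullet> h))\<^sup>2" by simp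
  also have "... <= (LBINT t. ?I t * (G (t *\<^sub>R h + x) \<bullet> h)\<^sup>2)"
  proof (rule weighted_jensen)
   show "integrable lborel ?I" using ci[of "%_. 1"] by simp
   show "integrable lborel (%t. ?I t * (G (t *\<^sub>R h + x) \<bullet> h))"
    "integrable lborel (%t. ?I t * (G (t *\<^sub>R h + x) \<bullet> h)\<^sup>2)"
    using ci[OF c1] ci[OF c2] by simp_all
   show "(LBINT t. ?I t) = 1" by simp
  qed auto
  also have "... <= (LBINT t. (norm h)\<^sup>2 * (?I t * (norm (G (t *\<^sub>R h + x)))\<^sup>2))"
  proof (rule integral_mono)
   show "integrable lborel (%t. ?I t * (G (t *\<^sub>R h + x) \<bullet> h)\<^sup>2)"
    "integrable lborel (%t. (norm h)\<^sup>2 * (?I t * (norm (G (t *\<^sub>R h + x)))\<^sup>2))"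
    using ci[OF c2] ci[OF c3] by simp_all
   fix t
   have "\<bar>G (t *\<^sub>R h + x) \<bullet> h\<bar>\<^sup>2 <= (norm (G (t *\<^sub>R h + x)) * norm h)\<^sup>2"
    by (intro power_mono Cauchy_Schwarz_ineq2) simp
   then show "?I t * (G (t *\<^sub>R h + x) \<bullet> h)\<^sup>2 <= (norm h)\<^sup>2 * (?I t * (norm (G (t *\<^sub>R h + x)))\<^sup>2)"
    by (auto simp: indicator_def power_mult_distrib mult.commute)
  qed
  also have "... = (norm h)\<^sup>2 * (LBINT t. ?I t * (norm (G (t *\<^sub>R h + x)))\<^sup>2)" by simp
  finally have "ennreal ((v (h + x) - v x)\<^sup>2) <= ennreal ((norm h)\<^sup>2) * ennreal (LBINT t. ?I t * (norm (G (t *\<^sub>R h + x)))\<^sup>2)"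
   by (simp add: ennreal_leI flip: ennreal_mult')
  also have "ennreal (LBINT t. ?I t * (norm (G (t *\<^sub>R h + x)))\<^sup>2) = (\<integral>\<^sup>+t. ennreal (?I t * (norm (G (t *\<^sub>R h + x)))\<^sup>2) \<partial>lborel)"
   using ci[OF c3] by (intro nn_integral_eq_integral[symmetric]) auto
  finally show ?thesis .
 qed
 have "(\<integral>\<^sup>+x. ennreal ((v (h + x) - v x)\<^sup>2) \<partial>lborel) <=
  (\<integral>\<^sup>+x. ennreal ((norm h)\<^sup>2) * (\<integral>\<^sup>+t. ennreal (?I t * (norm (G (t *\<^sub>R h + x)))\<^sup>2) \<partial>lborel) \<partial>lborel)"
  by (intro nn_integral_mono pw)
 also have "... = ennreal ((norm h)\<^sup>2) * (\<integral>\<^sup>+x. (\<integral>\<^sup>+t. ennreal (?I t * (norm (G (t *\<^sub>R h + x)))\<^sup>2) \<partial>lborel) \<partial>lborel)"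
  by (rule nn_integral_cmult) measurable
 also have "(\<integral>\<^sup>+x. (\<integral>\<^sup>+t. ennreal (?I t * (norm (G (t *\<^sub>R h + x)))\<^sup>2) \<partial>lborel) \<partial>lborel)
  = (\<integral>\<^sup>+t. (\<integral>\<^sup>+x. ennreal (?I t * (norm (G (t *\<^sub>R h + x)))\<^sup>2) \<partial>lborel) \<partial>lborel)"
  by (rule lborel_pair.Fubini'[symmetric]) measurable
 also have "... = (\<integral>\<^sup>+t. indicator {0..1} t * (\<integral>\<^sup>+x. ennreal ((norm (G x))\<^sup>2) \<partial>lborel) \<partial>(lborel :: real measure))"
 proof (intro nn_integral_cong)
  fix t :: real
  have "(\<integral>\<^sup>+x. ennreal ((norm (G (t *\<^sub>R h + x)))\<^sup>2) \<partial>lborel) = (\<integral>\<^sup>+x. ennreal ((norm (G x))\<^sup>2) \<partial>lborel)"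
   by (rule lborel_nn_integral_translate) measurable
  then show "(\<integral>\<^sup>+x. ennreal (?I t * (norm (G (t *\<^sub>R h + x)))\<^sup>2) \<partial>lborel) = indicator {0..1} t * (\<integral>\<^sup>+x. ennreal ((norm (G x))\<^sup>2) \<partial>lborel)"
   by (auto simp: indicator_def)
 qed
 also have "... = (\<integral>\<^sup>+x. ennreal ((norm (G x))\<^sup>2) \<partial>lborel)"
  by (subst nn_integral_multc) auto
 finally show ?thesis .
qed

lemma moll_L2:
 fixes g :: "real^'n => 'b::euclidean_space"
 assumes g: "locally_integrable g" "L2 g" and r: "r > 0"
 shows "(\<integral>\<^sup>+x. ennreal ((norm (moll r g x))\<^sup>2) \<partial>lborel) <= ennreal (sq g)"
proof -
 note [measurable] = locint_measurable[OF g(1)]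
 have "(\<integral>\<^sup>+x. ennreal ((norm (moll r g x - 0))\<^sup>2) \<partial>lborel) <= (\<integral>\<^sup>+x. (\<integral>\<^sup>+z. ennreal (eta r z * (norm (g (x + z) - 0))\<^sup>2) \<partial>lborel) \<partial>lborel)"
  by (intro nn_integral_mono moll_diff_norm2 r g)
 also have "... <= ennreal (sq g)"
 proof (rule moll_fubini[OF r])
  fix z :: "real^'n"
  have "(\<integral>\<^sup>+x. ennreal ((norm (g (z + x)))\<^sup>2) \<partial>lborel) = (\<integral>\<^sup>+x. ennreal ((norm (g x))\<^sup>2) \<partial>lborel)"
   by (rule lborel_nn_integral_translate) measurable
  then show "(\<integral>\<^sup>+x. ennreal ((norm (g (x + z) - 0))\<^sup>2) \<partial>lborel) <= ennreal (sq g)"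
   using nn_integral_eq_integral[OF g(2)] by (simp add: add.commute)
 qed auto
 finally show ?thesis by simp
qed

text \<open>Fatou along almost everywhere convergent mollifications; mollifying a gradient does not
  increase its L2 norm.\<close>

lemma translate_L2:
 fixes u :: "real^'n => real"
 assumes w: "is_weak_gradient u g" and g: "L2 g"
 shows "(\<integral>\<^sup>+x. ennreal ((u (h + x) - u x)\<^sup>2) \<partial>lborel) <= ennreal ((norm h)\<^sup>2 * (sq g))"
proof -
 note a = wgD[OF w]
 let ?r = "%n. 1 / real (Suc n)"
 note [measurable] = locint_measurable[OF a(1)] locint_measurable[OF a(2)]
 have sm: "smooth (moll (?r n) u)" for n by (intro moll_smooth a moll_seq(2))
 have gm: "grad (moll (?r n) u) = moll (?r n) g" for n using moll_is_weak_gradient[OF w moll_seq(2)] by blast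
 obtain r where r: "strict_mono r" and ae: "AE x in lborel. (%n. moll (?r (r n)) u x) ----> u x"
  using L1loc_AE_subseq[OF moll_locally_integrable[OF a(1) moll_seq(2)] a(1) moll_L1loc[OF a(1) moll_seq(2,1)]] by blast
 define v where "v n = moll (?r (r n)) u" for n
 have [measurable]: "v n \<in> Bmeas" for n
  unfolding v_def by (intro borel_measurable_continuous_onI smooth_continuous sm)
 let ?B = "ennreal ((norm h)\<^sup>2 * (sq g))"
 have bd: "(\<integral>\<^sup>+x. ennreal ((v n (h + x) - v n x)\<^sup>2) \<partial>lborel) <= ?B" for n
 proof -
  have "(\<integral>\<^sup>+x. ennreal ((v n (h + x) - v n x)\<^sup>2) \<partial>lborel) <= ennreal ((norm h)\<^sup>2) * (\<integral>\<^sup>+x. ennreal ((norm (grad (v n) x))\<^sup>2) \<partial>lborel)"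
   unfolding v_def by (intro translate_L2_C1 grad_has_derivative smooth_diff smooth_grad_continuous sm)
  also have "... <= ennreal ((norm h)\<^sup>2) * ennreal (sq g)"
   unfolding v_def gm by (intro mult_left_mono moll_L2 a g moll_seq(2)) simp
  finally show ?thesis by (simp add: ennreal_mult')
 qed
 have "(\<integral>\<^sup>+x. ennreal ((u (h + x) - u x)\<^sup>2) \<partial>lborel) = (\<integral>\<^sup>+x. liminf (%n. ennreal ((v n (h + x) - v n x)\<^sup>2)) \<partial>lborel)"
  using ae lborel_AE_translate[OF ae, of h]
 proof (intro nn_integral_cong_AE, eventually_elim)
  case (elim x)
  then have "(%n. ennreal ((v n (h + x) - v n x)\<^sup>2)) ----> ennreal ((u (h + x) - u x)\<^sup>2)"
   unfolding v_def by (intro tendsto_intros)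
  then show ?case using lim_imp_Liminf by force
 qed
 also have "... <= liminf (%n. \<integral>\<^sup>+x. ennreal ((v n (h + x) - v n x)\<^sup>2) \<partial>lborel)"
  by (rule nn_integral_liminf) measurable
 also have "... <= ?B" by (rule Liminf_le) (use bd in auto)
 finally show ?thesis .
qed

text \<open>A Poincare inequality at scale \<open>r\<close>, obtained by averaging the translation
  estimate. It is uniform over functions of bounded Dirichlet integral, which serves both the
  Sobolev inequality and compactness.\<close>

lemma moll_L2_diff:
 fixes u :: "real^'n => real"
 assumes w: "is_weak_gradient u g" and g: "L2 g" and r: "r > 0"
 shows "integrable lborel (%x. (moll r u x - u x)\<^sup>2)"
  "(LBINT x. (moll r u x - u x)\<^sup>2) <= r\<^sup>2 * (sq g)"
proof -
 note a = wgD[OF w]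
 note [measurable] = locint_measurable[OF a(1)] moll_measurable[OF r a(1)]
 let ?G = "\<integral>x. (norm (g x))\<^sup>2 \<partial>lborel"
 have "(\<integral>\<^sup>+x. ennreal ((norm (moll r u x - u x))\<^sup>2) \<partial>lborel) <= (\<integral>\<^sup>+x. (\<integral>\<^sup>+z. ennreal (eta r z * (norm (u (x + z) - u x))\<^sup>2) \<partial>lborel) \<partial>lborel)"
  by (intro nn_integral_mono moll_diff_norm2 r a)
 also have "... <= ennreal (r\<^sup>2 * ?G)"
 proof (rule moll_fubini[OF r])
  fix z :: "real^'n" assume z: "norm z < r"
  have "(\<integral>\<^sup>+x. ennreal ((u (z + x) - u x)\<^sup>2) \<partial>lborel) <= ennreal ((norm z)\<^sup>2 * ?G)"
   by (rule translate_L2[OF w g])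
  also have "... <= ennreal (r\<^sup>2 * ?G)" using z by (intro ennreal_leI mult_right_mono power_mono) auto
  finally show "(\<integral>\<^sup>+x. ennreal ((norm (u (x + z) - u x))\<^sup>2) \<partial>lborel) <= ennreal (r\<^sup>2 * ?G)" by (simp add: add.commute)
 qed auto
 finally have *: "(\<integral>\<^sup>+x. ennreal ((moll r u x - u x)\<^sup>2) \<partial>lborel) <= ennreal (r\<^sup>2 * ?G)" by simp
 then show i: "integrable lborel (%x. (moll r u x - u x)\<^sup>2)"
  using le_less_trans[OF * ennreal_less_top] by (intro integrableI_bounded) auto
 show "(LBINT x. (moll r u x - u x)\<^sup>2) <= r\<^sup>2 * ?G"
  using * by (subst (asm) nn_integral_eq_integral[OF i]) (auto simp: ennreal_le_iff)
qed

text \<open>The splitting \<open>|f| \<le> s + s\<^sup>1\<^sup>-\<^sup>q |f|\<^sup>q\<close> replaces Hoelder's inequality.\<close>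

lemma split_powr:
 fixes a s q :: real
 assumes "a >= 0" "s > 0" "q >= 1"
 shows "a <= s + s powr (1 - q) * a powr q"
proof (cases "a <= s")
 case False
 then have "a powr (1 - q) <= s powr (1 - q)" using assms by (intro powr_mono2') auto
 then have "a powr (1 - q) * a powr q <= s powr (1 - q) * a powr q" by (intro mult_right_mono) auto
 then have "a <= s powr (1 - q) * a powr q" using False assms by (simp flip: powr_add)
 then show ?thesis using assms by simp
qed (use assms in \<open>simp add: add_increasing2\<close>)

text \<open>The level \<open>s\<close> is left free, to be optimised by the user of the bound; the
  constant comes from the sup bound of the mollifier and is independent of \<open>f\<close>,
  \<open>q\<close>, \<open>r\<close> and \<open>s\<close>.\<close>

lemma moll_bound:
 obtains C where "C > 0"
  "!!f :: real^'n => 'b::euclidean_space. !!q r s x. q >= 1 ==> r > 0 ==> s > 0 ==> f \<in> Bmeas ==>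
   integrable lborel (%x. norm (f x) powr q) ==>
   norm (moll r f x) <= s + s powr (1 - q) * (C / r ^ CARD('n)) * (LBINT x. norm (f x) powr q)"
proof -
 obtain C where C: "C > 0" "!!r z. r > 0 ==> eta r (z::real^'n) <= C / r ^ CARD('n)" using eta_bound by metis
 have "norm (moll r f x) <= s + s powr (1 - q) * (C / r ^ CARD('n)) * (LBINT x. norm (f x) powr q)"
  if q: "q >= 1" and r: "r > 0" and s: "s > 0" and fm: "f \<in> Bmeas" and
   fi: "integrable lborel (%x. norm (f x) powr q)" for f :: "real^'n => 'b" and q r s x
 proof -
  have li: "locally_integrable f" by (rule locint_powr[OF q fm fi])
  note i = moll_eq[OF r li, of x]
  have fi': "integrable lborel (%z. norm (f (x + z)) powr q)" using integrable_lborel_translate[OF fi, of x] .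
  have e: "eta r (z::real^'n) >= 0" for z by (rule eta_nonneg[OF r])
  have ei: "integrable lborel (eta r :: real^'n => real)" by (rule test_integrable[OF eta_test[OF r]])
  have "norm (moll r f x) <= (LBINT z. norm (eta r z *\<^sub>R f (x + z)))"
   unfolding i(2) by (rule integral_norm_bound)
  also have "... <= (LBINT z. s * eta r z + s powr (1 - q) * (C / r ^ CARD('n)) * norm (f (x + z)) powr q)"
  proof (intro integral_mono integrable_norm i Badd integrable_mult_right ei fi')
   fix z :: "real^'n"
   have "norm (eta r z *\<^sub>R f (x + z)) = eta r z * norm (f (x + z))" using e by simp
   also have "... <= eta r z * (s + s powr (1 - q) * norm (f (x + z)) powr q)"
    using e s q by (intro mult_left_mono split_powr) auto
   also have "... <= s * eta r z + s powr (1 - q) * (C / r ^ CARD('n)) * norm (f (x + z)) powr q"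
    using mult_right_mono[OF C(2)[OF r, of z], of "s powr (1 - q) * norm (f (x + z)) powr q"] by (simp add: algebra_simps)
   finally show "norm (eta r z *\<^sub>R f (x + z)) <= s * eta r z + s powr (1 - q) * (C / r ^ CARD('n)) * norm (f (x + z)) powr q" .
  qed
  also have "... = s + s powr (1 - q) * (C / r ^ CARD('n)) * (LBINT z. norm (f (x + z)) powr q)"
   using ei fi' eta_integral[OF r, where 'n='n] by simp
  also have "(LBINT z. norm (f (x + z)) powr q) = (LBINT x. norm (f x) powr q)"
   by (rule lborel_integral_translate) (use fm in measurable)
  finally show ?thesis .
 qed
 with C(1) that show thesis by blast
qed

lemma markov_powr:
 fixes u :: "'a::euclidean_space => real"
 assumes q: "q > 0" and [measurable]: "u \<in> Bmeas" and i: "Lpw q u" and t: "t > 0"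
 shows "emeasure lborel {x. \<bar>u x\<bar> > t} < \<infinity>"
  and "t powr q * measure lborel {x. \<bar>u x\<bar> > t} <= (pw q u)"
proof -
 let ?A = "{x. \<bar>u x\<bar> > t}"
 have *: "ennreal (t powr q) * emeasure lborel ?A <= ennreal (pw q u)"
 proof -
  have "ennreal (t powr q) * emeasure lborel ?A = (\<integral>\<^sup>+x. ennreal (t powr q) * indicator ?A x \<partial>lborel)"
   by (subst nn_integral_cmult_indicator) auto
  also have "... <= (\<integral>\<^sup>+x. ennreal (\<bar>u x\<bar> powr q) \<partial>lborel)"
  proof (intro nn_integral_mono)
   fix x show "ennreal (t powr q) * indicator ?A x <= ennreal (\<bar>u x\<bar> powr q)"
    using t q by (cases "x \<in> ?A") (auto intro!: ennreal_leI powr_mono2)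
  qed
  also have "... = ennreal (pw q u)" using nn_integral_eq_integral[OF i] by simp
  finally show ?thesis .
 qed
 show f: "emeasure lborel ?A < \<infinity>"
 proof (rule ccontr)
  assume "\<not> ?thesis"
  then have "emeasure lborel ?A = \<infinity>" using less_top[of "emeasure lborel ?A"] by auto
  then show False using * t by (simp add: ennreal_mult_top top_unique)
 qed
 then have "emeasure lborel ?A = ennreal (measure lborel ?A)" by (intro emeasure_eq_ennreal_measure) auto
 then show "t powr q * measure lborel ?A <= (pw q u)"
  using * by (simp add: ennreal_le_iff flip: ennreal_mult')
qed

text \<open>The weak-type Sobolev inequality: on \<open>{|u| > t}\<close> the mean of \<open>u\<close> over a ball of a radius chosen
 in terms of \<open>t\<close> is at most \<open>t / 2\<close>, and the difference of \<open>u\<close> and its mean is controlled by the gradient.\<close>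

lemma sobolev_weak:
 assumes N: "CARD('n) >= 3" and q: "q = 2 * real CARD('n) / (real CARD('n) - 2)"
 obtains K where "K > 0"
  "!!(u::real^'n => real) g t. is_weak_gradient u g ==> L2 g ==>
   Lpw q u ==> t > 0 ==>
   t powr q * measure lborel {x. \<bar>u x\<bar> > t} <= K * (sq g) * (pw q u) powr (2 / CARD('n))"
proof -
 let ?N = "real CARD('n)"
 have N3: "?N >= 3" using N by simp
 have q2: "q > 2" unfolding q using N3 by (simp add: field_simps)
 have qN: "q * (2 / ?N) = q - 2" unfolding q using N3 by (simp add: field_simps)
 obtain C where C: "C > 0" "!!f :: real^'n => real. !!q r s x. q >= 1 ==> r > 0 ==> s > 0 ==> f \<in> Bmeas ==>
   integrable lborel (%x. norm (f x) powr q) ==>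
   norm (moll r f x) <= s + s powr (1 - q) * (C / r ^ CARD('n)) * (LBINT x. norm (f x) powr q)"
  using moll_bound by blast
 define K where "K = 4 powr (q - 1) * C powr (2 / ?N)"
 have "t powr q * measure lborel {x. \<bar>u x\<bar> > t} <= K * (sq g) * (pw q u) powr (2 / ?N)"
  if w: "is_weak_gradient u g" and g: "L2 g" and
   uq: "Lpw q u" and t: "t > 0" for u :: "real^'n => real" and g t
 proof -
  let ?G = "\<integral>x. (norm (g x))\<^sup>2 \<partial>lborel" and ?S = "\<integral>x. \<bar>u x\<bar> powr q \<partial>lborel"
  note a = wgD[OF w]
  have [measurable]: "u \<in> Bmeas" by (rule locint_measurable[OF a(1)])
  show ?thesis
  proof (cases "?S = 0")
   case True
   then have "AE x in lborel. \<bar>u x\<bar> powr q = 0"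
    by (subst (asm) integral_nonneg_eq_0_iff_AE[OF uq]) auto
   then have "AE x in lborel. x \<notin> {x. \<bar>u x\<bar> > t}" by eventually_elim (use t in auto)
   then have "{x. \<bar>u x\<bar> > t} \<in> null_sets lborel" by (subst (asm) AE_iff_null_sets[symmetric]) auto
   then have "measure lborel {x. \<bar>u x\<bar> > t} = 0" by (simp add: null_sets_def measure_def)
   then show ?thesis using True by simp
  next
   case False
   have "?S >= 0" by simp
   with False have S: "?S > 0" by linarith
   define s where "s = t / 4"
   have s: "s > 0" using t by (simp add: s_def)
   \<comment> \<open>With this radius both terms of \<open>moll_bound\<close> equal
     \<open>s = t / 4\<close>, so the mean is at most \<open>t / 2\<close>.\<close>
   define r where "r = (C * ?S * s powr (- q)) powr (1 / ?N)"
   have base: "C * ?S * s powr (- q) > 0" using C(1) S s by simp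
   have r: "r > 0" unfolding r_def powr_gt_zero using base by linarith
   have rN: "r ^ CARD('n) = C * ?S * s powr (- q)"
    using base N3 r by (simp add: r_def powr_powr flip: powr_realpow)
   have mb: "\<bar>moll r u x\<bar> <= t / 2" for x
   proof -
    have "\<bar>moll r u x\<bar> <= s + s powr (1 - q) * (C / r ^ CARD('n)) * ?S"
     using C(2)[of q r s u x] q2 r s uq by simp
    also have "s powr (1 - q) * (C / r ^ CARD('n)) * ?S = s powr (1 - q) / s powr (- q)"
     unfolding rN using C(1) S by simp
    also have "... = s" using s by (simp flip: powr_diff)
    finally show ?thesis by (simp add: s_def)
   qed
   let ?A = "{x. \<bar>u x\<bar> > t}"
   note d = moll_L2_diff[OF w g r]
   have Af: "emeasure lborel ?A < \<infinity>" using markov_powr(1)[OF _ _ uq t] q2 by simp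
   have "(t/2)\<^sup>2 * measure lborel ?A = (LBINT x. (t/2)\<^sup>2 * indicat_real ?A x)" by simp
   also have "... <= (LBINT x. (moll r u x - u x)\<^sup>2)"
   proof (rule integral_mono[OF _ d(1)])
    show "integrable lborel (%x. (t/2)\<^sup>2 * indicat_real ?A x)"
     using Af by (intro integrable_mult_right) (simp add: integrable_indicator_iff)
    fix x
    show "(t/2)\<^sup>2 * indicat_real ?A x <= (moll r u x - u x)\<^sup>2"
    proof (cases "x \<in> ?A")
     case True
     then have "t < \<bar>u x\<bar>" by simp
     then have "t/2 <= \<bar>moll r u x - u x\<bar>"
      using mb[of x] abs_triangle_ineq2[of "u x" "moll r u x"] abs_minus_commute[of "u x" "moll r u x"] by linarith
     then have "(t/2)\<^sup>2 <= \<bar>moll r u x - u x\<bar>\<^sup>2" using t by (intro power_mono) auto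
     then show ?thesis using True by simp
    qed simp
   qed
   also have "... <= r\<^sup>2 * ?G" by (rule d(2))
   also have "r\<^sup>2 = C powr (2 / ?N) * ?S powr (2/ ?N) * s powr (- (q - 2))"
   proof -
    have "r\<^sup>2 = r powr 2" using r by simp
    also have "... = (C * ?S * s powr (- q)) powr (2 / ?N)" by (simp add: r_def powr_powr)
    also have "... = C powr (2 / ?N) * ?S powr (2/ ?N) * s powr (- (q * (2 / ?N)))"
     using C(1) S s by (simp add: powr_mult powr_powr)
    finally show ?thesis unfolding qN .
   qed
   finally have *: "(t/2)\<^sup>2 * measure lborel ?A <= C powr (2 / ?N) * ?S powr (2/ ?N) * s powr (- (q - 2)) * ?G" .
   have t1: "s powr (- (q - 2)) = 4 powr (q - 2) * t powr (2 - q)"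
    using t by (simp add: s_def powr_divide powr_minus_divide powr_diff field_simps)
   have t2: "t powr q = (t powr (q - 2) * 4) * (t/2)\<^sup>2"
    using t by (simp add: powr_diff power2_eq_square)
   have "t powr q * measure lborel ?A <= (t powr (q - 2) * 4) * (C powr (2 / ?N) * ?S powr (2/ ?N) * s powr (- (q - 2)) * ?G)"
    unfolding t2 mult.assoc[of "t powr (q - 2) * 4" "(t/2)\<^sup>2"] by (intro mult_left_mono *) simp
   also have "... = (4 * 4 powr (q - 2)) * (t powr (q - 2) * t powr (2 - q)) * C powr (2 / ?N) * ?G * ?S powr (2/ ?N)"
    unfolding t1 by simp
   also have "t powr (q - 2) * t powr (2 - q) = 1" using t by (simp flip: powr_add)
   also have "4 * 4 powr (q - 2) = (4::real) powr (q - 1)" by (simp add: powr_diff)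
   finally show ?thesis by (simp add: K_def)
  qed
 qed
 moreover have "K > 0" unfolding K_def using C(1) by simp
 ultimately show thesis using that by blast
qed

lemma const_is_weak_gradient: "is_weak_gradient (%_. c) (%_. 0)"
 by (rule C1_is_weak_gradient) auto

text \<open>Truncation: the weak-type inequality is applied to the slab of
  \<open>\<bar>u\<bar>\<close> between \<open>a\<close> and \<open>2 * a\<close>, whose gradient is
  supported on that slab. Where \<open>\<bar>u\<bar> > 2 * a\<close> the truncated function equals
  \<open>a > a / 2\<close>; the ratio of \<open>4 * a\<close> to \<open>a / 2\<close> is the origin
  of the factor 8.\<close>

lemma sobolev_dyadic:
 assumes N: "CARD('n) >= 3" and q: "q = 2 * real CARD('n) / (real CARD('n) - 2)"
 obtains K where "K > 0"
  "!!(u::real^'n => real) g a. is_weak_gradient u g ==> L2 g ==>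
   Lpw q u ==> a > 0 ==>
   (LBINT x. \<bar>u x\<bar> powr q * (of_bool (2 * a < \<bar>u x\<bar>) - of_bool (4 * a < \<bar>u x\<bar>))) <=
    K * (pw q u) powr (2 / CARD('n)) *
    (LBINT x. (norm (g x))\<^sup>2 * (of_bool (a < \<bar>u x\<bar>) - of_bool (2 * a < \<bar>u x\<bar>)))"
proof -
 let ?N = "real CARD('n)"
 have N3: "?N >= 3" using N by simp
 have q2: "q > 2" unfolding q using N3 by (simp add: field_simps)
 obtain K where K: "K > 0"
  "!!(u::real^'n => real) g t. is_weak_gradient u g ==> L2 g ==>
   Lpw q u ==> t > 0 ==>
   t powr q * measure lborel {x. \<bar>u x\<bar> > t} <= K * (sq g) * (pw q u) powr (2 / CARD('n))"
  using sobolev_weak[OF N q] by blast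
 have "(LBINT x. \<bar>u x\<bar> powr q * (of_bool (2 * a < \<bar>u x\<bar>) - of_bool (4 * a < \<bar>u x\<bar>))) <=
    (8 powr q * K) * (pw q u) powr (2 / ?N) *
    (LBINT x. (norm (g x))\<^sup>2 * (of_bool (a < \<bar>u x\<bar>) - of_bool (2 * a < \<bar>u x\<bar>)))"
  if w: "is_weak_gradient u g" and g: "L2 g" and
   uq: "Lpw q u" and a: "a > 0" for u :: "real^'n => real" and g a
 proof -
  let ?S = "\<integral>x. \<bar>u x\<bar> powr q \<partial>lborel"
  have [measurable]: "u \<in> Bmeas" "g \<in> Bmeas"
   by (intro locint_measurable wgD[OF w])+
  define T where "T x = min (max 0 (\<bar>u x\<bar> - a)) a" for x
  define G where "G x = (if max 0 (\<bar>u x\<bar> - a) > a then 0 else if \<bar>u x\<bar> - a > 0 then sgn (u x) *\<^sub>R g x - 0 else 0)" for x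
  have TG: "is_weak_gradient T G" unfolding T_def[abs_def] G_def[abs_def]
   by (rule weak_gradient_min[OF weak_gradient_pos_part[OF weak_gradient_diff[OF weak_gradient_abs[OF w] const_is_weak_gradient]] const_is_weak_gradient])
  have G2: "(norm (G x))\<^sup>2 = (norm (g x))\<^sup>2 * (of_bool (a < \<bar>u x\<bar>) - of_bool (2 * a < \<bar>u x\<bar>))" for x
   using a by (auto simp: G_def max_def sgn_if)
  have Gi: "L2 G"
   unfolding G2 by (rule Bbound[OF g]) auto
  have [measurable]: "T \<in> Bmeas" by (intro locint_measurable wgD[OF TG])
  have Tb: "\<bar>T x\<bar> <= \<bar>u x\<bar>" for x using a by (auto simp: T_def)
  have Ti: "Lpw q T"
  proof (rule Bbound[OF uq])
   show "AE x in lborel. norm (\<bar>T x\<bar> powr q) <= norm (\<bar>u x\<bar> powr q)"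
    using Tb q2 by (auto intro!: powr_mono2)
  qed measurable
  have Ts: "(pw q T) <= ?S"
   using Tb q2 by (intro integral_mono Ti uq powr_mono2) auto
  have "(a/2) powr q * measure lborel {x. \<bar>T x\<bar> > a/2} <= K * (sq G) * (pw q T) powr (2 / ?N)"
   using a by (intro K(2)[OF TG Gi Ti]) simp
  also have "... <= K * (sq G) * ?S powr (2 / ?N)"
   using K(1) Ts N3 by (intro mult_left_mono powr_mono2 mult_nonneg_nonneg) auto
  finally have 1: "(a/2) powr q * measure lborel {x. \<bar>T x\<bar> > a/2} <= K * (sq G) * ?S powr (2 / ?N)" .
  let ?A = "{x. 2 * a < \<bar>u x\<bar>}"
  have Af: "emeasure lborel ?A < \<infinity>" using markov_powr(1)[OF _ _ uq, of "2 * a"] a q2 by simp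
  have sub: "?A \<subseteq> {x. \<bar>T x\<bar> > a/2}" using a by (auto simp: T_def)
  have "emeasure lborel {x. \<bar>T x\<bar> > a/2} < \<infinity>" using markov_powr(1)[OF _ _ Ti, of "a/2"] a q2 by simp
  then have mA: "measure lborel ?A <= measure lborel {x. \<bar>T x\<bar> > a/2}"
   using sub by (intro measure_mono_fmeasurable) (auto simp: fmeasurable_def)
  have "(LBINT x. \<bar>u x\<bar> powr q * (of_bool (2 * a < \<bar>u x\<bar>) - of_bool (4 * a < \<bar>u x\<bar>))) <= (LBINT x. (4 * a) powr q * indicat_real ?A x)"
  proof (rule integral_mono)
   show "integrable lborel (%x. (4 * a) powr q * indicat_real ?A x)"
    using Af by (intro integrable_mult_right) (simp add: integrable_indicator_iff)
   show "integrable lborel (%x. \<bar>u x\<bar> powr q * (of_bool (2 * a < \<bar>u x\<bar>) - of_bool (4 * a < \<bar>u x\<bar>)))"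
    by (rule Bbound[OF uq]) auto
   show "\<bar>u x\<bar> powr q * (of_bool (2 * a < \<bar>u x\<bar>) - of_bool (4 * a < \<bar>u x\<bar>)) <= (4 * a) powr q * indicat_real ?A x" for x
    using a q2 by (auto intro!: powr_mono2)
  qed
  also have "... = (4 * a) powr q * measure lborel ?A" by simp
  also have "(4 * a) powr q = 8 powr q * (a/2) powr q" using a by (simp flip: powr_mult)
  also have "8 powr q * (a/2) powr q * measure lborel ?A <= 8 powr q * ((a/2) powr q * measure lborel {x. \<bar>T x\<bar> > a/2})"
   using mA by (simp add: mult.assoc mult_left_mono)
  also have "... <= 8 powr q * (K * (sq G) * ?S powr (2 / ?N))"
   by (intro mult_left_mono 1) simp
  finally show ?thesis unfolding G2 by (simp add: mult_ac)
 qed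
 moreover have "8 powr q * K > 0" using K(1) by simp
 ultimately show thesis using that by blast
qed

text \<open>The slabs of different dyadic levels are disjoint, so the gradient integrals add up to
  at most the full one. The sum bounds the L^q integral by its own power 2/N times the Dirichlet
  integral; being finite, that power can be divided out, and \<open>1 - 2/N = 2/q\<close>.\<close>

theorem sobolev:
 assumes N: "CARD('n) >= 3" and q: "q = 2 * real CARD('n) / (real CARD('n) - 2)"
 obtains C where "C > 0"
  "!!(u::real^'n => real) g. is_weak_gradient u g ==> L2 g ==>
   Lpw q u ==>
   (pw q u) powr (2 / q) <= C * (sq g)"
proof -
 let ?N = "real CARD('n)"
 have N3: "?N >= 3" using N by simp
 have q2: "q > 2" unfolding q using N3 by (simp add: field_simps)
 have qN: "2 / q = 1 - 2 / ?N" unfolding q using N3 by (simp add: field_simps)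
 obtain K where K: "K > 0"
  "!!(u::real^'n => real) g a. is_weak_gradient u g ==> L2 g ==>
   Lpw q u ==> a > 0 ==>
   (LBINT x. \<bar>u x\<bar> powr q * (of_bool (2 * a < \<bar>u x\<bar>) - of_bool (4 * a < \<bar>u x\<bar>))) <=
    K * (pw q u) powr (2 / CARD('n)) *
    (LBINT x. (norm (g x))\<^sup>2 * (of_bool (a < \<bar>u x\<bar>) - of_bool (2 * a < \<bar>u x\<bar>)))"
  using sobolev_dyadic[OF N q] by blast
 have "(pw q u) powr (2 / q) <= K * (sq g)"
  if w: "is_weak_gradient u g" and g: "L2 g" and
   uq: "Lpw q u" for u :: "real^'n => real" and g
 proof -
  let ?S = "\<integral>x. \<bar>u x\<bar> powr q \<partial>lborel" and ?G = "\<integral>x. (norm (g x))\<^sup>2 \<partial>lborel"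
  have [measurable]: "u \<in> Bmeas" "g \<in> Bmeas"
   by (intro locint_measurable wgD[OF w])+
  \<comment> \<open>Levels from 2^(-n) to about 2^n: letting \<open>n\<close> grow exhausts all
    positive values, so one limit replaces a two-sided series.\<close>
  define a where "a n j = 2 powr (real j - real n)" for n j :: nat
  have apos: "a n j > 0" for n j by (simp add: a_def)
  have aS: "a n (Suc j) = 2 * a n j" for n j by (simp add: a_def powr_diff powr_add field_simps)
  define ch where "ch n j x = (of_bool (a n j < \<bar>u x\<bar>) :: real)" for n j x
  have ch01: "0 <= ch n j x" "ch n j x <= 1" for n j x by (auto simp: ch_def)
  have [measurable]: "ch n j \<in> Bmeas" for n j unfolding ch_def by measurable
  have i1: "integrable lborel (%x. \<bar>u x\<bar> powr q * (ch n i x - ch n j x))" for n i j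
   by (rule Bbound[OF uq]) (auto simp: ch_def)
  have i2: "integrable lborel (%x. (norm (g x))\<^sup>2 * (ch n i x - ch n j x))" for n i j
   by (rule Bbound[OF g]) (auto simp: ch_def)
  have fin: "(LBINT x. \<bar>u x\<bar> powr q * (ch n 1 x - ch n (Suc (2 * n)) x)) <= K * ?S powr (2 / ?N) * ?G" for n
  proof -
   have "(LBINT x. \<bar>u x\<bar> powr q * (ch n 1 x - ch n (Suc (2 * n)) x)) =
    (LBINT x. (\<Sum>j<2 * n. \<bar>u x\<bar> powr q * (ch n (Suc j) x - ch n (Suc (Suc j)) x)))"
    unfolding sum_distrib_left[symmetric] sum_lessThan_telescope'[of "%j. ch n (Suc j) _"] by simp
   also have "... = (\<Sum>j<2 * n. \<integral>x. \<bar>u x\<bar> powr q * (ch n (Suc j) x - ch n (Suc (Suc j)) x) \<partial>lborel)"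
    by (rule Bochner_Integration.integral_sum) (rule i1)
   also have "... <= (\<Sum>j<2 * n. K * ?S powr (2 / ?N) * (LBINT x. (norm (g x))\<^sup>2 * (ch n j x - ch n (Suc j) x)))"
    using K(2)[OF w g uq apos] by (intro sum_mono) (simp add: ch_def aS)
   also have "... = K * ?S powr (2 / ?N) * (LBINT x. (\<Sum>j<2 * n. (norm (g x))\<^sup>2 * (ch n j x - ch n (Suc j) x)))"
    by (subst Bochner_Integration.integral_sum[OF i2]) (simp add: sum_distrib_left)
   also have "... <= K * ?S powr (2 / ?N) * ?G"
   proof (intro mult_left_mono)
    show "(LBINT x. (\<Sum>j<2 * n. (norm (g x))\<^sup>2 * (ch n j x - ch n (Suc j) x))) <= ?G"
    proof (rule integral_mono[OF _ g])
     show "integrable lborel (%x. \<Sum>j<2 * n. (norm (g x))\<^sup>2 * (ch n j x - ch n (Suc j) x))"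
      by (intro Bochner_Integration.integrable_sum i2)
     fix x
     have "(\<Sum>j<2 * n. (norm (g x))\<^sup>2 * (ch n j x - ch n (Suc j) x)) = (norm (g x))\<^sup>2 * (ch n 0 x - ch n (2 * n) x)"
      unfolding sum_distrib_left[symmetric] sum_lessThan_telescope'[of "%j. ch n j x"] by simp
     also have "... <= (norm (g x))\<^sup>2 * 1" using ch01[of n 0 x] ch01[of n "2*n" x] by (intro mult_left_mono) auto
     finally show "(\<Sum>j<2 * n. (norm (g x))\<^sup>2 * (ch n j x - ch n (Suc j) x)) <= (norm (g x))\<^sup>2" by simp
    qed
   qed (use K(1) in simp)
   finally show ?thesis .
  qed
  have "(%n. \<integral>x. \<bar>u x\<bar> powr q * (ch n 1 x - ch n (Suc (2 * n)) x) \<partial>lborel) ----> ?S"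
  proof (rule integral_dominated_convergence[OF _ _ uq])
   have p0: "(%n. 2 * (1/2::real) ^ n) ----> 0" by (intro tendsto_mult_right_zero LIMSEQ_realpow_zero) auto
   show "AE x in lborel. (%n. \<bar>u x\<bar> powr q * (ch n 1 x - ch n (Suc (2 * n)) x)) ----> \<bar>u x\<bar> powr q"
   proof (intro AE_I2)
    fix x
    show "(%n. \<bar>u x\<bar> powr q * (ch n 1 x - ch n (Suc (2 * n)) x)) ----> \<bar>u x\<bar> powr q"
    proof (cases "u x = 0")
     case False
     then have 1: "\<forall>\<^sub>F n in sequentially. 2 * (1/2::real) ^ n < \<bar>u x\<bar>" by (intro order_tendstoD(2)[OF p0]) auto
     have 2: "\<forall>\<^sub>F n in sequentially. \<bar>u x\<bar> < 2 ^ n"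
     proof -
      have "\<forall>\<^sub>F n in sequentially. (1/2::real) ^ n < 1 / \<bar>u x\<bar>"
       using False by (intro order_tendstoD(2)[OF LIMSEQ_realpow_zero]) auto
      then show ?thesis by eventually_elim (use False in \<open>simp add: power_divide field_simps\<close>)
     qed
     have "\<forall>\<^sub>F n in sequentially. \<bar>u x\<bar> powr q * (ch n 1 x - ch n (Suc (2 * n)) x) = \<bar>u x\<bar> powr q"
      using 1 2
     proof eventually_elim
      case (elim n)
      have "a n 1 = 2 * (1/2)^n" by (simp add: a_def powr_diff powr_realpow power_divide)
      moreover have "a n (Suc (2 * n)) = 2 * 2 ^ n"
       using powr_realpow[of 2 "Suc n"] by (simp add: a_def add.commute)
      moreover have "\<not> 2 * 2 ^ n < \<bar>u x\<bar>" using elim(2) zero_less_power[of "2::real" n] by linarith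
      moreover have "u x ~= 0" using False .
      ultimately show ?case using elim by (simp add: ch_def)
     qed
     then show ?thesis by (simp add: tendsto_eventually)
    qed (use q2 in simp)
   qed
   show "AE x in lborel. norm (\<bar>u x\<bar> powr q * (ch n 1 x - ch n (Suc (2 * n)) x)) <= \<bar>u x\<bar> powr q" for n
    by (auto simp: ch_def)
  qed auto
  then have SK: "?S <= K * ?S powr (2 / ?N) * ?G" using fin by (intro LIMSEQ_le_const2) auto
  show ?thesis
  proof (cases "?S = 0")
   case True
   then show ?thesis using K(1) q2 by simp
  next
   case False
   have "?S >= 0" by simp
   with False have S: "?S > 0" by linarith
   have "?S powr (2 / q) = ?S / ?S powr (2 / ?N)" unfolding qN using S by (simp add: powr_diff)
   also have "... <= K * ?G" using SK S by (simp add: divide_le_eq mult_ac)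
   finally show ?thesis .
  qed
 qed
 with K(1) that show thesis by blast
qed

subsection \<open>Limits of weakly differentiable functions\<close>

lemma Lq_interpolate:
 fixes a s :: real
 assumes "a >= 0" "s > 0" "0 < s0" "s0 <= q"
 shows "a powr s0 <= min a s powr s0 + s powr (s0 - q) * a powr q"
proof (cases "a <= s")
 case False
 then have "a powr (s0 - q) <= s powr (s0 - q)" using assms by (intro powr_mono2') auto
 then have "a powr (s0 - q) * a powr q <= s powr (s0 - q) * a powr q" by (intro mult_right_mono) auto
 then have "a powr s0 <= s powr (s0 - q) * a powr q" using False assms by (simp flip: powr_add)
 then show ?thesis by (simp add: add_increasing)
qed (use assms in simp)

lemma powr_diff_bound:
 fixes a b :: real assumes "q >= 0"
 shows "\<bar>a - b\<bar> powr q <= 2 powr q * (\<bar>a\<bar> powr q + \<bar>b\<bar> powr q)"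
proof -
 have "\<bar>a - b\<bar> powr q <= (\<bar>a\<bar> + \<bar>b\<bar>) powr q" using assms by (intro powr_mono2) auto
 also have "... <= 2 powr q * (\<bar>a\<bar> powr q + \<bar>b\<bar> powr q)" using assms by (intro powr_triangle) auto
 finally show ?thesis .
qed

lemma integrable_powr_diff:
 fixes f g :: "'a => real"
 assumes q: "q >= 0" and [measurable]: "f \<in> borel_measurable M" "g \<in> borel_measurable M"
  and i: "integrable M (%x. \<bar>f x\<bar> powr q)" "integrable M (%x. \<bar>g x\<bar> powr q)"
 shows "integrable M (%x. \<bar>f x - g x\<bar> powr q)"
  "(\<integral>x. \<bar>f x - g x\<bar> powr q \<partial>M) <= 2 powr q * ((\<integral>x. \<bar>f x\<bar> powr q \<partial>M) + (\<integral>x. \<bar>g x\<bar> powr q \<partial>M))"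
proof -
 have s: "integrable M (%x. 2 powr q * (\<bar>f x\<bar> powr q + \<bar>g x\<bar> powr q))" using i by simp
 show 1: "integrable M (%x. \<bar>f x - g x\<bar> powr q)"
  by (rule Bbound[OF s]) (use powr_diff_bound[OF q] in auto)
 have "(\<integral>x. \<bar>f x - g x\<bar> powr q \<partial>M) <= (\<integral>x. 2 powr q * (\<bar>f x\<bar> powr q + \<bar>g x\<bar> powr q) \<partial>M)"
  by (intro integral_mono 1 s powr_diff_bound q)
 then show "(\<integral>x. \<bar>f x - g x\<bar> powr q \<partial>M) <= 2 powr q * ((\<integral>x. \<bar>f x\<bar> powr q \<partial>M) + (\<integral>x. \<bar>g x\<bar> powr q \<partial>M))"
  using i by simp
qed

text \<open>Values up to a level \<open>s\<close> are handled by dominated convergence on the set of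
  finite measure. Larger values carry the factor \<open>s powr (s0 - q)\<close>, which is small for
  large \<open>s\<close>, times the uniform L^q bound.\<close>

lemma Ls_convergence_finite_measure:
 fixes f :: "nat => 'a::euclidean_space => real"
 assumes s0: "0 < s0" "s0 < q" and A: "A \<in> sets borel" "emeasure lborel A < \<infinity>"
  and [measurable]: "!!k. f k \<in> Bmeas" "g \<in> Bmeas"
  and fi: "!!k. Lpw q (f k)" "!!k. (pw q (f k)) <= B"
  and gi: "Lpw q g"
  and ae: "AE x in lborel. (%k. f k x) ----> g x"
 shows "(%k. LBINT x:A. \<bar>f k x - g x\<bar> powr s0) ----> 0"
proof -
 note [measurable] = A(1)
 define h where "h k x = \<bar>f k x - g x\<bar>" for k x
 have [measurable]: "h k \<in> Bmeas" for k unfolding h_def by measurable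
 define C where "C = 2 powr q * (B + (pw q g))"
 have q0: "q >= 0" using s0 by simp
 have hi: "integrable lborel (%x. h k x powr q)" for k
  unfolding h_def by (intro integrable_powr_diff(1) q0 fi gi) auto
 have hC: "(LBINT x. h k x powr q) <= C" for k
 proof -
  have "(LBINT x. h k x powr q) <= 2 powr q * ((pw q (f k)) + (pw q g))"
   unfolding h_def by (intro integrable_powr_diff(2) q0 fi gi) auto
  also have "... <= C" unfolding C_def using fi(2)[of k] by (intro mult_left_mono) auto
  finally show ?thesis .
 qed
 have C0: "C >= 0" by (rule order_trans[OF _ hC[of 0]]) simp
 have iA: "integrable lborel (indicat_real A)" using A by (simp add: integrable_indicator_iff)
 have lim0: "(%k. LBINT x. indicat_real A x * min (h k x) s powr s0) ----> 0" if s: "s > 0" for s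
 proof -
  have "(%k. LBINT x. indicat_real A x * min (h k x) s powr s0) ----> (LINT x|(lborel::'a measure). 0)"
  proof (rule integral_dominated_convergence[where w="%x. indicat_real A x * s powr s0"])
   show "integrable lborel (%x. indicat_real A x * s powr s0)" using iA by simp
   show "AE x in lborel. (%k. indicat_real A x * min (h k x) s powr s0) ----> 0"
    using ae
   proof eventually_elim
    case (elim x)
    have "(%k. \<bar>f k x - g x\<bar>) ----> 0" using elim by (intro tendsto_rabs_zero LIM_zero)
    then have "(%k. min (h k x) s) ----> min 0 s" unfolding h_def by (intro tendsto_min tendsto_const)
    then have "(%k. min (h k x) s powr s0) ----> min 0 s powr s0"
     using s0 s by (intro tendsto_powr' tendsto_const) (auto simp: h_def)
    then show ?case using s by (auto intro: tendsto_mult_right_zero)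
   qed
   show "AE x in lborel. norm (indicat_real A x * min (h k x) s powr s0) <= indicat_real A x * s powr s0" for k
    using s0 s by (intro AE_I2) (auto simp: indicator_def h_def intro!: powr_mono2)
  qed auto
  then show ?thesis by simp
 qed
 have key: "(LBINT x:A. h k x powr s0) <= (LBINT x. indicat_real A x * min (h k x) s powr s0) + s powr (s0 - q) * C" if s: "s > 0" for s k
 proof -
  have im: "integrable lborel (%x. indicat_real A x * min (h k x) s powr s0)"
  proof (rule Bbound[where f="%x. indicat_real A x * s powr s0"])
   show "integrable lborel (%x. indicat_real A x * s powr s0)" using iA by simp
   show "AE x in lborel. norm (indicat_real A x * min (h k x) s powr s0) <= norm (indicat_real A x * s powr s0)"
    using s s0 by (intro AE_I2) (auto simp: indicator_def h_def intro!: powr_mono2)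
  qed auto
  have pw: "indicat_real A x * h k x powr s0 <= indicat_real A x * min (h k x) s powr s0 + s powr (s0 - q) * h k x powr q" for x
   using Lq_interpolate[of "h k x" s s0 q] s s0 by (auto simp: indicator_def h_def)
  have i0: "integrable lborel (%x. indicat_real A x * h k x powr s0)"
   by (rule Bbound[where f="%x. indicat_real A x * min (h k x) s powr s0 + s powr (s0 - q) * h k x powr q"])
    (use im hi pw in \<open>auto intro: order_trans[OF _ abs_ge_self]\<close>)
  have "(LBINT x:A. h k x powr s0) = (LBINT x. indicat_real A x * h k x powr s0)"
   by (simp add: set_lebesgue_integral_def)
  also have "... <= (LBINT x. indicat_real A x * min (h k x) s powr s0 + s powr (s0 - q) * h k x powr q)"
   by (intro integral_mono i0 Badd im integrable_mult_right hi pw)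
  also have "... = (LBINT x. indicat_real A x * min (h k x) s powr s0) + s powr (s0 - q) * (LBINT x. h k x powr q)"
   using im hi by simp
  also have "... <= (LBINT x. indicat_real A x * min (h k x) s powr s0) + s powr (s0 - q) * C"
   by (intro add_left_mono mult_left_mono hC) simp
  finally show ?thesis .
 qed
 show ?thesis
 proof (rule LIMSEQ_I)
  fix e :: real assume e: "e > 0"
  \<comment> \<open>The level at which the tail factor is \<open>(e / 2) / (C + 1)\<close>; adding 1
    avoids a division by 0.\<close>
  define s where "s = ((e / 2) / (C + 1)) powr (1 / (s0 - q))"
  have ed: "(e / 2) / (C + 1) > 0" using e C0 by simp
  have s: "s > 0" unfolding s_def powr_gt_zero using ed by linarith
  have "s powr (s0 - q) = (e / 2) / (C + 1)" using ed s0 e C0 by (simp add: s_def powr_powr)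
  then have sC: "s powr (s0 - q) * C <= e / 2" using e C0 by (simp add: divide_le_eq mult_left_mono)
  have "\<forall>\<^sub>F k in sequentially. (LBINT x. indicat_real A x * min (h k x) s powr s0) < e / 2"
   using e by (intro order_tendstoD(2)[OF lim0[OF s]]) simp
  then obtain K where K: "!!k. k >= K ==> (LBINT x. indicat_real A x * min (h k x) s powr s0) < e / 2"
   by (auto simp: eventually_sequentially)
  have "norm ((LBINT x:A. \<bar>f k x - g x\<bar> powr s0) - 0) < e" if "k >= K" for k
  proof -
   have "(LBINT x:A. h k x powr s0) < e" using key[OF s, of k] K[OF that] sC by linarith
   moreover have "(LBINT x:A. h k x powr s0) >= 0"
    unfolding set_lebesgue_integral_def by (intro Bnonneg) simp
   ultimately show ?thesis by (simp add: h_def)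
  qed
  then show "\<exists>K. \<forall>k\<ge>K. norm ((LBINT x:A. \<bar>f k x - g x\<bar> powr s0) - 0) < e" by blast
 qed
qed

lemma norm2_triangle: "(norm (a + b))\<^sup>2 <= 2 * (norm a)\<^sup>2 + 2 * (norm b)\<^sup>2" for a b :: "'a::real_normed_vector"
proof -
 have "(norm (a + b))\<^sup>2 <= (norm a + norm b)\<^sup>2" by (intro power_mono norm_triangle_ineq) simp
 also have "... <= 2 * (norm a)\<^sup>2 + 2 * (norm b)\<^sup>2"
  by (smt (verit) power2_sum sum_squares_bound)
 finally show ?thesis .
qed

lemma L2_integrable_add:
 fixes f g :: "'a => 'b::euclidean_space"
 assumes [measurable]: "f \<in> borel_measurable M" "g \<in> borel_measurable M"
  and i: "integrable M (%x. (norm (f x))\<^sup>2)" "integrable M (%x. (norm (g x))\<^sup>2)"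
 shows "integrable M (%x. (norm (f x + g x))\<^sup>2)"
 by (rule Bbound[where f="%x. 2 * (norm (f x))\<^sup>2 + 2 * (norm (g x))\<^sup>2"])
  (use i norm2_triangle in auto)

lemma L2_integrable_diff:
 fixes f g :: "'a => 'b::euclidean_space"
 assumes "f \<in> borel_measurable M" "g \<in> borel_measurable M"
  "integrable M (%x. (norm (f x))\<^sup>2)" "integrable M (%x. (norm (g x))\<^sup>2)"
 shows "integrable M (%x. (norm (f x - g x))\<^sup>2)"
 using L2_integrable_add[of f M "%x. - g x"] assms by simp

text \<open>Weak lower semicontinuity of the Dirichlet integral without weak compactness: the gradient of the
 limit is the strong limit of almost norm-minimal elements of the decreasing convex sets of gradients of
 functions close to the limit.\<close>

lemma weak_gradient_of_limit:
 fixes v :: "real^'n => real"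
 assumes w: "!!k. is_weak_gradient (u k) (g k)" and v: "locally_integrable v" "L1loc u v"
  and g: "!!k. L2 (g k)" "!!k. (sq (g k)) <= M"
 obtains h where "is_weak_gradient v h" "L2 h" "(sq h) <= M"
proof -
 define near where "near n u' \<longleftrightarrow> (ldist (real n) u' v) <= 1 / real (Suc n)" for n u'
 \<comment> \<open>Being near \<open>v\<close> is a convex condition and the sets decrease in
   \<open>n\<close>, so midpoints of elements of \<open>C n\<close> and of later sets remain in
   \<open>C n\<close>.\<close>
 define C where "C n = {G. \<exists>u'. is_weak_gradient u' G \<and> L2 G \<and> near n u'}" for n
 define E where "E G = (sq G)" for G :: "real^'n => real^'n"
 define d where "d n = Inf (E ` C n)" for n
 have E0: "E G >= 0" for G by (simp add: E_def)
 have bb: "bdd_below (E ` C n)" for n using E0 by (intro bdd_belowI[of _ 0]) auto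
 have dl: "d n <= E G" if "G \<in> C n" for n G unfolding d_def using that by (intro cInf_lower bb) auto
 have ne: "\<exists>k. g k \<in> C n" for n
 proof -
  have "\<forall>\<^sub>F k in sequentially. (ldist (real n) (u k) v) < 1 / real (Suc n)"
   by (intro order_tendstoD(2)[OF v(2)[unfolded L1loc_def, rule_format]]) simp
  then obtain k where "(ldist (real n) (u k) v) < 1 / real (Suc n)"
   by (auto simp: eventually_sequentially)
  then show ?thesis using w g(1) unfolding C_def near_def by (intro exI[of _ k]) fastforce
 qed
 have dM: "d n <= M" for n using ne[of n] dl g(2) unfolding E_def by (meson order_trans)
 have near_mono: "near n u'" if "near m u'" "n <= m" "locally_integrable u'" for n m u'
 proof -
  have "(ldist (real n) u' v) <= (ldist (real m) u' v)"
   unfolding set_lebesgue_integral_def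
   by (intro integral_mono set_integrable_cball locint_norm locint_diff that v)
    (use that in \<open>auto simp: indicator_def\<close>)
  also have "... <= 1 / real (Suc m)" using that(1) by (simp add: near_def)
  also have "... <= 1 / real (Suc n)" using that(2) by (intro divide_left_mono) auto
  finally show ?thesis by (simp add: near_def)
 qed
 have Cmono: "C m \<subseteq> C n" if "n <= m" for n m
  unfolding C_def using near_mono[OF _ that] wgD(1) by blast
 have dmono: "d n <= d m" if "n <= m" for n m
  unfolding d_def using ne[of m] by (intro cInf_superset_mono bb image_mono Cmono that) auto
 have "\<exists>H. H \<in> C n \<and> E H < d n + 1 / real (Suc n)" for n
  using cInf_lessD[of "E ` C n" "d n + 1 / real (Suc n)"] ne[of n] by (auto simp: d_def)
 then obtain H where H: "!!n. H n \<in> C n" "!!n. E (H n) < d n + 1 / real (Suc n)" by metis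
 then have "\<exists>u'. is_weak_gradient u' (H n) \<and> L2 (H n) \<and> near n u'" for n
  unfolding C_def by blast
 then obtain U where U: "!!n. is_weak_gradient (U n) (H n)" "!!n. L2 (H n)" "!!n. near n (U n)"
  by metis
 have [measurable]: "H n \<in> Bmeas" for n
  by (intro locint_measurable wgD[OF U(1)])
 have mid: "(%x. (1/2) *\<^sub>R (H n x + H m x)) \<in> C n" if "n <= m" for n m
 proof -
  have l: "locally_integrable (U n)" "locally_integrable (U m)" using wgD(1)[OF U(1)] by auto
  have "is_weak_gradient (%x. (1/2) * (U n x + U m x)) (%x. (1/2) *\<^sub>R (H n x + H m x))"
   by (intro wg_cmult wg_add U)
  moreover have "L2 (%x. (1/2) *\<^sub>R (H n x + H m x))"
   using L2_integrable_add[of "H n" lborel "H m"] U(2) by (simp add: power_divide power_mult_distrib)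
  moreover have "near n (%x. (1/2) * (U n x + U m x))"
  proof -
   have nn: "near n (U n)" "near n (U m)" using U(3) near_mono[OF U(3) that l(2)] by auto
   have "(ldist (real n) (%x. (1/2) * (U n x + U m x)) v) <=
    (LBINT x:cball 0 (real n). (1/2) *\<^sub>R norm (U n x - v x) + (1/2) *\<^sub>R norm (U m x - v x))"
    unfolding set_lebesgue_integral_def
   proof (intro integral_mono set_integrable_cball locint_norm locint_diff locint_add locint_scaleR v l)
    show "locally_integrable (%x. (1/2) * (U n x + U m x))"
     using locint_scaleR[OF locint_add[OF l], of "1/2"] by simp
    fix x
    have "norm ((1/2) * (U n x + U m x) - v x) <= (1/2) * norm (U n x - v x) + (1/2) * norm (U m x - v x)"
     unfolding real_norm_def by (simp add: abs_if field_simps)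
    then show "indicat_real (cball 0 (real n)) x *\<^sub>R norm ((1/2) * (U n x + U m x) - v x)
     <= indicat_real (cball 0 (real n)) x *\<^sub>R ((1/2) *\<^sub>R norm (U n x - v x) + (1/2) *\<^sub>R norm (U m x - v x))"
     by (auto simp: indicator_def)
   qed
   also have "... = (1/2) * (ldist (real n) (U n) v) + (1/2) * (ldist (real n) (U m) v)"
    unfolding set_lebesgue_integral_def
    using set_integrable_cball[OF locint_norm[OF locint_diff[OF l(1) v(1)]], of "real n"]
     set_integrable_cball[OF locint_norm[OF locint_diff[OF l(2) v(1)]], of "real n"]
    by (simp add: distrib_left mult.left_commute)
   also have "... <= 1 / real (Suc n)" using nn unfolding near_def by linarith
   finally show ?thesis by (simp add: near_def)
  qed
  ultimately show ?thesis unfolding C_def by blast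
 qed
 have Hd: "L2 (%x. H m x - H n x)" for m n
  by (intro L2_integrable_diff U) auto
 \<comment> \<open>Parallelogram identity: the midpoint has energy at least \<open>d n\<close>, so
   near-minimal elements are close as soon as the bounded increasing sequence \<open>d\<close> is
   nearly stationary.\<close>
 have par: "(sq (%x. H m x - H n x)) <= 2 * (d m - d n) + 2 * (1 / real (Suc n)) + 2 * (1 / real (Suc m))" if "n <= m" for n m
 proof -
  have i: "L2 (%x. (1/2) *\<^sub>R (H n x + H m x))"
   using L2_integrable_add[of "H n" lborel "H m"] U(2) by (simp add: power_divide power_mult_distrib)
  have pw: "(norm (a - b))\<^sup>2 = 2 * (norm a)\<^sup>2 + 2 * (norm b)\<^sup>2 - 4 * (norm ((1/2) *\<^sub>R (b + a)))\<^sup>2" for a b :: "real^'n"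
   by (simp add: power2_norm_eq_inner inner_simps inner_commute algebra_simps)
  have "(sq (%x. H m x - H n x)) = 2 * E (H m) + 2 * E (H n) - 4 * E (%x. (1/2) *\<^sub>R (H n x + H m x))"
   unfolding pw E_def using U(2) i by simp
  also have "... <= 2 * (d m + 1 / real (Suc m)) + 2 * (d n + 1 / real (Suc n)) - 4 * d n"
   by (intro diff_mono add_mono mult_left_mono dl[OF mid[OF that]] less_imp_le[OF H(2)]) auto
  finally show ?thesis by (simp add: algebra_simps)
 qed
 have conv_d: "Cauchy d"
 proof (rule convergent_Cauchy)
  have "incseq d" using dmono by (simp add: incseq_def)
  then show "convergent d" using dM incseq_convergent[of d M] by (metis convergentI)
 qed
 obtain h r where h: "h \<in> borel_measurable lborel" "strict_mono r" "AE x in lborel. (%n. H (r n) x) ----> h x"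
 proof (rule L2_Cauchy_AE_subseq[OF _ Hd])
  fix e :: real assume e: "e > 0"
  obtain N1 where N1: "!!m n. m >= N1 ==> n >= N1 ==> \<bar>d m - d n\<bar> < e / 8"
   using CauchyD[OF conv_d, of "e/8"] e by auto
  have "\<forall>\<^sub>F n in sequentially. 1 / real (Suc n) < e / 8"
   using e by (intro order_tendstoD(2)[OF moll_seq(1)]) simp
  then obtain N2 where N2: "!!n. n >= N2 ==> 1 / real (Suc n) < e / 8" by (auto simp: eventually_sequentially)
  have 1: "(sq (%x. H m x - H n x)) < e" if "m >= max N1 N2" "n >= max N1 N2" "n <= m" for m n
  proof -
   have "\<bar>d m - d n\<bar> < e / 8" using N1[of m n] that by simp
   then have "d m - d n < e / 8" by linarith
   moreover have "1 / real (Suc m) < e / 8" "1 / real (Suc n) < e / 8" using N2[of m] N2[of n] that by simp_all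
   moreover have "I < e" if "I <= 2 * D + 2 * a + 2 * b" "D < e / 8" "b < e / 8" "a < e / 8" for I D a b :: real
    using that e by linarith
   ultimately show ?thesis using par[OF that(3)] by blast
  qed
  have "(sq (%x. H m x - H n x)) < e" if "m >= max N1 N2" "n >= max N1 N2" for m n
   using 1[of m n] 1[of n m] that by (cases "n <= m") (auto simp: norm_minus_commute)
  then show "\<exists>N. \<forall>m\<ge>N. \<forall>n\<ge>N. (sq (%x. H m x - H n x)) < e" by blast
 qed auto
 have [measurable]: "h \<in> Bmeas" using h(1) by simp
 have fat: "L2 h" "(sq h) <= M"
 proof -
  have b: "(sq (H (r n))) <= M + 1 / real (Suc (r n))" for n
   using H(2)[of "r n"] dM[of "r n"] unfolding E_def by linarith
  have lim: "(%n. M + 1 / real (Suc (r n))) ----> M + 0"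
   using LIMSEQ_subseq_LIMSEQ[OF moll_seq(1) h(2)] by (intro tendsto_add tendsto_const) (simp add: o_def)
  have ae: "AE x in lborel. (%n. (norm (H (r n) x))\<^sup>2) ----> (norm (h x))\<^sup>2"
   using h(3) by eventually_elim (intro tendsto_intros)
  note f = fatou_bound[OF _ _ _ ae b lim]
  show "L2 h" by (rule f(1)) (use U(2) in auto)
  show "(sq h) <= M" using f(2) U(2) by auto
 qed
 have LU: "L1loc U v" unfolding L1loc_def
 proof
  fix R :: real
  obtain K :: nat where K: "R <= K" using real_arch_simple by blast
  show "(%n. LBINT x:cball 0 R. norm (U n x - v x)) ----> 0"
  proof (rule tendsto_sandwich[OF _ _ tendsto_const moll_seq(1)])
   show "\<forall>\<^sub>F n in sequentially. 0 <= (ldist R (U n) v)"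
    unfolding set_lebesgue_integral_def by (intro always_eventually allI Bnonneg) auto
   show "\<forall>\<^sub>F n in sequentially. (ldist R (U n) v) <= 1 / real (Suc n)"
    using eventually_ge_at_top[of K]
   proof eventually_elim
    case (elim n)
    have "(ldist R (U n) v) <= (ldist (real n) (U n) v)"
     unfolding set_lebesgue_integral_def
     by (intro integral_mono set_integrable_cball locint_norm locint_diff wgD(1)[OF U(1)] v)
      (use elim K in \<open>auto simp: indicator_def\<close>)
    then show ?case using U(3)[of n] by (simp add: near_def)
   qed
  qed
 qed
 have LH: "L1loc (%n. H (r n)) h" unfolding L1loc_def
 proof
  fix R :: real
  have i: "L2 (%x. H (r n) x - h x)" for n by (intro L2_integrable_diff U fat) auto
  have b: "(sq (%x. H (r n) x - h x)) <= 2 * (M + 1) + 2 * M" for n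
  proof -
   have "(sq (%x. H (r n) x - h x)) <= (LBINT x. 2 * (norm (H (r n) x))\<^sup>2 + 2 * (norm (h x))\<^sup>2)"
    by (rule integral_mono[OF i]) (use U(2) fat norm2_triangle[of _ "- h _"] in auto)
   also have "... = 2 * E (H (r n)) + 2 * (sq h)" using U(2) fat by (simp add: E_def)
   finally have "(sq (%x. H (r n) x - h x)) <= 2 * E (H (r n)) + 2 * (sq h)" .
   moreover have "1 / real (Suc (r n)) <= 1" by simp
   ultimately show ?thesis using fat(2) H(2)[of "r n"] dM[of "r n"] by argo
  qed
  have ae0: "AE x in lborel. (%n. norm (H (r n) x - h x)) ----> 0"
   using h(3) by eventually_elim (simp add: tendsto_norm_zero LIM_zero)
  show "(%n. LBINT x:cball 0 R. norm (H (r n) x - h x)) ----> 0"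
   using Ls_convergence_finite_measure[of 1 2 "cball 0 R" "%n x. norm (H (r n) x - h x)" "%_. 0" "2 * (M + 1) + 2 * M"] i b ae0
    emeasure_lborel_cball_finite[of "0::real^'n" R] by simp
 qed
 have "is_weak_gradient v h"
  by (rule wg_limit[OF U(1) v(1) _ L1loc_subseq[OF LU h(2)] LH])
   (rule locint_powr[of 2], use fat in auto)
 with fat that show thesis by blast
qed

text \<open>With this density bounded functions become integrable on the whole space, while
  positivity keeps the null sets unchanged. It is made for the compactness theorem that
  follows.\<close>

lemma positive_weight:
 obtains w :: "'a::euclidean_space => real" where "w \<in> Bmeas" "integrable lborel w" "!!x. 0 < w x" "!!x. w x <= 1"
proof -
 obtain h :: "'a => ennreal" where h: "h \<in> borel_measurable lborel" "integral\<^sup>N lborel h ~= \<infinity>" "!!x. 0 < h x" "!!x. h x < \<infinity>"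
  using sigma_finite_measure.Ex_finite_integrable_function[OF sigma_finite_lborel] by auto
 define w where "w x = min (enn2real (h x)) 1" for x
 note [measurable] = h(1)
 have m: "w \<in> Bmeas" unfolding w_def by measurable
 have "(\<integral>\<^sup>+x. ennreal (norm (w x)) \<partial>lborel) <= integral\<^sup>N lborel h"
 proof (intro nn_integral_mono)
  fix x :: 'a
  have "ennreal (norm (w x)) <= ennreal (enn2real (h x))" by (intro ennreal_leI) (simp add: w_def min_def)
  moreover have "ennreal (enn2real (h x)) = h x" using h(4)[of x] by (intro ennreal_enn2real) simp
  ultimately show "ennreal (norm (w x)) <= h x" by (simp only:)
 qed
 then have "integrable lborel w" using h(2) m by (intro integrableI_bounded) (auto simp: top.not_eq_extremum le_less_trans)
 moreover have "0 < w x" for x using h(3)[of x] h(4)[of x] by (auto simp: w_def enn2real_positive_iff)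
 moreover have "w x <= 1" for x by (simp add: w_def)
 ultimately show thesis using that m by blast
qed

text \<open>Rellich's theorem: mollified sequences are bounded and equicontinuous, hence converge pointwise along
 a subsequence, and the mollified functions are close to the original ones in \<open>L\<^sup>2\<close>, uniformly.\<close>

lemma rellich:
 fixes u :: "nat => real^'n => real"
 assumes w: "!!k. is_weak_gradient (u k) (g k)"
  and g: "!!k. L2 (g k)" "!!k. (sq (g k)) <= M"
  and q: "q >= 1"
  and uq: "!!k. Lpw q (u k)" "!!k. (pw q (u k)) <= B"
 obtains r v where "strict_mono (r :: nat => nat)" "v \<in> Bmeas" "AE x in lborel. (%k. u (r k) x) ----> v x"
proof -
 let ?e = "%n. 1 / real (Suc n)"
 note a = wgD[OF w]
 note [measurable] = locint_measurable[OF a(1)] locint_measurable[OF a(2)]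
 have M0: "M >= 0" by (rule order_trans[OF _ g(2)[of 0]]) simp
 have B0: "B >= 0" by (rule order_trans[OF _ uq(2)[of 0]]) simp
 define m where "m n k = moll (?e n) (u k)" for n k
 have sm: "smooth (m n k)" for n k unfolding m_def by (intro moll_smooth a moll_seq(2))
 have [measurable]: "m n k \<in> Bmeas" for n k
  by (intro borel_measurable_continuous_onI smooth_continuous sm)
 have gm: "grad (m n k) = moll (?e n) (g k)" for n k
  unfolding m_def using moll_is_weak_gradient[OF w moll_seq(2)] by blast
 obtain C where C: "C > 0" "!!f :: real^'n => real. !!q r s x. q >= 1 ==> r > 0 ==> s > 0 ==> f \<in> Bmeas ==>
   integrable lborel (%x. norm (f x) powr q) ==>
   norm (moll r f x) <= s + s powr (1 - q) * (C / r ^ CARD('n)) * (LBINT x. norm (f x) powr q)"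
  using moll_bound by blast
 obtain D where D: "D > 0" "!!f :: real^'n => real^'n. !!q r s x. q >= 1 ==> r > 0 ==> s > 0 ==> f \<in> Bmeas ==>
   integrable lborel (%x. norm (f x) powr q) ==>
   norm (moll r f x) <= s + s powr (1 - q) * (D / r ^ CARD('n)) * (LBINT x. norm (f x) powr q)"
  using moll_bound by blast
 define K where "K n = 1 + (C / ?e n ^ CARD('n)) * B" for n
 define L where "L n = 1 + (D / ?e n ^ CARD('n)) * M" for n
 have K1: "K n > 0" for n unfolding K_def using C(1) B0 by (intro add_pos_nonneg mult_nonneg_nonneg divide_nonneg_nonneg) auto
 have L1: "L n > 0" for n unfolding L_def using D(1) M0 by (intro add_pos_nonneg mult_nonneg_nonneg divide_nonneg_nonneg) auto
 have mK: "\<bar>m n k x\<bar> <= K n" for n k x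
 proof -
  have "\<bar>m n k x\<bar> <= 1 + (C / ?e n ^ CARD('n)) * (pw q (u k))"
   unfolding m_def using C(2)[of q "?e n" 1 "u k" x] q uq(1) by simp
  also have "... <= K n" unfolding K_def using C(1) by (intro add_left_mono mult_left_mono uq) auto
  finally show ?thesis .
 qed
 have mL: "norm (grad (m n k) x) <= L n" for n k x
 proof -
  have "norm (grad (m n k) x) <= 1 + (D / ?e n ^ CARD('n)) * (sq (g k))"
   unfolding gm using D(2)[of 2 "?e n" 1 "g k" x] g(1) by simp
  also have "... <= L n" unfolding L_def using D(1) by (intro add_left_mono mult_left_mono g) auto
  finally show ?thesis .
 qed
 have lip: "\<bar>m n k x - m n k y\<bar> <= L n * norm (x - y)" for n k x y
 proof -
  have "norm (m n k x - m n k y) <= L n * norm (x - y)"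
  proof (rule differentiable_bound[of UNIV])
   show "(m n k has_derivative (%h. grad (m n k) x \<bullet> h)) (at x within UNIV)" for x
    by (intro grad_has_derivative smooth_diff sm)
   show "onorm (%h. grad (m n k) x \<bullet> h) <= L n" for x
    by (rule onorm_le) (use order_trans[OF Cauchy_Schwarz_ineq2 mult_right_mono[OF mL]] in auto)
  qed auto
  then show ?thesis by simp
 qed
 obtain Q :: "(real^'n) set" where Q: "countable Q" "!!U. open U ==> U ~= {} ==> \<exists>d\<in>Q. d \<in> U"
  using countable_dense_exists by blast
 \<comment> \<open>One subsequence for all mollification radii and all points of a countable dense
   set; division by \<open>K n\<close> provides the common bound 1.\<close>
 obtain r where r: "strict_mono (r::nat=>nat)"
  and rc: "!!p. p \<in> UNIV \<times> Q ==> \<exists>l. (%k. (%k (n, x). m n k x / K n) (r k) p) ----> l"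
 proof (rule function_convergent_subsequence[of "UNIV \<times> Q" "%k (n, x). m n k x / K n" 1])
  show "countable ((UNIV::nat set) \<times> Q)" using Q(1) by simp
  fix k and p :: "nat \<times> (real^'n)"
  show "norm (case p of (n, x) => m n k x / K n) <= 1"
   using mK K1 by (auto simp: divide_le_eq abs_of_pos split: prod.split)
 qed blast
 have convQ: "convergent (%k. m n (r k) x)" if xQ: "x \<in> Q" for n x
 proof -
  obtain l where "(%k. m n (r k) x / K n) ----> l" using rc[of "(n, x)"] xQ by auto
  then have "(%k. m n (r k) x / K n * K n) ----> l * K n" by (intro tendsto_intros)
  then show ?thesis using K1[of n] by (simp add: convergentI)
 qed
 have conv: "convergent (%k. m n (r k) x)" for n x
 proof -
  have "Cauchy (%k. m n (r k) x)"
  proof (rule CauchyI)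
   fix e :: real assume e: "e > 0"
   have "e / (3 * L n) > 0" using e L1[of n] by simp
   then have "ball x (e / (3 * L n)) ~= {}" using centre_in_ball by blast
   then obtain y where y: "y \<in> Q" "dist x y < e / (3 * L n)" using Q(2)[of "ball x (e / (3 * L n))"] by auto
   have xy: "L n * norm (x - y) < e / 3" using y(2) L1[of n] by (simp add: dist_norm less_divide_eq field_simps)
   have "Cauchy (%k. m n (r k) y)" by (intro convergent_Cauchy convQ y)
   then obtain N where N: "!!i j. i >= N ==> j >= N ==> \<bar>m n (r i) y - m n (r j) y\<bar> < e / 3"
    using CauchyD[of "%k. m n (r k) y" "e/3"] e by auto
   have "norm (m n (r i) x - m n (r j) x) < e" if "i >= N" "j >= N" for i j
    using N[OF that] lip[of n "r i" x y] lip[of n "r j" x y] xy by (simp add: abs_if split: if_splits)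
   then show "\<exists>N. \<forall>i\<ge>N. \<forall>j\<ge>N. norm (m n (r i) x - m n (r j) x) < e" by blast
  qed
  then show ?thesis by (simp add: Cauchy_convergent_iff)
 qed
 define ml where "ml n x = lim (%k. m n (r k) x)" for n x
 have ml: "(%k. m n (r k) x) ----> ml n x" for n x
  using conv by (simp add: ml_def convergent_LIMSEQ_iff)
 have [measurable]: "ml n \<in> Bmeas" for n unfolding ml_def by measurable
 have mlK: "\<bar>ml n x\<bar> <= K n" for n x
  by (rule LIMSEQ_le_const2[OF tendsto_rabs[OF ml]]) (use mK in auto)
 obtain wt :: "real^'n => real" where wt: "wt \<in> Bmeas" "integrable lborel wt" "!!x. 0 < wt x" "!!x. wt x <= 1"
  using positive_weight by metis
 note [measurable] = wt(1)
 let ?W = "density lborel (%x. ennreal (wt x))"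
 have md: "integrable lborel (%x. (m n k x - u k x)\<^sup>2)" "(LBINT x. (m n k x - u k x)\<^sup>2) <= (?e n)\<^sup>2 * M" for n k
 proof -
  show "integrable lborel (%x. (m n k x - u k x)\<^sup>2)"
   unfolding m_def by (rule moll_L2_diff[OF w g(1) moll_seq(2)])
  have "(LBINT x. (m n k x - u k x)\<^sup>2) <= (?e n)\<^sup>2 * (sq (g k))"
   unfolding m_def by (rule moll_L2_diff[OF w g(1) moll_seq(2)])
  also have "... <= (?e n)\<^sup>2 * M" by (intro mult_left_mono g) simp
  finally show "(LBINT x. (m n k x - u k x)\<^sup>2) <= (?e n)\<^sup>2 * M" .
 qed
 have mi: "integrable lborel (%x. wt x * (m n k x - ml n x)\<^sup>2)" for n k
 proof (rule Bbound[where f="%x. wt x * (2 * K n)\<^sup>2"])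
  have "(m n k x - ml n x)\<^sup>2 <= (2 * K n)\<^sup>2" for x
   using mK[of n k x] mlK[of n x] by (intro abs_le_square_iff[THEN iffD1]) linarith
  then show "AE x in lborel. norm (wt x * (m n k x - ml n x)\<^sup>2) <= norm (wt x * (2 * K n)\<^sup>2)"
   using wt(3) by (auto simp: abs_mult abs_of_pos intro!: mult_left_mono)
 qed (use wt(2) in auto)
 have mlim: "(%k. \<integral>x. wt x * (m n (r k) x - ml n x)\<^sup>2 \<partial>lborel) ----> 0" for n
 proof -
  have "(%k. \<integral>x. wt x * (m n (r k) x - ml n x)\<^sup>2 \<partial>lborel) ----> (\<integral>x. 0 \<partial>(lborel::(real^'n) measure))"
  proof (rule integral_dominated_convergence[where w="%x. wt x * (2 * K n)\<^sup>2"])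
   have "(m n k x - ml n x)\<^sup>2 <= (2 * K n)\<^sup>2" for x k
    using mK[of n k x] mlK[of n x] by (intro abs_le_square_iff[THEN iffD1]) linarith
   then show "AE x in lborel. norm (wt x * (m n (r k) x - ml n x)\<^sup>2) <= wt x * (2 * K n)\<^sup>2" for k
    using wt(3) by (auto simp: abs_mult abs_of_pos intro!: mult_left_mono)
   show "AE x in lborel. (%k. wt x * (m n (r k) x - ml n x)\<^sup>2) ----> 0"
   proof (intro AE_I2)
    fix x
    have "(%k. wt x * (m n (r k) x - ml n x)\<^sup>2) ----> wt x * (ml n x - ml n x)\<^sup>2"
     by (intro tendsto_intros ml)
    then show "(%k. wt x * (m n (r k) x - ml n x)\<^sup>2) ----> 0" by simp
   qed
  qed (use wt(2) in auto)
  then show ?thesis by simp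
 qed
 have sq4: "(a - b)\<^sup>2 <= 4 * ((c - a)\<^sup>2 + (c - l)\<^sup>2 + (d - l)\<^sup>2 + (d - b)\<^sup>2)" for a b c d l :: real
 proof -
  have "(a - b)\<^sup>2 = ((c - l) - (c - a) - (d - l) + (d - b))\<^sup>2" by simp
  also have "... <= 4 * ((c - a)\<^sup>2 + (c - l)\<^sup>2 + (d - l)\<^sup>2 + (d - b)\<^sup>2)"
  proof -
   have "(x - y - z + t)\<^sup>2 <= 4 * (y\<^sup>2 + x\<^sup>2 + z\<^sup>2 + t\<^sup>2)" for x y z t :: real
   proof -
    have "0 <= (x + y)\<^sup>2 + (x + z)\<^sup>2 + (x - t)\<^sup>2 + (y - z)\<^sup>2 + (y + t)\<^sup>2 + (z + t)\<^sup>2" by simp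
    then show ?thesis by (simp add: power2_eq_square algebra_simps)
   qed
   then show ?thesis .
  qed
  finally show ?thesis .
 qed
 \<comment> \<open>The two mollification errors together cost
   \<open>8 * ((?e n)\<^sup>2 * M)\<close>, uniformly in the indices; for fixed \<open>n\<close> the
   remaining terms tend to 0.\<close>
 have ub: "integrable lborel (%x. wt x * (u i x - u j x)\<^sup>2)"
  "(LBINT x. wt x * (u i x - u j x)\<^sup>2) <= 8 * ((?e n)\<^sup>2 * M) + 4 * (LBINT x. wt x * (m n i x - ml n x)\<^sup>2) + 4 * (LBINT x. wt x * (m n j x - ml n x)\<^sup>2)" for i j n
 proof -
  let ?F = "%x. 4 * (m n i x - u i x)\<^sup>2 + 4 * (m n j x - u j x)\<^sup>2 + 4 * (wt x * (m n i x - ml n x)\<^sup>2) + 4 * (wt x * (m n j x - ml n x)\<^sup>2)"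
  have F: "integrable lborel ?F" using md(1) mi by simp
  have pw: "wt x * (u i x - u j x)\<^sup>2 <= ?F x" for x
  proof -
   have "wt x * (u i x - u j x)\<^sup>2 <= wt x * (4 * ((m n i x - u i x)\<^sup>2 + (m n i x - ml n x)\<^sup>2 + (m n j x - ml n x)\<^sup>2 + (m n j x - u j x)\<^sup>2))"
    using wt(3)[of x] by (intro mult_left_mono sq4) simp
   also have "... = 4 * (wt x * (m n i x - u i x)\<^sup>2) + 4 * (wt x * (m n j x - u j x)\<^sup>2) + 4 * (wt x * (m n i x - ml n x)\<^sup>2) + 4 * (wt x * (m n j x - ml n x)\<^sup>2)"
    by (simp add: algebra_simps)
   also have "... <= ?F x"
    using mult_right_mono[OF wt(4)[of x], of "(m n i x - u i x)\<^sup>2"] mult_right_mono[OF wt(4)[of x], of "(m n j x - u j x)\<^sup>2"] by simp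
   finally show ?thesis .
  qed
  show i: "integrable lborel (%x. wt x * (u i x - u j x)\<^sup>2)"
   by (rule Bbound[OF F])
    (use pw wt(3) in \<open>auto simp: abs_mult abs_of_pos intro: order_trans[OF _ abs_ge_self]\<close>)
  have "(LBINT x. wt x * (u i x - u j x)\<^sup>2) <= (LBINT x. ?F x)" by (intro integral_mono i F pw)
  also have "... = 4 * (LBINT x. (m n i x - u i x)\<^sup>2) + 4 * (LBINT x. (m n j x - u j x)\<^sup>2) + 4 * (LBINT x. wt x * (m n i x - ml n x)\<^sup>2) + 4 * (LBINT x. wt x * (m n j x - ml n x)\<^sup>2)"
   using md(1) mi by simp
  finally show "(LBINT x. wt x * (u i x - u j x)\<^sup>2) <= 8 * ((?e n)\<^sup>2 * M) + 4 * (LBINT x. wt x * (m n i x - ml n x)\<^sup>2) + 4 * (LBINT x. wt x * (m n j x - ml n x)\<^sup>2)"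
   using md(2)[of n i] md(2)[of n j] by linarith
 qed
 have wint: "integrable ?W (%x. (norm (u (r i) x - u (r j) x))\<^sup>2)"
  "(\<integral>x. (norm (u (r i) x - u (r j) x))\<^sup>2 \<partial>?W) = (LBINT x. wt x * (u (r i) x - u (r j) x)\<^sup>2)" for i j
  using ub(1) wt(3) by (auto simp: integrable_density integral_density less_imp_le)
 obtain v s where v: "v \<in> borel_measurable ?W" "strict_mono (s::nat=>nat)" "AE x in ?W. (%k. u (r (s k)) x) ----> v x"
 proof (rule L2_Cauchy_AE_subseq[of "%k. u (r k)" ?W, OF _ wint(1)])
  fix e :: real assume e: "e > 0"
  have "(%n. 8 * ((?e n)\<^sup>2 * M)) ----> 8 * (0\<^sup>2 * M)" by (intro tendsto_intros moll_seq)
  from order_tendstoD(2)[OF this, of "e / 3"] have "\<forall>\<^sub>F n in sequentially. 8 * ((?e n)\<^sup>2 * M) < e / 3" using e by simp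
  then obtain n where n: "8 * ((?e n)\<^sup>2 * M) < e / 3" by (auto simp: eventually_sequentially)
  have "\<forall>\<^sub>F k in sequentially. (LBINT x. wt x * (m n (r k) x - ml n x)\<^sup>2) < e / 12"
   using e by (intro order_tendstoD(2)[OF mlim]) auto
  then obtain N where N: "!!k. k >= N ==> (LBINT x. wt x * (m n (r k) x - ml n x)\<^sup>2) < e / 12"
   by (auto simp: eventually_sequentially)
  have "(\<integral>x. (norm (u (r i) x - u (r j) x))\<^sup>2 \<partial>?W) < e" if "i >= N" "j >= N" for i j
   unfolding wint(2) using ub(2)[of "r i" "r j" n] N[OF that(1)] N[OF that(2)] n by linarith
  then show "\<exists>N. \<forall>i\<ge>N. \<forall>j\<ge>N. (\<integral>x. (norm (u (r i) x - u (r j) x))\<^sup>2 \<partial>?W) < e" by blast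
 qed auto
 have "AE x in lborel. (%k. u ((r \<circ> s) k) x) ----> v x"
  using v(3) wt(3) by (subst (asm) AE_density) auto
 moreover have "strict_mono (r \<circ> s)" using r v(2) by (rule strict_mono_o)
 moreover have "v \<in> Bmeas" using v(1) by simp
 ultimately show thesis using that by blast
qed

subsection \<open>Mean value inequalities and precise representatives\<close>

lemma moll_add:
 fixes f g :: "real^'n => 'b::euclidean_space"
 assumes "r > 0" "locally_integrable f" "locally_integrable g"
 shows "moll r (%x. f x + g x) x = moll r f x + moll r g x"
 unfolding moll_def conv_def scaleR_add_right
 by (intro BIadd conv_integrable eta_test assms)

lemma moll_diff:
 fixes f g :: "real^'n => 'b::euclidean_space"
 assumes "r > 0" "locally_integrable f" "locally_integrable g"
 shows "moll r (%x. f x - g x) x = moll r f x - moll r g x"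
 unfolding moll_def conv_def scaleR_diff_right
 by (intro Bochner_Integration.integral_diff conv_integrable eta_test assms)

lemma moll_const: "r > 0 ==> moll r (%_::real^'n. c::real) x = c"
 using moll_eq(2)[of r "%_. c" x] eta_integral[of r, where 'n='n] locint_continuous[of "%_::real^'n. c"]
 by (simp add: continuous_on_const)

lemma moll_mono_AE:
 fixes f g :: "real^'n => real"
 assumes r: "r > 0" "locally_integrable f" "locally_integrable g" and le: "AE y in lborel. norm (y - x) < r --> f y <= g y"
 shows "moll r f x <= moll r g x"
 unfolding moll_def conv_def
proof (intro integral_mono_AE conv_integrable eta_test r)
 show "AE y in lborel. eta r (y - x) *\<^sub>R f y <= eta r (y - x) *\<^sub>R g y"
  using le
 proof eventually_elim
  case (elim y)
  then show ?case using eta_support[OF r(1), of "y - x"] eta_nonneg[OF r(1), of "y - x"]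
   by (cases "eta r (y - x) = 0") (auto intro: mult_left_mono)
 qed
qed

section \<open>The radius derivative of the mollifier\<close>

abbreviation bump_mass :: "'n::finite itself => real" where
 "bump_mass _ \<equiv> (LBINT z. bumpf (z :: real^'n))"

text \<open>The derivative of \<open>eta r z\<close> in \<open>r\<close>. With
  \<open>y = z / r\<close> and up to the mass, it is \<open>- r^(-N-1)\<close> times the divergence
  of \<open>bumpf y *\<^sub>R y\<close>, and that vector field is itself minus a gradient.\<close>

definition eta' :: "real => real^'n => real" where
 "eta' r z = (4 * (hexp 4 (1 - (norm (z /\<^sub>R r))\<^sup>2) - 2 * hexp 3 (1 - (norm (z /\<^sub>R r))\<^sup>2)) * (norm (z /\<^sub>R r))\<^sup>2
  - 2 * real CARD('n) * hexp 2 (1 - (norm (z /\<^sub>R r))\<^sup>2)) / (r ^ (CARD('n) + 1) * bump_mass TYPE('n))"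

lemma eta_derivative:
 fixes z :: "real^'n"
 assumes r: "r > 0"
 shows "((%r. eta r z) has_real_derivative eta' r z) (at r)"
proof -
 let ?m = "bump_mass TYPE('n)"
 let ?N = "CARD('n)"
 have m: "?m > 0" by (rule bumpf_mass_pos)
 let ?s = "%r. 1 - (norm z)\<^sup>2 / r\<^sup>2"
 have s: "1 - (norm (z /\<^sub>R t))\<^sup>2 = ?s t" for t :: real by (simp add: power_divide power_mult_distrib divide_inverse power_inverse mult.commute)
 have ds: "(?s has_real_derivative 2 * (norm z)\<^sup>2 / r ^ 3) (at r)"
  using r by (auto intro!: derivative_eq_intros simp: power2_eq_square power3_eq_cube field_simps)
 have "((%r. hexp 2 (?s r)) has_real_derivative (hexp 4 (?s r) - 2 * hexp 3 (?s r)) * (2 * (norm z)\<^sup>2 / r ^ 3)) (at r)"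
  using DERIV_chain'[OF ds hexp_deriv[of 2 "?s r"]] by (simp add: mult.commute)
 then have d1: "((%r. 2 * hexp 2 (?s r)) has_real_derivative 2 * ((hexp 4 (?s r) - 2 * hexp 3 (?s r)) * (2 * (norm z)\<^sup>2 / r ^ 3))) (at r)"
  by (rule DERIV_cmult)
 have "((%r. r ^ ?N) has_real_derivative real ?N * r ^ (?N - 1)) (at r)" by (auto intro!: derivative_eq_intros)
 then have d2: "((%r. r ^ ?N * ?m) has_real_derivative real ?N * r ^ (?N - 1) * ?m) (at r)" by (rule DERIV_cmult_right)
 have rN: "r ^ ?N * ?m ~= 0" using r m by simp
 have "((%r. 2 * hexp 2 (?s r) / (r ^ ?N * ?m)) has_real_derivative
  (2 * ((hexp 4 (?s r) - 2 * hexp 3 (?s r)) * (2 * (norm z)\<^sup>2 / r ^ 3)) * (r ^ ?N * ?m) - 2 * hexp 2 (?s r) * (real ?N * r ^ (?N - 1) * ?m)) / ((r ^ ?N * ?m) * (r ^ ?N * ?m))) (at r)"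
  by (rule DERIV_divide[OF d1 d2 rN])
 moreover have "(2 * ((hexp 4 (?s r) - 2 * hexp 3 (?s r)) * (2 * (norm z)\<^sup>2 / r ^ 3)) * (r ^ ?N * ?m) - 2 * hexp 2 (?s r) * (real ?N * r ^ (?N - 1) * ?m)) / ((r ^ ?N * ?m) * (r ^ ?N * ?m)) = eta' r z"
 proof -
  have alg: "(2 * (A * (2 * Z / r ^ 3)) * (r ^ Suc k * M) - 2 * B * (n * r ^ k * M)) / ((r ^ Suc k * M) * (r ^ Suc k * M))
    = (4 * A * (Z / r\<^sup>2) - 2 * n * B) / (r ^ (Suc k + 1) * M)" if "M > 0" for A B Z M n :: real and k
   using r that by (simp add: divide_simps power2_eq_square power3_eq_cube) (simp add: algebra_simps)
  have nz: "(norm (z /\<^sub>R r))\<^sup>2 = (norm z)\<^sup>2 / r\<^sup>2" by (simp add: power_divide power_mult_distrib divide_inverse power_inverse mult.commute)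
  show ?thesis unfolding eta'_def nz
   using alg[OF m, of "hexp 4 (?s r) - 2 * hexp 3 (?s r)" "(norm z)\<^sup>2" "?N - 1" "hexp 2 (?s r)" "real ?N"] by simp
 qed
 moreover have "bumpf (z /\<^sub>R t) = 2 * hexp 2 (?s t)" for t unfolding bumpf_def s ..
 then have "(%t. eta t z) = (%r. 2 * hexp 2 (?s r) / (r ^ ?N * ?m))" by (simp add: eta_def)
 ultimately show ?thesis by simp
qed

lemma hexp_le: "s <= 1 ==> \<bar>hexp k s\<bar> <= fact (k + 2)"
proof (cases "s > 0")
 case True
 assume "s <= 1"
 then have "s\<^sup>2 <= 1" using True by (simp add: power_le_one)
 then have "fact (k + 2) * s\<^sup>2 <= fact (k + 2) * (1::real)" by (intro mult_left_mono) auto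
 then show ?thesis using hexp_bound[of k s] by linarith
qed (simp add: hexp_def)

lemma eta'_bound:
 obtains C where "C > 0" "!!r z. r > 0 ==> \<bar>eta' r (z::real^'n)\<bar> <= C / r ^ (CARD('n) + 1)"
proof -
 let ?m = "bump_mass TYPE('n)"
 have m: "?m > 0" by (rule bumpf_mass_pos)
 define C where "C = (4 * (fact 6 + 2 * fact 5) + 2 * real CARD('n) * fact 4) / ?m"
 have C: "C > 0" unfolding C_def by (intro divide_pos_pos add_pos_nonneg add_pos_pos mult_pos_pos m fact_gt_zero) simp_all
 have "\<bar>eta' r z\<bar> <= C / r ^ (CARD('n) + 1)" if r: "r > 0" for r and z :: "real^'n"
 proof -
  define t where "t = (norm (z /\<^sub>R r))\<^sup>2"
  have t: "t >= 0" by (simp add: t_def)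
  have "\<bar>4 * (hexp 4 (1 - t) - 2 * hexp 3 (1 - t)) * t - 2 * real CARD('n) * hexp 2 (1 - t)\<bar> <= 4 * (fact 6 + 2 * fact 5) + 2 * real CARD('n) * fact 4"
  proof (cases "t < 1")
   case True
   have "\<bar>hexp 4 (1 - t)\<bar> <= fact 6" "\<bar>hexp 3 (1 - t)\<bar> <= fact 5" and h2: "\<bar>hexp 2 (1 - t)\<bar> <= fact 4"
    using hexp_le[of "1 - t" 4] hexp_le[of "1 - t" 3] hexp_le[of "1 - t" 2] t by simp_all
   then have a: "\<bar>hexp 4 (1 - t) - 2 * hexp 3 (1 - t)\<bar> <= fact 6 + 2 * fact 5" by linarith
   have "\<bar>4 * (hexp 4 (1 - t) - 2 * hexp 3 (1 - t)) * t - 2 * real CARD('n) * hexp 2 (1 - t)\<bar> <=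
    4 * \<bar>hexp 4 (1 - t) - 2 * hexp 3 (1 - t)\<bar> * t + 2 * real CARD('n) * \<bar>hexp 2 (1 - t)\<bar>"
   proof -
    have "\<bar>4 * A * t - 2 * real CARD('n) * B\<bar> <= 4 * \<bar>A\<bar> * t + 2 * real CARD('n) * \<bar>B\<bar>" for A B :: real
     using abs_triangle_ineq4[of "4 * A * t" "2 * real CARD('n) * B"] t by (simp add: abs_mult)
    then show ?thesis .
   qed
   also have "... <= 4 * (fact 6 + 2 * fact 5) * 1 + 2 * real CARD('n) * fact 4"
    using a h2 t True by (intro add_mono mult_mono) auto
   finally show ?thesis by simp
  qed (auto simp: hexp_def)
  then show ?thesis unfolding eta'_def C_def t_def[symmetric] using r m
   by (simp add: abs_divide abs_mult divide_right_mono mult.commute)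
 qed
 with C that show thesis by blast
qed

text \<open>Its Laplacian is the radius derivative of the mollifier up to a power of
  \<open>r\<close> and the mass. Testing with it turns a one-sided bound on the Laplacian into one
  on the derivative of means.\<close>

definition Psi_bump :: "real => real^'n => real^'n => real" where
 "Psi_bump r x y = hexp 0 (1 - (norm ((y - x) /\<^sub>R r))\<^sup>2)"

lemma Psi_bump_test: "r > 0 ==> Psi_bump r x \<in> TF"
 using test_affine[OF hexp_radial_test[of 0], of "1/r" "- x /\<^sub>R r"]
 by (simp add: Psi_bump_def[abs_def] scaleR_diff_right inverse_eq_divide)

lemma Psi_bump_nonneg: "Psi_bump r x y >= 0" by (simp add: Psi_bump_def hexp_nonneg)

text \<open>The radial derivative of the mollifier is a Laplacian.\<close>

lemma Psi_bump_laplacian: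
 fixes x y :: "real^'n"
 assumes r: "r > 0"
 shows "(\<Sum>m\<in>UNIV. pd m (pd m (Psi_bump r x)) y) = eta' r (y - x) * (r ^ (CARD('n) + 1) * bump_mass TYPE('n)) / r\<^sup>2"
proof -
 let ?H = "%z::real^'n. hexp 0 (1 - (norm z)\<^sup>2)"
 let ?H2 = "%z::real^'n. hexp 2 (1 - (norm z)\<^sup>2)"
 have sH: "smooth ?H" "smooth ?H2" by (simp_all add: smooth_def hexp_radial_C_k)
 have P: "Psi_bump r x = (%y. ?H (- x /\<^sub>R r + (1/r) *\<^sub>R y))"
  by (simp add: Psi_bump_def[abs_def] scaleR_diff_right inverse_eq_divide)
 have p1: "pd m ?H = (%z. (- 2 * z $ m) * ?H2 z)" for m
  by (rule ext, subst partial_derivative_eq[OF hexp_radial_has_derivative]) (simp add: inner_axis numeral_2_eq_2)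
 have sl: "smooth (%z::real^'n. - 2 * z $ m)" for m
  unfolding smooth_def by (intro allI C_k_mult C_k_const C_k_component)
 have pl: "pd m (%z::real^'n. - 2 * z $ m) z = - 2" for m z
 proof -
  have "((%z::real^'n. - 2 * z $ m) has_derivative (%h. - 2 * h $ m)) (at z)"
   by (intro has_derivative_mult_right bounded_linear_imp_has_derivative bounded_linear_vec_nth)
  from partial_derivative_eq[OF this, of m] show ?thesis by simp
 qed
 have p2: "pd m (pd m ?H) z = - 2 * ?H2 z + (- 2 * z $ m) * ((hexp 4 (1 - (norm z)\<^sup>2) - 2 * hexp 3 (1 - (norm z)\<^sup>2)) * (- 2 * z $ m))" for m z
 proof -
  have "pd m ?H2 z = (hexp 4 (1 - (norm z)\<^sup>2) - 2 * hexp 3 (1 - (norm z)\<^sup>2)) * (- 2 * z $ m)"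
   by (subst partial_derivative_eq[OF hexp_radial_has_derivative]) (simp add: inner_axis)
  then show ?thesis unfolding p1 using partial_derivative_mult[OF smooth_diff[OF sl[of m]] smooth_diff[OF sH(2)], of m z] pl[of m z] by simp
 qed
 have q1: "pd m (Psi_bump r x) = (%y. (1/r) * pd m ?H (- x /\<^sub>R r + (1/r) *\<^sub>R y))" for m
  unfolding P by (rule ext) (rule partial_derivative_affine[OF smooth_diff[OF sH(1)]])
 have q2: "pd m (pd m (Psi_bump r x)) y = (1/r) * ((1/r) * pd m (pd m ?H) (- x /\<^sub>R r + (1/r) *\<^sub>R y))" for m
 proof -
  have s: "smooth (pd m ?H)" by (rule smooth_partial[OF sH(1)])
  have d: "(%y. pd m ?H (- x /\<^sub>R r + (1/r) *\<^sub>R y)) differentiable_on UNIV"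
   by (rule smooth_diff[OF smooth_affine[OF s]])
  have c: "pd m (%_::real^'n. 1/r) y = 0"
   by (subst partial_derivative_eq[where D="%_. 0"]) auto
  show ?thesis unfolding q1
   using partial_derivative_mult[OF smooth_diff[OF smooth_const[of "1/r"]] d, of m y] c
    partial_derivative_affine[OF smooth_diff[OF s], of m "- x /\<^sub>R r" "1/r" y] by simp
 qed
 define z where "z = (y - x) /\<^sub>R r"
 have z: "- x /\<^sub>R r + (1/r) *\<^sub>R y = z" by (simp add: z_def scaleR_diff_right inverse_eq_divide)
 let ?a = "hexp 4 (1 - (norm z)\<^sup>2) - 2 * hexp 3 (1 - (norm z)\<^sup>2)"
 have "(\<Sum>m\<in>UNIV. pd m (pd m (Psi_bump r x)) y) = (\<Sum>m\<in>UNIV. (1/r\<^sup>2) * (4 * ?a * (z $ m * z $ m) - 2 * ?H2 z))"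
  unfolding q2 z p2 by (intro sum.cong refl) (simp add: power2_eq_square field_simps)
 also have "... = (1/r\<^sup>2) * (4 * ?a * (z \<bullet> z) - 2 * real CARD('n) * ?H2 z)"
 proof -
  have "(\<Sum>m\<in>UNIV. a * (c * (z $ m * z $ m) - d)) = a * (c * (z \<bullet> z) - real CARD('n) * d)" for a c d
   by (simp add: inner_vec_def sum_subtractf flip: sum_distrib_left)
  from this[of "1/r\<^sup>2" "4 * ?a" "2 * ?H2 z"] show ?thesis by simp
 qed
 also have "z \<bullet> z = (norm z)\<^sup>2" by (simp add: power2_norm_eq_inner)
 also have "(1/r\<^sup>2) * (4 * ?a * (norm z)\<^sup>2 - 2 * real CARD('n) * ?H2 z) = eta' r (y - x) * (r ^ (CARD('n) + 1) * bump_mass TYPE('n)) / r\<^sup>2"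
  using r bumpf_mass_pos[where 'n='n] by (simp add: eta'_def z_def)
 finally show ?thesis .
qed

text \<open>For radii within \<open>r / 2\<close> of \<open>r\<close> the bound on
  \<open>eta'\<close> is at worst that at \<open>r / 2\<close>, and all kernels live in the ball of
  radius \<open>2 * r\<close> about \<open>x\<close>; this supplies the Lipschitz factor.\<close>

lemma moll_radial_derivative:
 fixes w :: "real^'n => real"
 assumes w: "locally_integrable w" and r: "r > 0"
 shows "((%r. moll r w x) has_real_derivative (LBINT y. eta' r (y - x) * w y)) (at r)"
proof -
 obtain C where C: "C > 0" "!!r z. r > 0 ==> \<bar>eta' r (z::real^'n)\<bar> <= C / r ^ (CARD('n) + 1)" using eta'_bound by metis
 define L where "L = C / (r / 2) ^ (CARD('n) + 1)"
 have L0: "L >= 0" using C r by (simp add: L_def)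
 let ?K = "cball 0 (norm x + 2 * r) :: (real^'n) set"
 have near: "r / 2 <= s" "s < 2 * r" "s > 0" if "\<bar>s - r\<bar> < r / 2" for s
  using that r unfolding abs_less_iff by auto
 have lip: "\<bar>eta s z - eta r z\<bar> <= L * \<bar>s - r\<bar>" if "\<bar>s - r\<bar> < r / 2" for s and z :: "real^'n"
 proof -
  have "norm (eta s z - eta r z) <= L * norm (s - r)"
  proof (rule field_differentiable_bound[of "{r/2..}"])
   fix t assume t: "t \<in> {r/2..}"
   then have t0: "t > 0" using r by simp
   show "((%t. eta t z) has_field_derivative eta' t z) (at t within {r/2..})"
    by (rule has_field_derivative_at_within[OF eta_derivative[OF t0]])
   have "C / t ^ (CARD('n) + 1) <= L" unfolding L_def using t r C(1) t0
    by (intro divide_left_mono power_mono mult_pos_pos zero_less_power) auto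
   then show "norm (eta' t z) <= L" using C(2)[OF t0, of z] by simp
  qed (use near(1)[OF that] r in auto)
  then show ?thesis by simp
 qed
 have "((%r. \<integral>y. eta r (y - x) * w y \<partial>lborel) has_derivative (%h. \<integral>y. eta' r (y - x) * w y * h \<partial>lborel)) (at r)"
 proof (rule has_derivative_param_integral[where d="r/2" and L="%y. L * (indicat_real ?K y * \<bar>w y\<bar>)"])
  fix y :: "real^'n"
  have "((%s. eta s (y - x) * w y) has_real_derivative eta' r (y - x) * w y) (at r)"
   by (intro DERIV_cmult_right eta_derivative r)
  then show "((%s. eta s (y - x) * w y) has_derivative (%h. eta' r (y - x) * w y * h)) (at r)"
   by (simp add: has_field_derivative_def)
 next
  fix s :: real assume "norm (s - r) < r / 2"
  then have "s > 0" using near(3) by simp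
  then show "integrable lborel (%y. eta s (y - x) * w y)"
   using conv_integrable[OF eta_test w, of s x] by simp
 next
  show "integrable lborel (%y. L * (indicat_real ?K y * \<bar>w y\<bar>))"
   using set_integrable_cball[OF locint_norm[OF w], of "norm x + 2 * r"] by simp
 next
  fix s :: real and y :: "real^'n" assume s: "norm (s - r) < r / 2"
  then have s': "s > 0" "s < 2 * r" using near(2,3) by simp_all
  show "\<bar>eta s (y - x) * w y - eta r (y - x) * w y\<bar> <= L * (indicat_real ?K y * \<bar>w y\<bar>) * norm (s - r)"
  proof (cases "y \<in> ?K")
   case True
   have "\<bar>eta s (y - x) * w y - eta r (y - x) * w y\<bar> = \<bar>eta s (y - x) - eta r (y - x)\<bar> * \<bar>w y\<bar>"
    by (simp flip: abs_mult left_diff_distrib)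
   also have "... <= (L * \<bar>s - r\<bar>) * \<bar>w y\<bar>" using lip s by (intro mult_right_mono) auto
   finally show ?thesis using True by (simp add: mult_ac)
  next
   case False
   have "norm y <= norm (y - x) + norm x" by (metis norm_triangle_sub add.commute)
   then have "eta s (y - x) = 0" "eta r (y - x) = 0"
    using False eta_support[OF s'(1), of "y - x"] eta_support[OF r, of "y - x"] s' r by force+
   then show ?thesis using L0 by simp
  qed
 qed (use r in auto)
 then show ?thesis by (simp add: has_field_derivative_def moll_def conv_def mult.commute[of _ "\<integral>y. eta' r (y - x) * w y \<partial>lborel"])
qed

text \<open>Testing with \<open>Psi_bump\<close> bounds the radius derivative of the mean from below
  by \<open>- (2 * C' * r)\<close>, and the term \<open>C' * r\<^sup>2\<close> compensates. The
  constant is \<open>C\<close> times the ratio of the integral of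
  \<open>hexp 0 (1 - (norm z)\<^sup>2)\<close> to twice the mass of \<open>bumpf\<close>.\<close>

lemma moll_almost_monotone:
 fixes w :: "real^'n => real"
 assumes w: "is_weak_gradient w g" and C: "C >= 0"
  and sub: "!!\<phi>. \<phi> \<in> TF ==> (!!x. \<phi> x >= 0) ==> (LBINT x. g x \<bullet> grad \<phi> x) <= C * (LBINT x. \<phi> x)"
 obtains C' where "C' >= 0" "!!x s r. 0 < s ==> s <= r ==> moll s w x + C' * s\<^sup>2 <= moll r w x + C' * r\<^sup>2"
proof -
 note a = wgD[OF w]
 let ?m = "bump_mass TYPE('n)" and ?N = "CARD('n)"
 have m: "?m > 0" by (rule bumpf_mass_pos)
 define k where "k = (\<integral>z. hexp 0 (1 - (norm z)\<^sup>2) \<partial>(lborel::(real^'n) measure))"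
 have k0: "k >= 0" unfolding k_def by (simp add: hexp_nonneg)
 define C' where "C' = C * k / (2 * ?m)"
 have C': "C' >= 0" unfolding C'_def using C k0 m by simp
 have deriv: "(LBINT y. eta' r (y - x) * w y) >= - (2 * C' * r)" if r: "r > 0" for r x
 proof -
  let ?P = "Psi_bump r x"
  have P: "?P \<in> TF" by (rule Psi_bump_test[OF r])
  have i1: "integrable lborel (%y. w y * pd i (pd i ?P) y)" for i
   using test_integrable_mult[OF test_partial[OF test_partial[OF P]] a(1)] by (simp add: mult.commute)
  have i2: "integrable lborel (%y. g y $ i * pd i ?P y)" for i
   using test_integrable_mult[OF test_partial[OF P] locint_component[OF a(2)]] by (simp add: mult.commute)
  have "(LBINT y. w y * (\<Sum>i\<in>UNIV. pd i (pd i ?P) y)) = (\<Sum>i\<in>UNIV. \<integral>y. w y * pd i (pd i ?P) y \<partial>lborel)"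
   unfolding sum_distrib_left by (rule Bochner_Integration.integral_sum) (rule i1)
  also have "... = - (\<Sum>i\<in>UNIV. \<integral>y. g y $ i * pd i ?P y \<partial>lborel)"
   using a(3)[OF test_partial[OF P]] by (simp add: sum_negf)
  also have "(\<Sum>i\<in>UNIV. \<integral>y. g y $ i * pd i ?P y \<partial>lborel) = (LBINT y. g y \<bullet> grad ?P y)"
   unfolding inner_vec_def grad_def using i2 by (subst Bochner_Integration.integral_sum[symmetric]) auto
  finally have "(LBINT y. w y * (\<Sum>i\<in>UNIV. pd i (pd i ?P) y)) >= - (C * (LBINT y. ?P y))"
   using sub[OF P Psi_bump_nonneg] by simp
  moreover have "(LBINT y. ?P y) = r ^ ?N * k"
  proof -
   have hm: "(%z::real^'n. hexp 0 (1 - (norm z)\<^sup>2)) \<in> Bmeas" by (rule test_measurable[OF hexp_radial_test])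
   have "(LBINT y. ?P y) = (LBINT y. ?P (x + y))"
    by (rule lborel_integral_translate[symmetric]) (rule test_measurable[OF P])
   also have "... = r ^ ?N * k" using lborel_integral_scale[OF r hm] by (simp add: Psi_bump_def k_def)
   finally show ?thesis .
  qed
  moreover have "(LBINT y. w y * (\<Sum>i\<in>UNIV. pd i (pd i ?P) y)) = (r ^ (?N + 1) * ?m / r\<^sup>2) * (LBINT y. eta' r (y - x) * w y)"
   unfolding Psi_bump_laplacian[OF r] by (subst integral_mult_right_zero[symmetric]) (intro Bcong refl, simp add: mult_ac)
  ultimately have 1: "(r ^ (?N + 1) * ?m / r\<^sup>2) * (LBINT y. eta' r (y - x) * w y) >= - (C * (r ^ ?N * k))" by simp
  define I where "I = (LBINT y. eta' r (y - x) * w y)"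
  have "r ^ (?N + 1) * ?m / r\<^sup>2 = (?m / r) * r ^ ?N" using r by (simp add: power2_eq_square)
  then have "r ^ ?N * ((?m / r) * I) >= r ^ ?N * (- (C * k))" using 1 unfolding I_def by (simp add: mult_ac)
  then have "(?m / r) * I >= - (C * k)" using r by (simp only: mult_le_cancel_left_pos zero_less_power)
  then have "I >= - (C * k) * r / ?m" using r m by (simp add: field_simps)
  also have "- (C * k) * r / ?m = - (2 * C' * r)" by (simp add: C'_def)
  finally show ?thesis by (simp add: I_def)
 qed
 have "moll s w x + C' * s\<^sup>2 <= moll r w x + C' * r\<^sup>2" if s: "0 < s" "s <= r" for x s r
 proof (rule DERIV_nonneg_imp_nondecreasing[OF s(2)])
  fix t assume t: "s <= t" "t <= r"
  then have t0: "t > 0" using s by simp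
  have "((%t. moll t w x + C' * t\<^sup>2) has_real_derivative (LBINT y. eta' t (y - x) * w y) + C' * (2 * t)) (at t)"
   by (intro DERIV_add moll_radial_derivative a t0 DERIV_cmult) (auto intro!: derivative_eq_intros)
  moreover have "(LBINT y. eta' t (y - x) * w y) + C' * (2 * t) >= 0" using deriv[OF t0, of x] by simp
  ultimately show "\<exists>y. ((%t. moll t w x + C' * t\<^sup>2) has_real_derivative y) (at t) \<and> 0 <= y" by blast
 qed
 with C' that show thesis by blast
qed

section \<open>Precise representatives of functions with Laplacian bounded from below\<close>

definition precise :: "(real^'n => real) => real^'n => real" where
 "precise w x = lim (%n. moll (1 / real (Suc n)) w x)"

text \<open>The weak form of: minus the Laplacian of \<open>w\<close> is at most \<open>C\<close>.
  Essential boundedness keeps the decreasing means bounded from below, so that they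
  converge.\<close>

definition subsol :: "real => (real^'n => real) => (real^'n => real^'n) => bool" where
 "subsol C w g \<longleftrightarrow> is_weak_gradient w g \<and> C >= 0 \<and> (\<exists>B. AE x in lborel. \<bar>w x\<bar> <= B) \<and>
  (\<forall>\<phi>\<in>TF. (\<forall>x. \<phi> x >= 0) --> (LBINT x. g x \<bullet> grad \<phi> x) <= C * (LBINT x. \<phi> x))"

text \<open>The corrected means decrease as the radius shrinks, so their limit is an infimum of
  continuous functions.\<close>

lemma subsol_precise:
 fixes w :: "real^'n => real"
 assumes "subsol C w g"
 shows subsol_lim: "(%n. moll (1 / real (Suc n)) w x) ----> precise w x"
  and subsol_usc: "e > 0 ==> \<exists>d>0. \<forall>y\<in>ball x d. precise w y < precise w x + e"
proof -
 let ?e = "%n. 1 / real (Suc n)"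
 have w: "is_weak_gradient w g" and C: "C >= 0" using assms by (auto simp: subsol_def)
 obtain B where B: "AE x in lborel. \<bar>w x\<bar> <= B" using assms by (auto simp: subsol_def)
 note a = wgD[OF w]
 obtain C' where C': "C' >= 0" "!!x s r. 0 < s ==> s <= r ==> moll s w x + C' * s\<^sup>2 <= moll r w x + C' * r\<^sup>2"
 proof (rule moll_almost_monotone[OF w C])
  fix \<phi> :: "real^'n => real" assume "\<phi> \<in> TF" "!!x. \<phi> x >= 0"
  then show "(LBINT x. g x \<bullet> grad \<phi> x) <= C * (LBINT x. \<phi> x)"
   using assms by (simp add: subsol_def)
 qed blast
 let ?F = "%x n. moll (?e n) w x + C' * (?e n)\<^sup>2"
 have dec: "decseq (?F x)" for x
  unfolding decseq_Suc_iff by (intro allI C'(2)) (auto simp: frac_le)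
 have lb: "- B <= ?F x n" for x n
 proof -
  have "moll (?e n) (%_. - B) x <= moll (?e n) w x"
  proof (rule moll_mono_AE[OF moll_seq(2) _ a(1)])
   show "locally_integrable (%_::real^'n. - B)" by (intro locint_continuous continuous_intros)
   show "AE y in lborel. norm (y - x) < ?e n --> - B <= w y" using B by eventually_elim auto
  qed
  then show ?thesis using moll_const[OF moll_seq(2), where c="- B" and x=x] C'(1) by (simp add: add_increasing2)
 qed
 have e2: "(%n. C' * (?e n)\<^sup>2) ----> C' * 0\<^sup>2" by (intro tendsto_intros moll_seq(1))
 have lim: "(%n. moll (?e n) w x) ----> precise w x" "(%n. ?F x n) ----> precise w x" for x
 proof -
  obtain L where L: "?F x ----> L" using decseq_convergent[OF dec[of x], of "- B"] lb by blast
  have "(%n. ?F x n - C' * (?e n)\<^sup>2) ----> L - C' * 0\<^sup>2" by (intro tendsto_diff L e2)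
  then have *: "(%n. moll (?e n) w x) ----> L" by simp
  then have "precise w x = L" unfolding precise_def by (rule limI)
  then show "(%n. moll (?e n) w x) ----> precise w x" "(%n. ?F x n) ----> precise w x" using * L by auto
 qed
 show "(%n. moll (?e n) w x) ----> precise w x" by (rule lim)
 have le: "precise w x <= ?F x n" for x n
  by (rule decseq_ge[OF dec lim(2)])
 assume e: "e > 0"
 have "\<forall>\<^sub>F n in sequentially. ?F x n < precise w x + e" using e by (intro order_tendstoD(2)[OF lim(2)]) simp
 then obtain n where n: "?F x n < precise w x + e" by (auto simp: eventually_sequentially)
 have "continuous_on UNIV (moll (?e n) w)" by (intro smooth_continuous moll_smooth a moll_seq(2))
 then have "isCont (moll (?e n) w) x" by (simp add: continuous_on_eq_continuous_at)
 then have "((%y. ?F y n) \<longlongrightarrow> ?F x n) (at x)" unfolding isCont_def by (intro tendsto_intros)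
 then have "\<forall>\<^sub>F y in at x. ?F y n < precise w x + e" using n by (intro order_tendstoD(2))
 then obtain d where d: "d > 0" "!!y. y ~= x ==> dist y x < d ==> ?F y n < precise w x + e"
  by (auto simp: eventually_at)
 have "precise w y < precise w x + e" if "y \<in> ball x d" for y
  using le[of y n] d(2)[of y] n that by (cases "y = x") (auto simp: dist_commute e)
 with d(1) show "\<exists>d>0. \<forall>y\<in>ball x d. precise w y < precise w x + e" by blast
qed

lemma subsol_AE:
 fixes w :: "real^'n => real"
 assumes "subsol C w g"
 shows "AE x in lborel. precise w x = w x"
proof -
 have w: "is_weak_gradient w g" using assms by (simp add: subsol_def)
 note a = wgD[OF w]
 obtain r where r: "strict_mono r" "AE x in lborel. (%n. moll (1 / real (Suc (r n))) w x) ----> w x"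
  using L1loc_AE_subseq[OF moll_locally_integrable[OF a(1) moll_seq(2)] a(1) moll_L1loc[OF a(1) moll_seq(2,1)]] by blast
 show ?thesis using r(2)
 proof eventually_elim
  case (elim x)
  have "(%n. moll (1 / real (Suc (r n))) w x) ----> precise w x"
   using LIMSEQ_subseq_LIMSEQ[OF subsol_lim[OF assms, of x] r(1)] by (simp add: o_def)
  then show ?case using elim LIMSEQ_unique by blast
 qed
qed

text \<open>Upper semicontinuity makes every point a Lebesgue point.\<close>

lemma subsol_lebesgue_point:
 fixes w :: "real^'n => real"
 assumes s: "subsol C w g"
 shows "(%n. moll (1 / real (Suc n)) (%y. \<bar>w y - precise w x\<bar>) x) ----> 0"
proof (rule LIMSEQ_I)
 let ?e = "%n. 1 / real (Suc n)"
 have w: "is_weak_gradient w g" using s by (simp add: subsol_def)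
 note a = wgD[OF w]
 let ?c = "precise w x"
 have lc: "locally_integrable (%_::real^'n. c::real)" for c by (intro locint_continuous continuous_intros)
 have la: "locally_integrable (%y. \<bar>w y - ?c\<bar>)"
  using locint_norm[OF locint_diff[OF a(1) lc]] by simp
 fix e :: real assume e: "e > 0"
 obtain d where d: "d > 0" "!!y. y \<in> ball x d ==> precise w y < ?c + e / 4" using subsol_usc[OF s, of "e/4" x] e by auto
 have "\<forall>\<^sub>F n in sequentially. ?e n < d" using d(1) by (intro order_tendstoD(2)[OF moll_seq(1)])
 moreover have "\<forall>\<^sub>F n in sequentially. ?c - e / 4 < moll (?e n) w x" using e by (intro order_tendstoD(1)[OF subsol_lim[OF s]]) simp
 ultimately have "\<forall>\<^sub>F n in sequentially. norm (moll (?e n) (%y. \<bar>w y - ?c\<bar>) x - 0) < e"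
 proof eventually_elim
  case (elim n)
  have "moll (?e n) (%y. \<bar>w y - ?c\<bar>) x <= moll (?e n) (%y. (?c + e / 2) - w y) x"
  proof (rule moll_mono_AE[OF moll_seq(2) la])
   show "locally_integrable (%y. (?c + e / 2) - w y)" by (intro locint_diff lc a)
   show "AE y in lborel. norm (y - x) < ?e n --> \<bar>w y - ?c\<bar> <= (?c + e / 2) - w y"
    using subsol_AE[OF s]
   proof eventually_elim
    case (elim y)
    show ?case
    proof
     assume "norm (y - x) < ?e n"
     then have "y \<in> ball x d" using \<open>?e n < d\<close> by (simp add: dist_norm norm_minus_commute)
     then have "w y < ?c + e / 4" using d(2)[of y] elim by metis
     then show "\<bar>w y - ?c\<bar> <= (?c + e / 2) - w y" using e by (simp add: abs_le_iff)
    qed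
   qed
  qed
  also have "... = ?c + e / 2 - moll (?e n) w x"
   unfolding moll_diff[OF moll_seq(2) lc a(1)] moll_const[OF moll_seq(2)] ..
  also have "... < e" using elim(2) e by simp
  finally have "moll (?e n) (%y. \<bar>w y - ?c\<bar>) x < e" .
  moreover have "moll (?e n) (%_. 0) x <= moll (?e n) (%y. \<bar>w y - ?c\<bar>) x"
   by (intro moll_mono_AE moll_seq(2) lc la) auto
  ultimately show ?case using moll_const[OF moll_seq(2), where c=0 and x=x] by simp
 qed
 then show "\<exists>N. \<forall>n\<ge>N. norm (moll (?e n) (%y. \<bar>w y - ?c\<bar>) x - 0) < e" by (simp add: eventually_sequentially)
qed

text \<open>At almost every point one of the functions vanishes and so deviates from its precise
  value at \<open>x\<close> by at least the smaller value \<open>m\<close>. The mean deviations tend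
  to 0, which leaves \<open>m <= 0\<close>.\<close>

lemma segregated_precise:
 assumes s: "subsol C u g" "subsol C v h" and pos: "AE x in lborel. u x >= 0" "AE x in lborel. v x >= 0"
  and seg: "AE x in lborel. u x * v x = 0"
  and p: "precise u x >= 0" "precise v x >= 0"
 shows "precise u x * precise v x = 0"
proof -
 let ?e = "%n. 1 / real (Suc n)"
 have w: "is_weak_gradient u g" "is_weak_gradient v h" using s by (simp_all add: subsol_def)
 note a = wgD(1)[OF w(1)] wgD(1)[OF w(2)]
 define m where "m = min (precise u x) (precise v x)"
 have lc: "locally_integrable (%_::real^'a. c::real)" for c by (intro locint_continuous continuous_intros)
 have la: "locally_integrable (%y. \<bar>u y - precise u x\<bar>)" "locally_integrable (%y. \<bar>v y - precise v x\<bar>)"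
  using locint_norm[OF locint_diff[OF a(1) lc]] locint_norm[OF locint_diff[OF a(2) lc]] by simp_all
 have "m <= moll (?e n) (%y. \<bar>u y - precise u x\<bar>) x + moll (?e n) (%y. \<bar>v y - precise v x\<bar>) x" for n
 proof -
  have "moll (?e n) (%_. m) x <= moll (?e n) (%y. \<bar>u y - precise u x\<bar> + \<bar>v y - precise v x\<bar>) x"
  proof (rule moll_mono_AE[OF moll_seq(2) lc locint_add[OF la]])
   show "AE y in lborel. norm (y - x) < ?e n --> m <= \<bar>u y - precise u x\<bar> + \<bar>v y - precise v x\<bar>"
    using seg by eventually_elim (auto simp: m_def)
  qed
  then show ?thesis using moll_const[OF moll_seq(2), where c=m and x=x] moll_add[OF moll_seq(2) la, where x=x] by simp
 qed
 then have "m <= 0 + 0"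
  using LIMSEQ_le_const[OF tendsto_add[OF subsol_lebesgue_point[OF s(1), of x] subsol_lebesgue_point[OF s(2), of x]]] by blast
 then show ?thesis using p by (auto simp: m_def min_def split: if_splits)
qed

text \<open>The functions \<open>u\<^sub>i\<close> are upper semicontinuous and pointwise segregated, and \<open>u\<^sub>i - \<Sum>\<^sub>j\<^sub>\<noteq>\<^sub>i u\<^sub>j\<close> is
 lower semicontinuous: this forces continuity, both where \<open>u\<^sub>i > 0\<close> and where \<open>u\<^sub>i = 0\<close>.\<close>

lemma segregated_continuous:
 fixes u :: "'i => real^'n => real"
 assumes I: "finite I" and s: "!!i. i \<in> I ==> subsol C (u i) (g i)"
  and hat: "!!i. i \<in> I ==> subsol C (%x. (\<Sum>j\<in>I - {i}. u j x) - u i x) (G i)"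
  and pos: "!!i. i \<in> I ==> AE x in lborel. u i x >= 0"
  and seg: "!!i j. i \<in> I ==> j \<in> I ==> i ~= j ==> AE x in lborel. u i x * u j x = 0"
 shows "!!i x. i \<in> I ==> precise (u i) x >= 0"
  and "!!i j x. i \<in> I ==> j \<in> I ==> i ~= j ==> precise (u i) x * precise (u j) x = 0"
  and "!!i. i \<in> I ==> continuous_on UNIV (precise (u i))"
proof -
 let ?e = "%n. 1 / real (Suc n)"
 have li: "locally_integrable (u i)" if "i \<in> I" for i
  using s[OF that] wgD(1) by (auto simp: subsol_def)
 have lc: "locally_integrable (%_::real^'n. c::real)" for c by (intro locint_continuous continuous_intros)
 show p0: "precise (u i) x >= 0" if i: "i \<in> I" for i x
 proof (rule LIMSEQ_le_const[OF subsol_lim[OF s[OF i]]], intro exI allI impI)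
  fix n
  have "moll (?e n) (%_. 0) x <= moll (?e n) (u i) x"
   by (rule moll_mono_AE[OF moll_seq(2) lc li[OF i]]) (use pos[OF i] in \<open>auto elim: eventually_mono\<close>)
  then show "0 <= moll (?e n) (u i) x" using moll_const[OF moll_seq(2), where c=0 and x=x] by simp
 qed
 show seg0: "precise (u i) x * precise (u j) x = 0" if "i \<in> I" "j \<in> I" "i ~= j" for i j x
  by (intro segregated_precise[OF s s] pos seg p0 that)
 have msum: "moll r (%x. \<Sum>j\<in>J. u j x) x = (\<Sum>j\<in>J. moll r (u j) x) \<and> locally_integrable (%x. \<Sum>j\<in>J. u j x)" if "J \<subseteq> I" "r > 0" for J r x
  using finite_subset[OF that(1) I] that
 proof (induction J rule: finite_induct)
  case empty
  then show ?case using moll_const[where c=0 and x=x and r=r] lc[of 0] by simp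
 next
  case (insert j J)
  then have *: "moll r (%x. \<Sum>j\<in>J. u j x) x = (\<Sum>j\<in>J. moll r (u j) x)" "locally_integrable (%x. \<Sum>j\<in>J. u j x)" by auto
  then show ?case using insert moll_add[OF insert.prems(2) li[of j] *(2), where x=x] locint_add[OF li[of j] *(2)] by simp
 qed
 have hatp: "precise (%x. (\<Sum>j\<in>I - {i}. u j x) - u i x) x = (\<Sum>j\<in>I - {i}. precise (u j) x) - precise (u i) x" if i: "i \<in> I" for i x
 proof (rule LIMSEQ_unique[OF subsol_lim[OF hat[OF i]]])
  have "moll (?e n) (%x. (\<Sum>j\<in>I - {i}. u j x) - u i x) x = (\<Sum>j\<in>I - {i}. moll (?e n) (u j) x) - moll (?e n) (u i) x" for n
   using moll_diff[OF moll_seq(2) _ li[OF i], where f="%x. \<Sum>j\<in>I - {i}. u j x" and x=x] msum[OF _ moll_seq(2), where J="I - {i}" and x=x] by auto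
  then show "(%n. moll (?e n) (%x. (\<Sum>j\<in>I - {i}. u j x) - u i x) x) ----> (\<Sum>j\<in>I - {i}. precise (u j) x) - precise (u i) x"
   by (simp only:) (intro tendsto_diff tendsto_sum subsol_lim[OF s] i, auto)
 qed
 show "continuous_on UNIV (precise (u i))" if i: "i \<in> I" for i
  unfolding continuous_on_iff
 proof (intro ballI allI impI)
  fix x :: "real^'n" and e :: real assume e: "e > 0"
  obtain d1 where d1: "d1 > 0" "!!y. y \<in> ball x d1 ==> precise (u i) y < precise (u i) x + e"
   using subsol_usc[OF s[OF i] e, of x] by auto
  obtain d2 where d2: "d2 > 0" "!!y. y \<in> ball x d2 ==> precise (u i) y > precise (u i) x - e"
  proof (cases "precise (u i) x = 0")
   case True
   then show ?thesis using that[of 1] p0[OF i] e by (simp add: less_le_trans[of "-e" 0])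
  next
   case False
   \<comment> \<open>All other components vanish at \<open>x\<close>. Upper semicontinuity of the
     signed function then bounds \<open>u i\<close> from below, since the other components are
     nonnegative nearby.\<close>
   then have z: "(\<Sum>j\<in>I - {i}. precise (u j) x) = 0" using seg0[OF i] by (intro sum.neutral) fastforce
   obtain d where d: "d > 0" "!!y. y \<in> ball x d ==> (\<Sum>j\<in>I - {i}. precise (u j) y) - precise (u i) y < (\<Sum>j\<in>I - {i}. precise (u j) x) - precise (u i) x + e"
    using subsol_usc[OF hat[OF i] e, of x] unfolding hatp[OF i] by auto
   have "precise (u i) y > precise (u i) x - e" if "y \<in> ball x d" for y
   proof -
    have "(\<Sum>j\<in>I - {i}. precise (u j) y) >= 0" by (intro sum_nonneg p0) auto
    then show ?thesis using d(2)[OF that] z by simp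
   qed
   with d(1) show ?thesis using that by blast
  qed
  have "dist (precise (u i) y) (precise (u i) x) < e" if "dist y x < min d1 d2" for y
   using d1(2)[of y] d2(2)[of y] that by (simp add: dist_real_def dist_commute abs_less_iff)
  then show "\<exists>d>0. \<forall>y\<in>UNIV. dist y x < d --> dist (precise (u i) y) (precise (u i) x) < e"
   using d1(1) d2(1) by (intro exI[of _ "min d1 d2"]) auto
 qed
qed

subsection \<open>The space E\<close>

definition dirichlet :: "(real^'n => real) => (real^'n => real) => real" where
 "dirichlet u v = (LBINT x. weak_gradient u x \<bullet> weak_gradient v x)"

definition potential :: "real => real => (real^'n => real) => real" where
 "potential p m u = (LBINT x. m * Q1 x * \<bar>u x\<bar> powr (2 * p))"

lemma D12_norm_dirichlet: "(D12_norm u)\<^sup>2 = dirichlet u u"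
 by (simp add: D12_norm_def dirichlet_def power2_norm_eq_inner)

lemma dirichlet_nonneg: "dirichlet u u >= 0"
 by (simp add: dirichlet_def)

lemma D12_norm_eq: "D12_norm u = sqrt (dirichlet u u)"
 by (simp add: D12_norm_def dirichlet_def power2_norm_eq_inner)

lemma Q1_measurable [measurable]: "Q1 \<in> Bmeas"
 unfolding Q1_def[abs_def] by measurable

lemma Q1_abs: "\<bar>Q1 x\<bar> = 1" by (simp add: Q1_def)

lemma inner_integrable:
 fixes f g :: "'a => 'b::euclidean_space"
 assumes [measurable]: "f \<in> borel_measurable M" "g \<in> borel_measurable M"
  and i: "integrable M (%x. (norm (f x))\<^sup>2)" "integrable M (%x. (norm (g x))\<^sup>2)"
 shows "integrable M (%x. f x \<bullet> g x)"
proof (rule Bbound[where f="%x. (norm (f x))\<^sup>2 + (norm (g x))\<^sup>2"])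
 show "AE x in M. norm (f x \<bullet> g x) <= norm ((norm (f x))\<^sup>2 + (norm (g x))\<^sup>2)"
 proof (rule AE_I2)
  fix x
  have "\<bar>f x \<bullet> g x\<bar> <= norm (f x) * norm (g x)" by (rule Cauchy_Schwarz_ineq2)
  also have "... <= (norm (f x))\<^sup>2 + (norm (g x))\<^sup>2"
  proof -
   have "2 * (norm (f x) * norm (g x)) <= (norm (f x))\<^sup>2 + (norm (g x))\<^sup>2"
    using sum_squares_bound[of "norm (f x)" "norm (g x)"] by (simp only: mult.assoc)
   moreover have "0 <= norm (f x) * norm (g x)" by simp
   ultimately show ?thesis by linarith
  qed
  finally show "norm (f x \<bullet> g x) <= norm ((norm (f x))\<^sup>2 + (norm (g x))\<^sup>2)" by simp
 qed
qed (use i in auto)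

text \<open>\<open>dim\<close> fixes the dimension through its type, \<open>q\<close> is the
  critical Sobolev exponent, and the upper bound on \<open>p\<close> says that
  \<open>2 * p < q\<close>.\<close>

locale subcritical =
 fixes p q :: real and dim :: "'n::finite itself"
 assumes N3: "CARD('n) >= 3" and p1: "1 < p" and p2: "p < real CARD('n) / (real CARD('n) - 2)"
  and q_def: "q = 2 * real CARD('n) / (real CARD('n) - 2)"
begin

lemma exponents: "q > 2" "2 * p < q" "2 * p > 2"
 using N3 p1 p2 unfolding q_def by (auto simp: field_simps)

abbreviation E :: "(real^'n => real) set" where "E \<equiv> E_space p"

lemma E_iff: "u \<in> E \<longleftrightarrow> u \<in> Bmeas \<and> Lpw q u \<and>
 Lpw (2 * p) u \<and> (\<exists>g. is_weak_gradient u g \<and> L2 g)"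
 by (auto simp: E_space_def D12_def L_space_def set_integrable_def q_def)

lemma D12_iff: "u \<in> (D12 :: (real^'n => real) set) \<longleftrightarrow> u \<in> Bmeas \<and> Lpw q u \<and>
 (\<exists>g. is_weak_gradient u g \<and> L2 g)"
 by (auto simp: D12_def L_space_def set_integrable_def q_def)

lemma D12_weak_gradient:
 assumes "u \<in> (D12 :: (real^'n => real) set)"
 shows "is_weak_gradient u (weak_gradient u)" "L2 (weak_gradient u)"
proof -
 obtain g where g: "is_weak_gradient u g" "L2 g" using assms D12_iff by auto
 show w: "is_weak_gradient u (weak_gradient u)" unfolding weak_gradient_def by (rule someI[of _ g]) (rule g)
 have ae: "AE x in lborel. g x = weak_gradient u x" by (rule wg_unique[OF g(1) w]) simp
 show "L2 (weak_gradient u)"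
  by (rule integrable_cong_AE_imp[OF g(2)])
   (use ae locint_measurable[OF wgD(2)[OF w]] in \<open>auto elim: eventually_mono\<close>)
qed

lemma E_D12: "u \<in> E ==> u \<in> D12" by (simp add: E_space_def)

lemma E_D:
 assumes "u \<in> E"
 shows "u \<in> Bmeas" "Lpw q u" "Lpw (2 * p) u"
  "is_weak_gradient u (weak_gradient u)" "L2 (weak_gradient u)"
  "weak_gradient u \<in> Bmeas"
 using assms E_iff[of u] D12_weak_gradient[OF E_D12[OF assms]]
 by (auto intro: locint_measurable wgD(2))

lemma E_I:
 assumes "is_weak_gradient u g" "L2 g" "Lpw q u" "Lpw (2 * p) u"
 shows "u \<in> E" "AE x in lborel. weak_gradient u x = g x"
proof -
 show u: "u \<in> E" using assms E_iff locint_measurable[OF wgD(1)[OF assms(1)]] by blast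
 show "AE x in lborel. weak_gradient u x = g x"
  by (rule wg_unique[OF E_D(4)[OF u] assms(1)]) simp
qed

text \<open>Truncations and positive parts are dominated by the original function and inherit both
  integrability conditions, so only the gradient remains to be checked.\<close>

lemma E_I_bound:
 assumes w: "is_weak_gradient u g" "L2 g"
  and v: "v \<in> E" and le: "AE x in lborel. \<bar>u x\<bar> <= \<bar>v x\<bar>"
 shows "u \<in> E" "AE x in lborel. weak_gradient u x = g x"
proof -
 have [measurable]: "u \<in> Bmeas" by (rule locint_measurable[OF wgD(1)[OF w(1)]])
 have i: "Lpw s u" if "Lpw s v" "s > 0" for s
  by (rule Bbound[OF that(1)])
   (use le that(2) in \<open>auto elim!: eventually_mono intro!: powr_mono2\<close>)
 show "u \<in> E" "AE x in lborel. weak_gradient u x = g x"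
  by (intro E_I[OF w] i E_D[OF v]; use exponents in linarith)+
qed

lemma E_add:
 assumes u: "u \<in> E" and v: "v \<in> E"
 shows "(%x. u x + v x) \<in> E" "AE x in lborel. weak_gradient (%x. u x + v x) x = weak_gradient u x + weak_gradient v x"
proof -
 note [measurable] = E_D(1,6)[OF u] E_D(1,6)[OF v]
 have i: "Lpw s (%x. u x + v x)"
  if "Lpw s u" "Lpw s v" "s > 0" for s
  using integrable_powr_diff(1)[of s u lborel "%x. - v x"] that by simp
 note I = E_I[OF wg_add[OF E_D(4)[OF u] E_D(4)[OF v]] L2_integrable_add[OF _ _ E_D(5)[OF u] E_D(5)[OF v]]
  i[OF E_D(2)[OF u] E_D(2)[OF v]] i[OF E_D(3)[OF u] E_D(3)[OF v]]]
 show "(%x. u x + v x) \<in> E" "AE x in lborel. weak_gradient (%x. u x + v x) x = weak_gradient u x + weak_gradient v x"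
  by (rule I; use exponents in auto)+
qed

lemma E_cmult:
 assumes u: "u \<in> E"
 shows "(%x. c * u x) \<in> E" "AE x in lborel. weak_gradient (%x. c * u x) x = c *\<^sub>R weak_gradient u x"
proof -
 note I = E_I[OF wg_cmult[OF E_D(4)[OF u]]]
 show "(%x. c * u x) \<in> E" "AE x in lborel. weak_gradient (%x. c * u x) x = c *\<^sub>R weak_gradient u x"
  by (rule I; use E_D[OF u] in \<open>simp add: abs_mult powr_mult power_mult_distrib\<close>)+
qed

lemma E_diff:
 assumes u: "u \<in> E" and v: "v \<in> E"
 shows "(%x. u x - v x) \<in> E" "AE x in lborel. weak_gradient (%x. u x - v x) x = weak_gradient u x - weak_gradient v x"
proof -
 show "(%x. u x - v x) \<in> E" using E_add(1)[OF u E_cmult(1)[OF v, of "-1"]] by simp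
 show "AE x in lborel. weak_gradient (%x. u x - v x) x = weak_gradient u x - weak_gradient v x"
  using E_add(2)[OF u E_cmult(1)[OF v, of "-1"]] E_cmult(2)[OF v, of "-1"] by (auto elim: eventually_elim2)
qed

lemma E_zero: "(%_. 0) \<in> E"
 by (rule E_I[OF const_is_weak_gradient]) auto

lemma E_sum: "finite J ==> (!!j. j \<in> J ==> u j \<in> E) ==> (%x. \<Sum>j\<in>J. u j x) \<in> E"
 by (induction J rule: finite_induct) (auto intro: E_zero E_add)

lemma E_pos:
 assumes u: "u \<in> E"
 shows "(%x. max 0 (u x)) \<in> E" "AE x in lborel. weak_gradient (%x. max 0 (u x)) x = (if u x > 0 then weak_gradient u x else 0)"
proof -
 note [measurable] = E_D(1,6)[OF u]
 have i: "L2 (%x. if u x > 0 then weak_gradient u x else 0)"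
  by (rule Bbound[OF E_D(5)[OF u]]) auto
 note I = E_I_bound[OF weak_gradient_pos_part[OF E_D(4)[OF u]] i u]
 have le: "AE x in lborel. \<bar>max 0 (u x)\<bar> <= \<bar>u x\<bar>" by auto
 show "(%x. max 0 (u x)) \<in> E" by (rule I(1)[OF le])
 show "AE x in lborel. weak_gradient (%x. max 0 (u x)) x = (if u x > 0 then weak_gradient u x else 0)"
  by (rule I(2)[OF le])
qed

lemma E_min:
 assumes u: "u \<in> E" and v: "v \<in> E"
 shows "(%x. min (u x) (v x)) \<in> E" "AE x in lborel. weak_gradient (%x. min (u x) (v x)) x = (if u x > v x then weak_gradient v x else weak_gradient u x)"
proof -
 have eq: "min (u x) (v x) = u x - max 0 (u x - v x)" for x by auto
 show "(%x. min (u x) (v x)) \<in> E" unfolding eq by (intro E_diff E_pos u v)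
 from wg_unique[OF E_D(4)[OF this] weak_gradient_min[OF E_D(4)[OF u] E_D(4)[OF v]]]
 show "AE x in lborel. weak_gradient (%x. min (u x) (v x)) x = (if u x > v x then weak_gradient v x else weak_gradient u x)" by simp
qed

lemma E_trunc:
 assumes u: "u \<in> E" and k: "k >= 0"
 shows "(%x. max 0 (u x - k)) \<in> E" "AE x in lborel. weak_gradient (%x. max 0 (u x - k)) x = (if u x > k then weak_gradient u x else 0)"
proof -
 note [measurable] = E_D(1,6)[OF u]
 have w: "is_weak_gradient (%x. max 0 (u x - k)) (%x. if u x - k > 0 then weak_gradient u x - 0 else 0)"
  by (rule weak_gradient_pos_part[OF weak_gradient_diff[OF E_D(4)[OF u] const_is_weak_gradient]])
 have i: "L2 (%x. if u x - k > 0 then weak_gradient u x - 0 else 0)"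
  by (rule Bbound[OF E_D(5)[OF u]]) auto
 have le: "AE x in lborel. \<bar>max 0 (u x - k)\<bar> <= \<bar>u x\<bar>" using k by auto
 show "(%x. max 0 (u x - k)) \<in> E" by (rule E_I_bound(1)[OF w i u le])
 show "AE x in lborel. weak_gradient (%x. max 0 (u x - k)) x = (if u x > k then weak_gradient u x else 0)"
  using E_I_bound(2)[OF w i u le] by eventually_elim simp
qed

lemma E_test:
 assumes \<phi>: "\<phi> \<in> TF"
 shows "\<phi> \<in> E" "AE x in lborel. weak_gradient \<phi> x = grad \<phi> x"
proof -
 obtain R where R: "!!x. \<phi> x ~= 0 ==> norm x <= R" using \<phi> by (auto simp: test_functions_UNIV)
 have bi: "integrable lborel f" if f: "continuous_on UNIV f" "!!x. norm x > S ==> f x = 0" for f :: "real^'n => real" and S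
 proof -
  have "integrable lborel (%x. indicat_real (cball 0 S) x *\<^sub>R f x)" by (rule set_integrable_cball[OF locint_continuous[OF f(1)]])
  moreover have "(%x. indicat_real (cball 0 S) x *\<^sub>R f x) = f" using f(2) by (force simp: indicator_def)
  ultimately show ?thesis by simp
 qed
 have c: "continuous_on UNIV \<phi>" by (rule smooth_continuous[OF test_smooth[OF \<phi>]])
 have "\<exists>R. \<forall>x. pd m \<phi> x ~= 0 --> norm x <= R" for m
  using test_partial[OF \<phi>] by (simp add: test_functions_UNIV)
 then obtain R' where R': "!!m x. pd m \<phi> x ~= 0 ==> norm x <= R' m" by metis
 have R'': "grad \<phi> x = 0" if "norm x > Max (range R')" for x
 proof -
  have "R' m < norm x" for m using that by simp
  then have "pd m \<phi> x = 0" for m using R'[of m x] by (meson not_less)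
  then show ?thesis by (simp add: grad_def vec_eq_iff)
 qed
 have 1: "L2 (grad \<phi>)"
  by (rule bi[of _ "Max (range R')"]) (use R'' in \<open>auto intro!: continuous_intros smooth_grad_continuous test_smooth \<phi>\<close>)
 have 2: "Lpw s \<phi>" if "s > 0" for s
 proof (rule bi[of _ R])
  show "continuous_on UNIV (%x. \<bar>\<phi> x\<bar> powr s)" using that c by (intro continuous_on_powr' continuous_intros) auto
  show "\<bar>\<phi> x\<bar> powr s = 0" if "norm x > R" for x using R[of x] that by force
 qed
 show "\<phi> \<in> E" "AE x in lborel. weak_gradient \<phi> x = grad \<phi> x"
  by (rule E_I[OF smooth_is_weak_gradient[OF test_smooth[OF \<phi>]] 1 2 2]; use exponents in linarith)+
qed

lemma E_cong_AE:
 assumes u: "u \<in> E" and v: "v \<in> Bmeas" "AE x in lborel. u x = v x"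
 shows "v \<in> E" "AE x in lborel. weak_gradient v x = weak_gradient u x"
proof -
 have w: "is_weak_gradient v (weak_gradient u)"
  by (rule wg_cong[OF E_D(4)[OF u]]) (use v E_D(6)[OF u] in auto)
 note I = E_I_bound[OF w E_D(5)[OF u] u]
 have le: "AE x in lborel. \<bar>v x\<bar> <= \<bar>u x\<bar>" using v(2) by eventually_elim simp
 show "v \<in> E" by (rule I(1)[OF le])
 show "AE x in lborel. weak_gradient v x = weak_gradient u x" by (rule I(2)[OF le])
qed

section \<open>The Dirichlet form on \<open>E\<close>\<close>

lemma dirichlet_integrable:
 "u \<in> E ==> v \<in> E ==> integrable lborel (%x. weak_gradient u x \<bullet> weak_gradient v x)"
 using E_D[of u] E_D[of v] by (intro inner_integrable) auto

lemma dirichlet_cong: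
 assumes "u \<in> E" "v \<in> E" "AE x in lborel. weak_gradient u x = g x" "AE x in lborel. weak_gradient v x = h x"
  "g \<in> Bmeas" "h \<in> Bmeas"
 shows "dirichlet u v = (LBINT x. g x \<bullet> h x)"
 unfolding dirichlet_def using E_D(6)[OF assms(1)] E_D(6)[OF assms(2)] assms(3-6)
 by (intro integral_cong_AE) (auto elim: eventually_elim2)

lemma dirichlet_sym: "dirichlet u v = dirichlet v u"
 by (simp add: dirichlet_def inner_commute)

lemma dirichlet_add_left:
 assumes "u \<in> E" "v \<in> E" "w \<in> E"
 shows "dirichlet (%x. u x + v x) w = dirichlet u w + dirichlet v w"
proof -
 note [measurable] = E_D(6)[OF assms(1)] E_D(6)[OF assms(2)] E_D(6)[OF assms(3)]
 have "dirichlet (%x. u x + v x) w = (LBINT x. (weak_gradient u x + weak_gradient v x) \<bullet> weak_gradient w x)"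
  by (rule dirichlet_cong) (use assms E_add in auto)
 then show ?thesis using dirichlet_integrable assms by (simp add: inner_add_left dirichlet_def)
qed

lemma dirichlet_cmult_left:
 assumes "u \<in> E" "w \<in> E"
 shows "dirichlet (%x. c * u x) w = c * dirichlet u w"
proof -
 note [measurable] = E_D(6)[OF assms(1)] E_D(6)[OF assms(2)]
 have "dirichlet (%x. c * u x) w = (LBINT x. (c *\<^sub>R weak_gradient u x) \<bullet> weak_gradient w x)"
  by (rule dirichlet_cong) (use assms E_cmult in auto)
 then show ?thesis by (simp add: dirichlet_def)
qed

lemma dirichlet_sum_left:
 assumes "finite J" "!!j. j \<in> J ==> u j \<in> E" "w \<in> E"
 shows "dirichlet (%x. \<Sum>j\<in>J. u j x) w = (\<Sum>j\<in>J. dirichlet (u j) w)"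
 using assms
proof (induction J rule: finite_induct)
 case empty
 then show ?case using dirichlet_cmult_left[OF E_zero \<open>w \<in> E\<close>, of 0] by simp
next
 case (insert j J)
 then show ?case by (simp add: dirichlet_add_left E_sum)
qed

lemma dirichlet_square_add:
 assumes "u \<in> E" "v \<in> E"
 shows "dirichlet (%x. u x + c * v x) (%x. u x + c * v x) = dirichlet u u + 2 * c * dirichlet u v + c\<^sup>2 * dirichlet v v"
proof -
 note cv = E_cmult(1)[OF assms(2), of c] and s = E_add(1)[OF assms(1) E_cmult(1)[OF assms(2), of c]]
 have "dirichlet w (%x. u x + c * v x) = dirichlet w u + c * dirichlet w v" if "w \<in> E" for w
  using dirichlet_add_left[OF assms(1) cv that] dirichlet_cmult_left[OF assms(2) that, of c] by (simp add: dirichlet_sym)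
 then show ?thesis using dirichlet_add_left[OF assms(1) cv s] dirichlet_cmult_left[OF assms(2) s, of c] assms
  by (simp add: dirichlet_sym[of v u] algebra_simps power2_eq_square)
qed

lemma dirichlet_square_diff:
 assumes "u \<in> E" "v \<in> E"
 shows "dirichlet (%x. u x - v x) (%x. u x - v x) = dirichlet u u - 2 * dirichlet u v + dirichlet v v"
 using dirichlet_square_add[OF assms, of "-1"] by simp

text \<open>At almost every point one of the two functions vanishes, and its weak gradient with
  it.\<close>

lemma dirichlet_segregated:
 assumes "u \<in> E" "v \<in> E" "AE x in lborel. u x * v x = 0"
 shows "dirichlet u v = 0"
proof -
 note [measurable] = E_D(6)[OF assms(1)] E_D(6)[OF assms(2)]
 have "AE x in lborel. weak_gradient u x \<bullet> weak_gradient v x = 0"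
  using assms(3) weak_gradient_zero_set[OF E_D(4)[OF assms(1)]] weak_gradient_zero_set[OF E_D(4)[OF assms(2)]]
  by eventually_elim auto
 then have "dirichlet u v = (LINT x|(lborel::(real^'n) measure). 0)" unfolding dirichlet_def by (intro integral_cong_AE) auto
 then show ?thesis by simp
qed

text \<open>A Sobolev constant fixed by choice, so that later constants of the locale can be written
  down explicitly.\<close>

definition SC :: real where
 "SC = (SOME C. C > 0 \<and> (\<forall>u\<in>(D12 :: (real^'n => real) set). (pw q u) powr (2 / q) <= C * dirichlet u u))"

lemma sobolev_D12:
 shows SC_pos: "SC > 0" and "u \<in> (D12 :: (real^'n => real) set) ==> (pw q u) powr (2 / q) <= SC * dirichlet u u"
proof -
 obtain C where C: "C > 0"
  "!!(u::real^'n => real) g. is_weak_gradient u g ==> L2 g ==>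
   Lpw q u ==>
   (pw q u) powr (2 / q) <= C * (sq g)"
  using sobolev[OF N3 q_def] by blast
 have "(pw q u) powr (2 / q) <= C * dirichlet u u" if "u \<in> D12" for u :: "real^'n => real"
  using C(2)[OF D12_weak_gradient[OF that]] that D12_iff by (simp add: dirichlet_def power2_norm_eq_inner)
 with C(1) have "\<exists>C>0. \<forall>u\<in>(D12 :: (real^'n => real) set). (pw q u) powr (2 / q) <= C * dirichlet u u" by blast
 from someI_ex[OF this, folded SC_def]
 show "SC > 0" "u \<in> (D12 :: (real^'n => real) set) ==> (pw q u) powr (2 / q) <= SC * dirichlet u u" by blast+
qed

lemma Lq_bound:
 fixes u :: "real^'n => real"
 assumes "u \<in> D12" "dirichlet u u <= M" shows "(pw q u) <= (SC * M) powr (q / 2)"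
proof -
 have "((pw q u) powr (2 / q)) powr (q / 2) <= (SC * M) powr (q / 2)"
  using exponents order_trans[OF sobolev_D12(2)[OF assms(1)] mult_left_mono[OF assms(2)]] SC_pos by (intro powr_mono2) auto
 then show ?thesis using exponents by (simp add: powr_powr)
qed

lemma Lq_zero:
 fixes u :: "real^'n => real"
 assumes "u \<in> D12" "(pw q u) <= 0" shows "AE x in lborel. u x = 0"
proof -
 have i: "Lpw q u" using assms D12_iff by blast
 have "(pw q u) = 0" using assms(2) by (intro antisym) auto
 then have "AE x in lborel. \<bar>u x\<bar> powr q = 0" by (subst (asm) integral_nonneg_eq_0_iff_AE[OF i]) auto
 then show ?thesis by eventually_elim simp
qed

text \<open>Energy 0 forces the function to vanish by the Sobolev inequality; conversely a function
  that vanishes almost everywhere is segregated from itself.\<close>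

lemma nonzero_iff:
 assumes "u \<in> E" shows "nonzero u \<longleftrightarrow> dirichlet u u > 0"
proof
 assume "nonzero u"
 then have "dirichlet u u ~= 0" using Lq_zero[OF E_D12[OF assms]] Lq_bound[OF E_D12[OF assms], of 0] by (auto simp: nonzero_def)
 then show "dirichlet u u > 0" using dirichlet_nonneg[of u] by linarith
next
 assume *: "dirichlet u u > 0"
 have "AE x in lborel. u x * u x = 0" if "AE x in lborel. u x = 0" using that by eventually_elim simp
 then show "nonzero u" unfolding nonzero_def using dirichlet_segregated[OF assms assms] * by fastforce
qed

lemma potential_integrable: "u \<in> E ==> integrable lborel (%x. m * Q1 x * \<bar>u x\<bar> powr (2 * p))"
proof -
 assume u: "u \<in> E"
 note [measurable] = E_D(1)[OF u]
 show ?thesis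
  by (rule Bbound[OF integrable_mult_right[OF E_D(3)[OF u], of m]])
   (auto simp: abs_mult Q1_abs)
qed

lemma potential_cmult: "potential p m (%x. c * u x) = \<bar>c\<bar> powr (2 * p) * potential p m u"
proof -
 have "potential p m (%x. c * u x) = (LBINT x. \<bar>c\<bar> powr (2 * p) * (m * Q1 x * \<bar>u x\<bar> powr (2 * p)))"
  unfolding potential_def by (intro Bcong refl) (simp add: abs_mult powr_mult mult_ac)
 then show ?thesis by (simp add: potential_def)
qed

lemma dirichlet_cmult: "u \<in> E ==> dirichlet (%x. c * u x) (%x. c * u x) = c\<^sup>2 * dirichlet u u"
 using dirichlet_cmult_left[of u "%x. c * u x" c] dirichlet_cmult_left[of u u c] E_cmult(1)[of u c]
 by (simp add: dirichlet_sym[of u "%x. c * u x"] power2_eq_square)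

subsection \<open>The Nehari set of the system\<close>

definition coupling :: "(real^'n => real) => (real^'n => real) => real" where
 "coupling u v = (LBINT x. \<bar>u x\<bar> powr p * \<bar>v x\<bar> powr p)"

lemma coupling_integrable:
 assumes "u \<in> E" "v \<in> E" shows "integrable lborel (%x. \<bar>u x\<bar> powr p * \<bar>v x\<bar> powr p)"
proof (rule Bbound[OF Badd[OF E_D(3)[OF assms(1)] E_D(3)[OF assms(2)]]])
 note [measurable] = E_D(1)[OF assms(1)] E_D(1)[OF assms(2)]
 show "(%x. \<bar>u x\<bar> powr p * \<bar>v x\<bar> powr p) \<in> borel_measurable lborel" by measurable
 have sq: "\<bar>a\<bar> powr (2 * p) = (\<bar>a\<bar> powr p)\<^sup>2" for a :: real
  by (simp add: power2_eq_square flip: powr_add)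
 have "\<bar>a\<bar> powr p * \<bar>b\<bar> powr p <= \<bar>a\<bar> powr (2 * p) + \<bar>b\<bar> powr (2 * p)" for a b :: real
 proof -
  have "2 * (\<bar>a\<bar> powr p * \<bar>b\<bar> powr p) <= (\<bar>a\<bar> powr p)\<^sup>2 + (\<bar>b\<bar> powr p)\<^sup>2"
   using sum_squares_bound[of "\<bar>a\<bar> powr p" "\<bar>b\<bar> powr p"] by (simp only: mult.assoc)
  moreover have "0 <= \<bar>a\<bar> powr p * \<bar>b\<bar> powr p" by simp
  ultimately show ?thesis unfolding sq by linarith
 qed
 then show "AE x in lborel. norm (\<bar>u x\<bar> powr p * \<bar>v x\<bar> powr p) <= norm (\<bar>u x\<bar> powr (2 * p) + \<bar>v x\<bar> powr (2 * p))"
  by (intro AE_I2) (simp add: abs_mult)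
qed

lemma coupling_sym: "coupling u v = coupling v u"
 by (simp add: coupling_def mult.commute)

lemma coupling_nonneg: "coupling u v >= 0"
 by (simp add: coupling_def)

lemma coupling_cmult: "coupling (%x. c * u x) (%x. d * v x) = \<bar>c\<bar> powr p * \<bar>d\<bar> powr p * coupling u v"
proof -
 have "coupling (%x. c * u x) (%x. d * v x) = (LBINT x. (\<bar>c\<bar> powr p * \<bar>d\<bar> powr p) * (\<bar>u x\<bar> powr p * \<bar>v x\<bar> powr p))"
  unfolding coupling_def by (intro Bcong refl) (simp add: abs_mult powr_mult mult_ac)
 then show ?thesis by (simp add: coupling_def)
qed

text \<open>All terms are homogeneous, so on multiples of fixed functions the functional becomes an
  explicit function of the scalars. The Nehari derivative and \<open>J0_Nehari\<close> both reduce
  to it.\<close>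

lemma J0_scaled:
 assumes "!!i. i \<in> {1..l} ==> u i \<in> E"
 shows "J0 l p \<mu> (%i j. L) (%i x. s i * u i x) =
  1 / 2 * (\<Sum>i\<in>{1..l}. (s i)\<^sup>2 * dirichlet (u i) (u i))
  - 1 / (2 * p) * (\<Sum>i\<in>{1..l}. \<bar>s i\<bar> powr (2 * p) * potential p (\<mu> i) (u i))
  - 1 / (2 * p) * (\<Sum>i\<in>{1..l}. \<Sum>j\<in>{1..l} - {i}. L * (\<bar>s j\<bar> powr p * \<bar>s i\<bar> powr p * coupling (u j) (u i)))"
proof -
 have 1: "(\<Sum>i\<in>{1..l}. (D12_norm (%x. s i * u i x))\<^sup>2) = (\<Sum>i\<in>{1..l}. (s i)\<^sup>2 * dirichlet (u i) (u i))"
  unfolding D12_norm_dirichlet using assms by (intro sum.cong dirichlet_cmult refl) auto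
 have 2: "(LBINT x. m * Q1 x * \<bar>s i * u i x\<bar> powr (2 * p)) = \<bar>s i\<bar> powr (2 * p) * potential p m (u i)" for m i
  using potential_cmult[of m "s i" "u i"] by (simp add: potential_def)
 have 3: "(LBINT x. L * \<bar>s j * u j x\<bar> powr p * \<bar>s i * u i x\<bar> powr p) = L * (\<bar>s j\<bar> powr p * \<bar>s i\<bar> powr p * coupling (u j) (u i))" for i j
 proof -
  have "(LBINT x. L * \<bar>s j * u j x\<bar> powr p * \<bar>s i * u i x\<bar> powr p) = L * coupling (%x. s j * u j x) (%x. s i * u i x)"
   by (simp add: coupling_def mult.assoc)
  then show ?thesis by (simp add: coupling_cmult)
 qed
 show ?thesis unfolding J0_def 1 2 3 ..
qed

lemma abs_powr_derivative: "((%t::real. \<bar>1 + t\<bar> powr a) has_real_derivative a) (at 0)"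
proof -
 have "((%t::real. (1 + t) powr a) has_real_derivative a) (at 0)"
  by (auto intro!: derivative_eq_intros)
 then show ?thesis
  by (rule has_field_derivative_transform_within_open[where S="{-1<..}"]) auto
qed

lemma Nehari_derivative:
 assumes u: "!!i. i \<in> {1..l} ==> u i \<in> E" and i: "i \<in> {1..l}"
 shows "((%t. J0 l p \<mu> (%i j. L) (u(i := (%x. u i x + t * u i x)))) has_real_derivative
  dirichlet (u i) (u i) - potential p (\<mu> i) (u i) - L * (\<Sum>j\<in>{1..l} - {i}. coupling (u i) (u j))) (at 0)"
proof -
 define s where "s t k = (if k = i then 1 + t else 1 :: real)" for t k
 have eq: "u(i := (%x. u i x + t * u i x)) = (%k x. s t k * u k x)" for t
  by (auto simp: s_def fun_eq_iff algebra_simps)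
 let ?S = "{1..l}"
 have dp: "((%t. \<bar>s t k\<bar> powr a) has_real_derivative (if k = i then a else 0)) (at 0)" for k a
  using abs_powr_derivative[of a] by (simp add: s_def)
 have d2: "((%t. (s t k)\<^sup>2) has_real_derivative (if k = i then 2 else 0)) (at 0)" for k
  by (auto simp: s_def intro!: derivative_eq_intros)
 have s0: "\<bar>s 0 k\<bar> powr a = 1" for k a by (simp add: s_def)
 have dpp: "((%t. \<bar>s t j\<bar> powr p * \<bar>s t k\<bar> powr p) has_real_derivative (if j = i then p else 0) + (if k = i then p else 0)) (at 0)" for j k
  using DERIV_mult[OF dp[of j p] dp[of k p]] by (simp add: s0)
 have J: "J0 l p \<mu> (%i j. L) (%k x. s t k * u k x) =
  1 / 2 * (\<Sum>k\<in>?S. (s t k)\<^sup>2 * dirichlet (u k) (u k))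
  - 1 / (2 * p) * (\<Sum>k\<in>?S. \<bar>s t k\<bar> powr (2 * p) * potential p (\<mu> k) (u k))
  - 1 / (2 * p) * (\<Sum>k\<in>?S. \<Sum>j\<in>?S - {k}. L * (\<bar>s t j\<bar> powr p * \<bar>s t k\<bar> powr p * coupling (u j) (u k)))" for t
  using u by (rule J0_scaled)
 have "((%t. J0 l p \<mu> (%i j. L) (%k x. s t k * u k x)) has_real_derivative
   1 / 2 * (\<Sum>k\<in>?S. (if k = i then 2 else 0) * dirichlet (u k) (u k))
  - 1 / (2 * p) * (\<Sum>k\<in>?S. (if k = i then 2 * p else 0) * potential p (\<mu> k) (u k))
  - 1 / (2 * p) * (\<Sum>k\<in>?S. \<Sum>j\<in>?S - {k}. L * (((if j = i then p else 0) + (if k = i then p else 0)) * coupling (u j) (u k)))) (at 0)"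
  unfolding J
  by (intro DERIV_diff DERIV_cmult[where c="1/2"] DERIV_cmult[where c="1/(2*p)"] DERIV_cmult[where c=L] DERIV_sum DERIV_cmult_right d2 dp dpp)
 moreover have "1 / 2 * (\<Sum>k\<in>?S. (if k = i then 2 else 0) * dirichlet (u k) (u k)) = dirichlet (u i) (u i)"
  using i by (simp add: if_distrib[of "%z. z * _"] cong: if_cong)
 moreover have "1 / (2 * p) * (\<Sum>k\<in>?S. (if k = i then 2 * p else 0) * potential p (\<mu> k) (u k)) = potential p (\<mu> i) (u i)"
  using i p1 by (simp add: if_distrib[of "%z. z * _"] cong: if_cong)
 \<comment> \<open>Each pair containing \<open>i\<close> occurs twice among the ordered pairs, once
   in either position, and the two equal contributions absorb the factor 1/2.\<close>
 moreover have "1 / (2 * p) * (\<Sum>k\<in>?S. \<Sum>j\<in>?S - {k}. L * (((if j = i then p else 0) + (if k = i then p else 0)) * coupling (u j) (u k))) = L * (\<Sum>j\<in>?S - {i}. coupling (u i) (u j))"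
 proof -
  have "(\<Sum>k\<in>?S. \<Sum>j\<in>?S - {k}. L * (((if j = i then p else 0) + (if k = i then p else 0)) * coupling (u j) (u k)))
   = (\<Sum>k\<in>?S. \<Sum>j\<in>?S - {k}. (if j = i then L * p * coupling (u i) (u k) else 0)) + (\<Sum>k\<in>?S. \<Sum>j\<in>?S - {k}. (if k = i then L * p * coupling (u j) (u i) else 0))"
   unfolding sum.distrib[symmetric] by (intro sum.cong refl) (auto simp: algebra_simps)
  also have "(\<Sum>k\<in>?S. \<Sum>j\<in>?S - {k}. (if j = i then L * p * coupling (u i) (u k) else 0)) = (\<Sum>k\<in>?S. if k ~= i then L * p * coupling (u i) (u k) else 0)"
   using i by (intro sum.cong refl) auto
  also have "... = (\<Sum>k\<in>?S - {i}. L * p * coupling (u i) (u k))"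
   by (subst sum.inter_filter[symmetric]) (auto intro!: sum.cong)
  also have "(\<Sum>k\<in>?S. \<Sum>j\<in>?S - {k}. (if k = i then L * p * coupling (u j) (u i) else 0)) = (\<Sum>k\<in>?S. if k = i then \<Sum>j\<in>?S - {i}. L * p * coupling (u j) (u i) else 0)"
   by (intro sum.cong refl) auto
  also have "... = (\<Sum>j\<in>?S - {i}. L * p * coupling (u i) (u j))" using i by (simp add: coupling_sym)
  also have "(\<Sum>j\<in>?S - {i}. L * p * coupling (u i) (u j)) + (\<Sum>j\<in>?S - {i}. L * p * coupling (u i) (u j)) = 2 * p * (L * (\<Sum>j\<in>?S - {i}. coupling (u i) (u j)))"
   by (simp add: sum_distrib_left mult_ac)
  finally show ?thesis using p1 by (simp only:) simp
 qed
 ultimately show ?thesis unfolding eq by simp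
qed

lemma Nehari0_iff:
 "u \<in> Nehari0 l p \<mu> (%i j. L) \<longleftrightarrow> (\<forall>i\<in>{1..l}. u i \<in> E \<and> dirichlet (u i) (u i) > 0 \<and>
  dirichlet (u i) (u i) = potential p (\<mu> i) (u i) + L * (\<Sum>j\<in>{1..l} - {i}. coupling (u i) (u j)))"
proof -
 have "((%t. J0 l p \<mu> (%i j. L) (u(i := (%x. u i x + t * u i x)))) has_real_derivative 0) (at 0) \<longleftrightarrow>
  dirichlet (u i) (u i) = potential p (\<mu> i) (u i) + L * (\<Sum>j\<in>{1..l} - {i}. coupling (u i) (u j))"
  if "!!i. i \<in> {1..l} ==> u i \<in> E" "i \<in> {1..l}" for i
  using Nehari_derivative[where u=u and i=i and l=l and \<mu>=\<mu> and L=L] that DERIV_unique by fastforce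
 then show ?thesis unfolding Nehari0_def E_power_def using nonzero_iff by blast
qed

text \<open>Summing the Nehari identities eliminates potential and coupling terms together, whatever
  \<open>L\<close> is. Comparing energies on the Nehari set then means comparing total Dirichlet
  integrals.\<close>

lemma J0_Nehari:
 fixes u :: "nat => real^'n => real"
 assumes "u \<in> Nehari0 l p \<mu> (%i j. L)"
 shows "J0 l p \<mu> (%i j. L) u = (1 / 2 - 1 / (2 * p)) * (\<Sum>i\<in>{1..l}. dirichlet (u i) (u i))"
proof -
 have u: "u i \<in> E" "dirichlet (u i) (u i) = potential p (\<mu> i) (u i) + L * (\<Sum>j\<in>{1..l} - {i}. coupling (u i) (u j))" if "i \<in> {1..l}" for i
  using assms that by (auto simp: Nehari0_iff)
 have "(\<Sum>i\<in>{1..l}. dirichlet (u i) (u i)) = (\<Sum>i\<in>{1..l}. potential p (\<mu> i) (u i)) + (\<Sum>i\<in>{1..l}. \<Sum>j\<in>{1..l} - {i}. L * coupling (u j) (u i))"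
  using u(2) by (simp add: sum.distrib sum_distrib_left coupling_sym)
 moreover have "J0 l p \<mu> (%i j. L) u = 1 / 2 * (\<Sum>i\<in>{1..l}. dirichlet (u i) (u i))
  - 1 / (2 * p) * (\<Sum>i\<in>{1..l}. potential p (\<mu> i) (u i))
  - 1 / (2 * p) * (\<Sum>i\<in>{1..l}. \<Sum>j\<in>{1..l} - {i}. L * coupling (u j) (u i))"
  using J0_scaled[of l u \<mu> L "%_. 1", OF u(1)] by simp
 ultimately show ?thesis by (simp add: algebra_simps)
qed

lemma E_norm_cmult: "u \<in> E ==> E_norm p (%x. c * u x) = \<bar>c\<bar> * E_norm p u"
proof -
 assume u: "u \<in> E"
 have "(pw (2 * p) (%x. c * u x)) = \<bar>c\<bar> powr (2 * p) * (pw (2 * p) u)"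
  by (simp add: abs_mult powr_mult)
 then have "L_norm (2 * p) (%x. c * u x) = \<bar>c\<bar> * L_norm (2 * p) u"
  using p1 by (simp add: L_norm_def powr_mult powr_powr)
 then have "(D12_norm (%x. c * u x))\<^sup>2 + (L_norm (2 * p) (%x. c * u x))\<^sup>2 = c\<^sup>2 * ((D12_norm u)\<^sup>2 + (L_norm (2 * p) u)\<^sup>2)"
  using dirichlet_cmult[OF u, of c] by (simp add: D12_norm_dirichlet power_mult_distrib distrib_left)
 then show ?thesis by (simp add: E_norm_def real_sqrt_mult)
qed

text \<open>The vanishing Frechet derivative is used only along multiples of the \<open>i\<close>-th
  component, where the norm of the increment is linear in \<open>\<bar>t\<bar>\<close>.\<close>

lemma solution_Nehari0:
 fixes u :: "nat => real^'n => real"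
 assumes "solution l p \<mu> (%i j. L) u" shows "u \<in> Nehari0 l p \<mu> (%i j. L)"
proof -
 have u: "!!i. i \<in> {1..l} ==> u i \<in> E" "!!i. i \<in> {1..l} ==> nonzero (u i)" and cp: "critical_point l p (J0 l p \<mu> (%i j. L)) u"
  using assms by (auto simp: solution_def critical_point_def E_power_def)
 let ?J = "J0 l p \<mu> (%i j. L)"
 have "((%t. ?J (u(i := (%x. u i x + t * u i x)))) has_real_derivative 0) (at 0)" if i: "i \<in> {1..l}" for i
 proof -
  define h where "h t = (%j x. (if j = i then t else 0) * u j x)" for t :: real
  have hE: "h t \<in> E_power l p" for t unfolding E_power_def h_def using u(1) E_cmult by auto
  have eq: "(%j x. u j x + h t j x) = u(i := (%x. u i x + t * u i x))" for t
   by (auto simp: h_def fun_eq_iff)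
  let ?n = "E_norm p (u i)"
  have n0: "?n >= 0" by (simp add: E_norm_def)
  have hn: "E_power_norm l p (h t) = \<bar>t\<bar> * ?n" for t
  proof -
   have "(\<Sum>j\<in>{1..l}. (E_norm p (h t j))\<^sup>2) = (\<Sum>j\<in>{1..l}. if j = i then (\<bar>t\<bar> * ?n)\<^sup>2 else 0)"
    using u(1) E_norm_cmult[of "u _" t] E_norm_cmult[of "u _" 0]
    by (intro sum.cong refl) (auto simp: h_def)
   then show ?thesis using i n0 by (simp add: E_power_norm_def abs_mult)
  qed
  show ?thesis unfolding DERIV_def LIM_eq
  proof (intro allI impI)
   fix e :: real assume e: "e > 0"
   \<comment> \<open>The summand 1 avoids a division by 0, and the factor 2 leaves room for the
     strict inequality.\<close>
   define e' where "e' = e / (2 * (?n + 1))"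
   have e': "e' > 0" using e n0 by (simp add: e'_def)
   obtain d where d: "d > 0" "!!h. h \<in> E_power l p ==> E_power_norm l p h < d ==> \<bar>?J (%i x. u i x + h i x) - ?J u\<bar> <= e' * E_power_norm l p h"
    using cp e' unfolding critical_point_def by meson
   have "norm ((?J (u(i := (%x. u i x + (0 + t) * u i x))) - ?J (u(i := (%x. u i x + 0 * u i x)))) / t - 0) < e"
    if t: "t ~= 0" "norm (t - 0) < d / (?n + 1)" for t
   proof -
    have "\<bar>t\<bar> * ?n <= \<bar>t\<bar> * (?n + 1)" by (intro mult_left_mono) auto
    also have "... < d" using t(2) n0 by (simp add: less_divide_eq)
    finally have "\<bar>?J (%i x. u i x + h t i x) - ?J u\<bar> <= e' * (\<bar>t\<bar> * ?n)"
     using d(2)[OF hE, of t] by (simp add: hn)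
    then have "\<bar>?J (u(i := (%x. u i x + t * u i x))) - ?J u\<bar> / \<bar>t\<bar> <= e' * ?n"
     unfolding eq using t(1) by (simp add: divide_le_eq mult_ac)
    also have "... <= e' * (?n + 1)" using e' by (intro mult_left_mono) auto
    also have "... = e / 2" using n0 by (simp add: e'_def divide_simps)
    also have "... < e" using e by simp
    finally show ?thesis using t(1) by simp
   qed
   moreover have "d / (?n + 1) > 0" using d(1) n0 by simp
   ultimately show "\<exists>s>0. \<forall>x. x ~= 0 \<and> norm (x - 0) < s -->
    norm ((?J (u(i := (%xa. u i xa + (0 + x) * u i xa))) - ?J (u(i := (%xa. u i xa + 0 * u i xa)))) / x - 0) < e" by blast
  qed
 qed
 with u show ?thesis by (auto simp: Nehari0_def E_power_def)
qed

end

subsection \<open>Convergence of the least energy solutions\<close>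

text \<open>Successive extraction: stability of \<open>P\<close> under further subsequences protects
  the indices already treated.\<close>

lemma finite_subsequence:
 fixes P :: "'i => (nat => nat) => bool"
 assumes "finite I" and ex: "!!i r. i \<in> I ==> strict_mono r ==> \<exists>s::nat => nat. strict_mono s \<and> P i (r \<circ> s)"
  and sub: "!!i r s. P i r ==> strict_mono (s :: nat => nat) ==> P i (r \<circ> s)"
 shows "\<exists>r :: nat => nat. strict_mono r \<and> (\<forall>i\<in>I. P i r)"
 using assms(1) ex
proof (induction I rule: finite_induct)
 case empty
 show ?case by (rule exI[of _ id]) (simp add: strict_mono_def)
next
 case (insert i I)
 then obtain r where r: "strict_mono r" "\<forall>i\<in>I. P i r" by blast
 obtain s where s: "strict_mono s" "P i (r \<circ> s)" using insert.prems[of i r] r by blast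
 have "strict_mono (r \<circ> s)" using r s by (simp add: strict_mono_o)
 then have "strict_mono (r \<circ> s) \<and> (\<forall>j\<in>insert i I. P j (r \<circ> s))" using r s sub[of _ r s] by blast
 then show ?case by blast
qed

context subcritical begin

text \<open>Up to the factor \<open>1/2 - 1/(2p)\<close> this is the maximum over \<open>t > 0\<close> of \<open>t\<^sup>2 a / 2 - t\<^sup>2\<^sup>p b / (2p)\<close>.\<close>

definition psi :: "real => real => real" where
 "psi a b = a powr (p / (p - 1)) * b powr (- 1 / (p - 1))"

text \<open>\<open>s\<close> is the factor that moves a function with Dirichlet integral
  \<open>a\<close> and potential \<open>b\<close> onto its Nehari set, where both quantities become
  \<open>psi a b\<close>. Passing to logarithms makes the identities linear.\<close>

lemma psi_scale:
 assumes "a > 0" "b > 0"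
 defines "s \<equiv> (a / b) powr (1 / (2 * p - 2))"
 shows "s > 0" "s\<^sup>2 * a = psi a b" "s powr (2 * p) * b = psi a b"
proof -
 obtain x y where xy: "a = exp x" "b = exp y" using assms(1,2) by (metis exp_ln)
 have e: "exp u powr v = exp (u * v)" for u v :: real by (simp add: powr_def mult.commute)
 have s: "s = exp ((x - y) * (1 / (2 * p - 2)))" unfolding s_def xy exp_diff[symmetric] e ..
 have psi: "psi a b = exp (x * (p / (p - 1)) + y * (- 1 / (p - 1)))" unfolding psi_def xy e exp_add ..
 have p0: "2 * p - 2 = 2 * (p - 1)" "p - 1 ~= 0" using p1 by auto
 show "s > 0" by (simp add: s)
 have "2 * ((x - y) * (1 / (2 * (p - 1)))) + x = x * (p / (p - 1)) + y * (- 1 / (p - 1))"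
  using p0(2) by (simp add: divide_simps) (simp add: algebra_simps)
 moreover have "s\<^sup>2 * a = exp (2 * ((x - y) * (1 / (2 * (p - 1)))) + x)" by (simp only: s xy(1) exp_double exp_add p0(1))
 ultimately show "s\<^sup>2 * a = psi a b" unfolding psi by (simp only:)
 have "(x - y) * (1 / (2 * (p - 1))) * (2 * p) + y = x * (p / (p - 1)) + y * (- 1 / (p - 1))"
  using p0(2) by (simp add: divide_simps) (simp add: algebra_simps)
 then show "s powr (2 * p) * b = psi a b" unfolding psi by (simp only: s xy(2) p0(1) e exp_add[symmetric])
qed

text \<open>\<open>psi a b\<close> is \<open>a\<close> times a positive power of
  \<open>a / b\<close>. In the application \<open>a'\<close> is the limit of the energies,
  \<open>a\<close> the Dirichlet integral of the limit and \<open>b\<close> its potential; the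
  equality case excludes a loss of energy.\<close>

lemma psi_mono:
 assumes "0 < a" "a <= a'" "b >= a'" shows "psi a b <= a"
  and "psi a b = a ==> b = a"
proof -
 have b: "b > 0" "a <= b" using assms by auto
 obtain x y where xy: "a = exp x" "b = exp y" using assms(1) b(1) by (metis exp_ln)
 have e: "exp u powr v = exp (u * v)" for u v :: real by (simp add: powr_def mult.commute)
 have "psi a b = exp (x * (p / (p - 1)) + y * (- 1 / (p - 1)))" unfolding psi_def xy e exp_add ..
 moreover have "x * (p / (p - 1)) + y * (- 1 / (p - 1)) = x - (y - x) / (p - 1)"
  using p1 by (simp add: divide_simps) (simp add: algebra_simps)
 ultimately have psi: "psi a b = exp (x - (y - x) / (p - 1))" by simp
 have "(y - x) / (p - 1) >= 0" using b(2) p1 by (simp add: xy)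
 then show "psi a b <= a" unfolding psi by (simp add: xy)
 show "b = a" if "psi a b = a" using that p1 unfolding psi by (simp add: xy)
qed

text \<open>Segregation removes the coupling, so the rescaled tuple lies in the Nehari set for every
  \<open>L\<close> and the bound does not see \<open>L\<close>.\<close>

lemma energy_le_segregated:
 fixes u v :: "nat => real^'n => real"
 assumes u: "least_energy_solution l p \<mu> (%i j. L) u"
  and v: "!!i. i \<in> {1..l} ==> v i \<in> E" "!!i. i \<in> {1..l} ==> dirichlet (v i) (v i) > 0"
   "!!i. i \<in> {1..l} ==> potential p (\<mu> i) (v i) > 0"
  and seg: "!!i j. i \<in> {1..l} ==> j \<in> {1..l} ==> i ~= j ==> AE x in lborel. v i x * v j x = 0"
 shows "(\<Sum>i\<in>{1..l}. dirichlet (u i) (u i)) <= (\<Sum>i\<in>{1..l}. psi (dirichlet (v i) (v i)) (potential p (\<mu> i) (v i)))"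
proof -
 let ?N = "Nehari0 l p \<mu> (%i j. L) :: (nat => real ^ 'n => real) set" and ?J = "J0 l p \<mu> (%i j. L)"
 define s where "s i = (dirichlet (v i) (v i) / potential p (\<mu> i) (v i)) powr (1 / (2 * p - 2))" for i
 let ?w = "%i x. s i * v i x"
 have sc: "s i > 0" "(s i)\<^sup>2 * dirichlet (v i) (v i) = psi (dirichlet (v i) (v i)) (potential p (\<mu> i) (v i))"
  "s i powr (2 * p) * potential p (\<mu> i) (v i) = psi (dirichlet (v i) (v i)) (potential p (\<mu> i) (v i))" if "i \<in> {1..l}" for i
  unfolding s_def by (rule psi_scale[OF v(2)[OF that] v(3)[OF that]])+
 have A: "dirichlet (?w i) (?w i) = psi (dirichlet (v i) (v i)) (potential p (\<mu> i) (v i))" if "i \<in> {1..l}" for i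
  using dirichlet_cmult[OF v(1)[OF that]] sc[OF that] by simp
 have B: "potential p (\<mu> i) (?w i) = psi (dirichlet (v i) (v i)) (potential p (\<mu> i) (v i))" if "i \<in> {1..l}" for i
  using potential_cmult[of "\<mu> i" "s i" "v i"] sc[OF that] by simp
 have "coupling (?w i) (?w j) = 0" if "i \<in> {1..l}" "j \<in> {1..l} - {i}" for i j
 proof -
  have "AE x in lborel. v i x * v j x = 0" using seg[of i j] that by blast
  then have "AE x in lborel. \<bar>s i * v i x\<bar> powr p * \<bar>s j * v j x\<bar> powr p = 0"
   by eventually_elim (auto simp: abs_mult powr_mult)
  then have "coupling (?w i) (?w j) = (LINT x|(lborel::(real^'n) measure). 0)" unfolding coupling_def
   by (intro integral_cong_AE) (use v(1)[THEN E_D(1)] that in auto)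
  then show ?thesis by simp
 qed
 then have c: "(\<Sum>j\<in>{1..l} - {i}. coupling (?w i) (?w j)) = 0" if "i \<in> {1..l}" for i
  using that by (intro sum.neutral) blast
 have wN: "?w \<in> ?N" unfolding Nehari0_iff
 proof (intro ballI conjI)
  fix i assume i: "i \<in> {1..l}"
  show "?w i \<in> E" by (rule E_cmult(1)[OF v(1)[OF i]])
  show "dirichlet (?w i) (?w i) > 0" using dirichlet_cmult[OF v(1)[OF i], of "s i"] sc(1)[OF i] v(2)[OF i] by simp
  show "dirichlet (?w i) (?w i) = potential p (\<mu> i) (?w i) + L * (\<Sum>j\<in>{1..l} - {i}. coupling (?w i) (?w j))"
   using A[OF i] B[OF i] c[OF i] by simp
 qed
 have c0: "1 / 2 - 1 / (2 * p) > 0" using p1 by (simp add: field_simps)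
 have "bdd_below (?J ` ?N)"
 proof (rule bdd_belowI2)
  fix z assume "z \<in> ?N"
  then have "?J z = (1 / 2 - 1 / (2 * p)) * (\<Sum>i\<in>{1..l}. dirichlet (z i) (z i))" by (rule J0_Nehari)
  also have "... >= 0" using c0 dirichlet_nonneg by (intro mult_nonneg_nonneg sum_nonneg) auto
  finally show "0 <= ?J z" .
 qed
 then have "Inf (?J ` ?N) <= ?J ?w" using wN by (intro cInf_lower) auto
 moreover have "?J u = Inf (?J ` ?N)" "u \<in> ?N" using u solution_Nehari0 by (auto simp: least_energy_solution_def)
 ultimately have "(1 / 2 - 1 / (2 * p)) * (\<Sum>i\<in>{1..l}. dirichlet (u i) (u i)) <= (1 / 2 - 1 / (2 * p)) * (\<Sum>i\<in>{1..l}. dirichlet (?w i) (?w i))"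
  using J0_Nehari[of u l \<mu> L] J0_Nehari[OF wN] by (simp only:)
 then have "(\<Sum>i\<in>{1..l}. dirichlet (u i) (u i)) <= (\<Sum>i\<in>{1..l}. dirichlet (?w i) (?w i))" using c0 by simp
 also have "... = (\<Sum>i\<in>{1..l}. psi (dirichlet (v i) (v i)) (potential p (\<mu> i) (v i)))"
  by (intro sum.cong refl A)
 finally show ?thesis .
qed

section \<open>Mass in the unit ball, lower semicontinuity and strong convergence\<close>

definition mass :: "(real^'n) set => (real^'n => real) => real" where
 "mass S u = (LBINT x:S. \<bar>u x\<bar> powr (2 * p))"

lemma mass_integrable: "u \<in> E ==> S \<in> sets borel ==> set_integrable lborel S (%x. \<bar>u x\<bar> powr (2 * p))"
 unfolding set_integrable_def by (intro integrable_mult_indicator E_D) auto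

text \<open>\<open>Q1\<close> is twice the indicator of the open unit ball minus 1.\<close>

lemma potential_mass:
 assumes u: "u \<in> E" shows "potential p m u = m * (2 * mass (ball 0 1) u - mass UNIV u)"
proof -
 have "potential p m u = (LBINT x. m * (2 * (indicat_real (ball 0 1) x * \<bar>u x\<bar> powr (2 * p)) - \<bar>u x\<bar> powr (2 * p)))"
  unfolding potential_def by (intro Bcong refl) (auto simp: Q1_def indicator_def)
 then show ?thesis using mass_integrable[OF u, of "ball 0 1"] E_D(3)[OF u]
  by (simp add: mass_def set_lebesgue_integral_def set_integrable_def)
qed

lemma ball_mass_le_mass: "u \<in> E ==> mass (ball 0 1) u <= mass UNIV u"
 unfolding mass_def set_lebesgue_integral_def
 by (intro integral_mono mass_integrable[unfolded set_integrable_def]) (auto simp: indicator_def)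

lemma potential_le: "u \<in> E ==> m > 0 ==> potential p m u <= m * mass (ball 0 1) u"
 using potential_mass[of u m] ball_mass_le_mass[of u] by simp

text \<open>Interpolation between the finite measure of the ball and the L^q norm. Taking the L^q
  norm itself as the level \<open>s\<close> gives both terms the same power, to which Sobolev
  applies. As \<open>p > 1\<close>, this later keeps the energies away from 0.\<close>

lemma mass_bound:
 obtains C where "C > 0" "!!u. u \<in> E ==> dirichlet u u > 0 ==> mass (ball 0 1) u <= C * dirichlet u u powr p"
proof -
 let ?V = "measure lborel (ball (0::real^'n) 1)"
 have "mass (ball 0 1) u <= (?V + 1) * SC powr p * dirichlet u u powr p" if u: "u \<in> E" "dirichlet u u > 0" for u
 proof -
  define S where "S = (pw q u)"
  have S: "S >= 0" by (simp add: S_def)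
  have "S ~= 0" using Lq_zero[OF E_D12[OF u(1)]] nonzero_iff[OF u(1)] u(2) by (auto simp: nonzero_def S_def)
  with S have S0: "S > 0" by simp
  define s where "s = S powr (1 / q)"
  have s: "s > 0" using S0 by (simp add: s_def)
  have pw: "\<bar>u x\<bar> powr (2 * p) <= s powr (2 * p) + s powr (2 * p - q) * \<bar>u x\<bar> powr q" for x
  proof -
   have "min \<bar>u x\<bar> s powr (2 * p) <= s powr (2 * p)" using p1 s by (intro powr_mono2) auto
   then show ?thesis using Lq_interpolate[of "\<bar>u x\<bar>" s "2 * p" q] s exponents p1 by simp
  qed
  have fin: "emeasure lborel (ball (0::real^'n) 1) < \<infinity>" using emeasure_lborel_ball_finite by blast
  have i1: "integrable lborel (%x. indicat_real (ball 0 1) x * s powr (2 * p) + s powr (2 * p - q) * \<bar>u x\<bar> powr q)"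
   using fin E_D(2)[OF u(1)] by (intro Badd integrable_mult_left integrable_mult_right integrable_real_indicator) auto
  have "mass (ball 0 1) u <= (LBINT x. indicat_real (ball 0 1) x * s powr (2 * p) + s powr (2 * p - q) * \<bar>u x\<bar> powr q)"
   unfolding mass_def set_lebesgue_integral_def
   by (rule integral_mono[OF mass_integrable[OF u(1), of "ball 0 1", unfolded set_integrable_def] i1])
    (use pw in \<open>auto simp: indicator_def\<close>)
  also have "... = ?V * s powr (2 * p) + s powr (2 * p - q) * S"
   using fin E_D(2)[OF u(1)] by (subst BIadd) (auto simp: S_def)
  also have "s powr (2 * p - q) * S = s powr (2 * p)"
  proof -
   have "S = s powr q" using S0 exponents by (simp add: s_def powr_powr)
   then show ?thesis by (simp flip: powr_add)
  qed
  also have "s powr (2 * p) = (S powr (2 / q)) powr p" by (simp add: s_def powr_powr)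
  also have "?V * (S powr (2 / q)) powr p + (S powr (2 / q)) powr p = (?V + 1) * (S powr (2 / q)) powr p" by (simp add: algebra_simps)
  also have "... <= (?V + 1) * (SC * dirichlet u u) powr p"
   using sobolev_D12(2)[OF E_D12[OF u(1)]] p1 by (intro mult_left_mono powr_mono2) (auto simp: S_def)
  finally show ?thesis using SC_pos u(2) by (simp add: powr_mult mult_ac)
 qed
 moreover have "(?V + 1) * SC powr p > 0" using SC_pos by (simp add: add_nonneg_pos)
 ultimately show thesis using that by blast
qed

text \<open>Sobolev supplies an L^q bound, which upgrades almost everywhere convergence to local L1
  convergence. The result for weak gradients is then applied to a tail of the sequence, where
  \<open>b k < \<alpha> + e\<close>.\<close>

lemma dirichlet_lsc:
 assumes W: "!!k. W k \<in> E" and w[measurable]: "w \<in> Bmeas"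
  and ae: "AE x in lborel. (%k. W k x) ----> w x"
  and b: "!!k. dirichlet (W k) (W k) <= b k" "b ----> \<alpha>"
 shows "w \<in> D12" "dirichlet w w <= \<alpha>"
proof -
 note [measurable] = E_D(1)[OF W]
 obtain M where M: "!!k. \<bar>b k\<bar> <= M" using convergent_imp_Bseq[OF convergentI[OF b(2)]] by (auto simp: Bseq_def)
 let ?B = "(SC * M) powr (q / 2)"
 have Wq: "(pw q (W k)) <= ?B" for k
  by (rule Lq_bound[OF E_D12[OF W] order_trans[OF b(1) order_trans[OF abs_ge_self M]]])
 have wq: "Lpw q w"
 proof (rule fatou_bound(1)[of _ "%k x. \<bar>W k x\<bar> powr q" _ "%_. ?B"])
  show "AE x in lborel. (%n. \<bar>W n x\<bar> powr q) ----> \<bar>w x\<bar> powr q"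
   using ae by eventually_elim (use exponents in \<open>auto intro!: tendsto_powr' tendsto_rabs\<close>)
 qed (use Wq E_D(2)[OF W] in auto)
 have L: "L1loc W w" unfolding L1loc_def
 proof
  fix R
  show "(%n. LBINT x:cball 0 R. norm (W n x - w x)) ----> 0"
   using Ls_convergence_finite_measure[of 1 q "cball 0 R" W w ?B] exponents emeasure_lborel_cball_finite[of "0::real^'n" R]
    E_D(2)[OF W] Wq wq ae by simp
 qed
 have lw: "locally_integrable w" by (rule locint_powr[of q]) (use exponents wq in auto)
 have lim: "\<exists>h. is_weak_gradient w h \<and> L2 h \<and> (sq h) <= \<alpha> + e" if e: "e > 0" for e
 proof -
  have "eventually (%k. b k < \<alpha> + e) sequentially" using order_tendstoD(2)[OF b(2), of "\<alpha> + e"] e by simp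
  then obtain K where K: "!!k. k >= K ==> b k < \<alpha> + e" by (auto simp: eventually_sequentially)
  have L': "L1loc (%k. W (k + K)) w" using L unfolding L1loc_def by (auto intro: LIMSEQ_ignore_initial_segment)
  have bd: "(sq (weak_gradient (W (k + K)))) <= \<alpha> + e" for k
   using b(1)[of "k + K"] K[of "k + K"] by (simp add: dirichlet_def power2_norm_eq_inner)
  show ?thesis
   by (rule weak_gradient_of_limit[OF _ lw L' _ bd]) (use E_D[OF W] in auto)
 qed
 show wD: "w \<in> D12" unfolding D12_iff using wq lim[of 1] by auto
 show "dirichlet w w <= \<alpha>"
 proof (rule field_le_epsilon)
  fix e :: real assume "e > 0"
  from lim[OF this] obtain h where h: "is_weak_gradient w h" "(sq h) <= \<alpha> + e" by blast
  have "AE x in lborel. weak_gradient w x = h x"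
   by (rule wg_unique[OF D12_weak_gradient(1)[OF wD] h(1)]) simp
  then have "dirichlet w w = (LBINT x. h x \<bullet> h x)" unfolding dirichlet_def
   by (intro integral_cong_AE) (use locint_measurable[OF wgD(2)[OF h(1)]]
    locint_measurable[OF wgD(2)[OF D12_weak_gradient(1)[OF wD]]] in \<open>auto elim: eventually_mono\<close>)
  then show "dirichlet w w <= \<alpha> + e" using h(2) by (simp add: power2_norm_eq_inner)
 qed
qed

text \<open>If the differences kept energy at least \<open>e\<close>, the parallelogram identity
  would push the energies of \<open>W k + w\<close> below that of their limit \<open>2 * w\<close>
  by \<open>e\<close>, against semicontinuity.\<close>

lemma strong_convergence:
 assumes W: "!!k. W k \<in> E" and w: "w \<in> E" and ae: "AE x in lborel. (%k. W k x) ----> w x"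
  and A: "(%k. dirichlet (W k) (W k)) ----> dirichlet w w"
 shows "(%k. dirichlet (%x. W k x - w x) (%x. W k x - w x)) ----> 0"
proof (rule tendsto_zero_via_subseq)
 let ?d = "%k. dirichlet (%x. W k x - w x) (%x. W k x - w x)"
 show "?d n >= 0" for n by (rule dirichlet_nonneg)
 fix e :: real and r :: "nat => nat" assume e: "e > 0" and r: "strict_mono r" and ge: "!!n. ?d (r n) >= e"
 have "dirichlet (%x. 2 * w x) (%x. 2 * w x) <= 2 * dirichlet w w + 2 * dirichlet w w - e"
 proof (rule dirichlet_lsc(2)[of "%k x. W (r k) x + 1 * w x" _ "%k. 2 * dirichlet (W (r k)) (W (r k)) + 2 * dirichlet w w - e"])
  show "(%x. W (r k) x + 1 * w x) \<in> E" for k using E_add(1)[OF W w] by simp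
  show "AE x in lborel. (%k. W (r k) x + 1 * w x) ----> 2 * w x" using ae
  proof eventually_elim
   case (elim x)
   show ?case using tendsto_add[OF LIMSEQ_subseq_LIMSEQ[OF elim r] tendsto_const[of "w x"]] by (simp add: o_def)
  qed
  show "dirichlet (%x. W (r k) x + 1 * w x) (%x. W (r k) x + 1 * w x) <= 2 * dirichlet (W (r k)) (W (r k)) + 2 * dirichlet w w - e" for k
   using ge[of k] dirichlet_square_diff[OF W[of "r k"] w] dirichlet_square_add[OF W[of "r k"] w, of 1] by simp
  show "(%k. 2 * dirichlet (W (r k)) (W (r k)) + 2 * dirichlet w w - e) ----> 2 * dirichlet w w + 2 * dirichlet w w - e"
   using LIMSEQ_subseq_LIMSEQ[OF A r] by (intro tendsto_intros) (simp add: o_def)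
 qed (use E_D(1)[OF w] in auto)
 then show False using e dirichlet_cmult[OF w, of 2] by simp
qed

text \<open>In the ball \<open>2 * p < q\<close> makes the mass converge. For the rest, the Nehari
  inequality bounds the total mass by the ball mass and the energy, and Fatou preserves that bound.
  In the equality case the bound converges to the mass of the limit, which excludes any loss at
  infinity.\<close>

lemma component_limit:
 assumes W: "!!k. W k \<in> E" and w[measurable]: "w \<in> Bmeas"
  and ae: "AE x in lborel. (%k. W k x) ----> w x"
  and A: "(%k. dirichlet (W k) (W k)) ----> \<alpha>" and m: "m > 0"
  and le: "!!k. dirichlet (W k) (W k) <= potential p m (W k)"
 shows "w \<in> E" "dirichlet w w <= \<alpha>" "\<alpha> <= potential p m w"
  "dirichlet w w = \<alpha> ==> potential p m w = \<alpha> ==> (%k. E_norm p (%x. W k x - w x)) ----> 0"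
proof -
 have [measurable]: "ball (0::real^'n) 1 \<in> sets borel" by simp
 have wm: "(%x. indicat_real (ball 0 1) x * \<bar>w x\<bar> powr (2 * p)) \<in> borel_measurable lborel" by measurable
 note [measurable] = E_D(1)[OF W]
 note lsc = dirichlet_lsc[OF W w ae order_refl A]
 obtain M where "!!k. norm (dirichlet (W k) (W k)) <= M" using convergent_imp_Bseq[OF convergentI[OF A]] by (auto simp: Bseq_def)
 then have M: "dirichlet (W k) (W k) <= M" for k using abs_le_D1[of _ M] by simp
 let ?B = "(SC * M) powr (q / 2)"
 have Wq: "(pw q (W k)) <= ?B" for k
  by (rule Lq_bound[OF E_D12[OF W] M])
 have wq: "Lpw q w" using lsc(1) D12_iff by blast
 have pw: "(\<bar>a\<bar> powr (2 * p)) powr (q / (2 * p)) = \<bar>a\<bar> powr q" for a :: real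
  using p1 by (simp add: powr_powr)
 have aep: "AE x in lborel. (%k. \<bar>W k x\<bar> powr (2 * p)) ----> \<bar>w x\<bar> powr (2 * p)"
  using ae by eventually_elim (use p1 in \<open>auto intro!: tendsto_powr' tendsto_rabs\<close>)
 have dI: "(%k. LBINT x:ball 0 1. \<bar>\<bar>W k x\<bar> powr (2 * p) - \<bar>w x\<bar> powr (2 * p)\<bar> powr 1) ----> 0"
  using Ls_convergence_finite_measure[of 1 "q / (2 * p)" "ball 0 1" "%k x. \<bar>W k x\<bar> powr (2 * p)" "%x. \<bar>w x\<bar> powr (2 * p)" ?B]
   emeasure_lborel_ball_finite[of "0::real^'n" 1] exponents p1 wq Wq E_D(2)[OF W] aep by (simp add: pw)
 have iw: "integrable lborel (%x. indicat_real (ball 0 1) x * \<bar>w x\<bar> powr (2 * p))"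
 proof (rule Bbound)
  show "integrable lborel (%x. indicat_real (ball (0::real^'n) 1) x + \<bar>w x\<bar> powr q)"
   using emeasure_lborel_ball_finite[of "0::real^'n" 1] wq by (intro Badd integrable_real_indicator) auto
  have "\<bar>w x\<bar> powr (2 * p) <= 1 + \<bar>w x\<bar> powr q" for x
   using Lq_interpolate[of "\<bar>w x\<bar>" 1 "2 * p" q] powr_mono2[of "2 * p" "min \<bar>w x\<bar> 1" 1] exponents p1 by simp
  then show "AE x in lborel. norm (indicat_real (ball 0 1) x * \<bar>w x\<bar> powr (2 * p)) <= norm (indicat_real (ball 0 1) x + \<bar>w x\<bar> powr q)"
   by (intro AE_I2) (auto simp: indicator_def)
  show "(%x. indicat_real (ball 0 1) x * \<bar>w x\<bar> powr (2 * p)) \<in> borel_measurable lborel"  by (rule wm)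
 qed
 have In: "(%k. mass (ball 0 1) (W k)) ----> mass (ball 0 1) w"
 proof (rule LIM_zero_cancel, rule tendsto_0_le[OF dI, of _ 1], rule always_eventually, rule allI)
  fix k
  have ik: "integrable lborel (%x. indicat_real (ball 0 1) x * \<bar>W k x\<bar> powr (2 * p))"
   using mass_integrable[OF W[of k], of "ball 0 1"] by (simp add: set_integrable_def)
  have "mass (ball 0 1) (W k) - mass (ball 0 1) w = (LBINT x. indicat_real (ball 0 1) x * (\<bar>W k x\<bar> powr (2 * p) - \<bar>w x\<bar> powr (2 * p)))"
   unfolding mass_def set_lebesgue_integral_def using ik iw by (simp add: right_diff_distrib)
  also have "norm ... <= (LBINT x. norm (indicat_real (ball 0 1) x * (\<bar>W k x\<bar> powr (2 * p) - \<bar>w x\<bar> powr (2 * p))))"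
   by (rule integral_norm_bound)
  finally show "norm (mass (ball 0 1) (W k) - mass (ball 0 1) w) <= norm (LBINT x:ball 0 1. \<bar>\<bar>W k x\<bar> powr (2 * p) - \<bar>w x\<bar> powr (2 * p)\<bar> powr 1) * 1"
   by (simp add: set_lebesgue_integral_def abs_mult)
 qed
 \<comment> \<open>The Nehari inequality solved for the total mass, with the potential expressed by
   \<open>potential_mass\<close>.\<close>
 let ?b = "%k. 2 * mass (ball 0 1) (W k) - dirichlet (W k) (W k) / m"
 have b: "?b ----> 2 * mass (ball 0 1) w - \<alpha> / m" by (intro tendsto_intros In A) (use m in auto)
 have le': "(pw (2 * p) (W k)) <= ?b k" for k
  using le[of k] m unfolding potential_mass[OF W] by (simp add: mass_def set_lebesgue_integral_def field_simps)
 have w2p: "Lpw (2 * p) w" "(pw (2 * p) w) <= 2 * mass (ball 0 1) w - \<alpha> / m"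
  by (rule fatou_bound[OF _ _ _ aep le' b]; use E_D(3)[OF W] in auto)+
 show wE: "w \<in> E" using lsc(1) w2p(1) by (auto simp: E_space_def L_space_def set_integrable_def)
 show "dirichlet w w <= \<alpha>" by (rule lsc(2))
 have mw: "mass UNIV w = (pw (2 * p) w)" by (simp add: mass_def set_lebesgue_integral_def)
 show "\<alpha> <= potential p m w" using w2p(2) m unfolding potential_mass[OF wE] mw by (simp add: field_simps)
 assume a: "dirichlet w w = \<alpha>" "potential p m w = \<alpha>"
 have "(%k. \<integral>x. norm (W k x - w x) powr (2 * p) \<partial>lborel) ----> 0"
 proof (rule Lq_convergence[OF _ _ _ _ _ ae, of _ ?b])
  have "2 * mass (ball 0 1) w - \<alpha> / m = (LBINT x. norm (w x) powr (2 * p))"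
   using a(2) m unfolding potential_mass[OF wE] mw by (simp add: field_simps)
  then show "?b ----> (LBINT x. norm (w x) powr (2 * p))" using b by simp
 qed (use p1 le' w2p(1) E_D(3)[OF W] in auto)
 then have "(%k. L_norm (2 * p) (%x. W k x - w x)) ----> 0"
  unfolding L_norm_def using p1 by (auto intro!: tendsto_zero_powrI)
 moreover have "(%k. (D12_norm (%x. W k x - w x))\<^sup>2) ----> 0"
  unfolding D12_norm_dirichlet using strong_convergence[OF W wE ae] A a(1) by simp
 ultimately have "(%k. sqrt ((D12_norm (%x. W k x - w x))\<^sup>2 + (L_norm (2 * p) (%x. W k x - w x))\<^sup>2)) ----> sqrt (0 + 0\<^sup>2)"
  by (intro tendsto_real_sqrt tendsto_add tendsto_power)
 then show "(%k. E_norm p (%x. W k x - w x)) ----> 0" by (simp add: E_norm_def)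
qed

text \<open>Bumps on disjoint balls along one axis; \<open>d\<close> is so small that
  \<open>l\<close> balls of radius \<open>d\<close> with centers \<open>2 * d\<close> apart lie in
  the unit ball, where \<open>Q1\<close> is 1.\<close>

lemma segregated_tuple_exists:
 assumes \<mu>: "!!i. i \<in> {1..l} ==> \<mu> i > (0::real)"
 obtains v :: "nat => real^'n => real" where "!!i. i \<in> {1..l} ==> v i \<in> E" "!!i. i \<in> {1..l} ==> dirichlet (v i) (v i) > 0"
  "!!i. i \<in> {1..l} ==> potential p (\<mu> i) (v i) > 0"
  "!!i j. i \<in> {1..l} ==> j \<in> {1..l} ==> i ~= j ==> AE x in lborel. v i x * v j x = 0"
proof -
 define d where "d = 1 / (2 * (real l + 1))"
 have d: "d > 0" by (simp add: d_def)
 define c :: "nat => real^'n" where "c i = (real i * (2 * d)) *\<^sub>R axis undefined 1" for i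
 define v :: "nat => real^'n => real" where "v i x = eta d (x - c i)" for i x
 have nc: "norm (c i - c j) = \<bar>real i - real j\<bar> * (2 * d)" for i j
 proof -
  have "c i - c j = ((real i - real j) * (2 * d)) *\<^sub>R axis undefined 1" by (simp add: c_def algebra_simps)
  then show ?thesis using d by (simp add: abs_mult)
 qed
 have supp: "norm (x - c i) < d" if "v i x ~= 0" for i x using that eta_support[OF d] by (auto simp: v_def)
 have test: "v i \<in> TF" for i
  using test_affine[OF eta_test[OF d], of 1 "- c i"] by (simp add: v_def[abs_def])
 have nz: "nonzero (v i)" for i
 proof -
  have "(LBINT x. v i x) = 1"
   using eta_integral[OF d, where 'n='n] lborel_integral_translate[of "eta d" "- c i"] test_measurable[OF eta_test[OF d]] by (simp add: v_def)
  moreover have "(LBINT x. v i x) = 0" if "AE x in lborel. v i x = 0"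
   by (subst integral_cong_AE[of _ _ "%_. 0"]) (use that test_measurable[OF test] in auto)
  ultimately show ?thesis unfolding nonzero_def by force
 qed
 show thesis
 proof (rule that[of v])
  fix i assume i: "i \<in> {1..l}"
  show E: "v i \<in> E" by (rule E_test(1)[OF test])
  show "dirichlet (v i) (v i) > 0" using nonzero_iff[OF E] nz by simp
  have "norm x < 1" if "v i x ~= 0" for x
  proof -
   have "norm x <= norm (x - c i) + norm (c i - c 0)" using norm_triangle_ineq[of "x - c i" "c i"] by (simp add: c_def)
   also have "... < d + real i * (2 * d)" using supp[OF that] nc[of i 0] by simp
   also have "... <= d + real l * (2 * d)" using i d by simp
   also have "... < 1" by (simp add: d_def field_simps)
   finally show ?thesis .
  qed
  then have eq: "\<mu> i * Q1 x * \<bar>v i x\<bar> powr (2 * p) = \<mu> i * \<bar>v i x\<bar> powr (2 * p)" for x by (cases "v i x = 0") (auto simp: Q1_def)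
  have "(pw (2 * p) (v i)) ~= 0"
  proof
   assume "(pw (2 * p) (v i)) = 0"
   then have "AE x in lborel. \<bar>v i x\<bar> powr (2 * p) = 0"
    by (subst (asm) integral_nonneg_eq_0_iff_AE[OF E_D(3)[OF E]]) auto
   then have "AE x in lborel. v i x = 0" by eventually_elim simp
   then show False using nz by (simp add: nonzero_def)
  qed
  moreover have "(pw (2 * p) (v i)) >= 0" by simp
  ultimately have "(pw (2 * p) (v i)) > 0" by linarith
  then show "potential p (\<mu> i) (v i) > 0" using \<mu>[OF i] unfolding potential_def eq by simp
 next
  fix i j assume "i \<in> {1..l}" "j \<in> {1..l}" "i ~= j"
  have "v i x = 0 \<or> v j x = 0" for x
  proof (rule ccontr)
   assume "\<not> ?thesis"
   then have "norm (c i - c j) < 2 * d"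
    using supp[of i x] supp[of j x] norm_triangle_ineq4[of "x - c j" "x - c i"] by simp
   moreover have "\<bar>real i - real j\<bar> >= 1" using \<open>i ~= j\<close> by linarith
   ultimately show False using d unfolding nc by simp
  qed
  then show "AE x in lborel. v i x * v j x = 0" by auto
 qed
qed

theorem compactness:
 fixes U :: "nat => nat => real^'n => real"
 assumes \<mu>: "!!i. i \<in> {1..l} ==> \<mu> i > (0::real)" and L0: "!!k. \<Lambda> k < 0" and L: "filterlim \<Lambda> at_bot sequentially"
  and U: "!!k. least_energy_solution l p \<mu> (%i j. \<Lambda> k) (U k)" and nn: "!!k. nonnegative l (U k)"
 obtains r u where "strict_mono r"
  "!!i. i \<in> {1..l} ==> u i \<in> E" "!!i. i \<in> {1..l} ==> AE x in lborel. u i x >= 0"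
  "!!i. i \<in> {1..l} ==> (%k. E_norm p (%x. U (r k) i x - u i x)) ----> 0"
  "!!i. i \<in> {1..l} ==> dirichlet (u i) (u i) > 0"
  "!!i. i \<in> {1..l} ==> dirichlet (u i) (u i) = potential p (\<mu> i) (u i)"
  "!!i j. i \<in> {1..l} ==> j \<in> {1..l} ==> i ~= j ==> AE x in lborel. u i x * u j x = 0"
  "!!v. (!!i. i \<in> {1..l} ==> v i \<in> E) ==> (!!i. i \<in> {1..l} ==> dirichlet (v i) (v i) > 0) ==>
   (!!i. i \<in> {1..l} ==> potential p (\<mu> i) (v i) > 0) ==>
   (!!i j. i \<in> {1..l} ==> j \<in> {1..l} ==> i ~= j ==> AE x in lborel. v i x * v j x = 0) ==>
   (\<Sum>i\<in>{1..l}. dirichlet (u i) (u i)) <= (\<Sum>i\<in>{1..l}. psi (dirichlet (v i) (v i)) (potential p (\<mu> i) (v i)))"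
proof -
 let ?A = "%k i. dirichlet (U k i) (U k i)"
 obtain v0 :: "nat => real^'n => real" where v0: "!!i. i \<in> {1..l} ==> v0 i \<in> E" "!!i. i \<in> {1..l} ==> dirichlet (v0 i) (v0 i) > 0"
  "!!i. i \<in> {1..l} ==> potential p (\<mu> i) (v0 i) > 0"
  "!!i j. i \<in> {1..l} ==> j \<in> {1..l} ==> i ~= j ==> AE x in lborel. v0 i x * v0 j x = 0"
  using segregated_tuple_exists[of l \<mu>] \<mu> by blast
 define M where "M = (\<Sum>i\<in>{1..l}. psi (dirichlet (v0 i) (v0 i)) (potential p (\<mu> i) (v0 i)))"
 have "(\<Sum>i\<in>{1..l}. ?A k i) <= M" for k unfolding M_def by (rule energy_le_segregated[OF U v0])
 then have AM: "?A k i <= M" if "i \<in> {1..l}" for k i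
  using member_le_sum[of i "{1..l}" "?A k"] that dirichlet_nonneg by (meson finite_atLeastAtMost order_trans DiffD1)
 have N: "U k \<in> Nehari0 l p \<mu> (%i j. \<Lambda> k)" for k
  using U by (intro solution_Nehari0) (simp add: least_energy_solution_def)
 have UE: "U k i \<in> E" and A0: "?A k i > 0"
  and eq: "?A k i = potential p (\<mu> i) (U k i) + \<Lambda> k * (\<Sum>j\<in>{1..l} - {i}. coupling (U k i) (U k j))" if "i \<in> {1..l}" for k i
  using N[of k, unfolded Nehari0_iff] that by blast+
 have cs: "(\<Sum>j\<in>{1..l} - {i}. coupling (U k i) (U k j)) >= 0" for k i by (intro sum_nonneg coupling_nonneg)
 have Apot: "?A k i <= potential p (\<mu> i) (U k i)" if "i \<in> {1..l}" for k i
  using eq[OF that, of k] mult_nonpos_nonneg[OF less_imp_le[OF L0[of k]] cs[of k i]] by linarith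
 obtain C where C: "C > 0" "!!u. u \<in> E ==> dirichlet u u > 0 ==> mass (ball 0 1) u <= C * dirichlet u u powr p"
  using mass_bound by blast
 have potC: "potential p (\<mu> i) (U k i) <= \<mu> i * C * ?A k i powr p" if "i \<in> {1..l}" for k i
  using order_trans[OF potential_le[OF UE \<mu>] mult_left_mono[OF C(2)[OF UE A0]]] \<mu> that by (simp add: mult.assoc less_imp_le)
 \<comment> \<open>The Nehari inequality and \<open>mass_bound\<close> give
   \<open>1 <= \<mu> i * C\<close> times the energy to the power \<open>p - 1\<close>, so no
   component can disappear in the limit.\<close>
 have Alow: "?A k i >= (1 / (\<mu> i * C)) powr (1 / (p - 1))" if i: "i \<in> {1..l}" for k i
 proof -
  have "?A k i powr (p - 1) * ?A k i = ?A k i powr p" using A0[OF i, of k] powr_add[of "?A k i" "p - 1" 1] by simp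
  then have "?A k i <= \<mu> i * C * ?A k i powr (p - 1) * ?A k i" using Apot[OF i, of k] potC[OF i, of k] by (simp add: mult.assoc)
  then have "1 <= \<mu> i * C * ?A k i powr (p - 1)" using A0[OF i, of k] by simp
  then have "1 / (\<mu> i * C) <= ?A k i powr (p - 1)" using \<mu>[OF i] C(1) by (simp add: field_simps)
  then have "(1 / (\<mu> i * C)) powr (1 / (p - 1)) <= (?A k i powr (p - 1)) powr (1 / (p - 1))"
   using p1 \<mu>[OF i] C(1) by (intro powr_mono2) auto
  then show ?thesis using p1 A0[OF i, of k] by (simp add: powr_powr)
 qed
 \<comment> \<open>Almost everywhere convergence and convergence of the energies both pass to
   subsequences, as \<open>finite_subsequence\<close> requires.\<close>
 define P where "P i r \<longleftrightarrow> (\<exists>w a. w \<in> Bmeas \<and> (AE x in lborel. (%k. U (r k) i x) ----> w x) \<and> (%k. ?A (r k) i) ----> a)" for i and r :: "nat => nat"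
 have "\<exists>r. strict_mono r \<and> (\<forall>i\<in>{1..l}. P i r)"
 proof (rule finite_subsequence)
  fix i and r :: "nat => nat" assume i: "i \<in> {1..l}" and r: "strict_mono r"
  have "(sq (weak_gradient (U (r k) i))) <= M" for k
   using AM[OF i, of "r k"] by (simp add: dirichlet_def power2_norm_eq_inner)
  then obtain s w where s: "strict_mono s" "w \<in> Bmeas" "AE x in lborel. (%k. U (r (s k)) i x) ----> w x"
   using rellich[of "%k. U (r k) i" "%k. weak_gradient (U (r k) i)" M q "(SC * M) powr (q / 2)"] E_D[OF UE[OF i]] Lq_bound[OF E_D12[OF UE[OF i]] AM[OF i]] exponents by auto
  have "bounded (range (%k. ?A (r (s k)) i))" unfolding bounded_iff using AM[OF i] A0[OF i] by (intro exI[of _ M]) (auto simp: less_imp_le)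
  then obtain a t where t: "strict_mono t" "((%k. ?A (r (s k)) i) \<circ> t) ----> a" using bounded_imp_convergent_subsequence by blast
  have "P i (r \<circ> (s \<circ> t))" unfolding P_def
  proof (intro exI conjI)
   show "AE x in lborel. (%k. U ((r \<circ> (s \<circ> t)) k) i x) ----> w x" using s(3)
    by eventually_elim (use LIMSEQ_subseq_LIMSEQ[OF _ t(1)] in \<open>fastforce simp: o_def\<close>)
  qed (use s t in \<open>auto simp: o_def\<close>)
  then show "\<exists>s. strict_mono s \<and> P i (r \<circ> s)" using strict_mono_o[OF s(1) t(1)] by blast
 next
  fix i and r s :: "nat => nat" assume "P i r" and s: "strict_mono s"
  then obtain w a where w: "w \<in> Bmeas" "AE x in lborel. (%k. U (r k) i x) ----> w x" "(%k. ?A (r k) i) ----> a"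
   unfolding P_def by blast
  show "P i (r \<circ> s)" unfolding P_def
  proof (intro exI conjI)
   show "AE x in lborel. (%k. U ((r \<circ> s) k) i x) ----> w x" using w(2)
    by eventually_elim (use LIMSEQ_subseq_LIMSEQ[OF _ s] in \<open>fastforce simp: o_def\<close>)
   show "(%k. ?A ((r \<circ> s) k) i) ----> a" using LIMSEQ_subseq_LIMSEQ[OF w(3) s] by (simp add: o_def)
  qed (rule w)
 qed simp
 then obtain r where r: "strict_mono r" "\<forall>i\<in>{1..l}. P i r" by blast
 then obtain u a where u: "!!i. i \<in> {1..l} ==> u i \<in> Bmeas"
  "!!i. i \<in> {1..l} ==> AE x in lborel. (%k. U (r k) i x) ----> u i x" "!!i. i \<in> {1..l} ==> (%k. ?A (r k) i) ----> a i"
 proof -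
  from r(2) have "\<forall>i\<in>{1..l}. \<exists>w a. w \<in> Bmeas \<and> (AE x in lborel. (%k. U (r k) i x) ----> w x) \<and> (%k. ?A (r k) i) ----> a"
   unfolding P_def by blast
  from bchoice[OF this] obtain u where
   "\<forall>i\<in>{1..l}. \<exists>a. u i \<in> Bmeas \<and> (AE x in lborel. (%k. U (r k) i x) ----> u i x) \<and> (%k. ?A (r k) i) ----> a" by blast
  from bchoice[OF this] that show thesis by blast
 qed
 note lim = component_limit[OF UE u(1,2,3) \<mu> Apot]
 have a0: "a i > 0" if i: "i \<in> {1..l}" for i
 proof -
  have "(1 / (\<mu> i * C)) powr (1 / (p - 1)) <= a i"
   by (rule LIMSEQ_le_const[OF u(3)[OF i]]) (use Alow[OF i] in blast)
  moreover have "(1 / (\<mu> i * C)) powr (1 / (p - 1)) > 0" using \<mu>[OF i] C(1) by simp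
  ultimately show ?thesis by linarith
 qed
 have uE: "u i \<in> E" and ua: "dirichlet (u i) (u i) <= a i" and ap: "a i <= potential p (\<mu> i) (u i)" if "i \<in> {1..l}" for i
  using lim(1-3) that by blast+
 have upos: "dirichlet (u i) (u i) > 0" if i: "i \<in> {1..l}" for i
 proof -
  have "nonzero (u i)" unfolding nonzero_def
  proof
   assume "AE x in lborel. u i x = 0"
   then have "potential p (\<mu> i) (u i) = (LINT x|(lborel::(real^'n) measure). 0)" unfolding potential_def
   proof (intro integral_cong_AE)
    show "AE x in lborel. \<mu> i * Q1 x * \<bar>u i x\<bar> powr (2 * p) = 0" using \<open>AE x in lborel. u i x = 0\<close> by eventually_elim simp
   qed (use u(1)[OF i] in auto)
   then show False using ap[OF i] a0[OF i] by simp
  qed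
  then show ?thesis using nonzero_iff[OF uE[OF i]] by simp
 qed
 \<comment> \<open>The Nehari identity bounds \<open>- \<Lambda>\<close> times the coupling by the
   potential, which is bounded along the sequence; hence the couplings tend to 0 and Fatou
   applies.\<close>
 have seg: "AE x in lborel. u i x * u j x = 0" if ij: "i \<in> {1..l}" "j \<in> {1..l}" "i ~= j" for i j
 proof -
  let ?F = "%k x. \<bar>U (r k) i x\<bar> powr p * \<bar>U (r k) j x\<bar> powr p"
  define K where "K = \<mu> i * C * M powr p"
  have F: "(LBINT x. ?F k x) <= K / (- \<Lambda> (r k))" for k
  proof -
   have "coupling (U (r k) i) (U (r k) j) <= (\<Sum>j\<in>{1..l} - {i}. coupling (U (r k) i) (U (r k) j))"
    using ij by (intro member_le_sum coupling_nonneg) auto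
   then have "- \<Lambda> (r k) * coupling (U (r k) i) (U (r k) j) <= - \<Lambda> (r k) * (\<Sum>j\<in>{1..l} - {i}. coupling (U (r k) i) (U (r k) j))"
    using L0[of "r k"] by (intro mult_left_mono) auto
   also have "... <= potential p (\<mu> i) (U (r k) i)" using eq[OF ij(1), of "r k"] A0[OF ij(1), of "r k"] by simp
   also have "... <= \<mu> i * C * ?A (r k) i powr p" by (rule potC[OF ij(1)])
   also have "... <= K" unfolding K_def using \<mu>[OF ij(1)] C(1) AM[OF ij(1)] A0[OF ij(1), of "r k"] p1
    by (intro mult_left_mono powr_mono2) auto
   finally show ?thesis using L0[of "r k"] by (subst pos_le_divide_eq) (simp_all add: coupling_def mult.commute)
  qed
  have lim0: "(%k. K / (- \<Lambda> (r k))) ----> 0"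
   by (rule tendsto_divide_0[OF tendsto_const])
    (intro filterlim_at_top_imp_at_infinity filterlim_uminus_at_top[THEN iffD1] filterlim_compose[OF L filterlim_subseq[OF r(1)]] filterlim_uminus_at_bot_at_top filterlim_compose[OF filterlim_uminus_at_top_at_bot])
  have aeF: "AE x in lborel. (%k. ?F k x) ----> \<bar>u i x\<bar> powr p * \<bar>u j x\<bar> powr p"
   using u(2)[OF ij(1)] u(2)[OF ij(2)] by eventually_elim (use p1 in \<open>auto intro!: tendsto_mult tendsto_powr' tendsto_rabs\<close>)
  have int: "integrable lborel (%x. \<bar>u i x\<bar> powr p * \<bar>u j x\<bar> powr p)" "(LBINT x. \<bar>u i x\<bar> powr p * \<bar>u j x\<bar> powr p) <= 0"
   by (rule fatou_bound[OF _ _ _ aeF F lim0]; use coupling_integrable[OF UE[OF ij(1)] UE[OF ij(2)]] u(1)[OF ij(1)] u(1)[OF ij(2)] in auto)+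
  have "AE x in lborel. \<bar>u i x\<bar> powr p * \<bar>u j x\<bar> powr p = 0"
   using int(2) integral_nonneg_eq_0_iff_AE[OF int(1)] by (simp add: antisym)
  then show ?thesis by eventually_elim auto
 qed
 have min: "(\<Sum>i\<in>{1..l}. a i) <= (\<Sum>i\<in>{1..l}. psi (dirichlet (v i) (v i)) (potential p (\<mu> i) (v i)))"
  if v: "!!i. i \<in> {1..l} ==> v i \<in> E" "!!i. i \<in> {1..l} ==> dirichlet (v i) (v i) > 0" "!!i. i \<in> {1..l} ==> potential p (\<mu> i) (v i) > 0"
   "!!i j. i \<in> {1..l} ==> j \<in> {1..l} ==> i ~= j ==> AE x in lborel. v i x * v j x = 0" for v
 proof (rule LIMSEQ_le_const2)
  show "(%k. \<Sum>i\<in>{1..l}. ?A (r k) i) ----> (\<Sum>i\<in>{1..l}. a i)" by (intro tendsto_sum u(3))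
  show "\<exists>K. \<forall>k\<ge>K. (\<Sum>i\<in>{1..l}. ?A (r k) i) <= (\<Sum>i\<in>{1..l}. psi (dirichlet (v i) (v i)) (potential p (\<mu> i) (v i)))"
   using energy_le_segregated[OF U v] by blast
 qed
 have pot0: "potential p (\<mu> i) (u i) > 0" if "i \<in> {1..l}" for i using a0[OF that] ap[OF that] by linarith
 note ps = psi_mono[OF upos ua ap]
 have ge: "(\<Sum>i\<in>{1..l}. a i) <= (\<Sum>i\<in>{1..l}. psi (dirichlet (u i) (u i)) (potential p (\<mu> i) (u i)))"
  by (rule min[OF uE upos pot0 seg])
 \<comment> \<open>Each gap between \<open>a i\<close> and the level of the limit is nonnegative,
   and their sum is at most 0 because the limit competes with itself. So all gaps vanish, and the
   equality case of \<open>psi_mono\<close> then identifies the potentials.\<close>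
 have eqs: "psi (dirichlet (u i) (u i)) (potential p (\<mu> i) (u i)) = dirichlet (u i) (u i) \<and> dirichlet (u i) (u i) = a i" if i: "i \<in> {1..l}" for i
 proof -
  let ?f = "%i. a i - psi (dirichlet (u i) (u i)) (potential p (\<mu> i) (u i))"
  have f0: "?f j >= 0" if "j \<in> {1..l}" for j using ps(1)[OF that that that] ua[OF that] by simp
  have "sum ?f {1..l} <= 0" using ge by (simp add: sum_subtractf)
  moreover have "?f i <= sum ?f {1..l}" using i f0 by (intro member_le_sum) auto
  ultimately have "?f i = 0" using f0[OF i] by simp
  then show ?thesis using ps(1)[OF i i i] ua[OF i] by auto
 qed
 then have pe: "potential p (\<mu> i) (u i) = dirichlet (u i) (u i)" if "i \<in> {1..l}" for i using ps(2) that by blast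
 show thesis
 proof (rule that[OF r(1) uE])
  fix i assume i: "i \<in> {1..l}"
  have "AE x in lborel. \<forall>k. U (r k) i x >= 0" using nn i by (simp add: AE_all_countable nonnegative_def)
  then show "AE x in lborel. u i x >= 0" using u(2)[OF i]
   by eventually_elim (use LIMSEQ_le_const in blast)
  show "(%k. E_norm p (%x. U (r k) i x - u i x)) ----> 0"
   using eqs[OF i] pe[OF i] by (intro component_limit(4)[OF UE[OF i] u(1)[OF i] u(2)[OF i] u(3)[OF i] \<mu>[OF i] Apot[OF i]]) simp_all
 qed (use upos pe seg min eqs in auto)
qed

end

subsection \<open>First variations\<close>

lemma abs_powr_has_derivative:
 fixes x :: real assumes r: "r > 1"
 shows "((%x. \<bar>x\<bar> powr r) has_real_derivative (r * (\<bar>x\<bar> powr (r - 2) * x))) (at x)"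
proof (cases "x = 0")
 case True
 have "((%h::real. \<bar>h\<bar> powr (r - 1)) \<longlongrightarrow> 0) (at 0)"
  using r by (intro tendsto_zero_powrI[of _ _ "%_. r - 1" "r - 1"] tendsto_rabs_zero tendsto_ident_at tendsto_const) auto
 then have "((%h::real. (\<bar>0 + h\<bar> powr r - \<bar>0\<bar> powr r) / h) \<longlongrightarrow> 0) (at 0)"
 proof (rule tendsto_0_le[of _ _ _ 1])
  have "norm ((\<bar>0 + h\<bar> powr r - \<bar>0\<bar> powr r) / h) <= norm (\<bar>h\<bar> powr (r - 1)) * 1" if "h ~= 0" for h :: real
   using that by (simp add: powr_diff)
  then show "\<forall>\<^sub>F h in at 0. norm ((\<bar>0 + h\<bar> powr r - \<bar>0\<bar> powr r) / h) <= norm (\<bar>h\<bar> powr (r - 1)) * 1"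
   by (simp add: eventually_at_filter)
 qed
 then show ?thesis using True by (simp add: DERIV_def)
next
 case False
 have pw: "y powr (r - 2) * y = y powr (r - 1)" if "y > 0" for y :: real
  using that powr_add[of y "r - 2" 1] by simp
 show ?thesis
 proof (cases "x > 0")
  case True
  have "((%x. x powr r) has_real_derivative (r * x powr (r - 1))) (at x)"
   by (rule has_real_derivative_powr[OF True])
  then have "((%x. \<bar>x\<bar> powr r) has_real_derivative (r * x powr (r - 1))) (at x)"
   by (rule has_field_derivative_transform_within_open[where S="{0<..}"]) (use True in auto)
  then show ?thesis using True pw by simp
 next
  case neg: False
  with False have x: "- x > 0" by simp
  have "((%x. (- x) powr r) has_real_derivative (r * (- x) powr (r - 1)) * (- 1)) (at x)"
   by (rule DERIV_chain'[where f="%x. - x" and g="%y. y powr r", OF _ has_real_derivative_powr[OF x]]) (auto intro!: derivative_eq_intros)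
  then have "((%x. \<bar>x\<bar> powr r) has_real_derivative (r * (- x) powr (r - 1)) * (- 1)) (at x)"
   by (rule has_field_derivative_transform_within_open[where S="{..<0}"]) (use x in auto)
  moreover have "r * (- x) powr (r - 1) * (- 1) = r * (\<bar>x\<bar> powr (r - 2) * x)" unfolding pw[OF x, symmetric] using x by simp
  ultimately show ?thesis by (simp only:)
 qed
qed

lemma abs_powr_lipschitz:
 fixes x y :: real assumes r: "r > 1" and M: "\<bar>x\<bar> <= M" "\<bar>y\<bar> <= M"
 shows "\<bar>\<bar>x\<bar> powr r - \<bar>y\<bar> powr r\<bar> <= r * M powr (r - 1) * \<bar>x - y\<bar>"
proof -
 have "norm (\<bar>x\<bar> powr r - \<bar>y\<bar> powr r) <= (r * M powr (r - 1)) * norm (x - y)"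
 proof (rule field_differentiable_bound[of "{-M..M}" "%x. \<bar>x\<bar> powr r" "%x. r * (\<bar>x\<bar> powr (r - 2) * x)"])
  fix z assume z: "z \<in> {-M..M}"
  show "((%x. \<bar>x\<bar> powr r) has_field_derivative r * (\<bar>z\<bar> powr (r - 2) * z)) (at z within {-M..M})"
   by (rule has_field_derivative_at_within[OF abs_powr_has_derivative[OF r]])
  have "\<bar>z\<bar> powr (r - 2) * \<bar>z\<bar> = \<bar>z\<bar> powr (r - 1)"
   using powr_add[of "\<bar>z\<bar>" "r - 2" 1] by (cases "z = 0") auto
  also have "... <= M powr (r - 1)" using z r by (intro powr_mono2) auto
  finally show "norm (r * (\<bar>z\<bar> powr (r - 2) * z)) <= r * M powr (r - 1)" using r by (simp add: abs_mult)
 qed (use M in auto)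
 then show ?thesis by simp
qed

text \<open>The recursion lemma of De Giorgi iteration. The ratio \<open>\<theta>\<close> solves
  \<open>(b * \<theta>) powr s = \<theta>\<close>, so the geometric bound
  \<open>Y * \<theta> ^ n\<close> reproduces itself once the start is small enough.\<close>

lemma fast_convergence:
 fixes y :: "nat => real"
 assumes y: "!!n. y n >= 0" "!!n. y (Suc n) <= (c * b ^ n * y n) powr s" and Y: "y 0 <= Y" "Y > 0"
  and s: "s > 1" and b: "b > 1" and c: "c >= 0" "(c * Y) powr s <= Y * b powr (- s / (s - 1))"
 shows "y ----> 0"
proof -
 define \<theta> where "\<theta> = b powr (- s / (s - 1))"
 have \<theta>: "0 < \<theta>" "\<theta> < 1" using b s by (auto simp: \<theta>_def powr_less_one)
 have "(b * \<theta>) powr s = b powr s * b powr ((- s / (s - 1)) * s)" using b \<theta> unfolding \<theta>_def powr_powr[symmetric] by (intro powr_mult)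
 also have "... = b powr (s + (- s / (s - 1)) * s)" by (simp only: powr_add)
 also have "s + (- s / (s - 1)) * s = - s / (s - 1)" using s by (simp add: field_simps)
 finally have b\<theta>: "(b * \<theta>) powr s = \<theta>" by (simp add: \<theta>_def)
 have le: "y n <= Y * \<theta> ^ n" for n
 proof (induction n)
  case (Suc n)
  have "y (Suc n) <= (c * b ^ n * (Y * \<theta> ^ n)) powr s"
   using y[of n] Suc c b s by (intro order_trans[OF y(2)] powr_mono2 mult_left_mono) auto
  also have "c * b ^ n * (Y * \<theta> ^ n) = (c * Y) * (b * \<theta>) ^ n" by (simp add: power_mult_distrib)
  also have "... powr s = (c * Y) powr s * ((b * \<theta>) powr s) ^ n"
   using c Y b \<theta> by (simp add: powr_mult flip: powr_realpow powr_powr) (simp add: powr_powr mult.commute)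
  also have "... <= (Y * \<theta>) * \<theta> ^ n" unfolding b\<theta> using c(2) \<theta> by (intro mult_right_mono) (auto simp: \<theta>_def)
  finally show ?case by simp
 qed (use Y in auto)
 have "(%n. Y * \<theta> ^ n) ----> Y * 0" using \<theta> by (intro tendsto_mult_left LIMSEQ_realpow_zero) auto
 then show ?thesis
  by (intro tendsto_sandwich[OF always_eventually[OF allI[OF y(1)]] always_eventually[OF allI[OF le]] tendsto_const]) simp
qed

context subcritical begin

text \<open>First order expansion of \<open>psi\<close> at a diagonal point, uniform over
  perturbations up to size \<open>K * t\<close>. Families of competitors thus only have to depend on
  \<open>t\<close> with a linear bound at 0.\<close>

lemma psi_upper:
 assumes A: "A > 0" and e: "e > 0" and K: "K >= 0"
 shows "\<forall>\<^sub>F t in at_right 0. \<forall>\<alpha> \<beta>. \<bar>\<alpha>\<bar> <= K * t --> \<bar>\<beta>\<bar> <= K * t --> psi (A + \<alpha>) (A + \<beta>) <= A + (p * \<alpha> - \<beta>) / (p - 1) + e * t"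
proof -
 have c: "((%_::real\<times>real. r) has_derivative (%_. 0)) F" for r :: real and F by (rule has_derivative_const)
 have 1: "((%z. fst z powr r) has_derivative (%h. fst (A, A) powr r * (0 * ln (fst (A, A)) + fst h * r / fst (A, A)))) (at (A, A))" for r
  by (rule has_derivative_powr[OF has_derivative_fst[OF has_derivative_ident] c]) (use A in auto)
 have 2: "((%z. snd z powr r) has_derivative (%h. snd (A, A) powr r * (0 * ln (snd (A, A)) + snd h * r / snd (A, A)))) (at (A, A))" for r
  by (rule has_derivative_powr[OF has_derivative_snd[OF has_derivative_ident] c]) (use A in auto)
 have AA: "A powr (p / (p - 1)) * A powr (- 1 / (p - 1)) = A"
  unfolding powr_add[symmetric] using p1 A by (simp add: add_divide_distrib[symmetric] flip: diff_divide_distrib)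
 have "((%z. psi (fst z) (snd z)) has_derivative (%h. (p * fst h - snd h) / (p - 1))) (at (A, A))"
 proof (rule has_derivative_eq_rhs)
  show "((%z. psi (fst z) (snd z)) has_derivative (%h. fst (A, A) powr (p / (p - 1)) * (snd (A, A) powr (- 1 / (p - 1)) * (0 * ln (snd (A, A)) + snd h * (- 1 / (p - 1)) / snd (A, A)))
   + fst (A, A) powr (p / (p - 1)) * (0 * ln (fst (A, A)) + fst h * (p / (p - 1)) / fst (A, A)) * snd (A, A) powr (- 1 / (p - 1)))) (at (A, A))"
   unfolding psi_def by (rule has_derivative_mult[OF 1 2])
  show "(%h. fst (A, A) powr (p / (p - 1)) * (snd (A, A) powr (- 1 / (p - 1)) * (0 * ln (snd (A, A)) + snd h * (- 1 / (p - 1)) / snd (A, A)))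
   + fst (A, A) powr (p / (p - 1)) * (0 * ln (fst (A, A)) + fst h * (p / (p - 1)) / fst (A, A)) * snd (A, A) powr (- 1 / (p - 1))) = (%h. (p * fst h - snd h) / (p - 1))"
  proof
   fix h :: "real \<times> real"
   have "fst (A, A) powr (p / (p - 1)) * (snd (A, A) powr (- 1 / (p - 1)) * (0 * ln (snd (A, A)) + snd h * (- 1 / (p - 1)) / snd (A, A)))
   + fst (A, A) powr (p / (p - 1)) * (0 * ln (fst (A, A)) + fst h * (p / (p - 1)) / fst (A, A)) * snd (A, A) powr (- 1 / (p - 1))
    = (A powr (p / (p - 1)) * A powr (- 1 / (p - 1))) * ((p * fst h - snd h) / (p - 1) / A)"
    by (simp add: algebra_simps add_divide_distrib diff_divide_distrib)
   then show "fst (A, A) powr (p / (p - 1)) * (snd (A, A) powr (- 1 / (p - 1)) * (0 * ln (snd (A, A)) + snd h * (- 1 / (p - 1)) / snd (A, A)))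
   + fst (A, A) powr (p / (p - 1)) * (0 * ln (fst (A, A)) + fst h * (p / (p - 1)) / fst (A, A)) * snd (A, A) powr (- 1 / (p - 1))
    = (p * fst h - snd h) / (p - 1)" unfolding AA using A by simp
  qed
 qed
 then have "\<forall>e>0. \<exists>d>0. \<forall>y. norm (y - (A, A)) < d --> norm (psi (fst y) (snd y) - psi (fst (A, A)) (snd (A, A)) - (p * fst (y - (A, A)) - snd (y - (A, A))) / (p - 1)) <= e * norm (y - (A, A))"
  unfolding has_derivative_at_alt by blast
 moreover have "e / (2 * K + 1) > 0" using e K by simp
 ultimately obtain d where d: "d > 0" and D: "!!y. norm (y - (A, A)) < d ==> norm (psi (fst y) (snd y) - psi (fst (A, A)) (snd (A, A)) - (p * fst (y - (A, A)) - snd (y - (A, A))) / (p - 1)) <= e / (2 * K + 1) * norm (y - (A, A))"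
  by blast
 have "psi (A + \<alpha>) (A + \<beta>) <= A + (p * \<alpha> - \<beta>) / (p - 1) + e * t" if t: "0 < t" "t < d / (2 * K + 1)" and ab: "\<bar>\<alpha>\<bar> <= K * t" "\<bar>\<beta>\<bar> <= K * t" for t \<alpha> \<beta>
 proof -
  have n: "norm (\<alpha>, \<beta>) <= (2 * K + 1) * t" using norm_Pair_le[of \<alpha> \<beta>] ab t(1) by (simp add: algebra_simps)
  also have "... < d" using t(2) K by (simp add: field_simps)
  finally have "norm ((A + \<alpha>, A + \<beta>) - (A, A)) < d" by simp
  from D[OF this] have "\<bar>psi (A + \<alpha>) (A + \<beta>) - A - (p * \<alpha> - \<beta>) / (p - 1)\<bar> <= e / (2 * K + 1) * norm (\<alpha>, \<beta>)"
   using AA by (simp add: psi_def)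
  also have "... <= e / (2 * K + 1) * ((2 * K + 1) * t)" using n e K by (intro mult_left_mono) auto
  also have "... = e * t" using K by simp
  finally show ?thesis by simp
 qed
 moreover have "d / (2 * K + 1) > 0" using d K by simp
 ultimately show ?thesis unfolding eventually_at_right_field by blast
qed

lemma power_integrable:
 assumes "u \<in> E" "h \<in> E" shows "integrable lborel (%x. (\<bar>u x\<bar> + \<bar>h x\<bar>) powr (2 * p))"
 using integrable_powr_diff(1)[of "2 * p" "%x. \<bar>u x\<bar>" lborel "%x. - \<bar>h x\<bar>"] E_D(1,3)[OF assms(1)] E_D(1,3)[OF assms(2)] p1 by simp

text \<open>The factor \<open>\<bar>t\<bar>\<close> is split off so that difference quotients have a
  bound independent of \<open>t\<close>.\<close>

lemma power_difference:
 assumes "\<bar>t\<bar> <= 1"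
 shows "\<bar>\<bar>a + t * b\<bar> powr (2 * p) - \<bar>a\<bar> powr (2 * p)\<bar> <= \<bar>t\<bar> * (2 * p * (\<bar>a\<bar> + \<bar>b\<bar>) powr (2 * p))"
proof -
 let ?M = "\<bar>a\<bar> + \<bar>b\<bar>"
 have tb: "\<bar>t * b\<bar> <= \<bar>b\<bar>" using assms by (simp add: abs_mult mult_left_le_one_le)
 have "\<bar>\<bar>a + t * b\<bar> powr (2 * p) - \<bar>a\<bar> powr (2 * p)\<bar> <= 2 * p * ?M powr (2 * p - 1) * \<bar>a + t * b - a\<bar>"
  using p1 tb by (intro abs_powr_lipschitz) auto
 also have "... <= 2 * p * ?M powr (2 * p - 1) * (\<bar>t\<bar> * ?M)" using p1 by (intro mult_left_mono) (auto simp: abs_mult mult_left_mono)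
 also have "... = \<bar>t\<bar> * (2 * p * (?M powr (2 * p - 1) * ?M powr 1))" by simp
 also have "... = \<bar>t\<bar> * (2 * p * ?M powr (2 * p))" unfolding powr_add[symmetric] by simp
 finally show ?thesis .
qed

text \<open>The derivative of the potential in direction \<open>h\<close>, divided by
  \<open>2 * p\<close>.\<close>

definition force :: "real => (real^'n => real) => (real^'n => real) => real" where
 "force m u h = (LBINT x. m * Q1 x * (\<bar>u x\<bar> powr (2 * p - 2) * u x) * h x)"

lemma potential_derivative:
 assumes u: "u \<in> E" and h: "h \<in> E" and s: "s ----> 0" "!!n. 0 < s n" "!!n. s n <= 1"
 shows "(%n. (potential p m (%x. u x + s n * h x) - potential p m u) / s n) ----> 2 * p * force m u h"
  and "integrable lborel (%x. m * Q1 x * (\<bar>u x\<bar> powr (2 * p - 2) * u x) * h x)"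
proof -
 note [measurable] = E_D(1)[OF u] E_D(1)[OF h]
 let ?F = "%n x. m * Q1 x * ((\<bar>u x + s n * h x\<bar> powr (2 * p) - \<bar>u x\<bar> powr (2 * p)) / s n)"
 let ?w = "%x. \<bar>m\<bar> * (2 * p * (\<bar>u x\<bar> + \<bar>h x\<bar>) powr (2 * p))"
 let ?G = "%x. m * Q1 x * (2 * p * (\<bar>u x\<bar> powr (2 * p - 2) * u x) * h x)"
 have wi: "integrable lborel ?w" using power_integrable[OF u h] by simp
 have lim: "(%n. ?F n x) ----> ?G x" for x
 proof -
  have "((%t. \<bar>u x + t * h x\<bar> powr (2 * p)) has_real_derivative (2 * p * (\<bar>u x + 0 * h x\<bar> powr (2 * p - 2) * (u x + 0 * h x)) * h x)) (at 0)"
   by (rule DERIV_chain'[where f="%t. u x + t * h x" and g="%y. \<bar>y\<bar> powr (2 * p)", OF _ abs_powr_has_derivative]) (use p1 in \<open>auto intro!: derivative_eq_intros\<close>)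
  then have "((%t. (\<bar>u x + t * h x\<bar> powr (2 * p) - \<bar>u x\<bar> powr (2 * p)) / t) \<longlongrightarrow> 2 * p * (\<bar>u x\<bar> powr (2 * p - 2) * u x) * h x) (at 0)"
   by (simp add: DERIV_def)
  moreover have "filterlim s (at 0) sequentially" using s(1,2) by (simp add: filterlim_at less_imp_neq[THEN not_sym] always_eventually)
  ultimately have "(%n. (\<bar>u x + s n * h x\<bar> powr (2 * p) - \<bar>u x\<bar> powr (2 * p)) / s n) ----> 2 * p * (\<bar>u x\<bar> powr (2 * p - 2) * u x) * h x"
   by (rule filterlim_compose)
  then show ?thesis by (intro tendsto_mult_left)
 qed
 have bd: "norm (?F n x) <= ?w x" for n x
 proof -
  have "norm (?F n x) = \<bar>m\<bar> * (\<bar>\<bar>u x + s n * h x\<bar> powr (2 * p) - \<bar>u x\<bar> powr (2 * p)\<bar> / s n)"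
   using s(2)[of n] by (simp add: abs_mult Q1_abs)
  also have "... <= ?w x" using power_difference[of "s n" "u x" "h x"] s(2,3)[of n]
   by (intro mult_left_mono) (auto simp: divide_le_eq mult_ac)
  finally show ?thesis .
 qed
 have F: "(LBINT x. ?F n x) = (potential p m (%x. u x + s n * h x) - potential p m u) / s n" for n
 proof -
  have "(LBINT x. ?F n x) = (LBINT x. (m * Q1 x * \<bar>u x + s n * h x\<bar> powr (2 * p) - m * Q1 x * \<bar>u x\<bar> powr (2 * p)) / s n)"
   by (intro Bcong refl) (simp add: right_diff_distrib)
  then show ?thesis using potential_integrable[OF u, of m] potential_integrable[OF E_add(1)[OF u E_cmult(1)[OF h, of "s n"]], of m]
   by (simp add: potential_def)
 qed
 have Gi: "integrable lborel ?G"
  by (rule integrable_dominated_convergence[where w="?w" and s="?F"]) (use wi lim bd in \<open>auto simp del: abs_mult\<close>)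
 have L: "(%n. \<integral>x. ?F n x \<partial>lborel) ----> (LBINT x. ?G x)"
  by (rule integral_dominated_convergence[where w="?w"]) (use wi lim bd in \<open>auto simp del: abs_mult\<close>)
 have e: "?G x = 2 * p * (m * Q1 x * (\<bar>u x\<bar> powr (2 * p - 2) * u x) * h x)" for x by simp
 show "integrable lborel (%x. m * Q1 x * (\<bar>u x\<bar> powr (2 * p - 2) * u x) * h x)" using Gi p1 unfolding e by simp
 show "(%n. (potential p m (%x. u x + s n * h x) - potential p m u) / s n) ----> 2 * p * force m u h"
  using L unfolding F e by (simp add: force_def)
qed

end

text \<open>The properties of the limit that \<open>compactness\<close> delivers, detached from the
  approximating sequence.\<close>

locale minimal_partition = subcritical p q dim for p q and dim :: "'n::finite itself" +
 fixes S :: "'i set" and \<mu> :: "'i => real" and u :: "'i => real^'n => real"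
 assumes S: "finite S" and \<mu>: "!!i. i \<in> S ==> \<mu> i > 0" and uE: "!!i. i \<in> S ==> u i \<in> E"
  and nn: "!!i. i \<in> S ==> AE x in lborel. u i x >= 0" and pos: "!!i. i \<in> S ==> dirichlet (u i) (u i) > 0"
  and pot: "!!i. i \<in> S ==> potential p (\<mu> i) (u i) = dirichlet (u i) (u i)"
  and seg: "!!i j. i \<in> S ==> j \<in> S ==> i ~= j ==> AE x in lborel. u i x * u j x = 0"
  and minimal: "!!v. (!!i. i \<in> S ==> v i \<in> E) ==> (!!i. i \<in> S ==> dirichlet (v i) (v i) > 0) ==>
   (!!i. i \<in> S ==> potential p (\<mu> i) (v i) > 0) ==>
   (!!i j. i \<in> S ==> j \<in> S ==> i ~= j ==> AE x in lborel. v i x * v j x = 0) ==>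
   (\<Sum>i\<in>S. dirichlet (u i) (u i)) <= (\<Sum>i\<in>S. psi (dirichlet (v i) (v i)) (potential p (\<mu> i) (v i)))"
begin

text \<open>Minimality compares the levels of the competitor with the total energy, and
  \<open>psi_upper\<close> linearises them; \<open>pot\<close> makes the base points diagonal.
  Multiplication by \<open>p - 1\<close> removes the denominator.\<close>

lemma variation:
 assumes T: "T > 0" and e: "e > 0" and K: "K >= 0"
  and v: "!!t j. 0 < t ==> t <= T ==> j \<in> S ==> v t j \<in> E"
   "!!t j. 0 < t ==> t <= T ==> j \<in> S ==> \<bar>dirichlet (v t j) (v t j) - dirichlet (u j) (u j)\<bar> <= K * t"
   "!!t j. 0 < t ==> t <= T ==> j \<in> S ==> \<bar>potential p (\<mu> j) (v t j) - potential p (\<mu> j) (u j)\<bar> <= K * t"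
   "!!t i j. 0 < t ==> t <= T ==> i \<in> S ==> j \<in> S ==> i ~= j ==> AE x in lborel. v t i x * v t j x = 0"
 shows "\<forall>\<^sub>F t in at_right 0. (\<Sum>j\<in>S. p * (dirichlet (v t j) (v t j) - dirichlet (u j) (u j)) - (potential p (\<mu> j) (v t j) - potential p (\<mu> j) (u j))) >= - e * t"
proof -
 let ?A = "%j. dirichlet (u j) (u j)"
 let ?a = "%t j. dirichlet (v t j) (v t j) - ?A j" and ?b = "%t j. potential p (\<mu> j) (v t j) - ?A j"
 define e' where "e' = e / ((p - 1) * (real (card S) + 1))"
 have e': "e' > 0" using e p1 by (simp add: e'_def)
 have "\<forall>\<^sub>F t in at_right 0. \<forall>\<alpha> \<beta>. \<bar>\<alpha>\<bar> <= K * t --> \<bar>\<beta>\<bar> <= K * t --> psi (?A j + \<alpha>) (?A j + \<beta>) <= ?A j + (p * \<alpha> - \<beta>) / (p - 1) + e' * t" if "j \<in> S" for j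
  by (rule psi_upper[OF pos[OF that] e' K])
 then have 1: "\<forall>\<^sub>F t in at_right 0. \<forall>j\<in>S. \<forall>\<alpha> \<beta>. \<bar>\<alpha>\<bar> <= K * t --> \<bar>\<beta>\<bar> <= K * t --> psi (?A j + \<alpha>) (?A j + \<beta>) <= ?A j + (p * \<alpha> - \<beta>) / (p - 1) + e' * t"
  by (intro eventually_ball_finite[OF S] ballI)
 have "((%t. K * t) \<longlongrightarrow> 0) (at_right 0)" by (rule tendsto_mult_right_zero) (rule tendsto_ident_at)
 then have "\<forall>\<^sub>F t in at_right 0. K * t < ?A j" if "j \<in> S" for j by (rule order_tendstoD(2)) (rule pos[OF that])
 then have 2: "\<forall>\<^sub>F t in at_right 0. \<forall>j\<in>S. K * t < ?A j" by (intro eventually_ball_finite[OF S] ballI)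
 have 3: "\<forall>\<^sub>F t in at_right 0. 0 < t \<and> t <= T"
  unfolding eventually_at_right_field using T by (intro exI[of _ T]) auto
 from 1 2 3 show ?thesis
 proof eventually_elim
  case (elim t)
  then have t: "0 < t" "t <= T" by auto
  note v = v[OF t]
  have a: "\<bar>?a t j\<bar> <= K * t" "\<bar>?b t j\<bar> <= K * t" if "j \<in> S" for j using v(2,3)[OF that] pot[OF that] by auto
  have "(\<Sum>j\<in>S. ?A j) <= (\<Sum>j\<in>S. psi (dirichlet (v t j) (v t j)) (potential p (\<mu> j) (v t j)))"
   by (rule minimal[OF v(1) _ _ v(4)]) (use a elim(2) in fastforce)+
  also have "... <= (\<Sum>j\<in>S. ?A j + (p * ?a t j - ?b t j) / (p - 1) + e' * t)"
  proof (rule sum_mono)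
   fix j assume j: "j \<in> S"
   then have "psi (?A j + ?a t j) (?A j + ?b t j) <= ?A j + (p * ?a t j - ?b t j) / (p - 1) + e' * t" using elim(1) a by blast
   then show "psi (dirichlet (v t j) (v t j)) (potential p (\<mu> j) (v t j)) <= ?A j + (p * ?a t j - ?b t j) / (p - 1) + e' * t" by simp
  qed
  also have "... = (\<Sum>j\<in>S. ?A j) + (\<Sum>j\<in>S. p * ?a t j - ?b t j) / (p - 1) + real (card S) * (e' * t)"
   by (simp only: sum.distrib sum_divide_distrib sum_constant)
  finally have "- ((p - 1) * real (card S) * e' * t) <= (\<Sum>j\<in>S. p * ?a t j - ?b t j)"
   using p1 by (simp add: field_simps)
  moreover have "(p - 1) * real (card S) * e' * t <= e * t"
  proof (rule mult_right_mono)
   have "(p - 1) * real (card S) * e' = e * (real (card S) / (real (card S) + 1))" using p1 by (simp add: e'_def)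
   also have "... <= e" using e by (intro mult_left_le) auto
   finally show "(p - 1) * real (card S) * e' <= e" .
  qed (use t in simp)
  ultimately show ?case using pot by (simp add: sum_subtractf)
 qed
qed

text \<open>Adding \<open>t * h\<close> to the \<open>i\<close>-th component keeps the tuple
  segregated. The condition on \<open>h\<close> is also satisfied by \<open>- h\<close>, which
  yields the reverse inequality when it is wanted.\<close>

lemma one_sided:
 assumes i: "i \<in> S" and h: "h \<in> E" and sh: "!!j. j \<in> S ==> j ~= i ==> AE x in lborel. u j x * h x = 0"
 shows "force (\<mu> i) (u i) h <= dirichlet (u i) h"
proof -
 let ?s = "%n. 1 / real (Suc n)"
 define v where "v t = u(i := (%x. u i x + t * h x))" for t :: real
 define D where "D = (LBINT x. (\<bar>u i x\<bar> + \<bar>h x\<bar>) powr (2 * p))"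
 define K where "K = 2 * \<bar>dirichlet (u i) h\<bar> + dirichlet h h + \<mu> i * (2 * p * D)"
 have D0: "D >= 0" by (simp add: D_def)
 have sq: "dirichlet (%x. u i x + t * h x) (%x. u i x + t * h x) - dirichlet (u i) (u i) = t * (2 * dirichlet (u i) h + t * dirichlet h h)" for t
  using dirichlet_square_add[OF uE[OF i] h] by (simp add: algebra_simps power2_eq_square)
 have K1: "2 * \<bar>dirichlet (u i) h\<bar> + dirichlet h h <= K" "\<mu> i * (2 * p * D) <= K" "K >= 0"
  using \<mu>[OF i] p1 D0 dirichlet_nonneg[of h] by (auto simp: K_def)
 have 1: "\<bar>dirichlet (%x. u i x + t * h x) (%x. u i x + t * h x) - dirichlet (u i) (u i)\<bar> <= K * t" if t: "0 < t" "t <= 1" for t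
 proof -
  have "\<bar>2 * dirichlet (u i) h + t * dirichlet h h\<bar> <= 2 * \<bar>dirichlet (u i) h\<bar> + t * dirichlet h h"
   using dirichlet_nonneg[of h] t by (intro order_trans[OF abs_triangle_ineq]) (simp add: abs_mult)
  also have "... <= K" using K1(1) mult_right_mono[OF t(2) dirichlet_nonneg[of h]] by simp
  finally show ?thesis unfolding sq using t by (simp add: abs_mult mult.commute mult_left_mono)
 qed
 have 2: "\<bar>potential p (\<mu> i) (%x. u i x + t * h x) - potential p (\<mu> i) (u i)\<bar> <= K * t" if t: "0 < t" "t <= 1" for t
 proof -
  note I = potential_integrable[OF E_add(1)[OF uE[OF i] E_cmult(1)[OF h, of t]], of "\<mu> i"] potential_integrable[OF uE[OF i], of "\<mu> i"]
  have eq: "potential p (\<mu> i) (%x. u i x + t * h x) - potential p (\<mu> i) (u i) = (LBINT x. \<mu> i * Q1 x * \<bar>u i x + t * h x\<bar> powr (2 * p) - \<mu> i * Q1 x * \<bar>u i x\<bar> powr (2 * p))"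
   unfolding potential_def using I by simp
  have "\<bar>potential p (\<mu> i) (%x. u i x + t * h x) - potential p (\<mu> i) (u i)\<bar> <= (LBINT x. \<mu> i * (t * (2 * p * (\<bar>u i x\<bar> + \<bar>h x\<bar>) powr (2 * p))))"
   unfolding eq
  proof (rule integral_abs_bound[THEN order_trans], rule integral_mono)
   show "integrable lborel (%x. \<bar>\<mu> i * Q1 x * \<bar>u i x + t * h x\<bar> powr (2 * p) - \<mu> i * Q1 x * \<bar>u i x\<bar> powr (2 * p)\<bar>)"
    using I by simp
   show "integrable lborel (%x. \<mu> i * (t * (2 * p * (\<bar>u i x\<bar> + \<bar>h x\<bar>) powr (2 * p))))" using power_integrable[OF uE[OF i] h] by simp
   fix x
   have "\<bar>\<mu> i * Q1 x * \<bar>u i x + t * h x\<bar> powr (2 * p) - \<mu> i * Q1 x * \<bar>u i x\<bar> powr (2 * p)\<bar> = \<mu> i * \<bar>\<bar>u i x + t * h x\<bar> powr (2 * p) - \<bar>u i x\<bar> powr (2 * p)\<bar>"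
    using \<mu>[OF i] by (simp add: abs_mult Q1_abs flip: right_diff_distrib)
   also have "... <= \<mu> i * (t * (2 * p * (\<bar>u i x\<bar> + \<bar>h x\<bar>) powr (2 * p)))"
    using power_difference[of t "u i x" "h x"] t \<mu>[OF i] by (intro mult_left_mono) auto
   finally show "\<bar>\<mu> i * Q1 x * \<bar>u i x + t * h x\<bar> powr (2 * p) - \<mu> i * Q1 x * \<bar>u i x\<bar> powr (2 * p)\<bar> <= \<mu> i * (t * (2 * p * (\<bar>u i x\<bar> + \<bar>h x\<bar>) powr (2 * p)))" .
  qed
  also have "... = \<mu> i * (2 * p * D) * t"  by (simp add: D_def)
  also have "... <= K * t" using K1(2) t by (intro mult_right_mono) auto
  finally show ?thesis .
 qed
 have sg: "AE x in lborel. v t j x * v t k x = 0" if "j \<in> S" "k \<in> S" "j ~= k" for t j k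
 proof -
  have "AE x in lborel. v t i x * v t k x = 0" if k: "k \<in> S" "k ~= i" for k
   using seg[OF i k(1)] sh[OF k] k(2) by (auto simp: v_def distrib_right mult.commute elim!: eventually_elim2)
  then show ?thesis using that seg[of j k] by (cases "j = i"; cases "k = i") (auto simp: v_def mult.commute)
 qed
 have main: "2 * p * dirichlet (u i) h - 2 * p * force (\<mu> i) (u i) h >= - e" if e: "e > 0" for e
 proof -
  have ev: "\<forall>\<^sub>F t in at_right 0. (\<Sum>j\<in>S. p * (dirichlet (v t j) (v t j) - dirichlet (u j) (u j)) - (potential p (\<mu> j) (v t j) - potential p (\<mu> j) (u j))) >= - e * t"
   by (rule variation[OF zero_less_one e K1(3)]) (use 1 2 sg K1(3) uE E_add(1)[OF uE[OF i] E_cmult(1)[OF h]] in \<open>auto simp: v_def\<close>)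
  have sum: "(\<Sum>j\<in>S. p * (dirichlet (v t j) (v t j) - dirichlet (u j) (u j)) - (potential p (\<mu> j) (v t j) - potential p (\<mu> j) (u j)))
   = p * (t * (2 * dirichlet (u i) h + t * dirichlet h h)) - (potential p (\<mu> i) (%x. u i x + t * h x) - potential p (\<mu> i) (u i))" for t
   unfolding sum.remove[OF S i] sq[symmetric] by (simp add: v_def)
  have fl: "filterlim ?s (at_right 0) sequentially"
   using moll_seq by (intro tendsto_imp_filterlim_at_right) (auto simp: always_eventually)
  have "\<forall>\<^sub>F n in sequentially. p * (2 * dirichlet (u i) h + ?s n * dirichlet h h) - (potential p (\<mu> i) (%x. u i x + ?s n * h x) - potential p (\<mu> i) (u i)) / ?s n >= - e"
   using filterlim_iff[THEN iffD1, OF fl, rule_format, OF ev]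
  proof eventually_elim
   case (elim n)
   define s where "s = ?s n"
   have s: "s > 0" using moll_seq(2) by (simp add: s_def)
   have "- e * s <= p * (s * (2 * dirichlet (u i) h + s * dirichlet h h)) - (potential p (\<mu> i) (%x. u i x + s * h x) - potential p (\<mu> i) (u i))"
    using elim unfolding sum s_def .
   then show ?case unfolding s_def[symmetric] using s by (simp add: field_simps)
  qed
  moreover have "(%n. p * (2 * dirichlet (u i) h + ?s n * dirichlet h h) - (potential p (\<mu> i) (%x. u i x + ?s n * h x) - potential p (\<mu> i) (u i)) / ?s n)
   ----> p * (2 * dirichlet (u i) h + 0 * dirichlet h h) - 2 * p * force (\<mu> i) (u i) h"
   by (intro tendsto_intros moll_seq(1) potential_derivative(1)[OF uE[OF i] h]) (auto simp: divide_le_eq)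
  ultimately show ?thesis using tendsto_lowerbound[of _ _ sequentially "- e"] by (fastforce simp: mult_ac)
 qed
 have "2 * p * dirichlet (u i) h - 2 * p * force (\<mu> i) (u i) h >= 0"
  by (rule field_le_epsilon) (use main in fastforce)
 then have "0 <= 2 * p * (dirichlet (u i) h - force (\<mu> i) (u i) h)" by (simp add: right_diff_distrib)
 then show ?thesis using p1 by (simp add: zero_le_mult_iff)
qed

end

context subcritical begin

section \<open>Ingredients of the iteration and of the shifted competitor\<close>

lemma dirichlet_cong_AE:
 assumes "u \<in> E" "v \<in> E" "w \<in> E" "AE x in lborel. u x = v x"
 shows "dirichlet u w = dirichlet v w"
 by (subst dirichlet_cong[OF assms(1,3) _ AE_I2[OF refl] E_D(6)[OF assms(2)] E_D(6)[OF assms(3)]])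
  (use E_cong_AE(2)[OF assms(2) E_D(1)[OF assms(1)]] assms(4) in \<open>auto simp: dirichlet_def eq_commute elim: eventually_mono\<close>)

text \<open>Mixed terms vanish by segregation, so the signed function carries the total energy. A
  whole tuple can then be varied through one function.\<close>

lemma dirichlet_sum_segregated:
 assumes I: "finite I" "i \<in> I" and w: "!!j. j \<in> I ==> w j \<in> E"
  and sg: "!!j k. j \<in> I ==> k \<in> I ==> j ~= k ==> AE x in lborel. w j x * w k x = 0"
 defines "f \<equiv> (%x. w i x - (\<Sum>j\<in>I - {i}. w j x))"
 shows "dirichlet f f = (\<Sum>j\<in>I. dirichlet (w j) (w j))"
proof -
 define g where "g = (%x. \<Sum>j\<in>I - {i}. w j x)"
 have gE: "g \<in> E" unfolding g_def using I w by (intro E_sum) auto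
 have z: "dirichlet (w j) (w k) = 0" if "j \<in> I" "k \<in> I" "j ~= k" for j k by (intro dirichlet_segregated w sg that)
 have gl: "dirichlet g h = (\<Sum>j\<in>I - {i}. dirichlet (w j) h)" if "h \<in> E" for h
  unfolding g_def using I w that by (intro dirichlet_sum_left) auto
 have "dirichlet (w i) g = 0" using gl[OF w[OF I(2)]] z[OF _ I(2)] by (simp add: dirichlet_sym[of _ g])
 moreover have "dirichlet (w j) g = dirichlet (w j) (w j)" if "j \<in> I - {i}" for j
 proof -
  have "dirichlet g (w j) = (\<Sum>k\<in>I - {i}. dirichlet (w k) (w j))" by (rule gl[OF w]) (use that in auto)
  also have "... = (\<Sum>k\<in>I - {i}. if k = j then dirichlet (w j) (w j) else 0)"
   by (intro sum.cong refl) (use that z in auto)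
  finally show ?thesis using I that by (simp add: dirichlet_sym[of _ g])
 qed
 then have "dirichlet g g = (\<Sum>j\<in>I - {i}. dirichlet (w j) (w j))" using gl[OF gE] by simp
 moreover have "f = (%x. w i x - g x)" by (simp add: f_def g_def)
 ultimately show ?thesis using dirichlet_square_diff[OF w[OF I(2)] gE] sum.remove[OF I, of "%j. dirichlet (w j) (w j)"] by simp
qed

text \<open>The truncation levels of the iteration, rising from \<open>K\<close> to
  \<open>2 * K\<close>.\<close>

lemma level_props:
 fixes K :: real assumes "K >= 0"
 shows "0 <= K * (2 - 1 / 2 ^ n)" "K * (2 - 1 / 2 ^ n) <= 2 * K" "K * (2 - 1 / 2 ^ n) <= K * (2 - 1 / 2 ^ Suc n)"
proof -
 have "1 / 2 ^ n <= (1::real)" "1 / 2 ^ n >= (0::real)" "1 / 2 ^ Suc n <= (1 / 2 ^ n :: real)" by (simp_all add: divide_simps)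
 then have "0 <= (2 - 1 / 2 ^ n :: real)" "2 - 1 / 2 ^ n <= (2::real)" "2 - 1 / 2 ^ n <= (2 - 1 / 2 ^ Suc n :: real)" by linarith+
 from this[THEN mult_left_mono[OF _ assms]] show "0 <= K * (2 - 1 / 2 ^ n)" "K * (2 - 1 / 2 ^ n) <= 2 * K" "K * (2 - 1 / 2 ^ n) <= K * (2 - 1 / 2 ^ Suc n)"
  by (simp_all only: mult_zero_right mult.commute[of K 2])
qed

text \<open>Above level \<open>n + 1\<close> the excess \<open>w\<close> over level \<open>n\<close>
  is at least \<open>K / 2 ^ (n + 1)\<close>. This gives \<open>a <= 8 * 2 ^ n * w\<close>, and the
  negative power \<open>2 * p - q\<close> of \<open>w\<close> can be bounded at that lower end. The
  growth in \<open>n\<close> is the geometric factor of \<open>fast_convergence\<close>.\<close>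

lemma level_bound:
 fixes a K :: real and n :: nat
 defines "k \<equiv> %n. K * (2 - 1 / 2 ^ n)"
 assumes K: "K > 0" and a: "a > k (Suc n)"
 shows "a powr (2 * p) <= 2 powr (4 * p + q) * K powr (2 * p - q) * (2 powr q) ^ n * (a - k n) powr q"
proof -
 let ?N = "2 ^ n :: real"
 define w where "w = a - k n"
 define W where "W = K * 2 powr (- (real n + 1))"
 have "2 * ?N = 2 powr (real n + 1)" by (simp add: powr_add powr_realpow)
 then have N: "2 powr (- (real n + 1)) = 1 / (2 * ?N)" by (simp only: powr_minus_divide)
 have W': "W = K / (2 * ?N)" unfolding W_def N by simp
 have W: "W > 0" using K by (simp add: W_def)
 have "k (Suc n) - k n = W" by (simp add: k_def W' field_simps)
 then have w: "w >= W" "w > 0" using a W by (auto simp: w_def)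
 have "2 * K = 4 * ?N * W" by (simp add: W')
 moreover have "k n <= 2 * K" using K by (simp add: k_def)
 moreover have "4 * ?N * W <= 4 * ?N * w" using w by (intro mult_left_mono) auto
 moreover have "a = w + k n" by (simp add: w_def)
 ultimately have "a <= w + 4 * ?N * w" by linarith
 also have "... = (1 + 4 * ?N) * w" by (simp add: algebra_simps)
 also have "... <= (8 * ?N) * w"
 proof (rule mult_right_mono)
  have "?N >= 1" by simp
  then show "1 + 4 * ?N <= 8 * ?N" by linarith
 qed (use w in simp)
 also have "8 * ?N = 2 powr (real n + 3)" by (simp add: powr_add powr_realpow)
 finally have aw: "a <= 2 powr (real n + 3) * w" .
 have "k (Suc n) >= 0" unfolding k_def using K by (intro level_props) simp
 then have a0: "a > 0" using a by simp
 have "a powr (2 * p) <= (2 powr (real n + 3) * w) powr (2 * p)" using aw a0 p1 by (intro powr_mono2) auto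
 also have "... = 2 powr ((real n + 3) * (2 * p)) * w powr (2 * p - q + q)" by (simp add: powr_mult powr_powr)
 also have "... = 2 powr ((real n + 3) * (2 * p)) * (w powr (2 * p - q) * w powr q)" by (simp only: powr_add)
 also have "... <= 2 powr ((real n + 3) * (2 * p)) * (W powr (2 * p - q) * w powr q)"
  using w W exponents by (intro mult_left_mono mult_right_mono powr_mono2') auto
 also have "W powr (2 * p - q) = K powr (2 * p - q) * 2 powr (- (real n + 1) * (2 * p - q))" by (simp add: W_def powr_mult powr_powr)
 also have "2 powr ((real n + 3) * (2 * p)) * ((K powr (2 * p - q) * 2 powr (- (real n + 1) * (2 * p - q))) * w powr q)
  = (2 powr ((real n + 3) * (2 * p)) * 2 powr (- (real n + 1) * (2 * p - q))) * K powr (2 * p - q) * w powr q" by simp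
 also have "2 powr ((real n + 3) * (2 * p)) * 2 powr (- (real n + 1) * (2 * p - q)) = 2 powr ((4 * p + q) + q * real n)"
  unfolding powr_add[symmetric] by (simp add: algebra_simps)
 also have "... = 2 powr (4 * p + q) * (2 powr q) ^ n" by (simp add: powr_add powr_powr flip: powr_realpow)
 finally show ?thesis by (simp add: w_def mult_ac)
qed

text \<open>\<open>Q1 <= 1\<close> and the sign of \<open>u\<close> and \<open>h\<close> leave an
  integrand bounded by the essential bound \<open>K\<close> of \<open>u\<close>.\<close>

lemma force_le:
 assumes u: "u \<in> E" and h: "h \<in> E" and m: "m > 0" and ub: "AE x in lborel. 0 <= u x \<and> u x <= K"
  and hb: "AE x in lborel. 0 <= h x \<and> h x <= f x" and f: "integrable lborel f" and C: "m * K powr (2 * p - 1) <= C"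
 shows "force m u h <= C * (LBINT x. f x)"
proof -
 have "force m u h <= (LBINT x. C * f x)" unfolding force_def
 proof (rule integral_mono_AE)
  show "integrable lborel (%x. m * Q1 x * (\<bar>u x\<bar> powr (2 * p - 2) * u x) * h x)"
   by (rule potential_derivative(2)[OF u h moll_seq]) (simp add: divide_le_eq)
  show "AE x in lborel. m * Q1 x * (\<bar>u x\<bar> powr (2 * p - 2) * u x) * h x <= C * f x" using ub hb
  proof eventually_elim
   case (elim x)
   have "\<bar>u x\<bar> powr (2 * p - 2) * u x = u x powr (2 * p - 1)"
    using elim powr_add[of "u x" "2 * p - 2" 1] by (cases "u x = 0") auto
   also have "... <= K powr (2 * p - 1)" using elim p1 by (intro powr_mono2) auto
   finally have le: "\<bar>u x\<bar> powr (2 * p - 2) * u x <= K powr (2 * p - 1)" .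
   have "m * Q1 x * (\<bar>u x\<bar> powr (2 * p - 2) * u x) * h x <= m * 1 * (\<bar>u x\<bar> powr (2 * p - 2) * u x) * h x"
    using elim m by (intro mult_right_mono mult_left_mono) (auto simp: Q1_def)
   also have "... <= m * 1 * K powr (2 * p - 1) * h x" using elim m le by (intro mult_right_mono mult_left_mono) auto
   also have "... <= C * f x" using elim C m by (intro mult_mono) (auto intro: order_trans[rotated])
   finally show ?case .
  qed
 qed (use f in simp)
 then show ?thesis by simp
qed

end

text \<open>At one point at most one \<open>a j\<close> is nonzero, so the signed value is
  \<open>a i\<close> or \<open>- a k\<close>. Adding \<open>c\<close> and splitting by sign gives
  \<open>b\<close>; the cases are whether some component other than \<open>i\<close> is positive
  there.\<close>

lemma segregated_shift:
 fixes a :: "'i => real"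
 assumes I: "finite I" "i \<in> I" and a: "!!j. j \<in> I ==> a j >= 0" "!!j k. j \<in> I ==> k \<in> I ==> j ~= k ==> a j * a k = 0" and c: "c >= 0"
 defines "b \<equiv> %j. if j = i then max 0 (a i - (\<Sum>j\<in>I - {i}. a j) + c) else a j - min (a j) c"
 shows "!!j. j \<in> I ==> 0 <= b j \<and> \<bar>b j - a j\<bar> <= c" "!!j k. j \<in> I ==> k \<in> I ==> j ~= k ==> b j * b k = 0"
  "a i - (\<Sum>j\<in>I - {i}. a j) + c = b i - (\<Sum>j\<in>I - {i}. b j)"
proof -
 have *: "(\<forall>j\<in>I. 0 <= b j \<and> \<bar>b j - a j\<bar> <= c) \<and> (\<forall>j\<in>I. \<forall>k\<in>I. j ~= k --> b j * b k = 0) \<and>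
  a i - (\<Sum>j\<in>I - {i}. a j) + c = b i - (\<Sum>j\<in>I - {i}. b j)"
 proof (cases "\<forall>j\<in>I - {i}. a j = 0")
  case True
  then have "(\<Sum>j\<in>I - {i}. a j) = 0" "(\<Sum>j\<in>I - {i}. b j) = 0" and b: "b j = (if j = i then a i + c else 0)" if "j \<in> I" for j
   using c a(1)[OF I(2)] that by (auto simp: b_def intro!: sum.neutral)
  then show ?thesis using True a(1)[OF I(2)] c I(2) by auto
 next
  case False
  then obtain k where k: "k \<in> I" "k ~= i" "a k ~= 0" by blast
  have z: "a j = 0" if "j \<in> I" "j ~= k" for j using a(2)[OF that(1) k(1) that(2)] k(3) by simp
  have fin: "finite (I - {i})" "k \<in> I - {i}" using I k by auto
  have "(\<Sum>j\<in>I - {i}. a j) = a k" using sum.remove[OF fin, of a] z by simp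
  then have bi: "b i = max 0 (c - a k)" using z[OF I(2)] k(2) by (simp add: b_def)
  have bk: "b k = a k - min (a k) c" using k(2) by (simp add: b_def)
  have b0: "b j = 0" if "j \<in> I" "j ~= i" "j ~= k" for j using z[OF that(1,3)] that(2) c by (simp add: b_def)
  have "(\<Sum>j\<in>I - {i}. b j) = b k" using sum.remove[OF fin, of b] b0 by simp
  moreover have "0 <= b j \<and> \<bar>b j - a j\<bar> <= c" if "j \<in> I" for j
   using b0[OF that] z[OF that] a(1)[OF k(1)] c bi bk z[OF I(2)] k(2) by (cases "j = i"; cases "j = k") auto
  moreover have "b i * b k = 0" using bi bk a(1)[OF k(1)] by auto
  then have "b j * b j' = 0" if "j \<in> I" "j' \<in> I" "j ~= j'" for j j' using b0[OF that(1)] b0[OF that(2)] that(3) by (metis mult.commute mult_zero_left)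
  moreover have "a i - a k + c = b i - b k" using bi bk z[OF I(2)] k(2) by auto
  ultimately show ?thesis using \<open>(\<Sum>j\<in>I - {i}. a j) = a k\<close> by simp
 qed
 show "!!j. j \<in> I ==> 0 <= b j \<and> \<bar>b j - a j\<bar> <= c" using conjunct1[OF *] by blast
 show "!!j k. j \<in> I ==> k \<in> I ==> j ~= k ==> b j * b k = 0" using conjunct1[OF conjunct2[OF *]] by blast
 show "a i - (\<Sum>j\<in>I - {i}. a j) + c = b i - (\<Sum>j\<in>I - {i}. b j)" by (rule conjunct2[OF conjunct2[OF *]])
qed

context minimal_partition begin

text \<open>De Giorgi iteration. As \<open>2p < q\<close>, a large initial level makes the iteration start small.\<close>

lemma component_bounded:
 assumes i: "i \<in> S" obtains K where "K >= 0" "AE x in lborel. u i x <= K"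
proof -
 define Y where "Y = (pw q (u i)) + 1"
 have Y: "Y > 0" by (simp add: Y_def add_nonneg_pos)
 define G where "G = SC * (\<mu> i * 2 powr (4 * p + q))"
 have G: "G > 0" using SC_pos \<mu>[OF i] by (simp add: G_def)
 let ?\<theta> = "(2 powr q) powr (- (q / 2) / (q / 2 - 1))"
 \<comment> \<open>As \<open>2 * p - q < 0\<close>, the smallness condition of
   \<open>fast_convergence\<close> holds for large \<open>K\<close>: its starting value is bounded
   by \<open>Y\<close>, which does not depend on \<open>K\<close>.\<close>
 have "((%K. (G * K powr (2 * p - q) * Y) powr (q / 2)) \<longlongrightarrow> 0) at_top"
 proof (rule tendsto_zero_powrI[OF _ tendsto_const])
  have "((%K. G * K powr (2 * p - q) * Y) \<longlongrightarrow> G * 0 * Y) at_top"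
   by (intro tendsto_intros tendsto_neg_powr filterlim_ident) (use exponents in auto)
  then show "((%K. G * K powr (2 * p - q) * Y) \<longlongrightarrow> 0) at_top" by simp
 qed (use exponents G Y in auto)
 then have "\<forall>\<^sub>F K in at_top. (G * K powr (2 * p - q) * Y) powr (q / 2) < Y * ?\<theta>"
  by (rule order_tendstoD(2)) (use Y in simp)
 then have "\<forall>\<^sub>F K in at_top. 0 < K \<and> (G * K powr (2 * p - q) * Y) powr (q / 2) < Y * ?\<theta>"
  using eventually_gt_at_top[of 0] by eventually_elim auto
 then obtain K where K: "K > 0" "(G * K powr (2 * p - q) * Y) powr (q / 2) < Y * ?\<theta>"
  using eventually_happens'[OF trivial_limit_at_top_linorder] by blast
 define k where "k n = K * (2 - 1 / 2 ^ n)" for n :: nat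
 define w where "w n = (%x. max 0 (u i x - k n))" for n
 have k0: "k n >= 0" "k n <= 2 * K" and k1: "k n <= k (Suc n)" for n
  unfolding k_def using level_props[OF less_imp_le[OF K(1)]] by blast+
 have wE: "w n \<in> E" for n unfolding w_def by (rule E_trunc(1)[OF uE[OF i] k0(1)])
 define y where "y n = (pw q (w n))" for n
 let ?c = "G * K powr (2 * p - q)"
 have step: "y (Suc n) <= (?c * (2 powr q) ^ n * y n) powr (q / 2)" for n
 proof -
  let ?D = "\<mu> i * (2 powr (4 * p + q) * K powr (2 * p - q) * (2 powr q) ^ n)"
  have "dirichlet (w (Suc n)) (w (Suc n)) = dirichlet (u i) (w (Suc n))"
   unfolding dirichlet_def
  proof (rule integral_cong_AE)
   show "AE x in lborel. weak_gradient (w (Suc n)) x \<bullet> weak_gradient (w (Suc n)) x = weak_gradient (u i) x \<bullet> weak_gradient (w (Suc n)) x"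
    using E_trunc(2)[OF uE[OF i] k0(1), of "Suc n"] unfolding w_def by eventually_elim auto
  qed (use E_D(6)[OF uE[OF i]] E_D(6)[OF wE] in auto)
  also have "... <= force (\<mu> i) (u i) (w (Suc n))"
  proof -
   \<comment> \<open>The negative truncation vanishes where \<open>u i = 0\<close>, hence wherever
     another component lives, and is admissible.\<close>
   have "force (\<mu> i) (u i) (%x. - 1 * w (Suc n) x) <= dirichlet (u i) (%x. - 1 * w (Suc n) x)"
   proof (rule one_sided[OF i E_cmult(1)[OF wE]])
    fix j assume j: "j \<in> S" "j ~= i"
    show "AE x in lborel. u j x * (- 1 * w (Suc n) x) = 0" using seg[OF j(1) i j(2)] nn[OF i]
     by eventually_elim (use k0(1)[of "Suc n"] in \<open>auto simp: w_def\<close>)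
   qed
   then show ?thesis using dirichlet_cmult_left[OF wE[of "Suc n"] uE[OF i], of "- 1"]
    by (simp add: dirichlet_sym[of "u i"] force_def)
  qed
  also have "... <= (LBINT x. ?D * \<bar>w n x\<bar> powr q)" unfolding force_def
  proof (rule integral_mono_AE)
   show "integrable lborel (%x. \<mu> i * Q1 x * (\<bar>u i x\<bar> powr (2 * p - 2) * u i x) * w (Suc n) x)"
    by (rule potential_derivative(2)[OF uE[OF i] wE moll_seq]) (simp add: divide_le_eq)
   show "AE x in lborel. \<mu> i * Q1 x * (\<bar>u i x\<bar> powr (2 * p - 2) * u i x) * w (Suc n) x <= ?D * \<bar>w n x\<bar> powr q" using nn[OF i]
   proof eventually_elim
    case (elim x)
    show ?case
    proof (cases "u i x > k (Suc n)")
     case True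
     then have ux: "u i x > 0" using k0(1)[of "Suc n"] by linarith
     have "\<mu> i * Q1 x * (\<bar>u i x\<bar> powr (2 * p - 2) * u i x) * w (Suc n) x <= \<mu> i * 1 * (\<bar>u i x\<bar> powr (2 * p - 2) * u i x) * w (Suc n) x"
      using ux \<mu>[OF i] by (intro mult_right_mono mult_left_mono) (auto simp: Q1_def w_def)
     also have "... <= \<mu> i * 1 * (\<bar>u i x\<bar> powr (2 * p - 2) * u i x) * u i x"
      using ux \<mu>[OF i] True k0(1)[of "Suc n"] by (intro mult_left_mono) (auto simp: Q1_def w_def intro: mult_nonneg_nonneg)
     also have "... = \<mu> i * (u i x powr (2 * p - 2) * u i x powr 1 * u i x powr 1)" using ux by simp
     also have "... = \<mu> i * u i x powr (2 * p)" unfolding powr_add[symmetric] by simp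
     also have "... <= \<mu> i * (2 powr (4 * p + q) * K powr (2 * p - q) * (2 powr q) ^ n * (u i x - k n) powr q)"
      using level_bound[OF K(1) True[unfolded k_def]] \<mu>[OF i] unfolding k_def by (intro mult_left_mono) auto
     also have "u i x - k n = \<bar>w n x\<bar>" using True k1[of n] by (simp add: w_def)
     finally show ?thesis by (simp add: mult.assoc)
    qed (use \<mu>[OF i] in \<open>simp add: w_def\<close>)
   qed
  qed (use E_D(2)[OF wE] in simp)
  also have "... = ?D * y n" by (simp add: y_def)
  finally show ?thesis using Lq_bound[OF E_D12[OF wE[of "Suc n"]], of "?D * y n"] by (simp add: y_def G_def mult_ac)
 qed
 have y0: "y n >= 0" for n by (simp add: y_def)
 have mono: "\<bar>max 0 (u i x - c)\<bar> powr q <= \<bar>max 0 (u i x - d)\<bar> powr q" if "d <= c" for x c d using that exponents by (intro powr_mono2) auto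
 have "y ----> 0"
 proof (rule fast_convergence[OF y0 step _ Y])
  have "y 0 <= (pw q (u i))" unfolding y_def
   using E_D(2)[OF wE] E_D(2)[OF uE[OF i]] nn[OF i] k0(1)[of 0] exponents
   by (intro integral_mono_AE) (auto simp: w_def elim!: eventually_mono intro!: powr_mono2)
  then show "y 0 <= Y" by (simp add: Y_def)
  show "1 < 2 powr q" using exponents by (simp add: gr_one_powr)
 qed (use exponents G K in auto)
 moreover have TE: "(%x. max 0 (u i x - 2 * K)) \<in> E" by (rule E_trunc(1)[OF uE[OF i]]) (use K in simp)
 have "(pw q (%x. max 0 (u i x - 2 * K))) <= y n" for n
  unfolding y_def by (rule integral_mono[OF E_D(2)[OF TE] E_D(2)[OF wE]]) (unfold w_def, rule mono[OF k0(2)])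
 ultimately have "(pw q (%x. max 0 (u i x - 2 * K))) <= 0" by (intro LIMSEQ_le_const) auto
 then have "(pw q (%x. max 0 (u i x - 2 * K))) = 0" by (intro antisym) auto
 then have "AE x in lborel. \<bar>max 0 (u i x - 2 * K)\<bar> powr q = 0"
  by (subst (asm) integral_nonneg_eq_0_iff_AE[OF E_D(2)[OF TE]]) auto
 then have "AE x in lborel. u i x <= 2 * K" by eventually_elim auto
 then show thesis using that[of "2 * K"] K(1) by simp
qed

lemma uniform_bound:
 obtains K where "K >= 0" "!!i. i \<in> S ==> AE x in lborel. 0 <= u i x \<and> u i x <= K"
proof -
 have "\<forall>i\<in>S. \<exists>K. K >= 0 \<and> (AE x in lborel. u i x <= K)" using component_bounded by metis
 from bchoice[OF this] obtain K where K: "!!i. i \<in> S ==> K i >= 0" "!!i. i \<in> S ==> AE x in lborel. u i x <= K i" by blast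
 have "AE x in lborel. 0 <= u i x \<and> u i x <= sum K S" if i: "i \<in> S" for i
  using K(2)[OF i] nn[OF i] member_le_sum[OF i _ S, of K] K(1) by (auto elim!: eventually_elim2)
 then show thesis using that[of "sum K S"] K(1) by (simp add: sum_nonneg)
qed

text \<open>Admissible variations vanish where \<open>u i = 0\<close>, so \<open>\<phi>\<close> is
  replaced by its minimum with \<open>n * u i\<close>. Where the minimum is \<open>n * u i\<close>,
  the gradient product is \<open>n\<close> times a square and is dropped. As \<open>n\<close> grows,
  that region shrinks to part of the zero set, where the gradient vanishes.\<close>

lemma component_subsol:
 assumes i: "i \<in> S" and K: "K >= 0" "!!i. i \<in> S ==> AE x in lborel. 0 <= u i x \<and> u i x <= K" and C: "\<mu> i * K powr (2 * p - 1) <= C"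
 shows "subsol C (u i) (weak_gradient (u i))"
 unfolding subsol_def
proof (intro conjI ballI impI)
 show "is_weak_gradient (u i) (weak_gradient (u i))" by (rule E_D(4)[OF uE[OF i]])
 show "C >= 0" using C \<mu>[OF i] by (intro order_trans[OF _ C]) auto
 show "\<exists>B. AE x in lborel. \<bar>u i x\<bar> <= B" using K(2)[OF i] by (intro exI[of _ K]) (auto elim: eventually_mono)
 fix \<phi> :: "real^'n => real" assume \<phi>: "\<phi> \<in> TF" and \<phi>0: "\<forall>x. \<phi> x >= 0"
 have \<phi>E: "\<phi> \<in> E" by (rule E_test(1)[OF \<phi>])
 note [measurable] = E_D(1)[OF uE[OF i]] E_D(6)[OF uE[OF i]] E_D(1)[OF \<phi>E] E_D(6)[OF \<phi>E]
 let ?h = "%n x. min (\<phi> x) (real n * u i x)" and ?G = "%x. weak_gradient (u i) x \<bullet> weak_gradient \<phi> x"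
 let ?F = "%n x. if \<phi> x > real n * u i x then 0 else ?G x"
 have hE: "?h n \<in> E" for n by (rule E_min(1)[OF \<phi>E E_cmult(1)[OF uE[OF i]]])
 have Gi: "integrable lborel ?G" by (rule dirichlet_integrable[OF uE[OF i] \<phi>E])
 have Fi: "integrable lborel (?F n)" for n by (rule Bbound[OF Gi]) auto
 have le: "(LBINT x. ?F n x) <= C * (LBINT x. \<phi> x)" for n
 proof -
  have "(LBINT x. ?F n x) <= dirichlet (u i) (?h n)" unfolding dirichlet_def
  proof (rule integral_mono_AE[OF Fi dirichlet_integrable[OF uE[OF i] hE]])
   show "AE x in lborel. ?F n x <= weak_gradient (u i) x \<bullet> weak_gradient (?h n) x"
    using E_min(2)[OF \<phi>E E_cmult(1)[OF uE[OF i], of "real n"]] E_cmult(2)[OF uE[OF i], of "real n"]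
    by eventually_elim auto
  qed
  also have "... <= force (\<mu> i) (u i) (?h n)"
  proof -
   have "force (\<mu> i) (u i) (%x. - 1 * ?h n x) <= dirichlet (u i) (%x. - 1 * ?h n x)"
   proof (rule one_sided[OF i E_cmult(1)[OF hE]])
    fix j assume j: "j \<in> S" "j ~= i"
    show "AE x in lborel. u j x * (- 1 * ?h n x) = 0" using seg[OF j(1) i j(2)] by eventually_elim (use \<phi>0 in auto)
   qed
   then show ?thesis using dirichlet_cmult_left[OF hE[of n] uE[OF i], of "- 1"]
    by (simp add: dirichlet_sym[of "u i"] force_def)
  qed
  also have "... <= C * (LBINT x. \<phi> x)"
   by (rule force_le[OF uE[OF i] hE \<mu>[OF i] K(2)[OF i] _ test_integrable[OF \<phi>] C])
    (use K(2)[OF i] \<phi>0 in \<open>auto elim!: eventually_mono\<close>)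
  finally show ?thesis .
 qed
 have "(%n. \<integral>x. ?F n x \<partial>lborel) ----> (LBINT x. ?G x)"
 proof (rule integral_dominated_convergence[where w="%x. \<bar>?G x\<bar>"])
  show "AE x in lborel. (%n. ?F n x) ----> ?G x" using K(2)[OF i] weak_gradient_zero_set[OF E_D(4)[OF uE[OF i]]]
  proof eventually_elim
   case (elim x)
   show ?case
   proof (cases "u i x = 0")
    case False
    then have "u i x > 0" using elim by simp
    then obtain N :: nat where N: "\<phi> x / u i x < real N" using reals_Archimedean2 by blast
    have "?F n x = ?G x" if "n >= N" for n
    proof -
     have "\<phi> x < real N * u i x" using N \<open>u i x > 0\<close> by (simp add: divide_less_eq)
     also have "... <= real n * u i x" using that \<open>u i x > 0\<close> by simp
     finally show ?thesis by simp
    qed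
    then show ?thesis by (intro tendsto_eventually eventually_sequentiallyI[of N])
   qed (use elim in simp)
  qed
 qed (use Gi in auto)
 then have "(LBINT x. ?G x) <= C * (LBINT x. \<phi> x)" by (rule LIMSEQ_le_const2) (use le in auto)
 also have "(LBINT x. ?G x) = (LBINT x. weak_gradient (u i) x \<bullet> grad \<phi> x)"
  by (rule integral_cong_AE) (use E_test(2)[OF \<phi>] borel_measurable_continuous_onI[OF smooth_grad_continuous[OF test_smooth[OF \<phi>]]] in \<open>auto elim!: eventually_mono\<close>)
 finally show "(LBINT x. weak_gradient (u i) x \<bullet> grad \<phi> x) <= C * (LBINT x. \<phi> x)" .
qed

end

context minimal_partition begin

text \<open>
 Competitor: the positive part of \<open>u\<^sub>i - \<Sum>\<^sub>j u\<^sub>j + t \<phi>\<close> in the \<open>i\<close>-th component and of \<open>u\<^sub>j - t \<phi>\<close> in the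
 others. Its total Dirichlet energy is that of \<open>u\<^sub>i - \<Sum>\<^sub>j u\<^sub>j + t \<phi>\<close>.
\<close>

lemma hat_subsol:
 assumes i: "i \<in> S" and K: "K >= 0" "!!i. i \<in> S ==> AE x in lborel. 0 <= u i x \<and> u i x <= K"
 defines "w \<equiv> (%x. (\<Sum>j\<in>S - {i}. u j x) - u i x)"
 shows "subsol (sum \<mu> S * (K + 1) powr (2 * p - 1)) w (weak_gradient w)"
 unfolding subsol_def
proof (intro conjI ballI impI)
 \<comment> \<open>Lipschitz constant of the power \<open>2 * p\<close> for values up to
   \<open>K + 1\<close>.\<close>
 let ?D = "2 * p * (K + 1) powr (2 * p - 1)"
 have \<mu>s: "sum \<mu> S >= 0" by (intro sum_nonneg) (use \<mu> in force)
 have sE: "(%x. \<Sum>j\<in>S - {i}. u j x) \<in> E" by (intro E_sum) (use S uE in auto)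
 have wE: "w \<in> E" unfolding w_def by (rule E_diff(1)[OF sE uE[OF i]])
 show "is_weak_gradient w (weak_gradient w)" by (rule E_D(4)[OF wE])
 show "sum \<mu> S * (K + 1) powr (2 * p - 1) >= 0" using \<mu>s by simp
 have ab: "AE x in lborel. \<forall>j\<in>S. 0 <= u j x \<and> u j x <= K" by (rule AE_finite_allI[OF S K(2)])
 then show "\<exists>B. AE x in lborel. \<bar>w x\<bar> <= B"
 proof (intro exI, eventually_elim)
  case (elim x)
  have "0 <= (\<Sum>j\<in>S - {i}. u j x)" "(\<Sum>j\<in>S - {i}. u j x) <= (\<Sum>j\<in>S - {i}. K)"
   using elim by (intro sum_nonneg sum_mono; auto)+
  then show "\<bar>w x\<bar> <= (\<Sum>j\<in>S - {i}. K) + K" using elim i K(1) by (auto simp: w_def abs_le_iff)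
 qed
 fix \<phi> :: "real^'n => real" assume \<phi>: "\<phi> \<in> TF" and \<phi>0: "\<forall>x. \<phi> x >= 0"
 have \<phi>E: "\<phi> \<in> E" by (rule E_test(1)[OF \<phi>])
 have \<phi>i: "integrable lborel \<phi>" by (rule test_integrable[OF \<phi>])
 define f where "f = (%x. u i x - (\<Sum>j\<in>S - {i}. u j x))"
 have fE: "f \<in> E" unfolding f_def by (rule E_diff(1)[OF uE[OF i] sE])
 define m where "m t j = (%x. min (u j x) (t * \<phi> x))" for t j
 define v where "v t j = (if j = i then (%x. max 0 (f x + t * \<phi> x)) else (%x. u j x - m t j x))" for t j
 obtain M where M: "!!x. \<bar>\<phi> x\<bar> <= M" using test_bounded[OF \<phi>] by auto
 have M0: "M >= 0" using M[of 0] by linarith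
 \<comment> \<open>Until this time \<open>t * \<phi> <= 1\<close>, so the competitor stays below
   \<open>K + 1\<close> and the constant \<open>?D\<close> applies.\<close>
 define T where "T = 1 / (M + 1)"
 have T: "0 < T" "T <= 1" and T\<phi>: "T * \<phi> x <= 1" for x
 proof -
  show "0 < T" "T <= 1" using M0 by (auto simp: T_def)
  show "T * \<phi> x <= 1" using M[of x] M0 by (simp add: T_def divide_le_eq)
 qed
 have t\<phi>: "t * \<phi> x <= 1" if "t <= T" for t x using mult_right_mono[OF that, of "\<phi> x"] \<phi>0 T\<phi>[of x] by simp
 have mE: "m t j \<in> E" if "j \<in> S" for t j unfolding m_def by (rule E_min(1)[OF uE[OF that] E_cmult(1)[OF \<phi>E]])
 have f\<phi>E: "(%x. f x + t * \<phi> x) \<in> E" for t by (rule E_add(1)[OF fE E_cmult(1)[OF \<phi>E]])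
 have vE: "v t j \<in> E" if "j \<in> S" for t j
  unfolding v_def using E_pos(1)[OF f\<phi>E] E_diff(1)[OF uE[OF that] mE[OF that]] by simp
 have sg: "AE x in lborel. \<forall>j\<in>S. \<forall>k\<in>S. j ~= k --> u j x * u k x = 0"
  using seg by (intro AE_finite_allI[OF S]) (auto intro: AE_finite_allI[OF S])
 have shift: "AE x in lborel. (\<forall>j\<in>S. 0 <= v t j x \<and> \<bar>v t j x - u j x\<bar> <= t * \<phi> x) \<and> (\<forall>j\<in>S. \<forall>k\<in>S. j ~= k --> v t j x * v t k x = 0) \<and>
  f x + t * \<phi> x = v t i x - (\<Sum>j\<in>S - {i}. v t j x)" if t: "t > 0" for t
  using ab sg
 proof eventually_elim
  case (elim x)
  have e: "(%j. if j = i then max 0 (u i x - (\<Sum>j\<in>S - {i}. u j x) + t * \<phi> x) else u j x - min (u j x) (t * \<phi> x)) = (%j. v t j x)"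
   by (auto simp: v_def f_def m_def fun_eq_iff)
  have c: "0 <= t * \<phi> x" using t \<phi>0 by simp
  note s = segregated_shift[OF S i _ _ c, of "%j. u j x"]
  note s = s(1)[unfolded e[THEN fun_cong]] s(2)[unfolded e[THEN fun_cong]] s(3)[unfolded e[THEN fun_cong]]
  from elim show ?case by (intro conjI ballI impI) (use s in \<open>auto simp: f_def\<close>)
 qed
 have vseg: "AE x in lborel. v t j x * v t k x = 0" if "t > 0" "j \<in> S" "k \<in> S" "j ~= k" for t j k
  using shift[OF that(1)] by eventually_elim (use that in auto)
 \<comment> \<open>The competitor is \<open>f + t * \<phi>\<close> split into its components, so its
   total energy is exactly quadratic in \<open>t\<close>.\<close>
 have totalA: "(\<Sum>j\<in>S. dirichlet (v t j) (v t j)) = (\<Sum>j\<in>S. dirichlet (u j) (u j)) + (2 * t * dirichlet f \<phi> + t\<^sup>2 * dirichlet \<phi> \<phi>)" if t: "t > 0" for t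
 proof -
  let ?g = "%x. v t i x - (\<Sum>j\<in>S - {i}. v t j x)"
  have gE: "?g \<in> E" by (intro E_diff vE i E_sum) (use S in auto)
  have ae: "AE x in lborel. f x + t * \<phi> x = ?g x" using shift[OF t] by eventually_elim simp
  have "dirichlet (%x. f x + t * \<phi> x) (%x. f x + t * \<phi> x) = dirichlet ?g (%x. f x + t * \<phi> x)"
   by (rule dirichlet_cong_AE[OF f\<phi>E gE f\<phi>E ae])
  also have "... = dirichlet (%x. f x + t * \<phi> x) ?g" by (rule dirichlet_sym)
  also have "... = dirichlet ?g ?g" by (rule dirichlet_cong_AE[OF f\<phi>E gE gE ae])
  also have "... = (\<Sum>j\<in>S. dirichlet (v t j) (v t j))"
   by (rule dirichlet_sum_segregated[OF S i vE vseg[OF t]])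
  moreover have "dirichlet f f = (\<Sum>j\<in>S. dirichlet (u j) (u j))" unfolding f_def
   by (rule dirichlet_sum_segregated[OF S i uE seg])
  ultimately show ?thesis using dirichlet_square_add[OF fE \<phi>E, of t] by simp
 qed
 have pot_diff: "\<bar>potential p (\<mu> j) (v t j) - potential p (\<mu> j) (u j)\<bar> <= \<mu> j * ?D * t * (LBINT x. \<phi> x)" if t: "0 < t" "t <= T" and j: "j \<in> S" for t j
 proof -
  note I = potential_integrable[OF vE[OF j], of "\<mu> j" t] potential_integrable[OF uE[OF j], of "\<mu> j"]
  have eq: "potential p (\<mu> j) (v t j) - potential p (\<mu> j) (u j) = (LBINT x. \<mu> j * Q1 x * \<bar>v t j x\<bar> powr (2 * p) - \<mu> j * Q1 x * \<bar>u j x\<bar> powr (2 * p))"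
   unfolding potential_def using I by simp
  have "\<bar>potential p (\<mu> j) (v t j) - potential p (\<mu> j) (u j)\<bar> <= (LBINT x. \<mu> j * ?D * t * \<phi> x)"
   unfolding eq
  proof (rule integral_abs_bound[THEN order_trans], rule integral_mono_AE)
   show "AE x in lborel. \<bar>\<mu> j * Q1 x * \<bar>v t j x\<bar> powr (2 * p) - \<mu> j * Q1 x * \<bar>u j x\<bar> powr (2 * p)\<bar> <= \<mu> j * ?D * t * \<phi> x"
    using shift[OF t(1)] ab
   proof eventually_elim
    case (elim x)
    then have e: "\<bar>v t j x - u j x\<bar> <= t * \<phi> x" "0 <= u j x" "u j x <= K" "0 <= v t j x" using j by auto
    have "\<bar>\<mu> j * Q1 x * \<bar>v t j x\<bar> powr (2 * p) - \<mu> j * Q1 x * \<bar>u j x\<bar> powr (2 * p)\<bar> = \<mu> j * \<bar>\<bar>v t j x\<bar> powr (2 * p) - \<bar>u j x\<bar> powr (2 * p)\<bar>"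
     using \<mu>[OF j] by (simp add: abs_mult Q1_abs flip: right_diff_distrib)
    also have "... <= \<mu> j * (?D * \<bar>v t j x - u j x\<bar>)"
     using e t\<phi>[OF t(2), of x] p1 \<mu>[OF j] by (intro mult_left_mono abs_powr_lipschitz) auto
    also have "... <= \<mu> j * (?D * (t * \<phi> x))" using e(1) p1 \<mu>[OF j] by (intro mult_left_mono) auto
    finally show ?case by (simp add: mult.assoc)
   qed
  qed (use I \<phi>i in auto)
  then show ?thesis by simp
 qed
 define R where "R j = dirichlet (u j) (u j) + 2 * dirichlet \<phi> \<phi> + \<mu> j * K powr (2 * p - 1) * (LBINT x. \<phi> x)" for j
 have \<phi>int: "(LBINT x. \<phi> x) >= 0" using \<phi>0 by simp
 have R0: "R j >= 0" if "j \<in> S" for j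
  unfolding R_def using dirichlet_nonneg[of \<phi>] dirichlet_nonneg[of "u j"] \<mu>[OF that] \<phi>int by simp
 \<comment> \<open>\<open>variation\<close> wants a linear bound for every single energy, while
   \<open>totalA\<close> controls only their sum. For \<open>j ~= i\<close> the square of
   \<open>u j - m t j\<close> is expanded and each term estimated.\<close>
 have adiff: "\<bar>dirichlet (v t j) (v t j) - dirichlet (u j) (u j)\<bar> <= 3 * R j * t" if t: "0 < t" "t <= T" and j: "j \<in> S" "j ~= i" for t j
 proof -
  let ?a = "dirichlet (u j) (m t j)" and ?b = "dirichlet (m t j) (m t j)" and ?R = "dirichlet (u j) (u j) + 2 * dirichlet \<phi> \<phi>"
  have t1: "t <= 1" using t T by simp
  \<comment> \<open>The function \<open>m t j\<close> vanishes with \<open>u j\<close> and lies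
    below \<open>t * \<phi>\<close>; testing with its negative gives a bound of order
    \<open>t\<close>.\<close>
  have up: "?a <= t * (\<mu> j * K powr (2 * p - 1) * (LBINT x. \<phi> x))"
  proof -
   have "force (\<mu> j) (u j) (%x. - 1 * m t j x) <= dirichlet (u j) (%x. - 1 * m t j x)"
   proof (rule one_sided[OF j(1) E_cmult(1)[OF mE[OF j(1)]]])
    fix k assume k: "k \<in> S" "k ~= j"
    show "AE x in lborel. u k x * (- 1 * m t j x) = 0" using seg[OF k(1) j(1) k(2)] by eventually_elim (use \<phi>0 t in \<open>auto simp: m_def\<close>)
   qed
   then have "?a <= force (\<mu> j) (u j) (m t j)" using dirichlet_cmult_left[OF mE[OF j(1)] uE[OF j(1)], of "- 1" t]
    by (simp add: dirichlet_sym[of "u j"] force_def)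
   also have "... <= \<mu> j * K powr (2 * p - 1) * (LBINT x. t * \<phi> x)"
    by (rule force_le[OF uE[OF j(1)] mE[OF j(1)] \<mu>[OF j(1)] K(2)[OF j(1)] _ _ order_refl])
     (use K(2)[OF j(1)] \<phi>0 t \<phi>i in \<open>auto elim!: eventually_mono simp: m_def\<close>)
   finally show ?thesis by (simp add: mult_ac)
  qed
  note I = E_D(5)[OF uE[OF j(1)]] E_D(5)[OF \<phi>E]
  let ?h = "%x. t * ((norm (weak_gradient (u j) x))\<^sup>2 + 2 * (norm (weak_gradient \<phi> x))\<^sup>2)"
  have hi: "integrable lborel ?h" "(LBINT x. ?h x) = t * ?R" using I by (auto simp: dirichlet_def power2_norm_eq_inner)
  \<comment> \<open>Where \<open>u j > t * \<phi>\<close> the gradient of \<open>m t j\<close> is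
    \<open>t\<close> times that of \<open>\<phi>\<close>. Elsewhere it is that of
    \<open>u j\<close>, and the resulting square is nonnegative or cancels.\<close>
  have pt: "AE x in lborel. - ?h x <= weak_gradient (u j) x \<bullet> weak_gradient (m t j) x \<and>
   weak_gradient (m t j) x \<bullet> weak_gradient (m t j) x <= weak_gradient (u j) x \<bullet> weak_gradient (m t j) x + ?h x"
   using E_min(2)[OF uE[OF j(1)] E_cmult(1)[OF \<phi>E, of t]] E_cmult(2)[OF \<phi>E, of t]
  proof eventually_elim
   case (elim x)
   let ?U = "weak_gradient (u j) x" and ?P = "weak_gradient \<phi> x"
   have "2 * \<bar>?U \<bullet> ?P\<bar> <= (norm ?U)\<^sup>2 + (norm ?P)\<^sup>2"
    using Cauchy_Schwarz_ineq2[of ?U ?P] sum_squares_bound[of "norm ?U" "norm ?P"] by linarith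
   then have UP: "\<bar>?U \<bullet> ?P\<bar> <= (norm ?U)\<^sup>2 + (norm ?P)\<^sup>2" by linarith
   have P: "0 <= (norm ?P)\<^sup>2" "0 <= (norm ?U)\<^sup>2" "t * (norm ?P)\<^sup>2 <= (norm ?P)\<^sup>2"
    using t t1 by (auto simp: mult_left_le_one_le)
   then have "- ((norm ?U)\<^sup>2 + 2 * (norm ?P)\<^sup>2) <= ?U \<bullet> ?P" "t * (norm ?P)\<^sup>2 <= ?U \<bullet> ?P + ((norm ?U)\<^sup>2 + 2 * (norm ?P)\<^sup>2)"
    using UP by linarith+
   from this[THEN mult_left_mono, of t]
   have *: "t * - ((norm ?U)\<^sup>2 + 2 * (norm ?P)\<^sup>2) <= t * (?U \<bullet> ?P)"
    "t * (t * (norm ?P)\<^sup>2) <= t * (?U \<bullet> ?P + ((norm ?U)\<^sup>2 + 2 * (norm ?P)\<^sup>2))"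
    using t(1) by (simp_all only: less_imp_le)
   have **: "0 <= ?h x" using t by simp
   show ?case
   proof (cases "u j x > t * \<phi> x")
    case True
    then have "weak_gradient (m t j) x = t *\<^sub>R ?P" using elim by (simp add: m_def)
    then show ?thesis using * by (simp add: algebra_simps power2_norm_eq_inner)
   next
    case False
    then have "weak_gradient (m t j) x = ?U" using elim by (simp add: m_def)
    moreover have "- ?h x <= ?U \<bullet> ?U" using ** inner_ge_zero[of ?U] by linarith
    ultimately show ?thesis using ** by simp
   qed
  qed
  have "- (t * ?R) <= ?a" unfolding dirichlet_def[of "u j" "m t j"] hi(2)[symmetric] integral_minus[symmetric]
   by (rule integral_mono_AE) (use pt hi(1) dirichlet_integrable[OF uE[OF j(1)] mE[OF j(1)]] in auto)
  moreover have "?b <= ?a + t * ?R"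
   unfolding dirichlet_def[of "u j" "m t j"] dirichlet_def[of "m t j"] hi(2)[symmetric] BIadd[OF dirichlet_integrable[OF uE[OF j(1)] mE[OF j(1)]] hi(1), symmetric]
   by (rule integral_mono_AE) (use pt hi(1) dirichlet_integrable[OF mE[OF j(1)] mE[OF j(1)]] dirichlet_integrable[OF uE[OF j(1)] mE[OF j(1)]] in auto)
  moreover have "?b >= 0" by (rule dirichlet_nonneg)
  moreover have "dirichlet (v t j) (v t j) - dirichlet (u j) (u j) = - 2 * ?a + ?b"
   using dirichlet_square_diff[OF uE[OF j(1)] mE[OF j(1)]] j(2) by (simp add: v_def)
  moreover have "t * ?R >= 0" using t dirichlet_nonneg[of \<phi>] dirichlet_nonneg[of "u j"] by simp
  moreover have "3 * R j * t = 3 * (t * ?R) + 3 * (t * (\<mu> j * K powr (2 * p - 1) * (LBINT x. \<phi> x)))"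
   by (simp add: R_def algebra_simps)
  moreover have "t * (\<mu> j * K powr (2 * p - 1) * (LBINT x. \<phi> x)) >= 0" using t \<mu>[OF j(1)] \<phi>int by simp
  ultimately show ?thesis using up unfolding abs_le_iff by linarith
 qed
 define L where "L = 2 * \<bar>dirichlet f \<phi>\<bar> + dirichlet \<phi> \<phi> + (\<Sum>j\<in>S. 3 * R j)"
 define N where "N = sum \<mu> S * ?D * (LBINT x. \<phi> x)"
 have sumR: "3 * R j <= (\<Sum>j\<in>S. 3 * R j)" if "j \<in> S" for j using R0 that by (intro member_le_sum) (use S in auto)
 have NL: "N >= 0" "L >= 0" unfolding N_def L_def using \<mu>s \<phi>int p1 dirichlet_nonneg[of \<phi>] R0 by (auto intro!: add_nonneg_nonneg sum_nonneg)
 \<comment> \<open>The energy of the \<open>i\<close>-th component is the total minus the energies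
   already estimated.\<close>
 have aL: "\<bar>dirichlet (v t j) (v t j) - dirichlet (u j) (u j)\<bar> <= L * t" if t: "0 < t" "t <= T" and j: "j \<in> S" for t j
 proof (cases "j = i")
  case False
  have "3 * R j <= L" using sumR[OF j] dirichlet_nonneg[of \<phi>] by (simp add: L_def)
  then have "3 * R j * t <= L * t" using t by (intro mult_right_mono) auto
  then show ?thesis by (rule order_trans[OF adiff[OF t j False]])
 next
  case True
  let ?d = "%j. dirichlet (v t j) (v t j) - dirichlet (u j) (u j)"
  have "\<bar>\<Sum>j\<in>S - {i}. ?d j\<bar> <= (\<Sum>j\<in>S - {i}. \<bar>?d j\<bar>)" by (rule sum_abs)
  also have "... <= (\<Sum>j\<in>S - {i}. 3 * R j * t)" by (intro sum_mono adiff t) auto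
  also have "... <= (\<Sum>j\<in>S. 3 * R j * t)" using S R0 t by (intro sum_mono2) auto
  also have "... = (\<Sum>j\<in>S. 3 * R j) * t" by (simp add: sum_distrib_right)
  finally have 1: "\<bar>\<Sum>j\<in>S - {i}. ?d j\<bar> <= (\<Sum>j\<in>S. 3 * R j) * t" .
  have "?d i + (\<Sum>j\<in>S - {i}. ?d j) = 2 * t * dirichlet f \<phi> + t\<^sup>2 * dirichlet \<phi> \<phi>"
   using totalA[OF t(1)] sum.remove[OF S i, of ?d] by (simp add: sum_subtractf)
  moreover have "\<bar>2 * t * dirichlet f \<phi> + t\<^sup>2 * dirichlet \<phi> \<phi>\<bar> <= (2 * \<bar>dirichlet f \<phi>\<bar> + dirichlet \<phi> \<phi>) * t"
  proof -
   have "t\<^sup>2 * dirichlet \<phi> \<phi> <= t * dirichlet \<phi> \<phi>" using t T dirichlet_nonneg[of \<phi>] by (intro mult_right_mono) (auto simp: power2_eq_square)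
   moreover have "\<bar>2 * t * dirichlet f \<phi> + t\<^sup>2 * dirichlet \<phi> \<phi>\<bar> <= \<bar>2 * t * dirichlet f \<phi>\<bar> + t\<^sup>2 * dirichlet \<phi> \<phi>"
    using dirichlet_nonneg[of \<phi>] by (intro order_trans[OF abs_triangle_ineq]) simp
   ultimately show ?thesis using t by (simp add: abs_mult algebra_simps)
  qed
  moreover have "\<bar>a\<bar> <= A + B" if "a + s = b" "\<bar>b\<bar> <= A" "\<bar>s\<bar> <= B" for a b s A B :: real using that by linarith
  ultimately have "\<bar>?d i\<bar> <= (2 * \<bar>dirichlet f \<phi>\<bar> + dirichlet \<phi> \<phi>) * t + (\<Sum>j\<in>S. 3 * R j) * t" using 1 by blast
  then show ?thesis unfolding True L_def by (simp only: distrib_right)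
 qed
 have pL: "\<bar>potential p (\<mu> j) (v t j) - potential p (\<mu> j) (u j)\<bar> <= N * t" if t: "0 < t" "t <= T" and j: "j \<in> S" for t j
 proof -
  have "\<mu> j <= sum \<mu> S" using j \<mu> by (intro member_le_sum) (use S in \<open>auto intro: less_imp_le\<close>)
  then have "\<mu> j * (?D * t * (LBINT x. \<phi> x)) <= sum \<mu> S * (?D * t * (LBINT x. \<phi> x))"
   using t \<phi>int p1 by (intro mult_right_mono) auto
  then show ?thesis using pot_diff[OF t j] by (simp add: N_def mult_ac)
 qed
 \<comment> \<open>To first order in \<open>t\<close> the energies contribute
   \<open>2 * p * dirichlet f \<phi>\<close>, and the potentials at most \<open>N\<close>. Dividing
   by \<open>t\<close> and letting it tend to 0 leaves this sum.\<close>
 have "2 * p * dirichlet f \<phi> + N >= 0"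
 proof (rule field_le_epsilon)
  fix e :: real assume e: "e > 0"
  have "\<forall>\<^sub>F t in at_right 0. (\<Sum>j\<in>S. p * (dirichlet (v t j) (v t j) - dirichlet (u j) (u j)) - (potential p (\<mu> j) (v t j) - potential p (\<mu> j) (u j))) >= - e * t"
  proof (rule variation[OF T(1) e, of "L + N"])
   fix t j assume t: "0 < t" "t <= T" and j: "j \<in> S"
   have "L * t <= (L + N) * t" "N * t <= (L + N) * t" using NL t by (auto intro!: mult_right_mono)
   then show "\<bar>dirichlet (v t j) (v t j) - dirichlet (u j) (u j)\<bar> <= (L + N) * t" "\<bar>potential p (\<mu> j) (v t j) - potential p (\<mu> j) (u j)\<bar> <= (L + N) * t"
    using aL[OF t j] pL[OF t j] by linarith+
  qed (use NL vE vseg in auto)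
  moreover have "\<forall>\<^sub>F t in at_right 0. 0 < t \<and> t <= T"
   unfolding eventually_at_right_field using T by (intro exI[of _ T]) auto
  ultimately have ev: "\<forall>\<^sub>F t in at_right 0. p * (2 * dirichlet f \<phi> + t * dirichlet \<phi> \<phi>) + N >= - e"
  proof eventually_elim
   case (elim t)
   then have t: "0 < t" "t <= T" by auto
   let ?b = "%j. potential p (\<mu> j) (v t j) - potential p (\<mu> j) (u j)"
   have "- (\<Sum>j\<in>S. ?b j) <= (\<Sum>j\<in>S. \<mu> j * ?D * t * (LBINT x. \<phi> x))"
    unfolding sum_negf[symmetric] by (intro sum_mono) (use pot_diff[OF t] in \<open>auto simp: abs_le_iff\<close>)
   also have "... = N * t" unfolding N_def sum_distrib_right by (intro sum.cong refl) (simp only: mult_ac)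
   finally have b: "- (\<Sum>j\<in>S. ?b j) <= N * t" .
   have "(\<Sum>j\<in>S. p * (dirichlet (v t j) (v t j) - dirichlet (u j) (u j)) - ?b j)
     = p * ((\<Sum>j\<in>S. dirichlet (v t j) (v t j)) - (\<Sum>j\<in>S. dirichlet (u j) (u j))) - (\<Sum>j\<in>S. ?b j)"
    by (simp add: sum_subtractf sum_distrib_left right_diff_distrib)
   also have "(\<Sum>j\<in>S. dirichlet (v t j) (v t j)) - (\<Sum>j\<in>S. dirichlet (u j) (u j)) = 2 * t * dirichlet f \<phi> + t\<^sup>2 * dirichlet \<phi> \<phi>"
    using totalA[OF t(1)] by simp
   finally have "- e * t <= p * (2 * t * dirichlet f \<phi> + t\<^sup>2 * dirichlet \<phi> \<phi>) + N * t" using elim(1) b by linarith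
   then have "t * - e <= t * (p * (2 * dirichlet f \<phi> + t * dirichlet \<phi> \<phi>) + N)" by (simp add: algebra_simps power2_eq_square)
   then show ?case using t(1) by (simp only: mult_le_cancel_left_pos)
  qed
  have "((%t. p * (2 * dirichlet f \<phi> + t * dirichlet \<phi> \<phi>) + N) \<longlongrightarrow> p * (2 * dirichlet f \<phi> + 0 * dirichlet \<phi> \<phi>) + N) (at_right 0)"
   by (intro tendsto_intros)
  from tendsto_lowerbound[OF this ev] show "0 <= 2 * p * dirichlet f \<phi> + N + e" by (simp add: mult_ac)
 qed
 then have "2 * p * - dirichlet f \<phi> <= 2 * p * (sum \<mu> S * (K + 1) powr (2 * p - 1) * (LBINT x. \<phi> x))"
  by (simp add: N_def mult_ac)
 then have le: "- dirichlet f \<phi> <= sum \<mu> S * (K + 1) powr (2 * p - 1) * (LBINT x. \<phi> x)" using p1 by (simp only: mult_le_cancel_left_pos)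
 have "dirichlet w \<phi> = - dirichlet f \<phi>"
  using dirichlet_cmult_left[OF fE \<phi>E, of "-1"] by (simp add: f_def w_def)
 moreover have "dirichlet w \<phi> = (LBINT x. weak_gradient w x \<bullet> grad \<phi> x)" unfolding dirichlet_def
  by (rule integral_cong_AE) (use E_D(6)[OF wE] E_D(6)[OF \<phi>E] E_test(2)[OF \<phi>] borel_measurable_continuous_onI[OF smooth_grad_continuous[OF test_smooth[OF \<phi>]]] in \<open>auto elim!: eventually_mono\<close>)
 ultimately show "(LBINT x. weak_gradient w x \<bullet> grad \<phi> x) <= sum \<mu> S * (K + 1) powr (2 * p - 1) * (LBINT x. \<phi> x)"
  using le by simp
qed

lemma continuous_representatives:
 obtains U where "!!i. i \<in> S ==> AE x in lborel. U i x = u i x" "!!i x. i \<in> S ==> U i x >= 0"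
  "!!i j x. i \<in> S ==> j \<in> S ==> i ~= j ==> U i x * U j x = 0" "!!i. i \<in> S ==> continuous_on UNIV (U i)"
proof -
 obtain K where K: "K >= 0" "!!i. i \<in> S ==> AE x in lborel. 0 <= u i x \<and> u i x <= K" using uniform_bound by blast
 let ?C = "sum \<mu> S * (K + 1) powr (2 * p - 1)"
 have s: "subsol ?C (u i) (weak_gradient (u i))" if i: "i \<in> S" for i
 proof (rule component_subsol[OF i K])
  have "\<mu> i <= sum \<mu> S" using i \<mu> by (intro member_le_sum) (use S in \<open>auto intro: less_imp_le\<close>)
  then show "\<mu> i * K powr (2 * p - 1) <= ?C" using K(1) \<mu>[OF i] p1 by (intro mult_mono powr_mono2) auto
 qed
 note c = segregated_continuous[OF S s hat_subsol[OF _ K] nn seg]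
 show thesis
  by (rule that[of "%i. precise (u i)"]) (use subsol_AE[OF s] c in auto)
qed

end

subsection \<open>Functions vanishing outside an open set\<close>

lemma set_integral_eq_integral:
 fixes f :: "'a::euclidean_space => real"
 assumes "f \<in> Bmeas" "S \<in> sets borel" "AE x in lborel. x \<notin> S --> f x = 0"
 shows "(LBINT x:S. f x) = (LBINT x. f x)"
 unfolding set_lebesgue_integral_def
 by (rule integral_cong_AE) (use assms in \<open>auto elim!: eventually_mono simp: indicator_def\<close>)

text \<open>Mollification does not increase the L2 norm, so almost everywhere convergence along a
  subsequence becomes strong convergence by \<open>Lq_convergence\<close> with exponent 2.\<close>

lemma moll_L2_convergence:
 fixes g :: "real^'n => real^'n"
 assumes g: "locally_integrable g" "L2 g" and li: "!!r. r > 0 ==> locally_integrable (moll r g)"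
 obtains \<rho> where "strict_mono \<rho>" "(%n. \<integral>x. (norm (moll (1 / real (Suc (\<rho> n))) g x - g x))\<^sup>2 \<partial>lborel) ----> 0"
proof -
 let ?r = "%n. 1 / real (Suc n)"
 obtain \<rho> where \<rho>: "strict_mono \<rho>" "AE x in lborel. (%n. moll (?r (\<rho> n)) g x) ----> g x"
  using L1loc_AE_subseq[OF li[OF moll_seq(2)] g(1) moll_L1loc[OF g(1) moll_seq(2,1)]] by blast
 have M: "L2 (moll r g) \<and> (sq (moll r g)) <= (sq g)" if r: "r > 0" for r
 proof
  note [measurable] = moll_measurable[OF r g(1)]
  note le = moll_L2[OF g r]
  show i: "L2 (moll r g)"
   using le_less_trans[OF le ennreal_less_top] by (intro integrableI_bounded) auto
  have "ennreal (sq (moll r g)) <= ennreal (sq g)"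
   using le nn_integral_eq_integral[OF i] by simp
  then show "(sq (moll r g)) <= (sq g)"
   by (subst (asm) ennreal_le_iff) auto
 qed
 have "(%n. \<integral>x. norm (moll (?r (\<rho> n)) g x - g x) powr 2 \<partial>lborel) ----> 0"
  by (rule Lq_convergence[OF _ _ _ _ _ \<rho>(2), of 2 "%_. \<integral>x. (norm (g x))\<^sup>2 \<partial>lborel"])
   (use M g moll_measurable[OF _ g(1)] locint_measurable[OF g(1)] in auto)
 then show thesis using that[OF \<rho>(1)] by simp
qed

context subcritical begin

section \<open>Approximation by test functions in the Dirichlet norm\<close>

lemma dirichlet_add_le:
 assumes "u \<in> E" "v \<in> E"
 shows "dirichlet (%x. u x + v x) (%x. u x + v x) <= 2 * dirichlet u u + 2 * dirichlet v v"
 using dirichlet_square_add[OF assms, of 1] dirichlet_square_diff[OF assms] dirichlet_nonneg[of "%x. u x - v x"] by simp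

lemma D12_norm_less: "e > 0 ==> D12_norm u < e \<longleftrightarrow> dirichlet u u < e\<^sup>2"
 using real_sqrt_less_iff[of "dirichlet u u" "e\<^sup>2"] by (simp add: D12_norm_eq)

lemma D12_0_closed:
 assumes v: "v \<in> E" and w: "!!n. w n \<in> E" "!!n. w n \<in> D12_0 \<Omega>"
  and lim: "(%n. dirichlet (%x. v x - w n x) (%x. v x - w n x)) ----> 0"
 shows "v \<in> D12_0 \<Omega>"
 unfolding D12_0_def
proof (intro CollectI conjI allI impI)
 show "v \<in> D12" by (rule E_D12[OF v])
 fix e :: real assume e: "e > 0"
 have "\<forall>\<^sub>F n in sequentially. dirichlet (%x. v x - w n x) (%x. v x - w n x) < (e / 2)\<^sup>2"
  by (rule order_tendstoD(2)[OF lim]) (use e in simp)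
 then obtain n where n: "dirichlet (%x. v x - w n x) (%x. v x - w n x) < (e / 2)\<^sup>2"
  using eventually_happens'[OF sequentially_bot] by blast
 have "e / 2 > 0" using e by simp
 then obtain \<phi> where \<phi>: "\<phi> \<in> test_functions \<Omega>" "D12_norm (%x. w n x - \<phi> x) < e / 2" using w(2)[of n] unfolding D12_0_def by blast
 have \<phi>E: "\<phi> \<in> E" by (rule E_test(1)[OF test_functions_mono[OF \<phi>(1)]])
 have "dirichlet (%x. (v x - w n x) + (w n x - \<phi> x)) (%x. (v x - w n x) + (w n x - \<phi> x)) < e\<^sup>2"
  using dirichlet_add_le[OF E_diff(1)[OF v w(1)[of n]] E_diff(1)[OF w(1)[of n] \<phi>E]] n \<phi>(2)[unfolded D12_norm_less[OF \<open>e / 2 > 0\<close>]]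
  unfolding power_divide by simp
 then show "\<exists>\<phi>\<in>test_functions \<Omega>. D12_norm (%x. v x - \<phi> x) < e" using \<phi>(1) e by (intro bexI[of _ \<phi>]) (simp_all add: D12_norm_less)
qed

text \<open>At a radius below the distance from \<open>K\<close> to the complement, the
  mollification is a test function of the open set. Its gradient is the mollified weak gradient,
  which converges in L2.\<close>

lemma D12_0_compact_support:
 assumes f: "f \<in> E" and \<Omega>: "open \<Omega>" and K: "compact K" "K \<subseteq> \<Omega>" and supp: "!!x. f x ~= 0 ==> x \<in> K"
 shows "f \<in> D12_0 \<Omega>"
 unfolding D12_0_def
proof (intro CollectI conjI allI impI)
 show "f \<in> D12" by (rule E_D12[OF f])
 fix e :: real assume e: "e > 0"
 let ?r = "%n. 1 / real (Suc n)"
 note w = E_D(4)[OF f]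
 note lf = wgD(1)[OF w] and lg = wgD(2)[OF w]
 obtain d where d: "d > 0" "(\<Union>x\<in>K. ball x d) \<subseteq> \<Omega>"
  using compact_subset_open_imp_ball_epsilon_subset[OF K(1) \<Omega> K(2)] by blast
 have gm: "moll r (weak_gradient f) = grad (moll r f)" if "r > 0" for r
  using moll_is_weak_gradient[OF w that] by (simp add: fun_eq_iff)
 have "locally_integrable (moll r (weak_gradient f))" if "r > 0" for r
  unfolding gm[OF that] by (intro locint_continuous smooth_grad_continuous moll_smooth lf that)
 then obtain \<rho> where \<rho>: "strict_mono \<rho>" "(%n. \<integral>x. (norm (moll (?r (\<rho> n)) (weak_gradient f) x - weak_gradient f x))\<^sup>2 \<partial>lborel) ----> 0"
  using moll_L2_convergence[OF lg E_D(5)[OF f]] by blast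
 have "(%n. ?r (\<rho> n)) ----> 0" using LIMSEQ_subseq_LIMSEQ[OF moll_seq(1) \<rho>(1)] by (simp add: o_def)
 then have "\<forall>\<^sub>F n in sequentially. ?r (\<rho> n) < d" by (rule order_tendstoD(2)) (rule d)
 moreover have "\<forall>\<^sub>F n in sequentially. (sq (%x. moll (?r (\<rho> n)) (weak_gradient f) x - weak_gradient f x)) < e\<^sup>2"
  by (rule order_tendstoD(2)[OF \<rho>(2)]) (use e in simp)
 ultimately obtain n where n: "?r (\<rho> n) < d" "(sq (%x. moll (?r (\<rho> n)) (weak_gradient f) x - weak_gradient f x)) < e\<^sup>2"
  using eventually_happens'[OF sequentially_bot eventually_conj] by blast
 define s where "s = ?r (\<rho> n)"
 have s: "s > 0" "s < d" "(sq (%x. moll s (weak_gradient f) x - weak_gradient f x)) < e\<^sup>2"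
  using n moll_seq(2) by (auto simp: s_def)
 define K' where "K' = {x + y |x y. x \<in> K \<and> y \<in> cball 0 s}"
 have K': "compact K'" unfolding K'_def by (rule compact_sums[OF K(1) compact_cball])
 have "x \<in> K'" if "moll s f x ~= 0" for x
 proof (rule ccontr)
  assume x: "x \<notin> K'"
  have "eta s z *\<^sub>R f (x + z) = 0" for z :: "real^'n"
  proof (cases "eta s z = 0")
   case False
   have "x + z \<notin> K"
   proof
    assume "x + z \<in> K"
    then have "(x + z) + (- z) \<in> K'"
     unfolding K'_def mem_Collect_eq using eta_support[OF s(1) False] by (intro exI[of _ "x + z"] exI[of _ "- z"]) auto
    then show False using x by simp
   qed
   then show ?thesis using supp by auto
  qed simp
  then have "(%z. eta s z *\<^sub>R f (x + z)) = (%_. 0)" by blast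
  then have "moll s f x = 0" unfolding moll_eq(2)[OF s(1) lf] by (simp only:) simp
  then show False using that by simp
 qed
 then have "closure {x. moll s f x ~= 0} \<subseteq> K'" by (intro closure_minimal compact_imp_closed[OF K']) auto
 moreover have "K' \<subseteq> \<Omega>"
 proof
  fix z assume "z \<in> K'"
  then obtain x y where xy: "z = x + y" "x \<in> K" "norm y <= s" by (auto simp: K'_def)
  then have "z \<in> ball x d" using s(2) by (simp add: dist_norm)
  then show "z \<in> \<Omega>" using xy(2) d(2) by blast
 qed
 ultimately have t: "moll s f \<in> test_functions \<Omega>" unfolding test_functions_def
  using moll_smooth[OF lf s(1)] K' compact_closure bounded_subset[OF compact_imp_bounded[OF K']] closure_subset
  by (auto simp: smooth_def compact_eq_bounded_closed)
 have mE: "moll s f \<in> E" "AE x in lborel. weak_gradient (moll s f) x = moll s (weak_gradient f) x"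
  using E_test[OF test_functions_mono[OF t]] unfolding gm[OF s(1)] by auto
 have ae: "AE x in lborel. weak_gradient (%x. f x - moll s f x) x = weak_gradient f x - moll s (weak_gradient f) x"
  using E_diff(2)[OF f mE(1)] mE(2) by eventually_elim simp
 have "dirichlet (%x. f x - moll s f x) (%x. f x - moll s f x) < e\<^sup>2"
  using s(3) dirichlet_cong[OF E_diff(1)[OF f mE(1)] E_diff(1)[OF f mE(1)] ae ae] moll_measurable[OF s(1) lg] E_D(6)[OF f]
  by (simp add: power2_norm_eq_inner[symmetric] norm_minus_commute)
 then show "\<exists>\<phi>\<in>test_functions \<Omega>. D12_norm (%x. f x - \<phi> x) < e" using t e by (intro bexI[of _ "moll s f"]) (simp_all add: D12_norm_less)
qed

text \<open>By continuity the truncation is supported in the closed set \<open>w >= d\<close> inside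
  the positivity set, but possibly unbounded. Cut-offs on growing balls make the support compact.
  The error from their gradients tends to 0 since the truncation is square integrable: where
  \<open>w > d\<close>, its square is at most a constant times \<open>w powr q\<close>.\<close>

lemma cutoff_in_D12_0:
 assumes w: "w \<in> E" and c: "continuous_on UNIV w" and d: "d > 0"
 shows "(%x. max 0 (w x - d)) \<in> D12_0 {x. w x > 0}"
proof -
 let ?v = "%x. max 0 (w x - d)" and ?a = "%n. 1 / real (Suc n)"
 have vE: "?v \<in> E" by (rule E_trunc(1)[OF w less_imp_le[OF d]])
 note [measurable] = E_D(1,6)[OF vE]
 have "\<exists>z. eta 1 (z :: real^'n) ~= 0"
 proof (rule ccontr)
  assume "\<not> ?thesis"
  then show False using eta_integral[of 1, where 'n='n] by simp
 qed
 then obtain z :: "real^'n" where z: "eta 1 z ~= 0" by blast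
 \<comment> \<open>A mollifier, shifted and normalised to have value 1 at the origin; its dilates
   \<open>\<kappa> n\<close> tend to 1 pointwise.\<close>
 define \<psi> where "\<psi> = (%x. (1 / eta 1 z) * eta 1 (z + 1 *\<^sub>R x))"
 have \<psi>: "\<psi> \<in> TF" unfolding \<psi>_def by (intro test_smooth_mult test_affine eta_test smooth_const) auto
 have \<psi>0: "\<psi> 0 = 1" using z by (simp add: \<psi>_def)
 note s\<psi> = test_smooth[OF \<psi>]
 obtain M where M: "M > 0" "!!x. \<bar>\<psi> x\<bar> <= M" using test_bounded[OF \<psi>] by blast
 obtain R where R: "!!x. \<psi> x ~= 0 ==> norm x <= R" using \<psi> by (auto simp: test_functions_UNIV)
 have "\<exists>B. \<forall>x. \<bar>pd m \<psi> x\<bar> <= B" for m using test_bounded[OF test_partial[OF \<psi>]] by metis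
 then obtain B where B: "!!m x. \<bar>pd m \<psi> x\<bar> <= B m" by metis
 have gB: "norm (grad \<psi> x) <= (\<Sum>m\<in>UNIV. B m)" for x
  by (rule order_trans[OF norm_le_l1_cart sum_mono]) (use B in \<open>simp add: grad_def\<close>)
 define L where "L = (\<Sum>m\<in>UNIV. B m)"
 have L0: "L >= 0" using gB[of 0] norm_ge_zero order_trans unfolding L_def by blast
 define \<kappa> where "\<kappa> n = (%x. \<psi> (0 + ?a n *\<^sub>R x))" for n
 have \<kappa>s: "smooth (\<kappa> n)" for n unfolding \<kappa>_def by (rule smooth_affine[OF s\<psi>])
 have g\<kappa>: "grad (\<kappa> n) x = ?a n *\<^sub>R grad \<psi> (0 + ?a n *\<^sub>R x)" for n x
  unfolding \<kappa>_def grad_def using partial_derivative_affine[OF smooth_diff[OF s\<psi>], of _ 0 "?a n"] by (simp add: vec_eq_iff)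
 define f where "f n = (%x. \<kappa> n x * ?v x)" for n
 let ?g = "%n x. \<kappa> n x *\<^sub>R weak_gradient ?v x + ?v x *\<^sub>R grad (\<kappa> n) x"
 let ?G = "%n x. (1 - \<kappa> n x) *\<^sub>R weak_gradient ?v x - ?v x *\<^sub>R grad (\<kappa> n) x"
 have wf: "is_weak_gradient (f n) (?g n)" for n unfolding f_def by (rule wg_smooth_mult[OF E_D(4)[OF vE] \<kappa>s])
 have [measurable]: "\<kappa> n \<in> Bmeas" "grad (\<kappa> n) \<in> Bmeas" for n
  by (intro borel_measurable_continuous_onI smooth_continuous smooth_grad_continuous \<kappa>s)+
 have v2: "integrable lborel (%x. (?v x)\<^sup>2)"
 proof (rule Bbound)
  show "integrable lborel (%x. d powr (2 - q) * \<bar>w x\<bar> powr q)" using E_D(2)[OF w] by simp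
  have "(?v x)\<^sup>2 <= d powr (2 - q) * \<bar>w x\<bar> powr q" for x
  proof (cases "w x > d")
   case True
   then have wx: "w x > 0" using d by simp
   have "(?v x)\<^sup>2 <= (w x)\<^sup>2" using True d by (intro power_mono) auto
   also have "... = w x powr (2 - q) * w x powr q" unfolding powr_add[symmetric] using wx by simp
   also have "... <= d powr (2 - q) * w x powr q" using True d exponents by (intro mult_right_mono powr_mono2') auto
   finally show ?thesis using wx by simp
  qed (use d in simp)
  then show "AE x in lborel. norm ((?v x)\<^sup>2) <= norm (d powr (2 - q) * \<bar>w x\<bar> powr q)" by (intro AE_I2) simp
 qed simp
 let ?W = "%x. 2 * (1 + M)\<^sup>2 * (norm (weak_gradient ?v x))\<^sup>2 + 2 * L\<^sup>2 * (?v x)\<^sup>2"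
 have Wi: "integrable lborel ?W" using E_D(5)[OF vE] v2 by simp
 have \<kappa>M: "\<bar>\<kappa> n x\<bar> <= M" for n x unfolding \<kappa>_def by (rule M(2))
 have g\<kappa>L: "norm (grad (\<kappa> n) x) <= ?a n * L" for n x
  unfolding g\<kappa> using gB[of "0 + ?a n *\<^sub>R x"] by (simp add: L_def divide_right_mono)
 have g\<kappa>L1: "norm (grad (\<kappa> n) x) <= L" for n x
  using g\<kappa>L[of n x] L0 mult_right_mono[of "?a n" 1 L] by simp
 have dom: "(norm (\<alpha> *\<^sub>R weak_gradient ?v x + ?v x *\<^sub>R b))\<^sup>2 <= ?W x" if "\<bar>\<alpha>\<bar> <= 1 + M" "norm b <= L" for \<alpha> b x
 proof -
  have "(norm (\<alpha> *\<^sub>R weak_gradient ?v x + ?v x *\<^sub>R b))\<^sup>2 <= 2 * (norm (\<alpha> *\<^sub>R weak_gradient ?v x))\<^sup>2 + 2 * (norm (?v x *\<^sub>R b))\<^sup>2"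
   by (rule norm2_triangle)
  also have "... = 2 * (\<bar>\<alpha>\<bar>\<^sup>2 * (norm (weak_gradient ?v x))\<^sup>2) + 2 * ((norm b)\<^sup>2 * (?v x)\<^sup>2)" by (simp add: power_mult_distrib)
  also have "... <= 2 * ((1 + M)\<^sup>2 * (norm (weak_gradient ?v x))\<^sup>2) + 2 * (L\<^sup>2 * (?v x)\<^sup>2)"
   using that by (intro add_mono mult_left_mono mult_right_mono power_mono) auto
  finally show ?thesis by (simp add: mult.assoc)
 qed
 have fE: "f n \<in> E" "AE x in lborel. weak_gradient (f n) x = ?g n x" for n
 proof -
  have i: "L2 (?g n)"
  proof (rule Bbound[OF Wi])
   have "(norm (?g n x))\<^sup>2 <= ?W x" for x
    using dom[of "\<kappa> n x" "grad (\<kappa> n) x" x] \<kappa>M[of n x] g\<kappa>L1[of n x] by linarith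
   then show "AE x in lborel. norm ((norm (?g n x))\<^sup>2) <= norm (?W x)" by (intro AE_I2) simp
  qed simp
  have "AE x in lborel. \<bar>f n x\<bar> <= \<bar>M * ?v x\<bar>" using \<kappa>M[of n] M(1) by (intro AE_I2) (auto simp: f_def abs_mult intro!: mult_right_mono)
  from E_I_bound[OF wf i E_cmult(1)[OF vE] this] show "f n \<in> E" "AE x in lborel. weak_gradient (f n) x = ?g n x" by auto
 qed
 show ?thesis
 proof (rule D12_0_closed[OF vE fE(1)])
  fix n
  let ?K = "{x. w x >= d} \<inter> cball 0 (real (Suc n) * R)"
  show "f n \<in> D12_0 {x. w x > 0}"
  proof (rule D12_0_compact_support[OF fE(1), of _ ?K])
   show "open {x. w x > 0}" by (rule open_Collect_less[OF continuous_on_const c])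
   show "compact ?K" by (intro closed_Int_compact closed_Collect_le continuous_on_const c compact_cball)
   show "?K \<subseteq> {x. w x > 0}" using d by auto
   fix x assume "f n x ~= 0"
   then have x: "\<psi> (?a n *\<^sub>R x) ~= 0" "w x >= d" by (auto simp: f_def \<kappa>_def)
   have "norm x / real (Suc n) <= R" using R[OF x(1)] by simp
   then show "x \<in> ?K" using x(2) by (simp add: divide_le_eq mult.commute)
  qed
 next
  have ae: "AE x in lborel. weak_gradient (%x. ?v x - f n x) x = ?G n x" for n
   using E_diff(2)[OF vE fE(1)[of n]] fE(2)[of n] by eventually_elim (simp add: algebra_simps)
  have eq: "dirichlet (%x. ?v x - f n x) (%x. ?v x - f n x) = (sq (?G n))" for n
   unfolding power2_norm_eq_inner by (rule dirichlet_cong[OF _ _ ae ae]) (use E_diff(1)[OF vE fE(1)] in auto)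
  have "(%n. \<integral>x. (norm (?G n x))\<^sup>2 \<partial>lborel) ----> (\<integral>x. 0 \<partial>(lborel::(real^'n) measure))"
  proof (rule integral_dominated_convergence[OF _ _ Wi])
   show "AE x in lborel. (%n. (norm (?G n x))\<^sup>2) ----> 0"
   proof (rule AE_I2)
    fix x
    have "(%n. \<psi> (?a n *\<^sub>R x)) ----> \<psi> (0 *\<^sub>R x)"
     using smooth_continuous[OF s\<psi>]
     by (intro isCont_tendsto_compose[of _ \<psi>] tendsto_scaleR moll_seq(1) tendsto_const) (simp add: continuous_on_eq_continuous_at)
    then have 1: "(%n. \<kappa> n x) ----> 1" using \<psi>0 by (simp add: \<kappa>_def)
    have "(%n. ?a n * L) ----> 0" using tendsto_mult_right[OF moll_seq(1), of L] by simp
    from Lim_null_comparison[OF always_eventually[OF allI[OF g\<kappa>L]] this] have 2: "(%n. grad (\<kappa> n) x) ----> 0" .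
    have "(%n. (norm (?G n x))\<^sup>2) ----> (norm ((1 - 1) *\<^sub>R weak_gradient ?v x - ?v x *\<^sub>R 0))\<^sup>2" by (intro tendsto_intros 1 2)
    then show "(%n. (norm (?G n x))\<^sup>2) ----> 0" by simp
   qed
   show "AE x in lborel. norm ((norm (?G n x))\<^sup>2) <= ?W x" for n
   proof (rule AE_I2)
    fix x
    have "\<bar>1 - \<kappa> n x\<bar> <= 1 + M" using \<kappa>M[of n x] by (auto simp: abs_le_iff)
    then show "norm ((norm (?G n x))\<^sup>2) <= ?W x" using dom[of "1 - \<kappa> n x" "- grad (\<kappa> n) x" x] g\<kappa>L1[of n x] by simp
   qed
  qed auto
  then show "(%n. dirichlet (%x. ?v x - f n x) (%x. ?v x - f n x)) ----> 0" unfolding eq by simp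
 qed
qed

text \<open>Truncation at levels tending to 0: the error gradient lives where \<open>w\<close> is at
  most the level, a region shrinking to the zero set, on which the gradient vanishes.\<close>

lemma continuous_in_D12_0:
 assumes w: "w \<in> E" and c: "continuous_on UNIV w" and nn: "!!x. w x >= 0"
 shows "w \<in> D12_0 {x. w x > 0}"
proof (rule D12_0_closed[OF w])
 let ?d = "%n. 1 / real (Suc n)"
 let ?v = "%n x. max 0 (w x - ?d n)"
 show vE: "?v n \<in> E" for n by (rule E_trunc(1)[OF w]) simp
 show "?v n \<in> D12_0 {x. w x > 0}" for n by (rule cutoff_in_D12_0[OF w c moll_seq(2)])
 note [measurable] = E_D(1,6)[OF w]
 let ?G = "%n x. if w x > ?d n then 0 else weak_gradient w x"
 have ae: "AE x in lborel. weak_gradient (%x. w x - ?v n x) x = ?G n x" for n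
  using E_diff(2)[OF w vE[of n]] E_trunc(2)[OF w, of "?d n"] by (auto elim!: eventually_elim2)
 have eq: "dirichlet (%x. w x - ?v n x) (%x. w x - ?v n x) = (sq (?G n))" for n
  unfolding power2_norm_eq_inner by (rule dirichlet_cong[OF _ _ ae ae]) (use E_diff(1)[OF w vE] in auto)
 have "(%n. \<integral>x. (norm (?G n x))\<^sup>2 \<partial>lborel) ----> (\<integral>x. 0 \<partial>(lborel::(real^'n) measure))"
 proof (rule integral_dominated_convergence[OF _ _ E_D(5)[OF w]])
  show "AE x in lborel. (%n. (norm (?G n x))\<^sup>2) ----> 0" using weak_gradient_zero_set[OF E_D(4)[OF w]]
  proof eventually_elim
   case (elim x)
   show ?case
   proof (cases "w x = 0")
    case False
    then have "\<forall>\<^sub>F n in sequentially. ?d n < w x" using nn[of x] by (intro order_tendstoD(2)[OF moll_seq(1)]) auto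
    then show ?thesis by (intro tendsto_eventually) (erule eventually_mono, simp)
   qed (use elim in simp)
  qed
 qed auto
 then show "(%n. dirichlet (%x. w x - ?v n x) (%x. w x - ?v n x)) ----> 0" unfolding eq by simp
qed

text \<open>\<open>D12_0\<close> asks for approximation in the Dirichlet norm only; Sobolev turns it
  into L^q approximation by functions that vanish off the open set. Integrability of the power
  \<open>2 * p\<close>, asked by \<open>E_on\<close> on the open set, then extends to the whole
  space.\<close>

lemma E_on_vanishes:
 assumes v: "v \<in> E_on \<Omega> p" and \<Omega>: "open \<Omega>"
 shows "v \<in> E" "AE x in lborel. x \<notin> \<Omega> --> v x = 0"
proof -
 have vD: "v \<in> D12" "v \<in> D12_0 \<Omega>" and L: "set_integrable lborel \<Omega> (%x. \<bar>v x\<bar> powr (2 * p))"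
  using v by (auto simp: E_on_def D12_0_def L_space_def)
 have \<Omega>b[measurable]: "\<Omega> \<in> sets borel" using \<Omega> by simp
 have [measurable]: "v \<in> Bmeas" and vq: "Lpw q v" using vD(1) D12_iff by auto
 let ?f = "%x. indicat_real (- \<Omega>) x * \<bar>v x\<bar> powr q"
 have fi: "integrable lborel ?f" using integrable_mult_indicator[OF _ vq, of "- \<Omega>"] by simp
 have le: "(LBINT x. ?f x) powr (2 / q) <= e" if e: "e > 0" for e
 proof -
  have "sqrt (e / SC) > 0" using e SC_pos by simp
  then obtain \<phi> where \<phi>: "\<phi> \<in> test_functions \<Omega>" "D12_norm (%x. v x - \<phi> x) < sqrt (e / SC)" using vD(2) unfolding D12_0_def by blast
  have \<phi>E: "\<phi> \<in> E" by (rule E_test(1)[OF test_functions_mono[OF \<phi>(1)]])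
  have \<phi>0: "\<phi> x = 0" if "x \<notin> \<Omega>" for x using \<phi>(1) that closure_subset[of "{x. \<phi> x ~= 0}"] by (auto simp: test_functions_def)
  note wv = D12_weak_gradient[OF vD(1)]
  have "L2 (%x. weak_gradient v x - weak_gradient \<phi> x)"
   by (rule L2_integrable_diff) (use wv(2) E_D(5,6)[OF \<phi>E] locint_measurable[OF wgD(2)[OF wv(1)]] in auto)
  moreover have dq: "Lpw q (%x. v x - \<phi> x)"
   by (rule integrable_powr_diff(1)) (use vq E_D(1,2)[OF \<phi>E] exponents in auto)
  ultimately have D: "(%x. v x - \<phi> x) \<in> D12" unfolding D12_iff using weak_gradient_diff[OF wv(1) E_D(4)[OF \<phi>E]] E_D(1)[OF \<phi>E] by auto
  have "(LBINT x. ?f x) <= (pw q (%x. v x - \<phi> x))"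
   by (rule integral_mono[OF fi dq]) (use \<phi>0 in \<open>auto simp: indicator_def\<close>)
  then have "(LBINT x. ?f x) powr (2 / q) <= (pw q (%x. v x - \<phi> x)) powr (2 / q)"
   using exponents by (intro powr_mono2) (auto intro!: integral_nonneg)
  also have "... <= SC * dirichlet (%x. v x - \<phi> x) (%x. v x - \<phi> x)" by (rule sobolev_D12(2)[OF D])
  also have "... <= SC * (e / SC)" using \<phi>(2) SC_pos by (intro mult_left_mono) (simp_all add: D12_norm_eq)
  finally show ?thesis using SC_pos by simp
 qed
 have "(LBINT x. ?f x) powr (2 / q) <= 0" by (rule field_le_epsilon) (use le in simp)
 then have "(LBINT x. ?f x) = 0" by (simp add: antisym_conv)
 then have "AE x in lborel. ?f x = 0" by (subst (asm) integral_nonneg_eq_0_iff_AE[OF fi]) auto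
 then show z: "AE x in lborel. x \<notin> \<Omega> --> v x = 0" by eventually_elim auto
 have "Lpw (2 * p) v"
  by (rule integrable_cong_AE_imp[OF L[unfolded set_integrable_def]]) (use z in \<open>auto elim!: eventually_mono simp: indicator_def\<close>)
 then show "v \<in> E" using vD(1) unfolding E_iff D12_iff by blast
qed

text \<open>Off the open set the function vanishes almost everywhere, and so does its weak gradient;
  restricting the integrals changes nothing.\<close>

lemma integrals_on:
 assumes \<Omega>: "open \<Omega>" and w: "w \<in> E" "AE x in lborel. x \<notin> \<Omega> --> w x = 0" and h: "h \<in> E"
 shows "(LBINT x:\<Omega>. weak_gradient w x \<bullet> weak_gradient h x) = dirichlet w h"
  "(LBINT x:\<Omega>. m * Q1 x * (\<bar>w x\<bar> powr (2 * p - 2) * w x) * h x) = force m w h"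
  "(LBINT x:\<Omega>. m * Q1 x * \<bar>w x\<bar> powr (2 * p)) = potential p m w"
proof -
 note [measurable] = E_D(1,6)[OF w(1)] E_D(1,6)[OF h]
 have b: "\<Omega> \<in> sets borel" using \<Omega> by simp
 show "(LBINT x:\<Omega>. weak_gradient w x \<bullet> weak_gradient h x) = dirichlet w h" unfolding dirichlet_def
  by (rule set_integral_eq_integral[OF _ b]) (use weak_gradient_zero_set[OF E_D(4)[OF w(1)]] w(2) in \<open>auto elim!: eventually_elim2\<close>)
 show "(LBINT x:\<Omega>. m * Q1 x * (\<bar>w x\<bar> powr (2 * p - 2) * w x) * h x) = force m w h" unfolding force_def
  by (rule set_integral_eq_integral[OF _ b]) (use w(2) in \<open>auto elim!: eventually_mono\<close>)
 show "(LBINT x:\<Omega>. m * Q1 x * \<bar>w x\<bar> powr (2 * p)) = potential p m w" unfolding potential_def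
  by (rule set_integral_eq_integral[OF _ b]) (use w(2) p1 in \<open>auto elim!: eventually_mono\<close>)
qed

lemma psi_diagonal: "a > 0 ==> psi a a = a"
 unfolding psi_def powr_add[symmetric] using p1 by (simp add: add_divide_distrib[symmetric] flip: diff_divide_distrib)

end

section \<open>Least energy on the positivity sets\<close>

context minimal_partition begin

text \<open>Every function of \<open>E_on\<close> is segregated from the other components, so
  \<open>one_sided\<close> applies to it and to its negative and gives the equation. Replacing the
  \<open>i\<close>-th component by a Nehari function gives minimality, since \<open>psi\<close> on
  the diagonal is the Dirichlet integral. If the positivity set missed the ball, the potential could
  not be positive.\<close>

lemma component_least_energy:
 assumes i: "i \<in> S" and c: "continuous_on UNIV (u i)" and nn': "!!x. u i x >= 0"
 shows "least_energy_solution_on {x. u i x > 0} p (\<mu> i) (u i)" "{x. u i x > 0} \<inter> ball 0 1 ~= {}"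
proof -
 let ?\<Omega> = "{x. u i x > 0}"
 have \<Omega>: "open ?\<Omega>" by (rule open_Collect_less[OF continuous_on_const c])
 have z: "AE x in lborel. x \<notin> ?\<Omega> --> u i x = 0" using nn' by (intro AE_I2) (auto simp: not_less intro: antisym)
 note I = integrals_on[OF \<Omega> uE[OF i] z]
 have sq: "(norm a)\<^sup>2 = a \<bullet> a" for a :: "real^'n" by (rule power2_norm_eq_inner)
 have on: "u i \<in> E_on ?\<Omega> p"
  using continuous_in_D12_0[OF uE[OF i] c nn'] mass_integrable[OF uE[OF i] borel_open[OF \<Omega>]] E_D(1)[OF uE[OF i]]
  by (simp add: E_on_def L_space_def)
 have disj: "AE x in lborel. u j x * h x = 0" if j: "j \<in> S" "j ~= i" and h: "AE x in lborel. x \<notin> ?\<Omega> --> h x = 0" for j and h :: "real^'n => real"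
  using seg[OF j(1) i j(2)] h by eventually_elim auto
 have nz: "nonzero (u i)" using nonzero_iff[OF uE[OF i]] pos[OF i] by simp
 have "dirichlet (u i) h = force (\<mu> i) (u i) h" if h: "h \<in> E_on ?\<Omega> p" for h
 proof (rule antisym)
  note hE = E_on_vanishes[OF h \<Omega>]
  show "force (\<mu> i) (u i) h <= dirichlet (u i) h" by (rule one_sided[OF i hE(1) disj[OF _ _ hE(2)]])
  have "force (\<mu> i) (u i) (%x. - 1 * h x) <= dirichlet (u i) (%x. - 1 * h x)"
   by (rule one_sided[OF i E_cmult(1)[OF hE(1)] disj]) (use hE(2) in \<open>auto elim: eventually_mono\<close>)
  then show "dirichlet (u i) h <= force (\<mu> i) (u i) h" using dirichlet_cmult_left[OF hE(1) uE[OF i], of "- 1"]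
   by (simp add: dirichlet_sym[of "u i"] force_def)
 qed
 then have sol: "weak_solution_on ?\<Omega> p (\<mu> i) (u i)" unfolding weak_solution_on_def
  using on nz I(1,2) E_on_vanishes(1)[OF _ \<Omega>] by simp
 have neh: "u i \<in> Nehari_on ?\<Omega> p (\<mu> i)" unfolding Nehari_on_def sq using on nz I(1)[OF uE[OF i]] I(3)[OF uE[OF i]] pot[OF i] by simp
 have "energy_on ?\<Omega> p (\<mu> i) (u i) <= energy_on ?\<Omega> p (\<mu> i) v" if v: "v \<in> Nehari_on ?\<Omega> p (\<mu> i)" for v
 proof -
  have vo: "v \<in> E_on ?\<Omega> p" and vnz: "nonzero v" using v by (auto simp: Nehari_on_def)
  note vE = E_on_vanishes[OF vo \<Omega>]
  note J = integrals_on[OF \<Omega> vE vE(1)]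
  have vp: "dirichlet v v > 0" using nonzero_iff[OF vE(1)] vnz by simp
  have vB: "potential p (\<mu> i) v = dirichlet v v" using v unfolding Nehari_on_def sq by (simp add: J)
  have sg: "AE x in lborel. (u(i := v)) j x * (u(i := v)) k x = 0" if "j \<in> S" "k \<in> S" "j ~= k" for j k
   using disj[OF that(1) _ vE(2)] disj[OF that(2) _ vE(2)] seg[OF that] that by (cases "j = i"; cases "k = i") (auto simp: mult.commute)
  have "(\<Sum>j\<in>S. dirichlet (u j) (u j)) <= (\<Sum>j\<in>S. psi (dirichlet ((u(i := v)) j) ((u(i := v)) j)) (potential p (\<mu> j) ((u(i := v)) j)))"
   by (rule minimal[OF _ _ _ sg]) (use uE vE(1) pos vp pot vB in auto)
  also have "... = (\<Sum>j\<in>S. dirichlet ((u(i := v)) j) ((u(i := v)) j))"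
   by (intro sum.cong refl) (use pos vp pot vB psi_diagonal in auto)
  finally have "dirichlet (u i) (u i) <= dirichlet v v" unfolding sum.remove[OF S i] by simp
  moreover have "1 / 2 - 1 / (2 * p) >= 0" using p1 by (simp add: field_simps)
  ultimately have "(1 / 2 - 1 / (2 * p)) * dirichlet (u i) (u i) <= (1 / 2 - 1 / (2 * p)) * dirichlet v v" by (intro mult_left_mono)
  then show ?thesis unfolding energy_on_def sq I(1)[OF uE[OF i]] I(3)[OF uE[OF i]] J vB pot[OF i] by (simp add: left_diff_distrib)
 qed
 then show "least_energy_solution_on ?\<Omega> p (\<mu> i) (u i)" unfolding least_energy_solution_on_def using sol neh by blast
 show "?\<Omega> \<inter> ball 0 1 ~= {}"
 proof
  assume e: "?\<Omega> \<inter> ball 0 1 = {}"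
  have "u i x = 0" if "x \<in> ball 0 1" for x
  proof -
   have "\<not> u i x > 0" using e that by blast
   then show ?thesis using nn'[of x] by linarith
  qed
  then have "mass (ball 0 1) (u i) = (LINT x|(lborel::(real^'n) measure). 0)" unfolding mass_def set_lebesgue_integral_def
   using p1 by (intro Bcong refl) (auto simp: indicator_def)
  then show False using potential_le[OF uE[OF i] \<mu>[OF i]] pot[OF i] pos[OF i] by simp
 qed
qed

text \<open>The locale depends only on almost everywhere classes. This transfers it to the
  continuous representatives, whose positivity sets are open.\<close>

lemma cong_AE:
 assumes U: "!!i. i \<in> S ==> U i \<in> Bmeas" "!!i. i \<in> S ==> AE x in lborel. U i x = u i x"
 shows "minimal_partition p q S \<mu> U"
proof -
 have ae: "AE x in lborel. u i x = U i x" if "i \<in> S" for i using U(2)[OF that] by eventually_elim simp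
 have UE: "U i \<in> E" if "i \<in> S" for i by (rule E_cong_AE(1)[OF uE[OF that] U(1)[OF that] ae[OF that]])
 have A: "dirichlet (U i) (U i) = dirichlet (u i) (u i)" if "i \<in> S" for i
  using dirichlet_cong_AE[OF UE[OF that] uE[OF that] uE[OF that] U(2)[OF that]] dirichlet_cong_AE[OF UE[OF that] uE[OF that] UE[OF that] U(2)[OF that]]
  by (simp add: dirichlet_sym[of "u i" "U i"])
 have B: "potential p (\<mu> i) (U i) = potential p (\<mu> i) (u i)" if "i \<in> S" for i unfolding potential_def
 proof (rule integral_cong_AE)
  show "AE x in lborel. \<mu> i * Q1 x * \<bar>U i x\<bar> powr (2 * p) = \<mu> i * Q1 x * \<bar>u i x\<bar> powr (2 * p)" using U(2)[OF that] by eventually_elim simp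
 qed (use U[OF that] E_D(1)[OF uE[OF that]] in auto)
 show ?thesis
 proof unfold_locales
  show "AE x in lborel. U i x >= 0" if "i \<in> S" for i using U(2)[OF that] nn[OF that] by eventually_elim simp
  show "AE x in lborel. U i x * U j x = 0" if "i \<in> S" "j \<in> S" "i ~= j" for i j
   using U(2)[OF that(1)] U(2)[OF that(2)] seg[OF that] by eventually_elim simp
  show "(\<Sum>i\<in>S. dirichlet (U i) (U i)) <= (\<Sum>i\<in>S. psi (dirichlet (v i) (v i)) (potential p (\<mu> i) (v i)))"
   if "!!i. i \<in> S ==> v i \<in> E" "!!i. i \<in> S ==> dirichlet (v i) (v i) > 0" "!!i. i \<in> S ==> potential p (\<mu> i) (v i) > 0"
    "!!i j. i \<in> S ==> j \<in> S ==> i ~= j ==> AE x in lborel. v i x * v j x = 0" for v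
   using minimal[OF that] A by simp
 qed (use S \<mu> UE A B pos pot in auto)
qed

end

lemma (in subcritical) E_norm_cong_AE:
 assumes "u \<in> E" "v \<in> E" "AE x in lborel. u x = v x" shows "E_norm p u = E_norm p v"
proof -
 have "dirichlet u u = dirichlet v v"
  using dirichlet_cong_AE[OF assms(1,2,1,3)] dirichlet_cong_AE[OF assms(1,2,2,3)] by (simp add: dirichlet_sym[of v u])
 moreover have "(pw (2 * p) u) = (pw (2 * p) v)"
  by (rule integral_cong_AE) (use E_D(1)[OF assms(1)] E_D(1)[OF assms(2)] assms(3) in \<open>auto elim: eventually_mono\<close>)
 ultimately show ?thesis by (simp add: E_norm_def L_norm_def D12_norm_eq)
qed

theorem theorem1p4:
  fixes l :: nat and p :: real and \<mu> :: "nat \<Rightarrow> real" and \<Lambda> :: "nat \<Rightarrow> real"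
    and u :: "nat \<Rightarrow> nat \<Rightarrow> real ^ 'n \<Rightarrow> real"
  assumes "CARD('n) \<ge> 3"
    and "l \<ge> 1"
    and "1 < p" and "p < real CARD('n) / (real CARD('n) - 2)"
    and "\<And>i. i \<in> {1..l} \<Longrightarrow> \<mu> i > 0"
    and "\<And>k. \<Lambda> k < 0"
    and "filterlim \<Lambda> at_bot sequentially"
    and "\<And>k. least_energy_solution l p \<mu> (\<lambda>i j. \<Lambda> k) (u k)"
    and "\<And>k. nonnegative l (u k)"
  shows "\<exists>(r :: nat \<Rightarrow> nat) (uinf :: nat \<Rightarrow> real ^ 'n \<Rightarrow> real). strict_mono r \<and>
    (let \<Omega> = (\<lambda>i. {x. uinf i x > 0}) in
      (\<forall>i\<in>{1..l}.
        uinf i \<in> E_space p \<and>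
        (\<lambda>k. E_norm p (\<lambda>x. u (r k) i x - uinf i x)) \<longlonglongrightarrow> 0 \<and>
        (\<forall>x. uinf i x \<ge> 0) \<and>
        continuous_on UNIV (uinf i) \<and>
        least_energy_solution_on (\<Omega> i) p (\<mu> i) (\<lambda>x. indicat_real (\<Omega> i) x * uinf i x) \<and>
        \<Omega> i \<inter> ball 0 1 \<noteq> {}) \<and>
      (\<forall>i\<in>{1..l}. \<forall>j\<in>{1..l}. i \<noteq> j \<longrightarrow>
        (\<forall>x. uinf i x * uinf j x = 0) \<and> \<Omega> i \<inter> \<Omega> j = {}))"
proof -
 define q where "q = 2 * real CARD('n) / (real CARD('n) - 2)"
 interpret subcritical p q "TYPE('n)" by unfold_locales (use assms q_def in auto)
 have uE: "u k i \<in> E_space p" if "i \<in> {1..l}" for k i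
  using assms(8)[of k] that by (auto simp: least_energy_solution_def solution_def critical_point_def E_power_def)
 show ?thesis
 proof (rule compactness[OF assms(5-9)])
  fix r v assume r: "strict_mono (r :: nat => nat)"
   and v: "!!i. i \<in> {1..l} ==> v i \<in> (E_space p :: (real^'n => real) set)" "!!i. i \<in> {1..l} ==> AE x in lborel. v i x >= 0"
   "!!i. i \<in> {1..l} ==> (%k. E_norm p (%x. u (r k) i x - v i x)) ----> 0"
   "!!i. i \<in> {1..l} ==> dirichlet (v i) (v i) > 0"
   "!!i. i \<in> {1..l} ==> dirichlet (v i) (v i) = potential p (\<mu> i) (v i)"
   "!!i j. i \<in> {1..l} ==> j \<in> {1..l} ==> i ~= j ==> AE x in lborel. v i x * v j x = 0"
   "!!w. (!!i. i \<in> {1..l} ==> w i \<in> (E_space p :: (real^'n => real) set)) ==> (!!i. i \<in> {1..l} ==> dirichlet (w i) (w i) > 0) ==>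
    (!!i. i \<in> {1..l} ==> potential p (\<mu> i) (w i) > 0) ==>
    (!!i j. i \<in> {1..l} ==> j \<in> {1..l} ==> i ~= j ==> AE x in lborel. w i x * w j x = 0) ==>
    (\<Sum>i\<in>{1..l}. dirichlet (v i) (v i)) <= (\<Sum>i\<in>{1..l}. psi (dirichlet (w i) (w i)) (potential p (\<mu> i) (w i)))"
  interpret V: minimal_partition p q "TYPE('n)" "{1..l}" \<mu> v by unfold_locales (use assms(5) v in auto)
  obtain U where U: "!!i. i \<in> {1..l} ==> AE x in lborel. U i x = v i x" "!!i x. i \<in> {1..l} ==> U i x >= 0"
   "!!i j x. i \<in> {1..l} ==> j \<in> {1..l} ==> i ~= j ==> U i x * U j x = 0" "!!i. i \<in> {1..l} ==> continuous_on UNIV (U i)"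
   using V.continuous_representatives by blast
  interpret W: minimal_partition p q "TYPE('n)" "{1..l}" \<mu> U
   using U by (intro V.cong_AE borel_measurable_continuous_onI) auto
  \<comment> \<open>The representative is nonnegative everywhere, so cutting it off outside its
    positivity set changes no value, and the result for \<open>U i\<close> applies
    literally.\<close>
  have ind: "(%x. indicat_real {x. U i x > 0} x * U i x) = U i" if "i \<in> {1..l}" for i
   using U(2)[OF that] by (auto simp: fun_eq_iff indicator_def less_le)
  have lim: "(%k. E_norm p (%x. u (r k) i x - U i x)) ----> 0" if i: "i \<in> {1..l}" for i
  proof -
   have "E_norm p (%x. u (r k) i x - U i x) = E_norm p (%x. u (r k) i x - v i x)" for k
    by (rule E_norm_cong_AE) (use U(1)[OF i] E_diff(1)[OF uE[OF i]] W.uE[OF i] v(1)[OF i] in \<open>auto elim: eventually_mono\<close>)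
   then show ?thesis using v(3)[OF i] by simp
  qed
  have disj: "{x. U i x > 0} \<inter> {x. U j x > 0} = {}" if "i \<in> {1..l}" "j \<in> {1..l}" "i ~= j" for i j
   using U(3)[OF that] by (auto simp: mult_pos_pos) (metis less_irrefl mult_pos_pos)
  show ?thesis
   unfolding Let_def
   by (rule exI[of _ r], rule exI[of _ U])
    (use r W.uE lim U W.component_least_energy disj ind in auto)
 qed
qed

end
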